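(* Let $T>0$, $x_0\in\mathbb{R}$, and let $H,G:[0,\infty)\to\mathbb{R}$ and $F:[0,\infty)\times\mathbb{R}\to\mathbb{R}$ be (jointly) continuous. Let $h:[0,\infty)\to[0,\infty)$ and $k:[0,\infty)\to(0,\infty)$ be continuous and nondecreasing, and let $K>0$ and $\theta\in(0,1]$ be constants, such that $F\in C^{1,2}$ and for all $u,v\ge0$ and $x,y\in\mathbb{R}$: - $|F(u,x)-F(u,y)|\le h(u)|x-y|$; - $|H(u)|+|F(u,x)|+|G(u)|\le h(u)(1+|x|)$; - $|H(u)-H(v)|+|G(u)-G(v)|\le K|u-v|^\theta$; - $|F_u(u,x)|+|F_x(u,x)H(u)|+|F_x(u,x)F(u,x)|+|F_x(u,x)G(u)|+|F_{xx}(u,x)G^2(u)|\le k(u)(1+|x|)$. Let $X$ be the solution of the SDE $$X_t=x_0+\int_0^tH(E_r)\,\mathrm{d}r+\int_0^tF(E_r,X_r)\,\mathrm{d}E_r+\int_0^tG(E_r)\,\mathrm{d}B_{E_r},\qquad t\in[0,T].$$ Assume further that one of the following conditions holds: (a) $h$ and $k$ are constant; (b) $h$ and $k$ are continuous and nondecreasing, $h$ and $\log k$ are regularly varying at $\infty$ with indices $q\ge0$ and $\tilde q\ge0$, respectively, and the Laplace exponent $\psi$ of $D$ is regularly varying at $\infty$ with index $\beta\in\left(\frac{q_*-1}{q_*},1\right)$, where $q_*:=\max\{2q+1,\tilde q\}$. For $\delta\in(0,1)$ let $X^\delta=(X^\delta_t)_{t\in[0,T]}$ be the Euler--Maruyama-type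 approximation process with step size $\delta$ defined in the context. Then there exists a constant $C>0$ not depending on $\delta$ such that for all $\delta\in(0,1)$, $$\mathbb{E}\Big[\sup_{0\le s\le T}|X_s-X^\delta_s|\Big]\le C\,\delta^{\theta}.$$ Thus, $X^\delta$ converges strongly to $X$ uniformly on $[0,T]$ with order $\theta$.
   Context: Setting. $(\Omega,\mathcal{F},\mathbb{P})$ is a complete probability space with a filtration $(\mathcal{F}_t)_{t\ge0}$ satisfying the usual conditions; $B$ is a one-dimensional $(\mathcal{F}_t)$-adapted Brownian motion, independent of an $(\mathcal{F}_t)$-adapted subordinator $D$ with $D_0=0$, killing rate $0$, drift $0$ and infinite Lévy measure $\nu$. Its Laplace exponent is $\psi(s)=\int_0^\infty(1-e^{-sy})\,\nu(\mathrm{d}y)$, so $\mathbb{E}[e^{-sD_t}]=e^{-t\psi(s)}$. The probability space is the product $(\Omega_B\times\Omega_D,\mathcal{F}_B\times\mathcal{F}_D,\mathbb{P}_B\times\mathbb{P}_D)$, with $B$ depending only on the first coordinate and $D$ only on the second. The inverse of $D$ is $E_t:=\inf\{u>0:D_u>t\}$, which has continuous nondecreasing paths; $B\circ E=(B_{E_t})$ is a continuous $(\mathcal{F}_{E_t})$-martingale, and SDEs are understood as driven by continuous $(\mathcal{F}_{E_t})$-semimartingales. Under the stated assumptions the SDE has a unique strong solution, which is continuous. A function $f:(0,\infty)\to(0,\infty)$ is regularly varying at $\infty$ with index $p\in\mathbb{R}$ if $\lim_{s\to\infty}f(cs)/f(s)=c^p$ for every $c>0$. Subscripts $u,x$ on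 $F$ denote partial derivatives; $C^{1,2}$ means $C^1$ in the first variable $u$ and $C^2$ in the second variable $x$. Approximation. Fix $\delta\in(0,1)$. Put $\tau_n:=D_{n\delta}$, $n=0,1,2,\dots$, and let $N$ be the random nonnegative integer with $T\in[D_{N\delta},D_{(N+1)\delta})$. Note $E_{\tau_n}=n\delta$ a.s. Set $X^\delta_0:=x_0$ and for $n=0,1,\dots,N-1$, $$X^\delta_{\tau_{n+1}}:=X^\delta_{\tau_n}+H(n\delta)(\tau_{n+1}-\tau_n)+F(n\delta,X^\delta_{\tau_n})\delta+G(n\delta)(B_{(n+1)\delta}-B_{n\delta}).$$ Continuous interpolation: for $s\in[\tau_n,\tau_{n+1})$, $$X^\delta_s:=X^\delta_{\tau_n}+\int_{\tau_n}^sH(E_{\tau_n})\,\mathrm{d}r+\int_{\tau_n}^sF(E_{\tau_n},X^\delta_{\tau_n})\,\mathrm{d}E_r+\int_{\tau_n}^sG(E_{\tau_n})\,\mathrm{d}B_{E_r}.$$ Strong convergence: $X^\delta$ converges strongly to $X$ uniformly on $[0,T]$ with order $\eta\in(0,\infty)$ if there exist finite positive constants $C,\delta_0$ such that $\mathbb{E}[\sup_{0\le t\le T}|X_t-X^\delta_t|]\le C\delta^\eta$ for all $\delta\in(0,\delta_0)$. *)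

theory Defs
  imports "HOL-Probability.Probability"
begin

text \<open>
  Time is indexed by \<open>real\<close>; every condition on a process concerns nonnegative times only.
  A filtration on \<open>[0,\<infinity>)\<close> is read as a library filtration over \<open>real\<close> by extending it
  constantly to negative times.
\<close>

section \<open>The driving processes\<close>

definition usual_conditions :: "'w measure \<Rightarrow> (real \<Rightarrow> 'w measure) \<Rightarrow> bool" where
  "usual_conditions M Fl \<longleftrightarrow>
     filtration (space M) Fl \<and>
     (\<forall>t. sets (Fl t) \<subseteq> sets M) \<and>
     (\<forall>t. null_sets M \<subseteq> sets (Fl t)) \<and>
     (\<forall>t. sets (Fl t) = (\<Inter>s\<in>{t<..}. sets (Fl s)))"

definition brownian_motion ::
  "'w measure \<Rightarrow> (real \<Rightarrow> 'w measure) \<Rightarrow> (real \<Rightarrow> 'w \<Rightarrow> real) \<Rightarrow> bool" where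
  "brownian_motion M Fl B \<longleftrightarrow>
     (\<forall>t\<ge>0. B t \<in> borel_measurable (Fl t)) \<and>
     (AE \<omega> in M. B 0 \<omega> = 0 \<and> continuous_on {0..} (\<lambda>t. B t \<omega>)) \<and>
     (\<forall>s t. 0 \<le> s \<and> s < t \<longrightarrow>
        distributed M lborel (\<lambda>\<omega>. B t \<omega> - B s \<omega>)
          (\<lambda>x. ennreal (normal_density 0 (sqrt (t - s)) x)) \<and>
        prob_space.indep_set M
          (sets (vimage_algebra (space M) (\<lambda>\<omega>. B t \<omega> - B s \<omega>) borel)) (sets (Fl s)))"

definition levy_measure_infinite :: "real measure \<Rightarrow> bool" where
  "levy_measure_infinite \<nu> \<longleftrightarrow>
     sets \<nu> = sets borel \<and> emeasure \<nu> {..0} = 0 \<and>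
     (\<integral>\<^sup>+ y. ennreal (min 1 y) \<partial>\<nu>) < \<infinity> \<and> emeasure \<nu> {0<..} = \<infinity>"

definition laplace_exponent :: "real measure \<Rightarrow> real \<Rightarrow> real" where
  "laplace_exponent \<nu> s = (LINT y:{0<..}|\<nu>. 1 - exp (- s * y))"

text \<open>
  Adapted subordinator with Levy measure \<open>\<nu>\<close>. That killing rate and drift vanish is encoded by
  \<open>D\<close> being real-valued and by the form of the Laplace exponent.
\<close>

definition subordinator ::
  "'w measure \<Rightarrow> (real \<Rightarrow> 'w measure) \<Rightarrow> real measure \<Rightarrow> (real \<Rightarrow> 'w \<Rightarrow> real) \<Rightarrow> bool" where
  "subordinator M Fl \<nu> D \<longleftrightarrow>
     (\<forall>t\<ge>0. D t \<in> borel_measurable (Fl t)) \<and>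
     (AE \<omega> in M. D 0 \<omega> = 0 \<and> mono_on {0..} (\<lambda>t. D t \<omega>) \<and>
        (\<forall>t\<ge>0. continuous (at_right t) (\<lambda>t. D t \<omega>))) \<and>
     (\<forall>n (r :: nat \<Rightarrow> real). 0 \<le> r 0 \<and> mono r \<longrightarrow>
        prob_space.indep_vars M (\<lambda>_. borel) (\<lambda>i \<omega>. D (r (Suc i)) \<omega> - D (r i) \<omega>) {..<n}) \<and>
     (\<forall>s t. 0 \<le> s \<and> 0 \<le> t \<longrightarrow>
        distr M borel (\<lambda>\<omega>. D (s + t) \<omega> - D s \<omega>) = distr M borel (D t)) \<and>
     (\<forall>s t. 0 \<le> s \<and> 0 \<le> t \<longrightarrow>
        (LINT \<omega>|M. exp (- s * D t \<omega>)) = exp (- t * laplace_exponent \<nu> s))"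

definition inverse_subordinator :: "(real \<Rightarrow> 'w \<Rightarrow> real) \<Rightarrow> real \<Rightarrow> 'w \<Rightarrow> real" where
  "inverse_subordinator D t \<omega> = Inf {u. 0 < u \<and> t < D u \<omega>}"

text \<open>
  The setting on the (completed) product space. That \<open>B\<close> and \<open>D\<close> factor through the two
  projections makes them independent.
\<close>

definition product_setting ::
  "'a measure \<Rightarrow> 'b measure \<Rightarrow> (real \<Rightarrow> ('a \<times> 'b) measure) \<Rightarrow> real measure \<Rightarrow>
   (real \<Rightarrow> 'a \<times> 'b \<Rightarrow> real) \<Rightarrow> (real \<Rightarrow> 'a \<times> 'b \<Rightarrow> real) \<Rightarrow> bool" where
  "product_setting PB PD Fl \<nu> B D \<longleftrightarrow>
     prob_space PB \<and> prob_space PD \<and>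
     usual_conditions (completion (PB \<Otimes>\<^sub>M PD)) Fl \<and>
     (\<forall>t\<ge>0. \<exists>b\<in>borel_measurable PB. \<forall>\<omega>\<in>space (PB \<Otimes>\<^sub>M PD). B t \<omega> = b (fst \<omega>)) \<and>
     (\<forall>t\<ge>0. \<exists>d\<in>borel_measurable PD. \<forall>\<omega>\<in>space (PB \<Otimes>\<^sub>M PD). D t \<omega> = d (snd \<omega>)) \<and>
     levy_measure_infinite \<nu> \<and>
     brownian_motion (completion (PB \<Otimes>\<^sub>M PD)) Fl B \<and>
     subordinator (completion (PB \<Otimes>\<^sub>M PD)) Fl \<nu> D"

section \<open>Stochastic integration\<close>

text \<open>
  Following Protter, the stochastic integral is the continuous extension, for uniform convergence
  on compacts in probability (ucp), of the elementary integral on simple predictable processes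
  \<open>\<eta> 1\<^bsub>{0}\<^esub> + (\<Sum>i<n. \<xi>\<^sub>i 1\<^bsub>(\<tau>\<^sub>i, \<tau>\<^sub>i\<^sub>+\<^sub>1]\<^esub>)\<close>.
\<close>

definition simple_predictable ::
  "'w set \<Rightarrow> (real \<Rightarrow> 'w measure) \<Rightarrow> nat \<Rightarrow> ('w \<Rightarrow> real) \<Rightarrow> (nat \<Rightarrow> 'w \<Rightarrow> real) \<Rightarrow>
   (nat \<Rightarrow> 'w \<Rightarrow> real) \<Rightarrow> bool" where
  "simple_predictable \<Omega> Gl n \<eta> \<tau> \<xi> \<longleftrightarrow>
     (\<forall>\<omega>\<in>\<Omega>. \<tau> 0 \<omega> = 0) \<and>
     (\<forall>i\<le>n. stopping_time Gl (\<tau> i)) \<and>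
     (\<forall>i<n. \<forall>\<omega>\<in>\<Omega>. \<tau> i \<omega> \<le> \<tau> (Suc i) \<omega>) \<and>
     \<eta> \<in> borel_measurable (Gl 0) \<and>
     (\<forall>i<n. \<xi> i \<in> borel_measurable (filtration.pre_sigma \<Omega> Gl (\<tau> i)))"

definition simple_process ::
  "nat \<Rightarrow> ('w \<Rightarrow> real) \<Rightarrow> (nat \<Rightarrow> 'w \<Rightarrow> real) \<Rightarrow> (nat \<Rightarrow> 'w \<Rightarrow> real) \<Rightarrow> real \<Rightarrow> 'w \<Rightarrow> real" where
  "simple_process n \<eta> \<tau> \<xi> t \<omega> =
     \<eta> \<omega> * indicator {0} t + (\<Sum>i<n. \<xi> i \<omega> * indicator {\<tau> i \<omega><..\<tau> (Suc i) \<omega>} t)"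

definition simple_integral ::
  "nat \<Rightarrow> ('w \<Rightarrow> real) \<Rightarrow> (nat \<Rightarrow> 'w \<Rightarrow> real) \<Rightarrow> (nat \<Rightarrow> 'w \<Rightarrow> real) \<Rightarrow>
   (real \<Rightarrow> 'w \<Rightarrow> real) \<Rightarrow> real \<Rightarrow> 'w \<Rightarrow> real" where
  "simple_integral n \<eta> \<tau> \<xi> Z t \<omega> =
     \<eta> \<omega> * Z 0 \<omega> +
     (\<Sum>i<n. \<xi> i \<omega> * (Z (min (\<tau> (Suc i) \<omega>) t) \<omega> - Z (min (\<tau> i \<omega>) t) \<omega>))"

text \<open>The event below is \<open>{sup\<^bsub>s\<in>[0,t]\<^esub> \<bar>X\<^sup>n\<^sub>s - X\<^sub>s\<bar> > \<epsilon>}\<close>.\<close>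

definition ucp_limit ::
  "'w measure \<Rightarrow> (nat \<Rightarrow> real \<Rightarrow> 'w \<Rightarrow> real) \<Rightarrow> (real \<Rightarrow> 'w \<Rightarrow> real) \<Rightarrow> bool" where
  "ucp_limit M Xn X \<longleftrightarrow>
     (\<forall>t\<ge>0. \<forall>\<epsilon>>0.
        (\<forall>n. {\<omega>\<in>space M. \<exists>s\<in>{0..t}. \<epsilon> < \<bar>Xn n s \<omega> - X s \<omega>\<bar>} \<in> sets M) \<and>
        (\<lambda>n. measure M {\<omega>\<in>space M. \<exists>s\<in>{0..t}. \<epsilon> < \<bar>Xn n s \<omega> - X s \<omega>\<bar>}) \<longlonglongrightarrow> 0)"

definition simple_approximation ::
  "'w measure \<Rightarrow> (real \<Rightarrow> 'w measure) \<Rightarrow> (real \<Rightarrow> 'w \<Rightarrow> real) \<Rightarrow> (nat \<Rightarrow> nat) \<Rightarrow>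
   (nat \<Rightarrow> 'w \<Rightarrow> real) \<Rightarrow> (nat \<Rightarrow> nat \<Rightarrow> 'w \<Rightarrow> real) \<Rightarrow> (nat \<Rightarrow> nat \<Rightarrow> 'w \<Rightarrow> real) \<Rightarrow> bool" where
  "simple_approximation M Gl Y n \<eta> \<tau> \<xi> \<longleftrightarrow>
     (\<forall>m. simple_predictable (space M) Gl (n m) (\<eta> m) (\<tau> m) (\<xi> m)) \<and>
     ucp_limit M (\<lambda>m. simple_process (n m) (\<eta> m) (\<tau> m) (\<xi> m)) Y"

text \<open>
  \<open>has_stoch_integral M Gl Z Y I\<close>: the integrand \<open>Y\<close> lies in the ucp-closure of the simple
  predictable processes and \<open>I\<^sub>t = \<integral>\<^sub>0\<^sup>t Y\<^sub>r dZ\<^sub>r\<close>.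
\<close>

definition has_stoch_integral ::
  "'w measure \<Rightarrow> (real \<Rightarrow> 'w measure) \<Rightarrow> (real \<Rightarrow> 'w \<Rightarrow> real) \<Rightarrow> (real \<Rightarrow> 'w \<Rightarrow> real) \<Rightarrow>
   (real \<Rightarrow> 'w \<Rightarrow> real) \<Rightarrow> bool" where
  "has_stoch_integral M Gl Z Y I \<longleftrightarrow>
     (\<exists>n \<eta> \<tau> \<xi>. simple_approximation M Gl Y n \<eta> \<tau> \<xi>) \<and>
     (\<forall>n \<eta> \<tau> \<xi>. simple_approximation M Gl Y n \<eta> \<tau> \<xi> \<longrightarrow>
        ucp_limit M (\<lambda>m. simple_integral (n m) (\<eta> m) (\<tau> m) (\<xi> m) Z) I)"

section \<open>The time-changed SDE\<close>

definition time_changed_filtration ::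
  "'w measure \<Rightarrow> (real \<Rightarrow> 'w measure) \<Rightarrow> (real \<Rightarrow> 'w \<Rightarrow> real) \<Rightarrow> real \<Rightarrow> 'w measure" where
  "time_changed_filtration M Fl E t = filtration.pre_sigma (space M) Fl (E t)"

text \<open>The \<open>dE\<close>-integral is the pathwise Lebesgue-Stieltjes integral.\<close>

definition sde_solution ::
  "'w measure \<Rightarrow> (real \<Rightarrow> 'w measure) \<Rightarrow> (real \<Rightarrow> 'w \<Rightarrow> real) \<Rightarrow> (real \<Rightarrow> 'w \<Rightarrow> real) \<Rightarrow>
   (real \<Rightarrow> real) \<Rightarrow> (real \<Rightarrow> real \<Rightarrow> real) \<Rightarrow> (real \<Rightarrow> real) \<Rightarrow> real \<Rightarrow> real \<Rightarrow>
   (real \<Rightarrow> 'w \<Rightarrow> real) \<Rightarrow> bool" where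
  "sde_solution M Fl B D H F G x0 T X \<longleftrightarrow>
     (let E = inverse_subordinator D; Gl = time_changed_filtration M Fl E in
       (\<forall>t\<in>{0..T}. X t \<in> borel_measurable (Gl t)) \<and>
       (AE \<omega> in M. continuous_on {0..T} (\<lambda>t. X t \<omega>)) \<and>
       (\<exists>I. has_stoch_integral M Gl (\<lambda>t \<omega>. B (E t \<omega>) \<omega>) (\<lambda>t \<omega>. G (E t \<omega>)) I \<and>
         (AE \<omega> in M. \<forall>t\<in>{0..T}.
            X t \<omega> = x0 + (LINT r:{0..t}|lborel. H (E r \<omega>))
                       + (LINT r:{0..t}|interval_measure (\<lambda>r. E r \<omega>). F (E r \<omega>) (X r \<omega>))
                       + I t \<omega>)))"

section \<open>The Euler--Maruyama-type scheme\<close>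

primrec em_grid ::
  "(real \<Rightarrow> 'w \<Rightarrow> real) \<Rightarrow> (real \<Rightarrow> 'w \<Rightarrow> real) \<Rightarrow>
   (real \<Rightarrow> real) \<Rightarrow> (real \<Rightarrow> real \<Rightarrow> real) \<Rightarrow> (real \<Rightarrow> real) \<Rightarrow> real \<Rightarrow> real \<Rightarrow>
   nat \<Rightarrow> 'w \<Rightarrow> real" where
  "em_grid B D H F G x0 \<delta> 0 \<omega> = x0"
| "em_grid B D H F G x0 \<delta> (Suc n) \<omega> =
     em_grid B D H F G x0 \<delta> n \<omega>
     + H (real n * \<delta>) * (D (real (Suc n) * \<delta>) \<omega> - D (real n * \<delta>) \<omega>)
     + F (real n * \<delta>) (em_grid B D H F G x0 \<delta> n \<omega>) * \<delta>
     + G (real n * \<delta>) * (B (real (Suc n) * \<delta>) \<omega> - B (real n * \<delta>) \<omega>)"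

text \<open>
  On \<open>[\<tau>\<^sub>n, \<tau>\<^sub>n\<^sub>+\<^sub>1)\<close> all integrands of the interpolation are constant in the integration variable;
  for the stochastic integral this leaves the elementary integral over \<open>(\<tau>\<^sub>n, s]\<close>.
\<close>

definition em_process ::
  "(real \<Rightarrow> 'w \<Rightarrow> real) \<Rightarrow> (real \<Rightarrow> 'w \<Rightarrow> real) \<Rightarrow>
   (real \<Rightarrow> real) \<Rightarrow> (real \<Rightarrow> real \<Rightarrow> real) \<Rightarrow> (real \<Rightarrow> real) \<Rightarrow> real \<Rightarrow> real \<Rightarrow>
   real \<Rightarrow> 'w \<Rightarrow> real" where
  "em_process B D H F G x0 \<delta> s \<omega> =
     (let E = inverse_subordinator D;
          n = (THE n. D (real n * \<delta>) \<omega> \<le> s \<and> s < D (real (Suc n) * \<delta>) \<omega>);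
          \<tau> = D (real n * \<delta>) \<omega>;
          x = em_grid B D H F G x0 \<delta> n \<omega>
      in x + (LINT r:{\<tau>..s}|lborel. H (E \<tau> \<omega>))
           + (LINT r:{\<tau>..s}|interval_measure (\<lambda>r. E r \<omega>). F (E \<tau> \<omega>) x)
           + G (E \<tau> \<omega>) * (B (E s \<omega>) \<omega> - B (E \<tau> \<omega>) \<omega>))"

section \<open>Assumptions on the coefficients and the error\<close>

definition regularly_varying :: "(real \<Rightarrow> real) \<Rightarrow> real \<Rightarrow> bool" where
  "regularly_varying f p \<longleftrightarrow>
     (\<forall>s>0. 0 < f s) \<and> (\<forall>c>0. ((\<lambda>s. f (c * s) / f s) \<longlongrightarrow> c powr p) at_top)"

text \<open>
  \<open>F \<in> C\<^sup>1\<^sup>,\<^sup>2\<close> on \<open>[0,\<infinity>) \<times> \<real>\<close> with derivatives \<open>Fu = F\<^sub>u\<close>, \<open>Fx = F\<^sub>x\<close>, \<open>Fxx = F\<^sub>x\<^sub>x\<close>; the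
  \<open>u\<close>-derivative at \<open>u = 0\<close> is one-sided.
\<close>

definition C12 ::
  "(real \<Rightarrow> real \<Rightarrow> real) \<Rightarrow> (real \<Rightarrow> real \<Rightarrow> real) \<Rightarrow> (real \<Rightarrow> real \<Rightarrow> real) \<Rightarrow>
   (real \<Rightarrow> real \<Rightarrow> real) \<Rightarrow> bool" where
  "C12 F Fu Fx Fxx \<longleftrightarrow>
     (\<forall>u\<ge>0. \<forall>x.
        ((\<lambda>v. F v x) has_real_derivative Fu u x) (at u within {0..}) \<and>
        ((\<lambda>y. F u y) has_real_derivative Fx u x) (at x) \<and>
        ((\<lambda>y. Fx u y) has_real_derivative Fxx u x) (at x)) \<and>
     continuous_on ({0..} \<times> UNIV) (\<lambda>(u, x). Fu u x) \<and>
     continuous_on ({0..} \<times> UNIV) (\<lambda>(u, x). Fx u x) \<and>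
     continuous_on ({0..} \<times> UNIV) (\<lambda>(u, x). Fxx u x)"

text \<open>
  \<open>E[sup\<^bsub>0\<le>s\<le>T\<^esub> \<bar>X\<^sub>s - Y\<^sub>s\<bar>] \<le> c\<close>. The measurability clause is needed since \<open>nn_integral\<close> of a
  non-measurable function is only a lower integral.
\<close>

definition mean_sup_error_le ::
  "'w measure \<Rightarrow> real \<Rightarrow> (real \<Rightarrow> 'w \<Rightarrow> real) \<Rightarrow> (real \<Rightarrow> 'w \<Rightarrow> real) \<Rightarrow> real \<Rightarrow> bool" where
  "mean_sup_error_le M T X Y c \<longleftrightarrow>
     (\<lambda>\<omega>. SUP s\<in>{0..T}. ennreal \<bar>X s \<omega> - Y s \<omega>\<bar>) \<in> borel_measurable M \<and>
     (\<integral>\<^sup>+ \<omega>. (SUP s\<in>{0..T}. ennreal \<bar>X s \<omega> - Y s \<omega>\<bar>) \<partial>M) \<le> ennreal c"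

definition converges_strongly_with_order ::
  "'w measure \<Rightarrow> real \<Rightarrow> (real \<Rightarrow> real \<Rightarrow> 'w \<Rightarrow> real) \<Rightarrow> (real \<Rightarrow> 'w \<Rightarrow> real) \<Rightarrow> real \<Rightarrow> bool" where
  "converges_strongly_with_order M T Xd X \<eta> \<longleftrightarrow>
     (\<exists>C>0. \<exists>\<delta>0>0. \<forall>\<delta>\<in>{0<..<\<delta>0}. mean_sup_error_le M T X (Xd \<delta>) (C * \<delta> powr \<eta>))"

end

theory Submission
  imports Defs
begin

text \<open>
  Fix a path \<open>d\<close> of the subordinator, with inverse \<open>e\<close> and \<open>S = e T\<close>, and work in operational
  time \<open>v\<close>, where \<open>\<integral>\<^sub>0\<^sup>t f(r) de(r) = \<integral>\<^sub>0\<^bsup>e(t)\<^esup> f(d(v)) dv\<close>. By Gronwall's inequality the error is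
  controlled by the freezing errors of the three integrands. Those of \<open>H\<close> and \<open>G\<close> are at most
  \<open>K \<delta>\<^sup>\<theta>\<close>, pathwise and after Doob's \<open>L\<^sup>2\<close> inequality respectively. That of \<open>F\<close> has order \<open>\<delta>\<close>
  rather than \<open>\<delta>\<^bsup>1/2\<^esup>\<close>: a Taylor expansion splits it into a remainder whose mean has order
  \<open>\<delta>\<close> and a term \<open>F\<^sub>x G (b\<^sub>v - b\<^sub>n\<^sub>\<delta>)\<close>, whose time integral is a martingale transform averaged
  over one step. Taking means over the Brownian coordinate leaves the factor
  \<open>(1 + k(S)) exp(10 (1 + h(S)) (1 + S))\<close>. It has finite mean over the subordinator coordinate
  because of the Chernoff bound \<open>P(S > n) \<le> P(D\<^sub>n \<le> T) \<le> exp(s T - n \<psi>(s))\<close>; in case (b) one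
  takes \<open>s = n\<^sup>p\<close> with \<open>p\<close> slightly above \<open>q\<^sub>*\<close>.

  Ito's formula is not needed. The stochastic integral enters only as an almost sure limit of
  Riemann sums over deterministic grids, along a subsequence.
\<close>

section \<open>Pathwise inequalities\<close>

text \<open>The obstacle is that \<open>d\<close> jumps. Over one step the scheme moves by
  \<open>H\<close> times an increment of \<open>d\<close>, which is not small with \<delta>, so the
  local error of \<open>F\<close> need not have order \<delta> at a given time. The order is saved
  because the increments up to \<open>T\<close> add up to at most \<open>T\<close>: integrated over
  operational time they contribute at most \<delta> times \<open>T\<close>. Jumps also make
  \<open>d\<close> a one-sided inverse of \<open>e\<close>. The error in operational time is then
  merely bounded and measurable, which shapes the form of Gronwall's inequality, and the resulting
  bound still has to be carried over to the times that \<open>d\<close> skips. The maximal bounds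
  supply measurable majorants in place of suprema over uncountably many times; only the error of the
  final statement is itself shown to be measurable, in the completed product space. Since
  \<open>Fl\<close> lives on the product space, the Brownian coordinate receives its own filtration,
  consisting of the events whose cylinders belong to \<open>Fl\<close>.\<close>

primrec running_max :: "(nat \<Rightarrow> real) \<Rightarrow> nat \<Rightarrow> real" where
  "running_max S 0 = S 0"
| "running_max S (Suc n) = max (running_max S n) (S (Suc n))"

lemma running_max_ge: "k \<le> n \<Longrightarrow> S k \<le> running_max S n"
  by (induction n) (auto simp: le_Suc_eq max.coboundedI1)

text \<open>
  The trajectorial form of Doob's inequality: the subtracted sum has mean zero if \<open>S\<close> is a
  martingale.
\<close>

lemma doob_pathwise:
  assumes "S 0 = 0"
  shows "(running_max S n)\<^sup>2 \<le> 4 * (S n)\<^sup>2 - 4 * (\<Sum>k<n. running_max S k * (S (Suc k) - S k))"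
proof -
  let ?M = "running_max S"
  \<comment> \<open>While the maximum is not exceeded, both sides grow by
    \<open>?M n * (S (Suc n) - S n)\<close>. At a new maximum the right-hand side gains in addition
    half the square of \<open>S (Suc n) - ?M n\<close>.\<close>
  have *: "(?M n)\<^sup>2 / 2 + (\<Sum>k<n. ?M k * (S (Suc k) - S k)) \<le> ?M n * S n"
  proof (induction n)
    case 0
    then show ?case using assms by simp
  next
    case (Suc n)
    show ?case
    proof (cases "S (Suc n) \<le> ?M n")
      case True
      then show ?thesis using Suc.IH by (simp add: max_def algebra_simps)
    next
      case False
      have "0 \<le> (S (Suc n) - ?M n)\<^sup>2" by simp
      then show ?thesis using Suc.IH False
        by (simp add: max_def power2_eq_square algebra_simps)
    qed
  qed
  \<comment> \<open>Completing the square removes the mixed term \<open>?M n * S n\<close>; the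
    constant 4 of Doob's inequality arises here.\<close>
  have "0 \<le> (2 * S n - ?M n)\<^sup>2" by simp
  then show ?thesis using * by (simp add: power2_eq_square algebra_simps)
qed

section \<open>Gronwall inequalities in continuous and in discrete time\<close>

lemma set_integrable_bounded_interval:
  fixes f :: "real \<Rightarrow> real"
  assumes "f \<in> borel_measurable borel" and "\<And>x. x \<in> {a..b} \<Longrightarrow> \<bar>f x\<bar> \<le> m"
  shows "set_integrable lborel {a..b} f"
proof -
  have "set_integrable lborel {a..b} (\<lambda>_. m)"
    by (rule borel_integrable_atLeastAtMost') (rule continuous_on_const)
  then show ?thesis
    by (rule set_integrable_bound) (use assms in \<open>auto simp: set_borel_measurable_def intro!: AE_I2 order_trans[OF _ abs_ge_self]\<close>)
qed

text \<open>The supremum \<open>m'\<close> of \<open>Z v * exp (- lam * v)\<close> is finite because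
  \<open>Z\<close> is bounded, and \<open>lam = 2 * h + 1\<close> makes \<open>h / lam\<close> at
  most one half, so that \<open>m' \<le> A + m' / 2\<close>; hence the factor 2. Boundedness and
  measurability are what the error in operational time offers, as it can inherit jumps of the
  subordinator. The end point \<open>S\<close> is left out because the path may have jumped past the
  horizon there.\<close>

lemma gronwall_measurable:
  fixes Z :: "real \<Rightarrow> real"
  assumes Zm: "Z \<in> borel_measurable borel"
    and Z0: "\<And>v. 0 \<le> v \<Longrightarrow> v < S \<Longrightarrow> 0 \<le> Z v"
    and Zb: "\<And>v. 0 \<le> v \<Longrightarrow> v < S \<Longrightarrow> Z v \<le> m"
    and A: "0 \<le> A" and h: "0 \<le> h"
    and ineq: "\<And>v. 0 \<le> v \<Longrightarrow> v < S \<Longrightarrow> Z v \<le> A + h * (LINT w:{0..v}|lborel. Z w)"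
    and v: "0 \<le> v" "v < S"
  shows "Z v \<le> 2 * A * exp ((2 * h + 1) * v)"
proof -
  define lam where "lam = 2 * h + 1"
  have lam: "0 < lam" using h by (simp add: lam_def)
  define m' where "m' = (SUP v\<in>{0..<S}. Z v * exp (- lam * v))"
  have bdd: "bdd_above ((\<lambda>v. Z v * exp (- lam * v)) ` {0..<S})"
  proof (rule bdd_aboveI2[where M = m])
    fix v assume "v \<in> {0..<S}"
    then have v: "0 \<le> v" "v < S" by auto
    have "Z v * exp (- lam * v) \<le> Z v * 1"
      using Z0[OF v] lam v by (intro mult_left_mono) auto
    then show "Z v * exp (- lam * v) \<le> m" using Zb[OF v] by simp
  qed
  have up: "Z v \<le> m' * exp (lam * v)" if "0 \<le> v" "v < S" for v
  proof -
    have "Z v * exp (- lam * v) \<le> m'"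
      unfolding m'_def by (rule cSUP_upper[OF _ bdd]) (use that in auto)
    then show ?thesis by (simp add: exp_minus field_simps)
  qed
  have m'0: "0 \<le> m'" using up[of v] Z0[of v] v by (smt (verit) exp_gt_zero mult_neg_pos)
  have step: "Z v * exp (- lam * v) \<le> A + m' / 2" if v: "0 \<le> v" "v < S" for v
  proof -
    have int: "((\<lambda>w. m' * exp (lam * w)) has_integral (m' * exp (lam * v) / lam - m' * exp (lam * 0) / lam)) {0..v}"
      by (rule fundamental_theorem_of_calculus)
         (use v lam in \<open>auto intro!: derivative_eq_intros simp: has_real_derivative_iff_has_vector_derivative[symmetric]\<close>)
    have si: "set_integrable lborel {0..v} (\<lambda>w. m' * exp (lam * w))"
      by (rule borel_integrable_atLeastAtMost') (auto intro!: continuous_intros)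
    have "(LINT w:{0..v}|lborel. Z w) \<le> (LINT w:{0..v}|lborel. m' * exp (lam * w))"
    proof (rule set_integral_mono[OF _ si])
      show "set_integrable lborel {0..v} Z"
        by (rule set_integrable_bounded_interval[OF Zm, where m = m]) (use Z0 Zb v in force)
    qed (use up v in auto)
    also have "\<dots> = m' * exp (lam * v) / lam - m' / lam"
      by (subst set_borel_integral_eq_integral(2)[OF si], subst integral_unique[OF int]) simp
    also have "\<dots> \<le> m' * exp (lam * v) / lam" using m'0 lam by simp
    finally have "Z v \<le> A + h * (m' * exp (lam * v) / lam)"
      using ineq[OF v] \<open>0 \<le> h\<close> by (meson add_left_mono mult_left_mono order_trans)
    also have "h * (m' * exp (lam * v) / lam) \<le> m' * exp (lam * v) / 2"
    proof -
      have "h / lam \<le> 1 / 2" using \<open>0 \<le> h\<close> by (simp add: lam_def field_simps)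
      then have "(h / lam) * (m' * exp (lam * v)) \<le> (1/2) * (m' * exp (lam * v))"
        using m'0 by (intro mult_right_mono) auto
      then show ?thesis by simp
    qed
    also have "A + m' * exp (lam * v) / 2 \<le> (A + m' / 2) * exp (lam * v)"
    proof -
      have "A * 1 \<le> A * exp (lam * v)" using \<open>0 \<le> A\<close> v lam by (intro mult_left_mono) auto
      then show ?thesis by (simp add: algebra_simps)
    qed
    finally show ?thesis by (simp add: exp_minus field_simps)
  qed
  have "m' \<le> A + m' / 2"
    unfolding m'_def[symmetric]
    by (subst m'_def, rule cSUP_least) (use v step in auto)
  then have "m' \<le> 2 * A" by simp
  then have "m' * exp (lam * v) \<le> 2 * A * exp (lam * v)" by (intro mult_right_mono) auto
  then show ?thesis using up[OF v] unfolding lam_def by linarith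
qed

text \<open>The induction closes without loss because the bound solves the recursion with equality:
  \<open>1 + a * (\<Sum>i<n. (1 + a) ^ i) = (1 + a) ^ n\<close>.\<close>

lemma gronwall_discrete:
  fixes x :: "nat \<Rightarrow> real"
  assumes "0 \<le> a" and step: "\<And>n. n \<le> N \<Longrightarrow> x n \<le> c + a * (\<Sum>i<n. x i)"
    and n: "n \<le> N"
  shows "x n \<le> c * (1 + a) ^ n"
  using n
proof (induction n rule: less_induct)
  case (less n)
  have id: "1 + a * (\<Sum>i<n. (1 + a) ^ i) = (1 + a) ^ n" for n
    by (induction n) (auto simp: algebra_simps)
  have "(\<Sum>i<n. x i) \<le> (\<Sum>i<n. c * (1 + a) ^ i)"
    by (rule sum_mono) (use less in auto)
  then have "x n \<le> c + a * (\<Sum>i<n. c * (1 + a) ^ i)"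
    using step[OF less.prems] \<open>0 \<le> a\<close> by (meson add_left_mono mult_left_mono order_trans)
  also have "\<dots> = c * (1 + a * (\<Sum>i<n. (1 + a) ^ i))"
    by (simp add: sum_distrib_left algebra_simps)
  finally show ?case by (simp add: id)
qed

text \<open>The grid is an arbitrary monotone sequence so that it serves both the uniform grid of
  operational time and its image under the subordinator.\<close>

lemma set_integral_grid_split:
  fixes f :: "real \<Rightarrow> real"
  assumes "mono p" "p n \<le> s" and int: "set_integrable lborel {p 0..s} f"
  shows "(LINT v:{p 0..s}|lborel. f v) =
    (\<Sum>i<n. LINT v:{p i..p (Suc i)}|lborel. f v) + (LINT v:{p n..s}|lborel. f v)"
proof -
  have 1: "(LINT v:{a..c}|lborel. f v) = (LINT v:{a..b}|lborel. f v) + (LINT v:{b..c}|lborel. f v)"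
    if "p 0 \<le> a" "a \<le> b" "b \<le> c" "c \<le> s" for a b c
  proof -
    have i: "set_integrable lborel {x..y} f" if "p 0 \<le> x" "y \<le> s" for x y
      by (rule set_integrable_subset[OF int]) (use that in auto)
    have "f integrable_on {a..c}"
      using set_borel_integral_eq_integral(1)[OF i[of a c]] that by auto
    from Henstock_Kurzweil_Integration.integral_combine[OF that(2,3) this] show ?thesis
      using that by (simp add: set_borel_integral_eq_integral(2)[OF i])
  qed
  show ?thesis using \<open>p n \<le> s\<close>
  proof (induction n)
    case (Suc n)
    have m: "p n \<le> p (Suc n)" "p 0 \<le> p n" using \<open>mono p\<close> by (auto simp: mono_def)
    then show ?case using Suc 1[of "p n" "p (Suc n)" s] by simp
  qed simp
qed

section \<open>Paths of a subordinator and their inverses\<close>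

text \<open>Deterministic properties of almost every path when the Levy measure is infinite. Strict
  growth makes the inverse continuous, while jumps remain possible.\<close>

locale subordinator_path =
  fixes d :: "real \<Rightarrow> real"
  assumes d0: "d 0 = 0"
    and strict: "\<And>u v. 0 \<le> u \<Longrightarrow> u < v \<Longrightarrow> d u < d v"
    and right_cont: "\<And>u. 0 \<le> u \<Longrightarrow> continuous (at_right u) d"
    and unbounded: "\<And>m. \<exists>u\<ge>0. m < d u"
begin

definition e :: "real \<Rightarrow> real" where "e t = Inf {u. 0 < u \<and> t < d u}"

lemma d_le_iff: "0 \<le> u \<Longrightarrow> 0 \<le> v \<Longrightarrow> d u \<le> d v \<longleftrightarrow> u \<le> v"
  using strict by (metis linorder_not_le order_less_le)

lemma d_less_iff: "0 \<le> u \<Longrightarrow> 0 \<le> v \<Longrightarrow> d u < d v \<longleftrightarrow> u < v"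
  using d_le_iff by (metis linorder_not_le)

lemma d_nonneg: "0 \<le> u \<Longrightarrow> 0 \<le> d u"
  using d_le_iff[of 0 u] d0 by simp

lemma e_set: "{u. 0 < u \<and> t < d u} \<noteq> {}" "bdd_below {u. 0 < u \<and> t < d u}"
proof -
  obtain u where u: "0 \<le> u" "t < d u" using unbounded by blast
  have "d u < d (u + 1)" using strict u by simp
  then have "u + 1 \<in> {u. 0 < u \<and> t < d u}" using u by auto
  then show "{u. 0 < u \<and> t < d u} \<noteq> {}" by blast
  show "bdd_below {u. 0 < u \<and> t < d u}" by (rule bdd_belowI[of _ 0]) auto
qed

lemma e_nonneg: "0 \<le> e t"
  unfolding e_def by (rule cInf_greatest[OF e_set(1)]) auto

lemma e_le: "0 < u \<Longrightarrow> t < d u \<Longrightarrow> e t \<le> u"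
  unfolding e_def by (rule cInf_lower[OF _ e_set(2)]) auto

lemma e_lessD: "e t < u \<Longrightarrow> t < d u"
proof -
  assume "e t < u"
  then obtain u' where "u' < u" "0 < u'" "t < d u'"
    unfolding e_def using cInf_lessD[OF e_set(1)] by blast
  then show ?thesis using strict[of u' u] by simp
qed

text \<open>Strict growth makes \<open>e\<close> an exact left inverse. The other composition fails:
  \<open>d (e t)\<close> exceeds \<open>t\<close> when \<open>t\<close> lies inside a jump of
  \<open>d\<close>. The substitutes are \<open>d_less_le\<close>, valid strictly before
  \<open>e t\<close>, and \<open>le_e\<close>.\<close>

lemma e_d: "0 \<le> v \<Longrightarrow> e (d v) = v"
proof (rule antisym)
  assume v: "0 \<le> v"
  show "e (d v) \<le> v"
  proof (rule field_le_epsilon)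
    fix \<epsilon> :: real assume "0 < \<epsilon>"
    then show "e (d v) \<le> v + \<epsilon>" using v strict[of v "v + \<epsilon>"] by (intro e_le) auto
  qed
  show "v \<le> e (d v)"
    using e_lessD[of "d v" v] by (meson linorder_not_le order_less_irrefl)
qed

lemma e_mono: "s \<le> t \<Longrightarrow> e s \<le> e t"
  unfolding e_def by (rule cInf_superset_mono[OF e_set]) auto

lemma e_nonpos: "t \<le> 0 \<Longrightarrow> e t = 0"
  using e_mono[of t 0] e_nonneg[of t] e_d[of 0] d0 by simp

lemma d_less_le: "0 \<le> t \<Longrightarrow> 0 \<le> v \<Longrightarrow> v < e t \<Longrightarrow> d v \<le> t"
  using e_le[of v t] d0 by (cases "v = 0") fastforce+

lemma le_e: "0 \<le> v \<Longrightarrow> d v \<le> t \<Longrightarrow> v \<le> e t"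
  using e_mono[of "d v" t] e_d by simp

text \<open>A jump of \<open>e\<close> would be a flat stretch of \<open>d\<close>. From above,
  \<open>r = d (e t + \<epsilon> / 2)\<close> exceeds \<open>t\<close>, and before \<open>r\<close>
  the inverse is at most \<open>e t + \<epsilon> / 2\<close>. From below, two points
  \<open>u < u'\<close> under \<open>e t\<close> are used, since one alone gives
  \<open>d u \<le> t\<close> and not the strict inequality that a neighbourhood of \<open>t\<close>
  requires.\<close>

lemma isCont_e: "isCont e t"
  unfolding continuous_at_eps_delta
proof (intro allI impI)
  fix \<epsilon> :: real assume \<epsilon>: "0 < \<epsilon>"
  define r where "r = d (e t + \<epsilon> / 2)"
  have r: "t < r" unfolding r_def by (rule e_lessD) (use \<epsilon> in auto)
  have up: "e s < e t + \<epsilon>" if "s < r" for s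
  proof -
    have "e s \<le> e t + \<epsilon> / 2"
      by (rule e_le) (use that \<epsilon> e_nonneg[of t] in \<open>auto simp: r_def\<close>)
    then show ?thesis using \<epsilon> by simp
  qed
  obtain l where l: "l < t" and lo: "\<And>s. l < s \<Longrightarrow> e t - \<epsilon> < e s"
  proof (cases "e t < \<epsilon>")
    case True
    then show ?thesis using that[of "t - 1"] e_nonneg by (smt (verit))
  next
    case False
    define u where "u = e t - \<epsilon> / 2"
    have u: "0 \<le> u" "u < e t" using False \<epsilon> by (auto simp: u_def)
    have t: "0 \<le> t" using e_nonpos[of t] u by (cases "0 \<le> t") auto
    obtain u' where u': "u < u'" "u' < e t" using dense u by blast
    have "d u < d u'" "d u' \<le> t" using strict d_less_le t u u' by auto
    then have "d u < t" by simp
    moreover have "e t - \<epsilon> < e s" if "d u < s" for s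
      using le_e[OF u(1), of s] that \<epsilon> by (auto simp: u_def)
    ultimately show ?thesis using that by blast
  qed
  define \<eta> where "\<eta> = min (r - t) (t - l)"
  have "0 < \<eta>" using r l by (simp add: \<eta>_def)
  moreover have "dist (e s) (e t) < \<epsilon>" if "dist s t < \<eta>" for s
    using up[of s] lo[of s] that by (auto simp: \<eta>_def dist_real_def abs_less_iff)
  ultimately show "\<exists>\<eta>>0. \<forall>s. dist s t < \<eta> \<longrightarrow> dist (e s) (e t) < \<epsilon>" by blast
qed

lemma continuous_on_e: "continuous_on A e"
  using isCont_e by (simp add: continuous_at_imp_continuous_on)

lemma e_measurable [measurable]: "e \<in> borel_measurable borel"
  by (intro borel_measurable_continuous_onI continuous_on_e)

lemma grid_index:
  assumes "0 < \<delta>" "0 \<le> s"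
  obtains n where "d (real n * \<delta>) \<le> s" "s < d (real (Suc n) * \<delta>)"
proof -
  obtain u where u: "0 \<le> u" "s < d u" using unbounded by blast
  obtain k where "u < real k * \<delta>" using reals_Archimedean3[OF \<open>0 < \<delta>\<close>] by blast
  then have ex: "\<exists>k. s < d (real (Suc k) * \<delta>)"
    using u strict[of u "real (Suc k) * \<delta>"] assms(1)
    by (intro exI[of _ k]) (auto simp: algebra_simps)
  define n where "n = (LEAST k. s < d (real (Suc k) * \<delta>))"
  have 1: "s < d (real (Suc n) * \<delta>)" unfolding n_def using ex by (rule LeastI_ex)
  have "d (real n * \<delta>) \<le> s"
  proof (cases n)
    case 0 then show ?thesis using d0 assms by simp
  next
    case (Suc k)
    then have "\<not> s < d (real (Suc k) * \<delta>)" unfolding n_def using not_less_Least by (metis lessI)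
    then show ?thesis using Suc by simp
  qed
  then show ?thesis using that 1 by blast
qed

lemma grid_index_unique:
  assumes "0 < \<delta>" "d (real n * \<delta>) \<le> s" "s < d (real (Suc n) * \<delta>)"
    "d (real k * \<delta>) \<le> s" "s < d (real (Suc k) * \<delta>)"
  shows "k = n"
proof -
  have "d (real n * \<delta>) < d (real (Suc k) * \<delta>)" "d (real k * \<delta>) < d (real (Suc n) * \<delta>)"
    using assms by linarith+
  then have "real n < real (Suc k)" "real k < real (Suc n)"
    using d_less_iff[of "real n * \<delta>" "real (Suc k) * \<delta>"] d_less_iff[of "real k * \<delta>" "real (Suc n) * \<delta>"] assms(1)
    by (auto simp: mult_less_cancel_right simp del: of_nat_Suc)
  then show ?thesis by linarith
qed

text \<open>The upper bound is not strict: if \<open>d\<close> jumps at the next grid point,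
  \<open>e s\<close> already equals that point while \<open>s\<close> is inside the jump.\<close>

lemma grid_e:
  assumes "0 < \<delta>" "d (real n * \<delta>) \<le> s" "s < d (real (Suc n) * \<delta>)"
  shows "real n * \<delta> \<le> e s" "e s \<le> real (Suc n) * \<delta>"
  using assms by (auto intro!: le_e e_le simp del: of_nat_Suc)

section \<open>Integrals against the inverse in operational time\<close>

lemma d_max_mono: "mono (\<lambda>v. d (max 0 v))"
  by (rule monoI) (auto simp: d_le_iff)

text \<open>The path is unconstrained at negative times; freezing the argument at 0 gives a
  monotone, hence Borel, function on the whole line.\<close>

lemma d_max_measurable [measurable]: "(\<lambda>v. d (max 0 v)) \<in> borel_measurable borel"
  by (rule borel_measurable_mono[OF d_max_mono])

text \<open>The set of \<open>v\<close> with \<open>a < d v \<le> b\<close> lies between the open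
  and the closed interval with end points \<open>e a\<close> and \<open>e b\<close>, so that both
  measures give \<open>{a<..b}\<close> the mass \<open>e b - e a\<close>; such intervals determine
  them.\<close>

lemma interval_measure_e:
  "interval_measure e = distr (restrict_space lborel {0..}) borel (\<lambda>v. d (max 0 v))" (is "_ = ?R")
proof -
  have m: "(\<lambda>v. d (max 0 v)) \<in> measurable (restrict_space lborel {0..}) borel"
    by (intro measurable_restrict_space1) simp
  have E1: "emeasure (interval_measure e) {a<..b} = ennreal (e b - e a)" if "a \<le> b" for a b
    by (rule emeasure_interval_measure_Ioc[OF that])
       (auto intro: e_mono continuous_at_imp_continuous_at_within isCont_e)
  have E2: "emeasure ?R {a<..b} = ennreal (e b - e a)" if "a \<le> b" for a b
  proof -
    let ?A = "{v. 0 \<le> v \<and> a < d v \<and> d v \<le> b}"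
    have "emeasure ?R {a<..b} = emeasure (restrict_space lborel {0..}) ?A"
      by (subst emeasure_distr[OF m])
         (auto intro!: arg_cong[where f = "emeasure _"] simp: space_restrict_space max_def)
    also have "\<dots> = emeasure lborel ?A"
      by (rule emeasure_restrict_space) auto
    also have "\<dots> = ennreal (e b - e a)"
    proof (rule antisym)
      have "?A \<subseteq> {e a..e b}"
      proof safe
        fix v assume v: "0 \<le> v" "a < d v" "d v \<le> b"
        show "v \<in> {e a..e b}"
          using e_mono[of a "d v"] e_d[of v] le_e[of v b] v by simp
      qed
      then have "emeasure lborel ?A \<le> emeasure lborel {e a..e b}"
        by (rule emeasure_mono) auto
      then show "emeasure lborel ?A \<le> ennreal (e b - e a)" using e_mono[OF that] by simp
      have "{e a<..<e b} \<subseteq> ?A"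
      proof safe
        fix v assume v: "v \<in> {e a<..<e b}"
        then show "0 \<le> v" using e_nonneg[of a] by auto
        show "a < d v" using v e_lessD by auto
        have "0 \<le> b" using v e_nonpos[of b] e_nonneg[of a] by (cases "0 \<le> b") auto
        then show "d v \<le> b" using v d_less_le \<open>0 \<le> v\<close> by auto
      qed
      moreover have "?A \<in> sets lborel"
      proof -
        have "?A = {v\<in>space borel. 0 \<le> v \<and> a < d (max 0 v) \<and> d (max 0 v) \<le> b}" by (auto simp: max_def)
        also have "\<dots> \<in> sets borel" by measurable
        finally show ?thesis by simp
      qed
      ultimately have "emeasure lborel {e a<..<e b} \<le> emeasure lborel ?A"
        by (rule emeasure_mono)
      then show "ennreal (e b - e a) \<le> emeasure lborel ?A" using e_mono[OF that] by simp
    qed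
    finally show ?thesis .
  qed
  show ?thesis
  proof (rule measure_eqI_generator_eq[where E = "range (\<lambda>(a, b). {a<..b::real})"
        and \<Omega> = UNIV and A = "\<lambda>n. {- real n<..real n}"])
    show "Int_stable (range (\<lambda>(a, b). {a<..b::real}))"
      by (auto simp: Int_stable_def image_iff)
    fix X assume "X \<in> range (\<lambda>(a, b). {a<..b::real})"
    then obtain a b where X: "X = {a<..b}" by auto
    show "emeasure (interval_measure e) X = emeasure ?R X"
      by (cases "a \<le> b") (auto simp: X E1 E2)
  next
    show "(\<Union>n. {- real n<..real n}) = UNIV"
    proof safe
      fix x :: real
      obtain n where "\<bar>x\<bar> < real n" using reals_Archimedean2 by blast
      then show "x \<in> (\<Union>n. {- real n<..real n})" by (intro UN_I[of n]) auto
    qed auto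
    show "emeasure (interval_measure e) {- real n<..real n} \<noteq> \<infinity>" for n
      by (simp add: E1)
  qed (auto simp: borel_sigma_sets_Ioc)
qed

text \<open>Change of variables for the image measure. The set of \<open>v\<close> with
  \<open>d v \<le> t\<close> agrees with \<open>{0..e t}\<close> except possibly at
  \<open>e t\<close>, which is a null set.\<close>

lemma interval_measure_e_integral:
  fixes f :: "real \<Rightarrow> real"
  assumes f: "(\<lambda>r. indicator {0..t} r * f r) \<in> borel_measurable borel" and t: "0 \<le> t"
  shows "(LINT r:{0..t}|interval_measure e. f r) = (LINT v:{0..e t}|lborel. f (d (max 0 v)))"
proof -
  let ?d = "\<lambda>v. d (max 0 v)"
  have "(LINT r:{0..t}|interval_measure e. f r)
      = (LINT v|restrict_space lborel {0..}. indicator {0..t} (?d v) * f (?d v))"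
    unfolding set_lebesgue_integral_def interval_measure_e real_scaleR_def
    by (rule integral_distr[OF _ f]) (rule measurable_restrict_space1, simp)
  also have "\<dots> = (LINT v|lborel. indicator {0..} v * (indicator {0..t} (?d v) * f (?d v)))"
    by (subst integral_restrict_space) simp_all
  also have "\<dots> = (LINT v:{0..e t}|lborel. f (?d v))"
    unfolding set_lebesgue_integral_def
  proof (rule integral_cong_AE)
    have fd: "(\<lambda>v. indicator {0..t} (?d v) * f (?d v)) \<in> borel_measurable borel"
      using measurable_compose[OF d_max_measurable f] by simp
    then show "(\<lambda>v. indicator {0..} v * (indicator {0..t} (?d v) * f (?d v))) \<in> borel_measurable lborel"
      by simp
    have ae: "AE v in lborel. v \<noteq> e t" by (rule AE_lborel_singleton)
    have eq: "indicator {0..} v * (indicator {0..t} (?d v) * f (?d v)) = indicator {0..e t} v *\<^sub>R f (?d v)"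
      if "v \<noteq> e t" for v
      using that d_less_le[of t v] le_e[of v t] d_nonneg[of v] t by (auto simp: indicator_def max_def)
    show "AE v in lborel. indicator {0..} v * (indicator {0..t} (?d v) * f (?d v)) = indicator {0..e t} v *\<^sub>R f (?d v)"
      using ae by eventually_elim (rule eq)
    \<comment> \<open>\<open>f\<close> is assumed measurable only on \<open>{0..t}\<close>, and
      \<open>?d (e t)\<close> may lie beyond it; the value there enters as a constant on a single
      point.\<close>
    have "indicator {0..e t} v *\<^sub>R f (?d v) = indicator {0..<e t} v * (indicator {0..t} (?d v) * f (?d v))
        + indicator {e t} v * f (?d (e t))" for v
      using d_less_le[of t v] d_nonneg[of v] e_nonneg[of t] t by (auto simp: indicator_def max_def)
    moreover have "(\<lambda>v. indicator {0..<e t} v * (indicator {0..t} (?d v) * f (?d v))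
        + indicator {e t} v * f (?d (e t))) \<in> borel_measurable borel"
      by (intro borel_measurable_add borel_measurable_times fd borel_measurable_indicator borel_measurable_const) auto
    ultimately show "(\<lambda>v. indicator {0..e t} v *\<^sub>R f (?d v)) \<in> borel_measurable lborel" by simp
  qed
  finally show ?thesis .
qed

lemma interval_measure_e_const:
  assumes "a \<le> b"
  shows "(LINT r:{a..b}|interval_measure e. c) = c * (e b - e a)"
proof -
  have "emeasure (interval_measure e) {a..b} = ennreal (e b - e a)"
    by (rule emeasure_interval_measure_Icc[OF assms])
       (auto intro: e_mono continuous_on_e)
  then have "measure (interval_measure e) {a..b} = e b - e a" "emeasure (interval_measure e) {a..b} < \<infinity>"
    using e_mono[OF assms] by (auto simp: measure_def)
  then show ?thesis by (simp add: set_lebesgue_integral_def)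
qed

end

section \<open>Maximal inequalities for Brownian step integrals\<close>

definition square_integrable :: "'a measure \<Rightarrow> ('a \<Rightarrow> real) \<Rightarrow> bool" where
  "square_integrable M f \<longleftrightarrow> f \<in> borel_measurable M \<and> integrable M (\<lambda>x. (f x)\<^sup>2)"

lemma square_integrableD:
  "square_integrable M f \<Longrightarrow> f \<in> borel_measurable M"
  "square_integrable M f \<Longrightarrow> integrable M (\<lambda>x. (f x)\<^sup>2)"
  by (auto simp: square_integrable_def)

lemma square_integrable_prod:
  assumes "square_integrable M f" "square_integrable M g"
  shows "integrable M (\<lambda>x. f x * g x)"
proof (rule Bochner_Integration.integrable_bound)
  show "integrable M (\<lambda>x. (f x)\<^sup>2 + (g x)\<^sup>2)"
    using assms by (auto simp: square_integrable_def)
  show "(\<lambda>x. f x * g x) \<in> borel_measurable M"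
    using assms by (auto simp: square_integrable_def)
  have "\<bar>a * b\<bar> \<le> \<bar>a\<^sup>2 + b\<^sup>2\<bar>" for a b :: real
    using sum_squares_bound[of "\<bar>a\<bar>" "\<bar>b\<bar>"] mult_nonneg_nonneg[of "\<bar>a\<bar>" "\<bar>b\<bar>"]
    by (simp add: abs_mult del: mult_nonneg_nonneg zero_le_mult_iff)
  then show "AE x in M. norm (f x * g x) \<le> norm ((f x)\<^sup>2 + (g x)\<^sup>2)" by simp
qed

lemma square_integrable_add:
  assumes "square_integrable M f" "square_integrable M g"
  shows "square_integrable M (\<lambda>x. f x + g x)"
proof -
  have "integrable M (\<lambda>x. (f x)\<^sup>2 + (g x)\<^sup>2 + 2 * (f x * g x))"
    using assms square_integrable_prod[OF assms] by (auto simp: square_integrable_def)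
  moreover have "(\<lambda>x. (f x)\<^sup>2 + (g x)\<^sup>2 + 2 * (f x * g x)) = (\<lambda>x. (f x + g x)\<^sup>2)"
    by (auto simp: power2_eq_square algebra_simps)
  ultimately show ?thesis using assms by (auto simp: square_integrable_def)
qed

lemma square_integrable_bound_mult:
  assumes f: "f \<in> borel_measurable M" and b: "\<And>x. x \<in> space M \<Longrightarrow> \<bar>f x\<bar> \<le> c"
    and g: "square_integrable M g"
  shows "square_integrable M (\<lambda>x. f x * g x)"
  unfolding square_integrable_def
proof
  have gm[measurable]: "g \<in> borel_measurable M" using g by (rule square_integrableD)
  note f[measurable]
  show "(\<lambda>x. f x * g x) \<in> borel_measurable M" by measurable
  show "integrable M (\<lambda>x. (f x * g x)\<^sup>2)"
  proof (rule Bochner_Integration.integrable_bound)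
    show "integrable M (\<lambda>x. c\<^sup>2 * (g x)\<^sup>2)" using square_integrableD(2)[OF g] by simp
    show "(\<lambda>x. (f x * g x)\<^sup>2) \<in> borel_measurable M" by measurable
    show "AE x in M. norm ((f x * g x)\<^sup>2) \<le> norm (c\<^sup>2 * (g x)\<^sup>2)"
    proof (rule AE_I2)
      fix x assume "x \<in> space M"
      then have "\<bar>f x\<bar>\<^sup>2 \<le> c\<^sup>2" by (intro power_mono b) auto
      then show "norm ((f x * g x)\<^sup>2) \<le> norm (c\<^sup>2 * (g x)\<^sup>2)"
        by (simp add: power_mult_distrib mult_right_mono)
    qed
  qed
qed

lemma square_integrable_cmult: "square_integrable M f \<Longrightarrow> square_integrable M (\<lambda>x. c * f x)"
  by (auto simp: square_integrable_def power_mult_distrib)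

lemma square_integrable_uminus: "square_integrable M f \<Longrightarrow> square_integrable M (\<lambda>x. - f x)"
  by (auto simp: square_integrable_def)

lemma square_integrable_diff:
  "square_integrable M f \<Longrightarrow> square_integrable M g \<Longrightarrow> square_integrable M (\<lambda>x. f x - g x)"
  using square_integrable_add[of M f "\<lambda>x. - g x"] square_integrable_uminus[of M g] by simp

lemma square_integrable_0: "square_integrable M (\<lambda>x. 0)"
  by (auto simp: square_integrable_def)

lemma square_integrable_sum:
  "(\<And>i. i \<in> I \<Longrightarrow> square_integrable M (f i)) \<Longrightarrow> square_integrable M (\<lambda>x. \<Sum>i\<in>I. f i x)"
  by (induction I rule: infinite_finite_induct) (auto intro: square_integrable_add square_integrable_0)

lemma square_integrable_max:
  assumes "square_integrable M f" "square_integrable M g"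
  shows "square_integrable M (\<lambda>x. max (f x) (g x))"
  unfolding square_integrable_def
proof
  have m[measurable]: "f \<in> borel_measurable M" "g \<in> borel_measurable M"
    using assms by (auto dest: square_integrableD)
  show "(\<lambda>x. max (f x) (g x)) \<in> borel_measurable M" by measurable
  show "integrable M (\<lambda>x. (max (f x) (g x))\<^sup>2)"
    by (rule Bochner_Integration.integrable_bound[where f = "\<lambda>x. (f x)\<^sup>2 + (g x)\<^sup>2"])
       (use assms in \<open>auto simp: square_integrable_def max_def\<close>)
qed

lemma square_integrable_running_max:
  assumes "\<And>k. k \<le> n \<Longrightarrow> square_integrable M (S k)"
  shows "square_integrable M (\<lambda>x. running_max (\<lambda>k. S k x) n)"
  using assms by (induction n) (auto intro: square_integrable_max)

lemma measurable_running_max: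
  assumes "\<And>k. k \<le> n \<Longrightarrow> S k \<in> borel_measurable M"
  shows "(\<lambda>x. running_max (\<lambda>k. S k x) n) \<in> borel_measurable M"
  using assms by (induction n) auto

lemma running_max_abs: "running_max (\<lambda>k. \<bar>S k\<bar>) n = max (running_max S n) (running_max (\<lambda>k. - S k) n)"
  by (induction n) (auto simp: max_def abs_if)

lemma running_max_attained: "\<exists>k\<le>n. running_max S n = S k"
  by (induction n) (auto simp: max_def le_Suc_eq)

lemma integrable_square_integrable:
  assumes "prob_space M" "square_integrable M f" shows "integrable M f"
proof -
  interpret prob_space M by fact
  have "square_integrable M (\<lambda>x. 1)" by (auto simp: square_integrable_def)
  from square_integrable_prod[OF assms(2) this] show ?thesis by simp
qed

text \<open>Weighted inequality of arithmetic and geometric means. With \<alpha> of the order of the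
  square root of \<open>c\<close> it has the strength of Cauchy-Schwarz up to a constant; later
  \<alpha> is 1 where a finite mean suffices and \<open>\<delta> powr \<theta>\<close> where the
  rate matters.\<close>

lemma nn_integral_abs_le_square:
  assumes "prob_space M" "square_integrable M f" "0 < \<alpha>" "(\<integral>x. (f x)\<^sup>2 \<partial>M) \<le> c"
  shows "(\<integral>\<^sup>+x. ennreal \<bar>f x\<bar> \<partial>M) \<le> ennreal ((\<alpha> + c / \<alpha>) / 2)"
proof -
  interpret prob_space M by fact
  have le: "\<bar>f x\<bar> \<le> (\<alpha> + (f x)\<^sup>2 / \<alpha>) / 2" for x
  proof -
    have "0 \<le> (\<bar>f x\<bar> - \<alpha>)\<^sup>2" by simp
    then have "2 * \<alpha> * \<bar>f x\<bar> \<le> \<alpha>\<^sup>2 + (f x)\<^sup>2" by (simp add: power2_eq_square algebra_simps)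
    then show ?thesis using \<open>0 < \<alpha>\<close> by (simp add: field_simps power2_eq_square)
  qed
  have i: "integrable M (\<lambda>x. (\<alpha> + (f x)\<^sup>2 / \<alpha>) / 2)"
    using assms(2) by (auto simp: square_integrable_def)
  have "(\<integral>\<^sup>+x. ennreal \<bar>f x\<bar> \<partial>M) \<le> (\<integral>\<^sup>+x. ennreal ((\<alpha> + (f x)\<^sup>2 / \<alpha>) / 2) \<partial>M)"
    by (intro nn_integral_mono ennreal_leI le)
  also have "\<dots> = ennreal (\<integral>x. (\<alpha> + (f x)\<^sup>2 / \<alpha>) / 2 \<partial>M)"
    by (rule nn_integral_eq_integral[OF i]) (use \<open>0 < \<alpha>\<close> in auto)
  also have "(\<integral>x. (\<alpha> + (f x)\<^sup>2 / \<alpha>) / 2 \<partial>M) = (\<alpha> + (\<integral>x. (f x)\<^sup>2 \<partial>M) / \<alpha>) / 2"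
    using assms(2) by (simp add: square_integrable_def prob_space)
  also have "\<dots> \<le> (\<alpha> + c / \<alpha>) / 2"
    using assms(3,4) by (auto intro!: divide_right_mono)
  finally show ?thesis by (simp add: ennreal_leI)
qed

section \<open>Brownian increments and Doob's inequality in mean square\<close>

locale brownian = prob_space +
  fixes b :: "real \<Rightarrow> 'a \<Rightarrow> real" and Fb :: "real \<Rightarrow> 'a measure"
  assumes space_Fb: "\<And>t. space (Fb t) = space M"
    and sets_Fb: "\<And>t. sets (Fb t) \<subseteq> sets M"
    and Fb_mono: "\<And>s t. s \<le> t \<Longrightarrow> sets (Fb s) \<subseteq> sets (Fb t)"
    and adapted: "\<And>t. 0 \<le> t \<Longrightarrow> b t \<in> borel_measurable (Fb t)"
    and b_paths: "AE \<omega> in M. b 0 \<omega> = 0 \<and> continuous_on {0..} (\<lambda>t. b t \<omega>)"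
    and normal: "\<And>s t. 0 \<le> s \<Longrightarrow> s < t \<Longrightarrow>
      distributed M lborel (\<lambda>\<omega>. b t \<omega> - b s \<omega>) (\<lambda>x. ennreal (normal_density 0 (sqrt (t - s)) x))"
    and indep: "\<And>s t Z. 0 \<le> s \<Longrightarrow> s < t \<Longrightarrow> Z \<in> borel_measurable (Fb s) \<Longrightarrow>
      indep_var borel Z borel (\<lambda>\<omega>. b t \<omega> - b s \<omega>)"
begin

lemma Fb_measurable: "f \<in> borel_measurable (Fb s) \<Longrightarrow> f \<in> borel_measurable M"
  by (metis measurable_mono[OF order_refl refl sets_Fb space_Fb] subsetD)

lemma Fb_measurable_mono: "s \<le> t \<Longrightarrow> f \<in> borel_measurable (Fb s) \<Longrightarrow> f \<in> borel_measurable (Fb t)"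
  by (metis measurable_mono[OF order_refl refl Fb_mono] space_Fb subsetD)

lemma b_adapted: "0 \<le> s \<Longrightarrow> s \<le> t \<Longrightarrow> b s \<in> borel_measurable (Fb t)"
  using Fb_measurable_mono adapted by blast

lemma b_measurable: "0 \<le> t \<Longrightarrow> b t \<in> borel_measurable M"
  using Fb_measurable adapted by blast

text \<open>The case \<open>s = t\<close> is treated apart because the locale provides a normal
  density only for positive variance.\<close>

lemma incr_power:
  assumes "0 \<le> s" "s \<le> t"
  shows "integrable M (\<lambda>\<omega>. (b t \<omega> - b s \<omega>) ^ k)"
proof (cases "s = t")
  case False
  then have st: "s < t" using assms by simp
  have "integrable lborel (\<lambda>x. normal_density 0 (sqrt (t - s)) x * x ^ k)"
    using integrable_normal_moment[where \<mu> = 0 and \<sigma> = "sqrt (t - s)" and k = k] st by simp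
  then show ?thesis
    using distributed_integrable[OF normal[OF assms(1) st], of "\<lambda>x. x ^ k"] by simp
qed (cases k, auto)

lemma incr_mean: "0 \<le> s \<Longrightarrow> s \<le> t \<Longrightarrow> (\<integral>\<omega>. b t \<omega> - b s \<omega> \<partial>M) = 0"
proof (cases "s = t")
  case False
  assume "0 \<le> s" "s \<le> t"
  then have st: "0 \<le> s" "s < t" using False by auto
  show ?thesis
    using distributed_integral[OF normal[OF st], of "\<lambda>x. x"]
      has_bochner_integral_integral_eq[OF normal_moment_odd[where \<mu> = 0 and \<sigma> = "sqrt (t - s)" and k = 0]] st by simp
qed simp

lemma incr_even:
  assumes "0 \<le> s" "s \<le> t" "0 < k"
  shows "(\<integral>\<omega>. (b t \<omega> - b s \<omega>) ^ (2 * k) \<partial>M) = fact (2 * k) / (2 ^ k * fact k) * (t - s) ^ k"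
proof (cases "s = t")
  case False
  then have st: "s < t" using assms by simp
  have "(\<integral>\<omega>. (b t \<omega> - b s \<omega>) ^ (2 * k) \<partial>M) = fact (2 * k) / ((2 / (t - s)) ^ k * fact k)"
    using distributed_integral[OF normal[OF assms(1) st], of "\<lambda>x. x ^ (2 * k)"]
      integral_normal_moment_even[where \<mu> = 0 and \<sigma> = "sqrt (t - s)" and k = k] st by simp
  then show ?thesis by (simp add: power_divide)
qed (use assms in \<open>simp add: power_0_left\<close>)

lemma incr_var: "0 \<le> s \<Longrightarrow> s \<le> t \<Longrightarrow> (\<integral>\<omega>. (b t \<omega> - b s \<omega>)\<^sup>2 \<partial>M) = t - s"
  using incr_even[of s t 1] by simp

lemma incr_fourth: "0 \<le> s \<Longrightarrow> s \<le> t \<Longrightarrow> (\<integral>\<omega>. (b t \<omega> - b s \<omega>) ^ 4 \<partial>M) = 3 * (t - s)\<^sup>2"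
  using incr_even[of s t 2] by (simp add: fact_numeral)

lemma incr_square_integrable: "0 \<le> s \<Longrightarrow> s \<le> t \<Longrightarrow> square_integrable M (\<lambda>\<omega>. b t \<omega> - b s \<omega>)"
  using incr_power[of s t 2] b_measurable by (auto simp: square_integrable_def)

text \<open>Independence is stated in the locale for one real random variable of the past at a time,
  the form in which the mean of a product factors; conditional expectations do not appear.\<close>

lemma incr_orthogonal:
  assumes "0 \<le> s" "s \<le> t" "Z \<in> borel_measurable (Fb s)" "integrable M Z"
  shows "(\<integral>\<omega>. Z \<omega> * (b t \<omega> - b s \<omega>) \<partial>M) = 0"
proof (cases "s = t")
  case False
  then have st: "s < t" using assms by simp
  have "integrable M (\<lambda>\<omega>. b t \<omega> - b s \<omega>)" using incr_power[of s t 1] assms by simp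
  then show ?thesis
    using indep_var_lebesgue_integral[OF indep[OF assms(1) st assms(3)] assms(4)] incr_mean assms by simp
qed simp

lemma incr_square_indep:
  assumes "0 \<le> s" "s \<le> t" "Z \<in> borel_measurable (Fb s)" "integrable M Z"
  shows "(\<integral>\<omega>. Z \<omega> * (b t \<omega> - b s \<omega>)\<^sup>2 \<partial>M) = (\<integral>\<omega>. Z \<omega> \<partial>M) * (t - s)"
    and "integrable M (\<lambda>\<omega>. Z \<omega> * (b t \<omega> - b s \<omega>)\<^sup>2)"
proof -
  have "(\<integral>\<omega>. Z \<omega> * (b t \<omega> - b s \<omega>)\<^sup>2 \<partial>M) = (\<integral>\<omega>. Z \<omega> \<partial>M) * (t - s) \<and>
    integrable M (\<lambda>\<omega>. Z \<omega> * (b t \<omega> - b s \<omega>)\<^sup>2)"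
  proof (cases "s = t")
    case False
    then have st: "s < t" using assms by simp
    have i: "indep_var borel Z borel (\<lambda>\<omega>. (b t \<omega> - b s \<omega>)\<^sup>2)"
      using indep_var_compose[OF indep[OF assms(1) st assms(3)], of "\<lambda>x. x" borel "\<lambda>x. x\<^sup>2" borel]
      by (simp add: comp_def)
    show ?thesis
      using indep_var_lebesgue_integral[OF i assms(4) incr_power] indep_var_integrable[OF i assms(4) incr_power]
        incr_var assms by simp
  qed simp
  then show "(\<integral>\<omega>. Z \<omega> * (b t \<omega> - b s \<omega>)\<^sup>2 \<partial>M) = (\<integral>\<omega>. Z \<omega> \<partial>M) * (t - s)"
    and "integrable M (\<lambda>\<omega>. Z \<omega> * (b t \<omega> - b s \<omega>)\<^sup>2)" by auto
qed

text \<open>Means are taken in \<open>doob_pathwise\<close>: the running maximum at step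
  \<open>k\<close> is known at time \<open>t k\<close>, so every product in the subtracted sum has
  mean zero. The martingale property enters as orthogonality of the increments to square-integrable
  variables of the past.\<close>

lemma doob_one_sided:
  assumes S0: "\<And>\<omega>. S 0 \<omega> = 0"
    and ad: "\<And>k. k \<le> n \<Longrightarrow> S k \<in> borel_measurable (Fb (t k))"
    and t: "mono t"
    and L2: "\<And>k. k \<le> n \<Longrightarrow> square_integrable M (S k)"
    and orth: "\<And>k Z. k < n \<Longrightarrow> Z \<in> borel_measurable (Fb (t k)) \<Longrightarrow> square_integrable M Z \<Longrightarrow>
      (\<integral>\<omega>. Z \<omega> * (S (Suc k) \<omega> - S k \<omega>) \<partial>M) = 0"
  shows "(\<integral>\<omega>. (running_max (\<lambda>k. S k \<omega>) n)\<^sup>2 \<partial>M) \<le> 4 * (\<integral>\<omega>. (S n \<omega>)\<^sup>2 \<partial>M)"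
proof -
  let ?M = "\<lambda>k \<omega>. running_max (\<lambda>k. S k \<omega>) k"
  have ML2: "square_integrable M (?M k)" if "k \<le> n" for k
    by (rule square_integrable_running_max) (use L2 that in auto)
  have Mad: "?M k \<in> borel_measurable (Fb (t k))" if "k \<le> n" for k
  proof (rule measurable_running_max)
    fix j assume "j \<le> k"
    then have "S j \<in> borel_measurable (Fb (t j))" using that by (intro ad) simp
    then show "S j \<in> borel_measurable (Fb (t k))"
      by (rule Fb_measurable_mono[OF monoD[OF t \<open>j \<le> k\<close>]])
  qed
  have prod: "integrable M (\<lambda>\<omega>. ?M k \<omega> * (S (Suc k) \<omega> - S k \<omega>))" if "k < n" for k
    by (rule square_integrable_prod) (use ML2 L2 that in \<open>auto intro: square_integrable_diff\<close>)
  have "(\<integral>\<omega>. (?M n \<omega>)\<^sup>2 \<partial>M) \<le> (\<integral>\<omega>. 4 * (S n \<omega>)\<^sup>2 - 4 * (\<Sum>k<n. ?M k \<omega> * (S (Suc k) \<omega> - S k \<omega>)) \<partial>M)"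
  proof (rule integral_mono)
    show "integrable M (\<lambda>\<omega>. 4 * (S n \<omega>)\<^sup>2 - 4 * (\<Sum>k<n. ?M k \<omega> * (S (Suc k) \<omega> - S k \<omega>)))"
      by (intro Bochner_Integration.integrable_diff Bochner_Integration.integrable_sum integrable_mult_right
          square_integrableD(2) L2 prod) auto
    show "(?M n \<omega>)\<^sup>2 \<le> 4 * (S n \<omega>)\<^sup>2 - 4 * (\<Sum>k<n. ?M k \<omega> * (S (Suc k) \<omega> - S k \<omega>))" for \<omega>
      by (rule doob_pathwise) (rule S0)
  qed (rule square_integrableD(2)[OF ML2], simp)
  also have "\<dots> = 4 * (\<integral>\<omega>. (S n \<omega>)\<^sup>2 \<partial>M) - 4 * (\<integral>\<omega>. (\<Sum>k<n. ?M k \<omega> * (S (Suc k) \<omega> - S k \<omega>)) \<partial>M)"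
  proof (subst Bochner_Integration.integral_diff)
    show "integrable M (\<lambda>\<omega>. 4 * (S n \<omega>)\<^sup>2)"
      using square_integrableD(2)[OF L2[of n]] by simp
    show "integrable M (\<lambda>\<omega>. 4 * (\<Sum>k<n. ?M k \<omega> * (S (Suc k) \<omega> - S k \<omega>)))"
      by (intro integrable_mult_right Bochner_Integration.integrable_sum prod) auto
  qed simp
  also have "(\<integral>\<omega>. (\<Sum>k<n. ?M k \<omega> * (S (Suc k) \<omega> - S k \<omega>)) \<partial>M) = (\<Sum>k<n. \<integral>\<omega>. ?M k \<omega> * (S (Suc k) \<omega> - S k \<omega>) \<partial>M)"
    by (rule Bochner_Integration.integral_sum) (use prod in auto)
  also have "\<dots> = 0"
    by (rule sum.neutral) (auto intro!: orth[OF _ Mad ML2])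
  finally show ?thesis by simp
qed

text \<open>The maximum of the absolute values is the larger of the running maxima of
  \<open>S\<close> and \<open>- S\<close>. Bounding its square by the sum of both squares gives 8 as
  twice 4.\<close>

lemma doob_L2:
  assumes S0: "\<And>\<omega>. S 0 \<omega> = 0"
    and ad: "\<And>k. k \<le> n \<Longrightarrow> S k \<in> borel_measurable (Fb (t k))"
    and t: "mono t"
    and L2: "\<And>k. k \<le> n \<Longrightarrow> square_integrable M (S k)"
    and orth: "\<And>k Z. k < n \<Longrightarrow> Z \<in> borel_measurable (Fb (t k)) \<Longrightarrow> square_integrable M Z \<Longrightarrow>
      (\<integral>\<omega>. Z \<omega> * (S (Suc k) \<omega> - S k \<omega>) \<partial>M) = 0"
  shows "(\<integral>\<omega>. (running_max (\<lambda>k. \<bar>S k \<omega>\<bar>) n)\<^sup>2 \<partial>M) \<le> 8 * (\<integral>\<omega>. (S n \<omega>)\<^sup>2 \<partial>M)"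
    and "square_integrable M (\<lambda>\<omega>. running_max (\<lambda>k. \<bar>S k \<omega>\<bar>) n)"
proof -
  let ?P = "\<lambda>\<omega>. running_max (\<lambda>k. S k \<omega>) n" and ?N = "\<lambda>\<omega>. running_max (\<lambda>k. - S k \<omega>) n"
  have N: "(\<integral>\<omega>. (?N \<omega>)\<^sup>2 \<partial>M) \<le> 4 * (\<integral>\<omega>. (- S n \<omega>)\<^sup>2 \<partial>M)"
  proof (rule doob_one_sided[where t = t])
    fix k Z assume "k < n" "Z \<in> borel_measurable (Fb (t k))" "square_integrable M Z"
    note 0 = orth[OF this]
    have "(\<lambda>\<omega>. Z \<omega> * (- S (Suc k) \<omega> - - S k \<omega>)) = (\<lambda>\<omega>. - (Z \<omega> * (S (Suc k) \<omega> - S k \<omega>)))"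
      by (simp add: fun_eq_iff algebra_simps)
    then show "(\<integral>\<omega>. Z \<omega> * (- S (Suc k) \<omega> - - S k \<omega>) \<partial>M) = 0"
      using 0 by (simp only: Bochner_Integration.integral_minus minus_zero)
  next
    fix k assume "k \<le> n"
    from ad[OF this] show "(\<lambda>\<omega>. - S k \<omega>) \<in> borel_measurable (Fb (t k))" by simp
    from L2[OF \<open>k \<le> n\<close>] show "square_integrable M (\<lambda>\<omega>. - S k \<omega>)" by (rule square_integrable_uminus)
  qed (simp_all only: S0 t minus_zero)
  have P: "(\<integral>\<omega>. (?P \<omega>)\<^sup>2 \<partial>M) \<le> 4 * (\<integral>\<omega>. (S n \<omega>)\<^sup>2 \<partial>M)"
    by (rule doob_one_sided[where t = t]) (rule S0, erule ad, rule t, erule L2, erule (2) orth)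
  have L: "square_integrable M ?P" "square_integrable M ?N"
    by (rule square_integrable_running_max, erule L2)
       (rule square_integrable_running_max, rule square_integrable_uminus, erule L2)
  show *: "square_integrable M (\<lambda>\<omega>. running_max (\<lambda>k. \<bar>S k \<omega>\<bar>) n)"
    unfolding running_max_abs by (rule square_integrable_max[OF L])
  have "(\<integral>\<omega>. (running_max (\<lambda>k. \<bar>S k \<omega>\<bar>) n)\<^sup>2 \<partial>M) \<le> (\<integral>\<omega>. (?P \<omega>)\<^sup>2 + (?N \<omega>)\<^sup>2 \<partial>M)"
  proof (rule integral_mono[OF square_integrableD(2)[OF *] Bochner_Integration.integrable_add[OF L[THEN square_integrableD(2)]]])
    have "(max x y)\<^sup>2 \<le> x\<^sup>2 + y\<^sup>2" for x y :: real by (simp add: max_def)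
    then show "(running_max (\<lambda>k. \<bar>S k \<omega>\<bar>) n)\<^sup>2 \<le> (?P \<omega>)\<^sup>2 + (?N \<omega>)\<^sup>2" for \<omega>
      unfolding running_max_abs by this
  qed
  also have "\<dots> = (\<integral>\<omega>. (?P \<omega>)\<^sup>2 \<partial>M) + (\<integral>\<omega>. (?N \<omega>)\<^sup>2 \<partial>M)"
    using square_integrableD(2)[OF L(1)] square_integrableD(2)[OF L(2)]
    by (rule Bochner_Integration.integral_add)
  finally show "(\<integral>\<omega>. (running_max (\<lambda>k. \<bar>S k \<omega>\<bar>) n)\<^sup>2 \<partial>M) \<le> 8 * (\<integral>\<omega>. (S n \<omega>)\<^sup>2 \<partial>M)"
    using P N by simp
qed

end

section \<open>Step integrals: isometry, martingale property and maximal inequality\<close>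

lemma integrable_indicator_Ioc: "integrable lborel (indicator {a<..b} :: real \<Rightarrow> real)"
  by (cases "a \<le> b") (auto intro!: integrable_real_indicator)

text \<open>The overlap is expressed through the kernel \<open>min\<close>, the Brownian covariance,
  so that the covariance of two increments becomes the inner product of the indicators of their
  intervals.\<close>

lemma lborel_Ioc_inter:
  fixes x y x' y' :: real
  assumes "x \<le> y" "x' \<le> y'"
  shows "(LINT v|lborel. indicator {x<..y} v * indicator {x'<..y'} v) =
    min y y' - min y x' - min x y' + min x x'"
proof -
  have "(\<lambda>v. indicator {x<..y} v * indicator {x'<..y'} v :: real) = indicator {max x x'<..min y y'}"
    by (auto simp: fun_eq_iff indicator_def)
  then have "(LINT v|lborel. indicator {x<..y} v * indicator {x'<..y'} v) = max 0 (min y y' - max x x')"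
    by (cases "max x x' \<le> min y y'") auto
  then show ?thesis
    using assms by (simp add: min_def max_def split: if_splits)
qed

lemma sum_square_expand:
  fixes f :: "'i \<Rightarrow> real"
  shows "(\<Sum>j\<in>J. f j)\<^sup>2 = (\<Sum>i\<in>J. \<Sum>j\<in>J. f i * f j)"
  by (simp add: power2_eq_square sum_product)

context brownian
begin

lemma b_AE_eq: "AE \<omega> in M. b t \<omega> - b 0 \<omega> = b t \<omega>"
  using b_paths by eventually_elim simp

lemma b_square_integrable: "0 \<le> t \<Longrightarrow> square_integrable M (b t)"
proof -
  assume t: "0 \<le> t"
  have "integrable M (\<lambda>\<omega>. (b t \<omega> - b 0 \<omega>)\<^sup>2)" using incr_power[of 0 t 2] t by simp
  also have "?this \<longleftrightarrow> integrable M (\<lambda>\<omega>. (b t \<omega>)\<^sup>2)"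
    by (rule integrable_cong_AE) (use t b_measurable b_AE_eq[of t] in auto)
  finally show ?thesis using b_measurable[OF t] by (simp add: square_integrable_def)
qed

lemma b_covariance:
  assumes "0 \<le> s" "0 \<le> t"
  shows "(\<integral>\<omega>. b s \<omega> * b t \<omega> \<partial>M) = min s t"
proof -
  have *: "(\<integral>\<omega>. b s \<omega> * b t \<omega> \<partial>M) = s" if "0 \<le> s" "s \<le> t" for s t
  proof -
    have L2: "square_integrable M (b s)" "square_integrable M (\<lambda>\<omega>. b t \<omega> - b s \<omega>)"
      using b_square_integrable incr_square_integrable that by auto
    have "(\<integral>\<omega>. b s \<omega> * b t \<omega> \<partial>M) = (\<integral>\<omega>. b s \<omega> * (b t \<omega> - b s \<omega>) + (b s \<omega>)\<^sup>2 \<partial>M)"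
      by (rule Bochner_Integration.integral_cong) (auto simp: algebra_simps power2_eq_square)
    also have "\<dots> = (\<integral>\<omega>. b s \<omega> * (b t \<omega> - b s \<omega>) \<partial>M) + (\<integral>\<omega>. (b s \<omega>)\<^sup>2 \<partial>M)"
      by (rule Bochner_Integration.integral_add) (auto intro: square_integrable_prod L2 square_integrableD)
    also have "(\<integral>\<omega>. b s \<omega> * (b t \<omega> - b s \<omega>) \<partial>M) = 0"
      by (rule incr_orthogonal)
         (use that b_adapted[of s s] integrable_square_integrable[OF prob_space_axioms L2(1)] in auto)
    also have "(\<integral>\<omega>. (b s \<omega>)\<^sup>2 \<partial>M) = (\<integral>\<omega>. (b s \<omega> - b 0 \<omega>)\<^sup>2 \<partial>M)"
      by (rule integral_cong_AE) (use that b_measurable b_AE_eq[of s] in auto)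
    finally show ?thesis using incr_var[of 0 s] that by simp
  qed
  show ?thesis
    using *[of s t] *[of t s] assms by (cases "s \<le> t") (auto simp: mult.commute)
qed

lemma incr_covariance:
  assumes "0 \<le> x" "x \<le> y" "0 \<le> x'" "x' \<le> y'"
  shows "(\<integral>\<omega>. (b y \<omega> - b x \<omega>) * (b y' \<omega> - b x' \<omega>) \<partial>M) =
    (LINT v|lborel. indicator {x<..y} v * indicator {x'<..y'} v)"
proof -
  have i: "integrable M (\<lambda>\<omega>. b s \<omega> * b t \<omega>)" if "0 \<le> s" "0 \<le> t" for s t
    by (rule square_integrable_prod) (use b_square_integrable that in auto)
  have p: "0 \<le> x" "0 \<le> y" "0 \<le> x'" "0 \<le> y'" using assms by auto
  have "(\<integral>\<omega>. (b y \<omega> - b x \<omega>) * (b y' \<omega> - b x' \<omega>) \<partial>M) =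
      (\<integral>\<omega>. b y \<omega> * b y' \<omega> - b y \<omega> * b x' \<omega> - b x \<omega> * b y' \<omega> + b x \<omega> * b x' \<omega> \<partial>M)"
    by (rule Bochner_Integration.integral_cong) (auto simp: algebra_simps)
  also have "\<dots> = min y y' - min y x' - min x y' + min x x'"
    by (simp add: i p b_covariance)
  finally show ?thesis using assms by (simp add: lborel_Ioc_inter)
qed

text \<open>The intervals from \<open>x j\<close> to \<open>y j\<close> may overlap, and they carry
  an arbitrary index type. The difference of integrals over two partitions is therefore again a step
  integral, indexed by a disjoint sum.\<close>

definition step_integral :: "'i set \<Rightarrow> ('i \<Rightarrow> real) \<Rightarrow> ('i \<Rightarrow> real) \<Rightarrow> ('i \<Rightarrow> real) \<Rightarrow> real \<Rightarrow> 'a \<Rightarrow> real"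
  where "step_integral J c x y v \<omega> = (\<Sum>j\<in>J. c j * (b (min (y j) v) \<omega> - b (min (x j) v) \<omega>))"

text \<open>By \<open>incr_covariance\<close> both sides are the same quadratic form in
  \<open>c\<close>. Overlapping intervals are thereby covered without passing to a common
  refinement.\<close>

lemma step_isometry:
  assumes xy: "\<And>j. j \<in> J \<Longrightarrow> 0 \<le> x j \<and> x j \<le> y j" and "0 \<le> S"
  shows "(\<integral>\<omega>. (step_integral J c x y S \<omega>)\<^sup>2 \<partial>M) =
    (LINT v|lborel. (\<Sum>j\<in>J. c j * indicator {min (x j) S<..min (y j) S} v)\<^sup>2)"
proof -
  let ?d = "\<lambda>j \<omega>. b (min (y j) S) \<omega> - b (min (x j) S) \<omega>"
  let ?I = "\<lambda>j v. indicator {min (x j) S<..min (y j) S} v :: real"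
  have d2: "square_integrable M (?d j)" if "j \<in> J" for j
    by (rule incr_square_integrable) (use xy[OF that] \<open>0 \<le> S\<close> in auto)
  have int: "integrable M (\<lambda>\<omega>. c i * ?d i \<omega> * (c j * ?d j \<omega>))" if "i \<in> J" "j \<in> J" for i j
    by (rule square_integrable_prod) (use d2 that in \<open>auto intro: square_integrable_cmult\<close>)
  have int': "integrable lborel (\<lambda>v. c i * ?I i v * (c j * ?I j v))" for i j
  proof -
    have "(\<lambda>v. c i * ?I i v * (c j * ?I j v)) =
        (\<lambda>v. (c i * c j) * indicator {max (min (x i) S) (min (x j) S)<..min (min (y i) S) (min (y j) S)} v)"
      by (auto simp: fun_eq_iff indicator_def)
    then show ?thesis by (simp only: integrable_mult_right integrable_indicator_Ioc)
  qed
  have "(\<integral>\<omega>. (step_integral J c x y S \<omega>)\<^sup>2 \<partial>M) = (\<Sum>i\<in>J. \<Sum>j\<in>J. \<integral>\<omega>. c i * ?d i \<omega> * (c j * ?d j \<omega>) \<partial>M)"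
    unfolding step_integral_def sum_square_expand
    by (subst Bochner_Integration.integral_sum, (auto intro!: Bochner_Integration.integrable_sum int)[1])
       (intro sum.cong refl Bochner_Integration.integral_sum int)
  also have "\<dots> = (\<Sum>i\<in>J. \<Sum>j\<in>J. LINT v|lborel. c i * ?I i v * (c j * ?I j v))"
  proof (intro sum.cong refl)
    fix i j assume "i \<in> J" "j \<in> J"
    then have "(\<integral>\<omega>. ?d i \<omega> * ?d j \<omega> \<partial>M) = (LINT v|lborel. ?I i v * ?I j v)"
      using xy \<open>0 \<le> S\<close> by (intro incr_covariance) (auto simp: min_le_iff_disj)
    then have "(\<integral>\<omega>. (c i * c j) * (?d i \<omega> * ?d j \<omega>) \<partial>M) = (LINT v|lborel. (c i * c j) * (?I i v * ?I j v))"
      by simp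
    then show "(\<integral>\<omega>. c i * ?d i \<omega> * (c j * ?d j \<omega>) \<partial>M) = (LINT v|lborel. c i * ?I i v * (c j * ?I j v))"
      by (simp only: mult.assoc mult.left_commute)
  qed
  also have "\<dots> = (LINT v|lborel. (\<Sum>j\<in>J. c j * ?I j v)\<^sup>2)"
    unfolding sum_square_expand
    by (subst Bochner_Integration.integral_sum, (auto intro!: Bochner_Integration.integrable_sum int')[1])
       (intro sum.cong refl Bochner_Integration.integral_sum[symmetric] int')
  finally show ?thesis .
qed

lemma step_isometry_bound:
  assumes xy: "\<And>j. j \<in> J \<Longrightarrow> 0 \<le> x j \<and> x j \<le> y j" and S: "0 \<le> S" and "0 \<le> m"
    and g: "\<And>v. 0 < v \<Longrightarrow> v \<le> S \<Longrightarrow> \<bar>\<Sum>j\<in>J. c j * indicator {x j<..y j} v\<bar> \<le> m"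
  shows "(\<integral>\<omega>. (step_integral J c x y S \<omega>)\<^sup>2 \<partial>M) \<le> m\<^sup>2 * S"
proof -
  let ?g = "\<lambda>v. (\<Sum>j\<in>J. c j * indicator {min (x j) S<..min (y j) S} v)"
  have le: "(?g v)\<^sup>2 \<le> m\<^sup>2 * indicator {0<..S} v" for v
  proof (cases "0 < v \<and> v \<le> S")
    case True
    have "?g v = (\<Sum>j\<in>J. c j * indicator {x j<..y j} v)"
      using True by (intro sum.cong) (auto simp: indicator_def min_def)
    then have "\<bar>?g v\<bar> \<le> m" using g True by simp
    then have "\<bar>?g v\<bar>\<^sup>2 \<le> m\<^sup>2" by (intro power_mono) auto
    then show ?thesis using True by simp
  next
    case False
    then have "?g v = 0"
      using xy S by (intro sum.neutral) (force simp: indicator_def min_def)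
    then show ?thesis by simp
  qed
  have "(\<integral>\<omega>. (step_integral J c x y S \<omega>)\<^sup>2 \<partial>M) = (LINT v|lborel. (?g v)\<^sup>2)"
    by (rule step_isometry[OF xy S])
  also have "\<dots> \<le> (LINT v|lborel. m\<^sup>2 * indicator {0<..S} v)"
    by (rule integral_mono') (use le in \<open>auto intro!: integrable_mult_right integrable_indicator_Ioc\<close>)
  also have "\<dots> = m\<^sup>2 * S" using S by simp
  finally show ?thesis .
qed

lemma step_square_integrable:
  assumes "\<And>j. j \<in> J \<Longrightarrow> 0 \<le> x j \<and> x j \<le> y j" "0 \<le> v"
  shows "square_integrable M (step_integral J c x y v)"
  unfolding step_integral_def[abs_def]
  by (intro square_integrable_sum square_integrable_cmult incr_square_integrable)
     (use assms in \<open>auto simp: min_le_iff_disj\<close>)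

lemma step_adapted:
  assumes "\<And>j. j \<in> J \<Longrightarrow> 0 \<le> x j \<and> x j \<le> y j" "0 \<le> v"
  shows "step_integral J c x y v \<in> borel_measurable (Fb v)"
  unfolding step_integral_def[abs_def]
  by (intro borel_measurable_sum borel_measurable_times borel_measurable_const borel_measurable_diff b_adapted)
     (use assms in force)+

text \<open>For an end point \<open>z\<close>, the change of \<open>b (min z v)\<close> from
  \<open>v\<close> to \<open>v'\<close> is zero if \<open>z \<le> v\<close> and is otherwise an
  increment starting at \<open>v\<close>; either way it is orthogonal to the past.\<close>

lemma step_orthogonal:
  assumes xy: "\<And>j. j \<in> J \<Longrightarrow> 0 \<le> x j \<and> x j \<le> y j" and v: "0 \<le> v" "v \<le> v'"
    and Z: "Z \<in> borel_measurable (Fb v)" "square_integrable M Z"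
  shows "(\<integral>\<omega>. Z \<omega> * (step_integral J c x y v' \<omega> - step_integral J c x y v \<omega>) \<partial>M) = 0"
proof -
  have orth: "(\<integral>\<omega>. Z \<omega> * (b (min z v') \<omega> - b (min z v) \<omega>) \<partial>M) = 0"
    and int: "integrable M (\<lambda>\<omega>. Z \<omega> * (b (min z v') \<omega> - b (min z v) \<omega>))" if "0 \<le> z" for z
  proof -
    show "integrable M (\<lambda>\<omega>. Z \<omega> * (b (min z v') \<omega> - b (min z v) \<omega>))"
      by (rule square_integrable_prod[OF Z(2) incr_square_integrable]) (use that v in auto)
    show "(\<integral>\<omega>. Z \<omega> * (b (min z v') \<omega> - b (min z v) \<omega>) \<partial>M) = 0"
    proof (cases "z \<le> v")
      case True
      then show ?thesis using v by (simp add: min_def)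
    next
      case False
      then have "(\<integral>\<omega>. Z \<omega> * (b (min z v') \<omega> - b v \<omega>) \<partial>M) = 0"
        by (intro incr_orthogonal[OF v(1) _ Z(1) integrable_square_integrable[OF prob_space_axioms Z(2)]])
           (use v in auto)
      then show ?thesis using False by (simp add: min_def)
    qed
  qed
  have "(\<integral>\<omega>. Z \<omega> * (step_integral J c x y v' \<omega> - step_integral J c x y v \<omega>) \<partial>M) =
    (\<integral>\<omega>. (\<Sum>j\<in>J. c j * (Z \<omega> * (b (min (y j) v') \<omega> - b (min (y j) v) \<omega>))
       - c j * (Z \<omega> * (b (min (x j) v') \<omega> - b (min (x j) v) \<omega>))) \<partial>M)"
    unfolding step_integral_def sum_subtractf[symmetric] sum_distrib_left
    by (intro Bochner_Integration.integral_cong sum.cong refl) (simp add: algebra_simps)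
  also have "\<dots> = (\<Sum>j\<in>J. \<integral>\<omega>. c j * (Z \<omega> * (b (min (y j) v') \<omega> - b (min (y j) v) \<omega>))
       - c j * (Z \<omega> * (b (min (x j) v') \<omega> - b (min (x j) v) \<omega>)) \<partial>M)"
    by (intro Bochner_Integration.integral_sum Bochner_Integration.integrable_diff integrable_mult_right int)
       (use xy in force)+
  also have "\<dots> = 0"
  proof (rule sum.neutral, rule ballI)
    fix j assume "j \<in> J"
    then have "0 \<le> x j" "0 \<le> y j" using xy[of j] by auto
    then show "(\<integral>\<omega>. c j * (Z \<omega> * (b (min (y j) v') \<omega> - b (min (y j) v) \<omega>))
       - c j * (Z \<omega> * (b (min (x j) v') \<omega> - b (min (x j) v) \<omega>)) \<partial>M) = 0"
      by (subst Bochner_Integration.integral_diff) (auto intro!: integrable_mult_right int simp: orth)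
  qed
  finally show ?thesis .
qed

lemma step_continuous:
  assumes "continuous_on {0..} (\<lambda>t. b t \<omega>)" "\<And>j. j \<in> J \<Longrightarrow> 0 \<le> x j \<and> x j \<le> y j"
  shows "continuous_on {0..S} (\<lambda>v. step_integral J c x y v \<omega>)"
  unfolding step_integral_def
proof (intro continuous_intros)
  fix j assume "j \<in> J"
  then have xy: "0 \<le> x j" "0 \<le> y j" using assms(2)[of j] by auto
  show "continuous_on {0..S} (\<lambda>v. b (min (y j) v) \<omega>)"
    by (rule continuous_on_compose2[OF assms(1)]) (use xy in \<open>auto intro!: continuous_intros\<close>)
  show "continuous_on {0..S} (\<lambda>v. b (min (x j) v) \<omega>)"
    by (rule continuous_on_compose2[OF assms(1)]) (use xy in \<open>auto intro!: continuous_intros\<close>)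
qed

text \<open>
  A maximal inequality in mean with a free parameter: \<open>\<bar>z\<bar> \<le> (\<alpha> + z\<^sup>2 / \<alpha>) / 2\<close>.
\<close>

lemma step_maximal:
  assumes xy: "\<And>j. j \<in> J \<Longrightarrow> 0 \<le> x j \<and> x j \<le> y j" and S: "0 \<le> S" and "0 < \<alpha>" "0 \<le> m"
    and g: "\<And>v. 0 < v \<Longrightarrow> v \<le> S \<Longrightarrow> \<bar>\<Sum>j\<in>J. c j * indicator {x j<..y j} v\<bar> \<le> m"
  obtains Q :: "'a \<Rightarrow> ennreal" where "Q \<in> borel_measurable M"
    "(\<integral>\<^sup>+\<omega>. Q \<omega> \<partial>M) \<le> ennreal ((\<alpha> + 8 * m\<^sup>2 * S / \<alpha>) / 2)"
    "AE \<omega> in M. \<forall>v\<in>{0..S}. ennreal \<bar>step_integral J c x y v \<omega>\<bar> \<le> Q \<omega>"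
proof -
  let ?\<Phi> = "step_integral J c x y"
  define t where "t n k = S * real k / real (Suc n)" for n k
  define R where "R n \<omega> = running_max (\<lambda>k. \<bar>?\<Phi> (min (t n k) S) \<omega>\<bar>) (Suc n)" for n \<omega>
  \<comment> \<open>The lower limit of maxima over ever finer uniform grids: Fatou's lemma bounds
    its mean, and continuity of the paths makes it dominate every time in the interval.\<close>
  define Q where "Q \<omega> = liminf (\<lambda>n. ennreal \<bar>R n \<omega>\<bar>)" for \<omega>
  have tm: "mono (\<lambda>k. min (t n k) S)" for n
    unfolding t_def using S by (intro monoI min.mono divide_right_mono mult_left_mono) auto
  have t0: "0 \<le> min (t n k) S" for n k using S by (auto simp: t_def)
  have tn: "min (t n (Suc n)) S = S" for n by (simp add: t_def)
  have 0: "?\<Phi> (min (t n 0) S) \<omega> = 0" for n \<omega>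
  proof -
    have "min (x j) 0 = 0" "min (y j) 0 = 0" if "j \<in> J" for j using xy[OF that] by auto
    then show ?thesis using S by (simp add: step_integral_def t_def)
  qed
  have R2: "square_integrable M (R n)" "(\<integral>\<omega>. (R n \<omega>)\<^sup>2 \<partial>M) \<le> 8 * m\<^sup>2 * S" for n
  proof -
    have L2: "square_integrable M (?\<Phi> (min (t n k) S))" for k
      by (rule step_square_integrable[OF xy t0])
    have ad: "?\<Phi> (min (t n k) S) \<in> borel_measurable (Fb (min (t n k) S))" for k
      by (rule step_adapted[OF xy t0])
    have orth: "(\<integral>\<omega>. Z \<omega> * (?\<Phi> (min (t n (Suc k)) S) \<omega> - ?\<Phi> (min (t n k) S) \<omega>) \<partial>M) = 0"
      if "Z \<in> borel_measurable (Fb (min (t n k) S))" "square_integrable M Z" for k Z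
      by (rule step_orthogonal[OF xy t0 monoD[OF tm le_SucI[OF order_refl]] that])
    note doob = doob_L2[where S = "\<lambda>k. ?\<Phi> (min (t n k) S)" and t = "\<lambda>k. min (t n k) S" and n = "Suc n"]
    have "(\<integral>\<omega>. (R n \<omega>)\<^sup>2 \<partial>M) \<le> 8 * (\<integral>\<omega>. (?\<Phi> (min (t n (Suc n)) S) \<omega>)\<^sup>2 \<partial>M)"
      unfolding R_def by (rule doob(1)) (rule 0 ad tm L2 orth | assumption)+
    moreover have "square_integrable M (R n)"
      unfolding R_def by (rule doob(2)) (rule 0 ad tm L2 orth | assumption)+
    moreover have "(\<integral>\<omega>. (?\<Phi> (min (t n (Suc n)) S) \<omega>)\<^sup>2 \<partial>M) \<le> m\<^sup>2 * S"
      unfolding tn by (rule step_isometry_bound[OF xy S \<open>0 \<le> m\<close> g])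
    ultimately show "square_integrable M (R n)" "(\<integral>\<omega>. (R n \<omega>)\<^sup>2 \<partial>M) \<le> 8 * m\<^sup>2 * S" by auto
  qed
  have Rm[measurable]: "R n \<in> borel_measurable M" for n by (rule square_integrableD[OF R2(1)])
  show ?thesis
  proof (rule that[of Q])
    show "Q \<in> borel_measurable M" unfolding Q_def by measurable
    have "(\<integral>\<^sup>+\<omega>. Q \<omega> \<partial>M) \<le> liminf (\<lambda>n. \<integral>\<^sup>+\<omega>. ennreal \<bar>R n \<omega>\<bar> \<partial>M)"
      unfolding Q_def by (rule nn_integral_liminf) measurable
    also have "\<dots> \<le> liminf (\<lambda>n. ennreal ((\<alpha> + 8 * m\<^sup>2 * S / \<alpha>) / 2))"
      by (intro Liminf_mono always_eventually allI
          nn_integral_abs_le_square[OF prob_space_axioms R2(1) \<open>0 < \<alpha>\<close> R2(2)])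
    also have "\<dots> = ennreal ((\<alpha> + 8 * m\<^sup>2 * S / \<alpha>) / 2)" by (simp add: Liminf_const)
    finally show "(\<integral>\<^sup>+\<omega>. Q \<omega> \<partial>M) \<le> ennreal ((\<alpha> + 8 * m\<^sup>2 * S / \<alpha>) / 2)" .
    show "AE \<omega> in M. \<forall>v\<in>{0..S}. ennreal \<bar>?\<Phi> v \<omega>\<bar> \<le> Q \<omega>"
      using b_paths
    proof eventually_elim
      case (elim \<omega>)
      then have cont: "continuous_on {0..S} (\<lambda>v. ?\<Phi> v \<omega>)" using step_continuous xy by blast
      show ?case
      proof
        fix v assume v: "v \<in> {0..S}"
        \<comment> \<open>The index of the last grid point at or before \<open>v\<close>, which is
          within \<open>S / real (Suc n)\<close> of \<open>v\<close>. For \<open>S = 0\<close> all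
          grid points coincide and the quotient carries no information.\<close>
        define k where "k n = nat \<lfloor>v * real (Suc n) / S\<rfloor>" for n
        have kn: "t n (k n) \<le> v \<and> v - S / real (Suc n) \<le> t n (k n) \<and> k n \<le> Suc n" if "S \<noteq> 0" for n
        proof -
          have Sp: "0 < S" using S that by simp
          have nn: "0 \<le> v * real (Suc n) / S" using v Sp by auto
          have k: "real (k n) = of_int \<lfloor>v * real (Suc n) / S\<rfloor>"
            unfolding k_def using nn by (simp add: floor_less_iff)
          have 1: "real (k n) \<le> v * real (Suc n) / S" "v * real (Suc n) / S < real (k n) + 1"
            unfolding k by linarith+
          have "S * real (k n) \<le> v * real (Suc n)" using 1 Sp by (simp add: field_simps)
          then have a: "t n (k n) \<le> v" unfolding t_def by (simp add: field_simps)
          have "v * real (Suc n) \<le> S * real (k n) + S" using 1 Sp by (simp add: field_simps)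
          then have "v * real (Suc n) / real (Suc n) \<le> (S * real (k n) + S) / real (Suc n)"
            by (rule divide_right_mono) simp
          then have b: "v - S / real (Suc n) \<le> t n (k n)" unfolding t_def by (simp add: add_divide_distrib)
          have "v * real (Suc n) \<le> S * real (Suc n)" using v by (intro mult_right_mono) auto
          then have "v * real (Suc n) / S \<le> real (Suc n)" using Sp by (simp add: field_simps)
          then have "real (k n) \<le> real (Suc n)" using 1 by linarith
          then show ?thesis using a b by simp
        qed
        define w where "w n = min (t n (k n)) S" for n
        have w: "w n \<in> {0..S}" for n unfolding w_def using t0 by auto
        have wl: "w \<longlonglongrightarrow> v"
        proof (cases "S = 0")
          case True
          then have "w = (\<lambda>_. v)" using w v by (auto simp: fun_eq_iff)
          then show ?thesis by simp
        next
          case False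
          have "(\<lambda>n. S * (1 / real (Suc n))) \<longlonglongrightarrow> S * 0"
            by (intro tendsto_mult tendsto_const LIMSEQ_Suc[OF lim_1_over_n])
          then have "(\<lambda>n. v - S / real (Suc n)) \<longlonglongrightarrow> v - 0"
            by (intro tendsto_diff tendsto_const) simp
          then have l: "(\<lambda>n. v - S / real (Suc n)) \<longlonglongrightarrow> v" by simp
          have "w n = t n (k n)" for n using kn[OF False, of n] v by (simp add: w_def)
          then show ?thesis
            using kn[OF False] by (intro tendsto_sandwich[OF _ _ l tendsto_const] always_eventually allI) auto
        qed
        have "(\<lambda>n. ?\<Phi> (w n) \<omega>) \<longlonglongrightarrow> ?\<Phi> v \<omega>"
          using continuous_on_tendsto_compose[OF cont wl v] w by (simp add: always_eventually)
        then have lim: "(\<lambda>n. ennreal \<bar>?\<Phi> (w n) \<omega>\<bar>) \<longlonglongrightarrow> ennreal \<bar>?\<Phi> v \<omega>\<bar>"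
          by (intro tendsto_ennrealI tendsto_rabs)
        have le: "\<bar>?\<Phi> (w n) \<omega>\<bar> \<le> \<bar>R n \<omega>\<bar>" for n
        proof (cases "S = 0")
          case True
          then have "w n = min (t n 0) S" using w[of n] by (auto simp: t_def)
          then show ?thesis using 0[of n \<omega>] by simp
        next
          case False
          have "\<bar>?\<Phi> (min (t n (k n)) S) \<omega>\<bar> \<le> R n \<omega>"
            unfolding R_def by (rule running_max_ge[where S = "\<lambda>k. \<bar>?\<Phi> (min (t n k) S) \<omega>\<bar>"]) (use kn[OF False] in auto)
          then show ?thesis by (simp add: w_def)
        qed
        have "ennreal \<bar>?\<Phi> v \<omega>\<bar> = liminf (\<lambda>n. ennreal \<bar>?\<Phi> (w n) \<omega>\<bar>)"
          using lim_imp_Liminf[OF _ lim] by simp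
        also have "\<dots> \<le> Q \<omega>"
          unfolding Q_def by (intro Liminf_mono always_eventually allI ennreal_leI le)
        finally show "ennreal \<bar>?\<Phi> v \<omega>\<bar> \<le> Q \<omega>" .
      qed
    qed
  qed
qed

end

section \<open>Martingale transforms averaged over one step\<close>

lemma running_max_square_le_sum:
  assumes "\<And>k. 0 \<le> S k"
  shows "(running_max S n)\<^sup>2 \<le> (\<Sum>k\<le>n. (S k)\<^sup>2)"
proof -
  obtain k where "k \<le> n" "running_max S n = S k" using running_max_attained by blast
  then show ?thesis using member_le_sum[of k "{..n}" "\<lambda>k. (S k)\<^sup>2"] by simp
qed

lemma set_integral_shift:
  fixes f :: "real \<Rightarrow> real"
  shows "(LINT v:{a..a + r}|lborel. f v) = (LINT w:{0..r}|lborel. f (a + w))"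
  unfolding set_lebesgue_integral_def
  by (subst lborel_integral_real_affine[where c = 1 and t = a])
     (auto intro!: Bochner_Integration.integral_cong simp: indicator_def)

context brownian
begin

text \<open>For a fixed offset \<open>w\<close> at most \<delta> the increments live on intervals
  that do not overlap, and each coefficient is known at the left end. The sums are adapted to the
  coarse grid with orthogonal increments, and each step adds at most \<open>c\<^sup>2 * w\<close> to
  the second moment.\<close>

lemma transform_maximal:
  fixes \<xi> :: "nat \<Rightarrow> 'a \<Rightarrow> real"
  assumes \<delta>: "0 < \<delta>" and w: "0 \<le> w" "w \<le> \<delta>"
    and ad: "\<And>i. \<xi> i \<in> borel_measurable (Fb (real i * \<delta>))"
    and bd: "\<And>i \<omega>. \<omega> \<in> space M \<Longrightarrow> \<bar>\<xi> i \<omega>\<bar> \<le> c"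
  defines "S \<equiv> \<lambda>k \<omega>. \<Sum>i<k. \<xi> i \<omega> * (b (real i * \<delta> + w) \<omega> - b (real i * \<delta>) \<omega>)"
  shows "square_integrable M (\<lambda>\<omega>. running_max (\<lambda>k. \<bar>S k \<omega>\<bar>) N)"
    and "(\<integral>\<omega>. (running_max (\<lambda>k. \<bar>S k \<omega>\<bar>) N)\<^sup>2 \<partial>M) \<le> 8 * (real N * c\<^sup>2 * w)"
proof -
  let ?\<Delta> = "\<lambda>i \<omega>. b (real i * \<delta> + w) \<omega> - b (real i * \<delta>) \<omega>"
  have i0: "0 \<le> real i * \<delta>" for i using \<delta> by simp
  have \<Delta>2: "square_integrable M (?\<Delta> i)" for i
    by (rule incr_square_integrable) (use i0 w in auto)
  have \<xi>m: "\<xi> i \<in> borel_measurable M" for i by (rule Fb_measurable[OF ad])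
  have \<xi>\<Delta>2: "square_integrable M (\<lambda>\<omega>. \<xi> i \<omega> * ?\<Delta> i \<omega>)" for i
    by (rule square_integrable_bound_mult[OF \<xi>m bd \<Delta>2])
  have S2: "square_integrable M (S k)" for k
    unfolding S_def by (rule square_integrable_sum) (rule \<xi>\<Delta>2)
  have tm: "mono (\<lambda>k. real k * \<delta>)"
    by (rule monoI) (use \<delta> in \<open>simp add: mult_right_mono\<close>)
  have Sad: "S k \<in> borel_measurable (Fb (real k * \<delta>))" for k
    unfolding S_def
  proof (intro borel_measurable_sum borel_measurable_times borel_measurable_diff)
    fix i assume "i \<in> {..<k}"
    then have "real (Suc i) * \<delta> \<le> real k * \<delta>" by (intro monoD[OF tm]) auto
    then have "real i * \<delta> + \<delta> \<le> real k * \<delta>" by (simp add: distrib_right add.commute)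
    then have ik: "real i * \<delta> + w \<le> real k * \<delta>" "real i * \<delta> \<le> real k * \<delta>"
      using w \<delta> by linarith+
    show "\<xi> i \<in> borel_measurable (Fb (real k * \<delta>))"
      by (rule Fb_measurable_mono[OF ik(2) ad])
    show "b (real i * \<delta> + w) \<in> borel_measurable (Fb (real k * \<delta>))"
      by (rule b_adapted[OF _ ik(1)]) (use i0 w in auto)
    show "b (real i * \<delta>) \<in> borel_measurable (Fb (real k * \<delta>))"
      by (rule b_adapted[OF i0 ik(2)])
  qed
  have orth: "(\<integral>\<omega>. Z \<omega> * (\<xi> k \<omega> * ?\<Delta> k \<omega>) \<partial>M) = 0"
    if Z: "Z \<in> borel_measurable (Fb (real k * \<delta>))" "square_integrable M Z" for k Z
  proof -
    have "square_integrable M (\<lambda>\<omega>. \<xi> k \<omega> * Z \<omega>)"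
      by (rule square_integrable_bound_mult[OF \<xi>m bd Z(2)])
    then have "(\<integral>\<omega>. (\<xi> k \<omega> * Z \<omega>) * ?\<Delta> k \<omega> \<partial>M) = 0"
      by (intro incr_orthogonal[OF i0] borel_measurable_times ad Z(1) integrable_square_integrable[OF prob_space_axioms])
         (use w in auto)
    then show ?thesis by (simp add: ac_simps)
  qed
  have orth': "(\<integral>\<omega>. Z \<omega> * (S (Suc k) \<omega> - S k \<omega>) \<partial>M) = 0"
    if "Z \<in> borel_measurable (Fb (real k * \<delta>))" "square_integrable M Z" for k Z
    using orth[OF that] by (simp add: S_def)
  have S0: "S 0 \<omega> = 0" for \<omega> by (simp add: S_def)
  have var: "(\<integral>\<omega>. (S k \<omega>)\<^sup>2 \<partial>M) \<le> real k * c\<^sup>2 * w" for k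
  proof (induction k)
    case (Suc k)
    let ?X = "\<lambda>\<omega>. \<xi> k \<omega> * ?\<Delta> k \<omega>"
    have "(\<integral>\<omega>. (S (Suc k) \<omega>)\<^sup>2 \<partial>M) = (\<integral>\<omega>. (S k \<omega>)\<^sup>2 + 2 * (S k \<omega> * ?X \<omega>) + (?X \<omega>)\<^sup>2 \<partial>M)"
      by (rule Bochner_Integration.integral_cong) (auto simp: S_def power2_eq_square algebra_simps)
    also have "\<dots> = (\<integral>\<omega>. (S k \<omega>)\<^sup>2 \<partial>M) + 2 * (\<integral>\<omega>. S k \<omega> * ?X \<omega> \<partial>M) + (\<integral>\<omega>. (?X \<omega>)\<^sup>2 \<partial>M)"
      using square_integrableD(2)[OF S2[of k]] square_integrableD(2)[OF \<xi>\<Delta>2[of k]] square_integrable_prod[OF S2 \<xi>\<Delta>2, of k k]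
      by simp
    also have "(\<integral>\<omega>. S k \<omega> * ?X \<omega> \<partial>M) = 0" by (rule orth[OF Sad S2])
    also have "(\<integral>\<omega>. (?X \<omega>)\<^sup>2 \<partial>M) \<le> (\<integral>\<omega>. c\<^sup>2 * (?\<Delta> k \<omega>)\<^sup>2 \<partial>M)"
    proof (rule integral_mono)
      show "integrable M (\<lambda>\<omega>. (?X \<omega>)\<^sup>2)" by (rule square_integrableD(2)[OF \<xi>\<Delta>2])
      show "integrable M (\<lambda>\<omega>. c\<^sup>2 * (?\<Delta> k \<omega>)\<^sup>2)"
        by (intro integrable_mult_right square_integrableD(2)[OF \<Delta>2])
      fix \<omega> assume "\<omega> \<in> space M"
      then have "\<bar>\<xi> k \<omega>\<bar>\<^sup>2 \<le> c\<^sup>2" by (intro power_mono bd) auto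
      then show "(?X \<omega>)\<^sup>2 \<le> c\<^sup>2 * (?\<Delta> k \<omega>)\<^sup>2"
        unfolding power_mult_distrib by (intro mult_right_mono) auto
    qed
    also have "\<dots> = c\<^sup>2 * w"
      using incr_var[of "real k * \<delta>" "real k * \<delta> + w"] i0 w by simp
    finally show ?case using Suc by (simp add: algebra_simps)
  qed (simp add: S0)
  note doob = doob_L2[where S = S and t = "\<lambda>k. real k * \<delta>" and n = N]
  have "(\<integral>\<omega>. (running_max (\<lambda>k. \<bar>S k \<omega>\<bar>) N)\<^sup>2 \<partial>M) \<le> 8 * (\<integral>\<omega>. (S N \<omega>)\<^sup>2 \<partial>M)"
    by (rule doob(1)) (rule S0 Sad tm S2 orth' | assumption)+
  also have "\<dots> \<le> 8 * (real N * c\<^sup>2 * w)" using var[of N] by simp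
  finally show "(\<integral>\<omega>. (running_max (\<lambda>k. \<bar>S k \<omega>\<bar>) N)\<^sup>2 \<partial>M) \<le> 8 * (real N * c\<^sup>2 * w)" .
  show "square_integrable M (\<lambda>\<omega>. running_max (\<lambda>k. \<bar>S k \<omega>\<bar>) N)"
    by (rule doob(2)) (rule S0 Sad tm S2 orth' | assumption)+
qed

text \<open>Exchanging integrals over time and sample point requires joint measurability. On a null
  set containing the bad paths the process is replaced by 0, which makes every path continuous.
  Rounding time down to multiples of \<open>1 / real (Suc n)\<close> leaves countably many times,
  and the limit over \<open>n\<close> is jointly measurable.\<close>

lemma continuous_modification:
  obtains b' :: "real \<Rightarrow> 'a \<Rightarrow> real" where
    "(\<lambda>(v, \<omega>). b' v \<omega>) \<in> borel_measurable (borel \<Otimes>\<^sub>M M)"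
    "AE \<omega> in M. \<forall>v\<ge>0. b' v \<omega> = b v \<omega>"
    "\<And>\<omega>. \<omega> \<in> space M \<Longrightarrow> continuous_on UNIV (\<lambda>v. b' v \<omega>)"
proof -
  obtain N where N: "{\<omega>\<in>space M. \<not> (b 0 \<omega> = 0 \<and> continuous_on {0..} (\<lambda>t. b t \<omega>))} \<subseteq> N"
    "emeasure M N = 0" "N \<in> sets M"
    by (rule AE_E[OF b_paths])
  define b' where "b' v \<omega> = (if \<omega> \<in> N then 0 else b (max 0 v) \<omega>)" for v \<omega>
  have m: "b' v \<in> borel_measurable M" for v
    unfolding b'_def using N(3) b_measurable[of "max 0 v"]
    by (intro measurable_If_set) (auto simp: sets.Int_space_eq2)
  have cont: "continuous_on UNIV (\<lambda>v. b' v \<omega>)" if "\<omega> \<in> space M" for \<omega>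
  proof (cases "\<omega> \<in> N")
    case False
    then have "continuous_on {0..} (\<lambda>t. b t \<omega>)" using N(1) that by auto
    then have "continuous_on UNIV (\<lambda>v. b (max 0 v) \<omega>)"
      by (rule continuous_on_compose2) (auto intro!: continuous_intros)
    then show ?thesis using False by (simp add: b'_def)
  qed (simp add: b'_def)
  define u where "u n = (\<lambda>(v, \<omega>). b' (of_int \<lfloor>v * real (Suc n)\<rfloor> / real (Suc n)) \<omega>)" for n
  have um: "u n \<in> borel_measurable (borel \<Otimes>\<^sub>M M)" for n
  proof -
    have "(\<lambda>p. (\<lambda>i p. b' (of_int i / real (Suc n)) (snd p)) \<lfloor>fst p * real (Suc n)\<rfloor> p) \<in> borel_measurable (borel \<Otimes>\<^sub>M M)"
    proof (rule measurable_compose_countable[where g = "\<lambda>p. \<lfloor>fst p * real (Suc n)\<rfloor>"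
          and f = "\<lambda>i p. b' (of_int i / real (Suc n)) (snd p)"])
      show "(\<lambda>p. b' (of_int i / real (Suc n)) (snd p)) \<in> borel_measurable (borel \<Otimes>\<^sub>M M)" for i
        by (rule measurable_compose[OF measurable_snd m])
      show "(\<lambda>p. \<lfloor>fst p * real (Suc n)\<rfloor>) \<in> measurable (borel \<Otimes>\<^sub>M M) (count_space UNIV)"
        by measurable
    qed
    then show ?thesis by (simp add: u_def split_beta')
  qed
  have lim: "(\<lambda>n. u n p) \<longlonglongrightarrow> (\<lambda>(v, \<omega>). b' v \<omega>) p" if ps: "p \<in> space (borel \<Otimes>\<^sub>M M)" for p
  proof -
    obtain v \<omega> where p: "p = (v, \<omega>)" "\<omega> \<in> space M"
      using ps by (cases p) (auto simp: space_pair_measure)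
    have l: "(\<lambda>n. v - 1 / real (Suc n)) \<longlonglongrightarrow> v"
      using tendsto_diff[OF tendsto_const[of v] LIMSEQ_Suc[OF lim_1_over_n]] by simp
    have "(\<lambda>n. of_int \<lfloor>v * real (Suc n)\<rfloor> / real (Suc n)) \<longlonglongrightarrow> v"
    proof (rule tendsto_sandwich[OF _ _ l tendsto_const]; intro always_eventually allI)
      fix n
      have "v * real (Suc n) - 1 \<le> of_int \<lfloor>v * real (Suc n)\<rfloor>" by linarith
      then have "(v * real (Suc n) - 1) / real (Suc n) \<le> of_int \<lfloor>v * real (Suc n)\<rfloor> / real (Suc n)"
        by (rule divide_right_mono) simp
      then show "v - 1 / real (Suc n) \<le> of_int \<lfloor>v * real (Suc n)\<rfloor> / real (Suc n)"
        by (simp add: diff_divide_distrib)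
      have "of_int \<lfloor>v * real (Suc n)\<rfloor> \<le> v * real (Suc n)" by linarith
      then have "of_int \<lfloor>v * real (Suc n)\<rfloor> / real (Suc n) \<le> v * real (Suc n) / real (Suc n)"
        by (rule divide_right_mono) simp
      then show "of_int \<lfloor>v * real (Suc n)\<rfloor> / real (Suc n) \<le> v" by simp
    qed
    then show ?thesis
      unfolding p u_def prod.case
      by (rule continuous_on_tendsto_compose[OF cont[OF p(2)]]) auto
  qed
  show ?thesis
  proof (rule that)
    show "(\<lambda>(v, \<omega>). b' v \<omega>) \<in> borel_measurable (borel \<Otimes>\<^sub>M M)"
      by (rule borel_measurable_LIMSEQ_real[OF lim um])
    have "AE \<omega> in M. \<omega> \<notin> N" using N by (intro AE_not_in) auto
    then show "AE \<omega> in M. \<forall>v\<ge>0. b' v \<omega> = b v \<omega>"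
      by eventually_elim (simp add: b'_def max_def)
  qed (rule cont)
qed

text \<open>
  With \<open>v = i\<delta> + w\<close> the time integrals are averages over \<open>w \<in> [0, \<delta>]\<close> of the martingale transforms
  \<open>\<Sum>\<^sub>i \<xi>\<^sub>i (b\<^bsub>i\<delta>+w\<^esub> - b\<^bsub>i\<delta>\<^esub>)\<close>, to each of which Doob's inequality applies.
\<close>

lemma averaged_martingale:
  fixes \<xi> :: "nat \<Rightarrow> 'a \<Rightarrow> real"
  assumes \<delta>: "0 < \<delta>" and c: "0 \<le> c" and L: "real (Suc N) * \<delta> \<le> L"
    and ad: "\<And>i. \<xi> i \<in> borel_measurable (Fb (real i * \<delta>))"
    and bd: "\<And>i \<omega>. \<omega> \<in> space M \<Longrightarrow> \<bar>\<xi> i \<omega>\<bar> \<le> c"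
  obtains U :: "'a \<Rightarrow> ennreal" where "U \<in> borel_measurable M"
    "(\<integral>\<^sup>+\<omega>. U \<omega> \<partial>M) \<le> ennreal (\<delta> * ((1 + 8 * c\<^sup>2 * L) / 2 + c * (1 + L) / 2))"
    "AE \<omega> in M. \<forall>n\<le>N. \<forall>s\<in>{real n * \<delta>..real (Suc n) * \<delta>}.
       ennreal \<bar>(\<Sum>i<n. \<xi> i \<omega> * (LINT v:{real i * \<delta>..real (Suc i) * \<delta>}|lborel. b v \<omega> - b (real i * \<delta>) \<omega>))
         + \<xi> n \<omega> * (LINT v:{real n * \<delta>..s}|lborel. b v \<omega> - b (real n * \<delta>) \<omega>)\<bar> \<le> U \<omega>"
proof -
  obtain b' where b'm: "(\<lambda>(v, \<omega>). b' v \<omega>) \<in> borel_measurable (borel \<Otimes>\<^sub>M M)"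
    and b'eq: "AE \<omega> in M. \<forall>v\<ge>0. b' v \<omega> = b v \<omega>"
    and b'c: "\<And>\<omega>. \<omega> \<in> space M \<Longrightarrow> continuous_on UNIV (\<lambda>v. b' v \<omega>)"
    using continuous_modification by blast
  have i0: "0 \<le> real i * \<delta>" for i using \<delta> by simp
  \<comment> \<open>\<open>R1\<close> treats the completed steps and \<open>R2\<close> the last one,
    which at time \<open>s\<close> is completed only up to the offset \<open>r\<close>. Means of
    order 1 are enough for both, since integration over \<open>w\<close> in
    \<open>{0..\<delta>}\<close> supplies the factor \<delta>. This is why the squared maximum in
    \<open>R2\<close> may be bounded crudely by a sum of squares.\<close>
  define R1 where "R1 w \<omega> = running_max (\<lambda>k. \<bar>\<Sum>i<k. \<xi> i \<omega> * (b' (real i * \<delta> + w) \<omega> - b' (real i * \<delta>) \<omega>)\<bar>) N" for w \<omega>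
  define R2 where "R2 w \<omega> = running_max (\<lambda>k. \<bar>b' (real k * \<delta> + w) \<omega> - b' (real k * \<delta>) \<omega>\<bar>) N" for w \<omega>
  define U where "U \<omega> = (\<integral>\<^sup>+w. ennreal \<bar>R1 w \<omega>\<bar> * indicator {0..\<delta>} w + ennreal c * (ennreal \<bar>R2 w \<omega>\<bar> * indicator {0..\<delta>} w) \<partial>lborel)" for \<omega>
  have bs[measurable]: "(\<lambda>p. b' (a + fst p) (snd p)) \<in> borel_measurable (lborel \<Otimes>\<^sub>M M)" for a
    using measurable_compose[of "\<lambda>p. (a + fst p, snd p)" "lborel \<Otimes>\<^sub>M M" "borel \<Otimes>\<^sub>M M", OF _ b'm] by simp
  have bc: "(\<lambda>\<omega>. b' a \<omega>) \<in> borel_measurable M" for a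
    using measurable_compose[of "\<lambda>\<omega>. (a, \<omega>)" M "borel \<Otimes>\<^sub>M M", OF _ b'm] by simp
  have bc2[measurable]: "(\<lambda>p. b' a (snd p)) \<in> borel_measurable (lborel \<Otimes>\<^sub>M M)" for a
    by (rule measurable_compose[OF measurable_snd bc])
  have \<xi>m: "\<xi> i \<in> borel_measurable M" for i by (rule Fb_measurable[OF ad])
  have \<xi>m2[measurable]: "(\<lambda>p. \<xi> i (snd p)) \<in> borel_measurable (lborel \<Otimes>\<^sub>M M)" for i
    by (rule measurable_compose[OF measurable_snd \<xi>m])
  have R1m[measurable]: "(\<lambda>p. R1 (fst p) (snd p)) \<in> borel_measurable (lborel \<Otimes>\<^sub>M M)"
    unfolding R1_def
    by (rule measurable_running_max[where S = "\<lambda>k p. \<bar>\<Sum>i<k. \<xi> i (snd p) * (b' (real i * \<delta> + fst p) (snd p) - b' (real i * \<delta>) (snd p))\<bar>"]) measurable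
  have R2m[measurable]: "(\<lambda>p. R2 (fst p) (snd p)) \<in> borel_measurable (lborel \<Otimes>\<^sub>M M)"
    unfolding R2_def
    by (rule measurable_running_max[where S = "\<lambda>k p. \<bar>b' (real k * \<delta> + fst p) (snd p) - b' (real k * \<delta>) (snd p)\<bar>"]) measurable
  let ?I = "\<lambda>w \<omega>. ennreal \<bar>R1 w \<omega>\<bar> * indicator {0..\<delta>} w + ennreal c * (ennreal \<bar>R2 w \<omega>\<bar> * indicator {0..\<delta>} w)"
  have Im: "(\<lambda>(w, \<omega>). ?I w \<omega>) \<in> borel_measurable (lborel \<Otimes>\<^sub>M M)"
    unfolding split_beta' by measurable
  interpret lM: pair_sigma_finite lborel M ..
  define K1 K2 where "K1 = (1 + 8 * c\<^sup>2 * L) / 2" and "K2 = (1 + L) / 2"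
  have L0: "0 \<le> L" using i0[of "Suc N"] L by linarith
  have K: "0 \<le> K1" "0 \<le> K2" using L0 by (auto simp: K1_def K2_def)
  have E1: "(\<integral>\<^sup>+\<omega>. ennreal \<bar>R1 w \<omega>\<bar> \<partial>M) \<le> ennreal K1" if w: "0 \<le> w" "w \<le> \<delta>" for w
  proof -
    let ?S = "\<lambda>k \<omega>. \<Sum>i<k. \<xi> i \<omega> * (b (real i * \<delta> + w) \<omega> - b (real i * \<delta>) \<omega>)"
    have "real N * w \<le> real (Suc N) * \<delta>" using w \<delta> by (intro mult_mono) auto
    then have "c\<^sup>2 * (real N * w) \<le> c\<^sup>2 * L" using L by (intro mult_left_mono) auto
    then have "(\<integral>\<omega>. (running_max (\<lambda>k. \<bar>?S k \<omega>\<bar>) N)\<^sup>2 \<partial>M) \<le> 8 * c\<^sup>2 * L"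
      using transform_maximal(2)[OF \<delta> w ad bd, of N] by (simp add: ac_simps)
    from nn_integral_abs_le_square[OF prob_space_axioms transform_maximal(1)[OF \<delta> w ad bd, of N] _ this, of 1]
    have "(\<integral>\<^sup>+\<omega>. ennreal \<bar>running_max (\<lambda>k. \<bar>?S k \<omega>\<bar>) N\<bar> \<partial>M) \<le> ennreal K1"
      by (simp add: K1_def)
    moreover have "(\<integral>\<^sup>+\<omega>. ennreal \<bar>R1 w \<omega>\<bar> \<partial>M) = (\<integral>\<^sup>+\<omega>. ennreal \<bar>running_max (\<lambda>k. \<bar>?S k \<omega>\<bar>) N\<bar> \<partial>M)"
    proof (rule nn_integral_cong_AE)
      show "AE \<omega> in M. ennreal \<bar>R1 w \<omega>\<bar> = ennreal \<bar>running_max (\<lambda>k. \<bar>?S k \<omega>\<bar>) N\<bar>"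
        using b'eq by eventually_elim (use w i0 in \<open>simp add: R1_def\<close>)
    qed
    ultimately show ?thesis by simp
  qed
  have E2: "(\<integral>\<^sup>+\<omega>. ennreal \<bar>R2 w \<omega>\<bar> \<partial>M) \<le> ennreal K2" if w: "0 \<le> w" "w \<le> \<delta>" for w
  proof -
    let ?\<Delta> = "\<lambda>k \<omega>. b (real k * \<delta> + w) \<omega> - b (real k * \<delta>) \<omega>"
    have \<Delta>2: "square_integrable M (?\<Delta> k)" for k
      by (rule incr_square_integrable) (use i0 w in auto)
    have \<Delta>2': "square_integrable M (\<lambda>\<omega>. \<bar>?\<Delta> k \<omega>\<bar>)" for k
      using \<Delta>2[of k] by (auto simp: square_integrable_def)
    have r2: "square_integrable M (\<lambda>\<omega>. running_max (\<lambda>k. \<bar>?\<Delta> k \<omega>\<bar>) N)"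
      by (rule square_integrable_running_max) (rule \<Delta>2')
    have "(\<integral>\<omega>. (running_max (\<lambda>k. \<bar>?\<Delta> k \<omega>\<bar>) N)\<^sup>2 \<partial>M) \<le> (\<integral>\<omega>. (\<Sum>k\<le>N. (?\<Delta> k \<omega>)\<^sup>2) \<partial>M)"
    proof (rule integral_mono)
      show "integrable M (\<lambda>\<omega>. \<Sum>k\<le>N. (?\<Delta> k \<omega>)\<^sup>2)"
        by (intro Bochner_Integration.integrable_sum square_integrableD(2)[OF \<Delta>2])
      show "(running_max (\<lambda>k. \<bar>?\<Delta> k \<omega>\<bar>) N)\<^sup>2 \<le> (\<Sum>k\<le>N. (?\<Delta> k \<omega>)\<^sup>2)" for \<omega>
        using running_max_square_le_sum[of "\<lambda>k. \<bar>?\<Delta> k \<omega>\<bar>" N] by simp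
    qed (rule square_integrableD(2)[OF r2])
    also have "\<dots> = (\<Sum>k\<le>N. \<integral>\<omega>. (?\<Delta> k \<omega>)\<^sup>2 \<partial>M)"
      by (rule Bochner_Integration.integral_sum) (rule square_integrableD(2)[OF \<Delta>2])
    also have "\<dots> = real (Suc N) * w"
    proof -
      have "(\<integral>\<omega>. (?\<Delta> k \<omega>)\<^sup>2 \<partial>M) = w" for k
        using incr_var[of "real k * \<delta>" "real k * \<delta> + w"] i0 w by simp
      then show ?thesis by simp
    qed
    also have "\<dots> \<le> real (Suc N) * \<delta>" using w by (intro mult_left_mono) auto
    also have "\<dots> \<le> L" by (rule L)
    finally have "(\<integral>\<omega>. (running_max (\<lambda>k. \<bar>?\<Delta> k \<omega>\<bar>) N)\<^sup>2 \<partial>M) \<le> L" .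
    from nn_integral_abs_le_square[OF prob_space_axioms r2 _ this, of 1]
    have "(\<integral>\<^sup>+\<omega>. ennreal \<bar>running_max (\<lambda>k. \<bar>?\<Delta> k \<omega>\<bar>) N\<bar> \<partial>M) \<le> ennreal K2"
      by (simp add: K2_def)
    moreover have "(\<integral>\<^sup>+\<omega>. ennreal \<bar>R2 w \<omega>\<bar> \<partial>M) = (\<integral>\<^sup>+\<omega>. ennreal \<bar>running_max (\<lambda>k. \<bar>?\<Delta> k \<omega>\<bar>) N\<bar> \<partial>M)"
    proof (rule nn_integral_cong_AE)
      show "AE \<omega> in M. ennreal \<bar>R2 w \<omega>\<bar> = ennreal \<bar>running_max (\<lambda>k. \<bar>?\<Delta> k \<omega>\<bar>) N\<bar>"
        using b'eq by eventually_elim (use w i0 in \<open>simp add: R2_def\<close>)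
    qed
    ultimately show ?thesis by simp
  qed
  have RM: "(\<lambda>\<omega>. R1 w \<omega>) \<in> borel_measurable M" "(\<lambda>\<omega>. R2 w \<omega>) \<in> borel_measurable M" for w
    using measurable_compose[of "\<lambda>\<omega>. (w, \<omega>)" M "lborel \<Otimes>\<^sub>M M", OF _ R1m]
      measurable_compose[of "\<lambda>\<omega>. (w, \<omega>)" M "lborel \<Otimes>\<^sub>M M", OF _ R2m] by auto
  have E: "(\<integral>\<^sup>+\<omega>. ?I w \<omega> \<partial>M) \<le> ennreal (K1 + c * K2) * indicator {0..\<delta>} w" for w
  proof (cases "w \<in> {0..\<delta>}")
    case True
    have "(\<integral>\<^sup>+\<omega>. ?I w \<omega> \<partial>M) = (\<integral>\<^sup>+\<omega>. ennreal \<bar>R1 w \<omega>\<bar> \<partial>M) + ennreal c * (\<integral>\<^sup>+\<omega>. ennreal \<bar>R2 w \<omega>\<bar> \<partial>M)"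
      using True RM[of w] by (subst nn_integral_cmult[symmetric], simp, subst nn_integral_add[symmetric]) auto
    also have "\<dots> \<le> ennreal K1 + ennreal c * ennreal K2"
      using True by (intro add_mono mult_left_mono E1 E2) auto
    also have "\<dots> = ennreal (K1 + c * K2)"
      using K c by (simp add: ennreal_mult ennreal_plus)
    finally show ?thesis using True by simp
  qed simp
  show ?thesis
  proof (rule that[of U])
    show "U \<in> borel_measurable M"
      unfolding U_def
      by (rule lborel.borel_measurable_nn_integral) (use measurable_pair_swap[OF Im] in \<open>simp add: split_beta'\<close>)
    have "(\<integral>\<^sup>+\<omega>. U \<omega> \<partial>M) = (\<integral>\<^sup>+w. \<integral>\<^sup>+\<omega>. ?I w \<omega> \<partial>M \<partial>lborel)"
      unfolding U_def using lM.Fubini'[OF Im] by simp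
    also have "\<dots> \<le> (\<integral>\<^sup>+w. ennreal (K1 + c * K2) * indicator {0..\<delta>} w \<partial>lborel)"
      by (intro nn_integral_mono E)
    also have "\<dots> = ennreal (\<delta> * (K1 + c * K2))"
    proof -
      have "0 \<le> K1 + c * K2" using K c by simp
      then have "ennreal (K1 + c * K2) * ennreal \<delta> = ennreal (\<delta> * (K1 + c * K2))"
        using \<delta> by (simp only: ennreal_mult[symmetric] less_imp_le mult.commute)
      then show ?thesis using \<delta> by (subst nn_integral_cmult_indicator) simp_all
    qed
    finally show "(\<integral>\<^sup>+\<omega>. U \<omega> \<partial>M) \<le> ennreal (\<delta> * ((1 + 8 * c\<^sup>2 * L) / 2 + c * (1 + L) / 2))"
      by (simp add: K1_def K2_def)
    show "AE \<omega> in M. \<forall>n\<le>N. \<forall>s\<in>{real n * \<delta>..real (Suc n) * \<delta>}.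
       ennreal \<bar>(\<Sum>i<n. \<xi> i \<omega> * (LINT v:{real i * \<delta>..real (Suc i) * \<delta>}|lborel. b v \<omega> - b (real i * \<delta>) \<omega>))
         + \<xi> n \<omega> * (LINT v:{real n * \<delta>..s}|lborel. b v \<omega> - b (real n * \<delta>) \<omega>)\<bar> \<le> U \<omega>"
      using b'eq AE_space
    proof eventually_elim
      case (elim \<omega>)
      then have eq: "\<And>v. 0 \<le> v \<Longrightarrow> b v \<omega> = b' v \<omega>" and sp: "\<omega> \<in> space M" by auto
      let ?g = "\<lambda>i w. b' (real i * \<delta> + w) \<omega> - b' (real i * \<delta>) \<omega>"
      have gi: "set_integrable lborel {0..r} (?g i)" for i r
        by (rule borel_integrable_atLeastAtMost')
           (intro continuous_intros continuous_on_compose2[OF b'c[OF sp]]; auto)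
      have sh: "(LINT v:{real i * \<delta>..real i * \<delta> + r}|lborel. b v \<omega> - b (real i * \<delta>) \<omega>) = (LINT w:{0..r}|lborel. ?g i w)" for i r
        unfolding set_integral_shift
        by (rule set_lebesgue_integral_cong) (use eq i0 in auto)
      show ?case
      proof (intro allI impI ballI)
        fix n s assume n: "n \<le> N" and s: "s \<in> {real n * \<delta>..real (Suc n) * \<delta>}"
        define r where "r = s - real n * \<delta>"
        have r: "0 \<le> r" "r \<le> \<delta>" "s = real n * \<delta> + r" using s by (auto simp: r_def algebra_simps)
        let ?H = "\<lambda>w. (\<Sum>i<n. \<xi> i \<omega> * (indicator {0..\<delta>} w *\<^sub>R ?g i w)) + \<xi> n \<omega> * (indicator {0..r} w *\<^sub>R ?g n w)"
        note gi0 = gi[unfolded set_integrable_def]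
        have i1: "integrable lborel (\<lambda>w. \<Sum>i<n. \<xi> i \<omega> * (indicator {0..\<delta>} w *\<^sub>R ?g i w))"
          by (intro Bochner_Integration.integrable_sum integrable_mult_right gi0)
        have i2: "integrable lborel (\<lambda>w. \<xi> n \<omega> * (indicator {0..r} w *\<^sub>R ?g n w))"
          by (intro integrable_mult_right gi0)
        have e1: "(LINT w|lborel. (\<Sum>i<n. \<xi> i \<omega> * (indicator {0..\<delta>} w *\<^sub>R ?g i w))) =
            (\<Sum>i<n. \<xi> i \<omega> * (LINT w:{0..\<delta>}|lborel. ?g i w))"
          unfolding set_lebesgue_integral_def
          by (subst Bochner_Integration.integral_sum, intro integrable_mult_right gi0)
             (simp only: integral_mult_right_zero)
        have e2: "(LINT w|lborel. \<xi> n \<omega> * (indicator {0..r} w *\<^sub>R ?g n w)) = \<xi> n \<omega> * (LINT w:{0..r}|lborel. ?g n w)"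
          unfolding set_lebesgue_integral_def by (simp only: integral_mult_right_zero)
        have "(\<Sum>i<n. \<xi> i \<omega> * (LINT v:{real i * \<delta>..real (Suc i) * \<delta>}|lborel. b v \<omega> - b (real i * \<delta>) \<omega>))
           + \<xi> n \<omega> * (LINT v:{real n * \<delta>..s}|lborel. b v \<omega> - b (real n * \<delta>) \<omega>)
          = (\<Sum>i<n. \<xi> i \<omega> * (LINT w:{0..\<delta>}|lborel. ?g i w)) + \<xi> n \<omega> * (LINT w:{0..r}|lborel. ?g n w)"
          using sh[of _ \<delta>] sh[of n r] by (simp add: r(3) algebra_simps)
        also have "\<dots> = (LINT w|lborel. ?H w)"
          unfolding Bochner_Integration.integral_add[OF i1 i2] e1 e2 ..
        finally have "ennreal \<bar>(\<Sum>i<n. \<xi> i \<omega> * (LINT v:{real i * \<delta>..real (Suc i) * \<delta>}|lborel. b v \<omega> - b (real i * \<delta>) \<omega>))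
           + \<xi> n \<omega> * (LINT v:{real n * \<delta>..s}|lborel. b v \<omega> - b (real n * \<delta>) \<omega>)\<bar> = ennreal (norm (LINT w|lborel. ?H w))"
          by simp
        also have "\<dots> \<le> (\<integral>\<^sup>+w. ennreal (norm (?H w)) \<partial>lborel)"
          by (rule integral_norm_bound_ennreal[OF Bochner_Integration.integrable_add[OF i1 i2]])
        also have "\<dots> \<le> U \<omega>"
          unfolding U_def
        proof (rule nn_integral_mono)
          fix w :: real
          show "ennreal (norm (?H w)) \<le> ?I w \<omega>"
          proof (cases "w \<in> {0..\<delta>}")
            case True
            have 1: "\<bar>\<Sum>i<n. \<xi> i \<omega> * ?g i w\<bar> \<le> \<bar>R1 w \<omega>\<bar>"
              unfolding R1_def using running_max_ge[OF n, of "\<lambda>k. \<bar>\<Sum>i<k. \<xi> i \<omega> * ?g i w\<bar>"] by simp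
            have 2: "\<bar>?g n w\<bar> \<le> \<bar>R2 w \<omega>\<bar>"
              unfolding R2_def using running_max_ge[OF n, of "\<lambda>k. \<bar>?g k w\<bar>"] by simp
            have 3: "\<bar>\<xi> n \<omega> * (indicator {0..r} w *\<^sub>R ?g n w)\<bar> \<le> c * \<bar>R2 w \<omega>\<bar>"
              unfolding abs_mult using 2 bd[OF sp, of n] c
              by (intro mult_mono) (auto simp: indicator_def)
            have "norm (?H w) \<le> \<bar>R1 w \<omega>\<bar> + c * \<bar>R2 w \<omega>\<bar>"
              unfolding real_norm_def by (rule abs_triangle_ineq[THEN order_trans], rule add_mono[OF _ 3]) (use 1 True in simp)
            then have "ennreal (norm (?H w)) \<le> ennreal (\<bar>R1 w \<omega>\<bar> + c * \<bar>R2 w \<omega>\<bar>)" by (rule ennreal_leI)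
            also have "\<dots> = ?I w \<omega>" using True c by (simp add: ennreal_plus ennreal_mult)
            finally show ?thesis .
          next
            case False
            then have "w \<notin> {0..r}" using r by auto
            then have "?H w = 0" using False by simp
            then show ?thesis by simp
          qed
        qed
        finally show "ennreal \<bar>(\<Sum>i<n. \<xi> i \<omega> * (LINT v:{real i * \<delta>..real (Suc i) * \<delta>}|lborel. b v \<omega> - b (real i * \<delta>) \<omega>))
           + \<xi> n \<omega> * (LINT v:{real n * \<delta>..s}|lborel. b v \<omega> - b (real n * \<delta>) \<omega>)\<bar> \<le> U \<omega>" .
      qed
    qed
  qed
qed

end

section \<open>The scheme along a fixed path of the subordinator\<close>

locale em_coefficients =
  fixes H G h k :: "real \<Rightarrow> real" and F Fu Fx Fxx :: "real \<Rightarrow> real \<Rightarrow> real" and K \<theta> :: real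
  assumes H_cont: "continuous_on {0..} H" and G_cont: "continuous_on {0..} G"
    and F_cont: "continuous_on ({0..} \<times> UNIV) (\<lambda>(u, x). F u x)"
    and h_nonneg: "\<forall>u\<ge>0. 0 \<le> h u" and h_mono: "mono_on {0..} h"
    and k_pos: "\<forall>u\<ge>0. 0 < k u" and k_mono: "mono_on {0..} k"
    and K: "0 < K" and \<theta>: "0 < \<theta>" "\<theta> \<le> 1"
    and C12: "C12 F Fu Fx Fxx"
    and lipschitz: "\<forall>u\<ge>0. \<forall>x y. \<bar>F u x - F u y\<bar> \<le> h u * \<bar>x - y\<bar>"
    and growth: "\<forall>u\<ge>0. \<forall>x. \<bar>H u\<bar> + \<bar>F u x\<bar> + \<bar>G u\<bar> \<le> h u * (1 + \<bar>x\<bar>)"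
    and hoelder: "\<forall>u\<ge>0. \<forall>v\<ge>0. \<bar>H u - H v\<bar> + \<bar>G u - G v\<bar> \<le> K * \<bar>u - v\<bar> powr \<theta>"
    and deriv_growth: "\<forall>u\<ge>0. \<forall>x.
      \<bar>Fu u x\<bar> + \<bar>Fx u x * H u\<bar> + \<bar>Fx u x * F u x\<bar> + \<bar>Fx u x * G u\<bar> + \<bar>Fxx u x * (G u)\<^sup>2\<bar>
        \<le> k u * (1 + \<bar>x\<bar>)"
begin

lemma h_le: "0 \<le> u \<Longrightarrow> u \<le> S \<Longrightarrow> h u \<le> h S"
  using h_mono by (auto simp: mono_on_def)

lemma k_le: "0 \<le> u \<Longrightarrow> u \<le> S \<Longrightarrow> k u \<le> k S"
  using k_mono by (auto simp: mono_on_def)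

lemma HG_bound:
  assumes "0 \<le> u" "u \<le> S" shows "\<bar>H u\<bar> \<le> h S" "\<bar>G u\<bar> \<le> h S"
  using growth[rule_format, of u 0] h_le[OF assms] assms by auto

lemma F_bound:
  assumes "0 \<le> u" "u \<le> S" shows "\<bar>F u x\<bar> \<le> h S * (1 + \<bar>x\<bar>)"
proof -
  have "\<bar>F u x\<bar> \<le> h u * (1 + \<bar>x\<bar>)" using growth[rule_format, of u x] assms by auto
  also have "\<dots> \<le> h S * (1 + \<bar>x\<bar>)" using h_le[OF assms] by (intro mult_right_mono) auto
  finally show ?thesis .
qed

lemma F_lipschitz:
  assumes "0 \<le> u" "u \<le> S" shows "\<bar>F u x - F u y\<bar> \<le> h S * \<bar>x - y\<bar>"
  using lipschitz[rule_format, OF assms(1), of x y] h_le[OF assms]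
  by (meson abs_ge_zero mult_right_mono order_trans)

lemma Fx_deriv: "0 \<le> u \<Longrightarrow> ((\<lambda>y. F u y) has_real_derivative Fx u x) (at x)"
  using C12 by (auto simp: C12_def)

lemma Fxx_deriv: "0 \<le> u \<Longrightarrow> ((\<lambda>y. Fx u y) has_real_derivative Fxx u x) (at x)"
  using C12 by (auto simp: C12_def)

lemma Fx_bound:
  assumes "0 \<le> u" "u \<le> S" shows "\<bar>Fx u x\<bar> \<le> h S"
proof -
  have "((\<lambda>y. \<bar>(F u y - F u x) / (y - x)\<bar>) \<longlongrightarrow> \<bar>Fx u x\<bar>) (at x)"
    using Fx_deriv[OF assms(1), of x] by (intro tendsto_rabs) (simp add: has_field_derivative_iff)
  moreover have "eventually (\<lambda>y. \<bar>(F u y - F u x) / (y - x)\<bar> \<le> h S) (at x)"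
  proof (rule eventually_at_topological[THEN iffD2], intro exI[of _ UNIV] conjI ballI impI)
    fix y :: real assume "y \<noteq> x"
    then show "\<bar>(F u y - F u x) / (y - x)\<bar> \<le> h S"
      using F_lipschitz[OF assms, of y x] by (simp add: abs_divide field_simps)
  qed auto
  ultimately show ?thesis by (rule tendsto_upperbound) simp
qed

lemma F_time:
  assumes "0 \<le> u" "u \<le> v" "v \<le> S"
  shows "\<bar>F v y - F u y\<bar> \<le> (v - u) * (k S * (1 + \<bar>y\<bar>))"
proof -
  have "norm (F v y - F u y) \<le> (k S * (1 + \<bar>y\<bar>)) * norm (v - u)"
  proof (rule field_differentiable_bound[where S = "{u..v}" and f = "\<lambda>v. F v y" and f' = "\<lambda>v. Fu v y"])
    fix z assume z: "z \<in> {u..v}"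
    then have "((\<lambda>v. F v y) has_field_derivative Fu z y) (at z within {0..})"
      using C12 assms by (auto simp: C12_def)
    then show "((\<lambda>v. F v y) has_field_derivative Fu z y) (at z within {u..v})"
      by (rule DERIV_subset) (use assms in auto)
    have "\<bar>Fu z y\<bar> \<le> k z * (1 + \<bar>y\<bar>)"
      using deriv_growth[rule_format, of z y] z assms by auto
    also have "\<dots> \<le> k S * (1 + \<bar>y\<bar>)" using k_le[of z S] z assms by (intro mult_right_mono) auto
    finally show "norm (Fu z y) \<le> k S * (1 + \<bar>y\<bar>)" by simp
  qed (use assms in auto)
  then show ?thesis using assms by (simp add: mult.commute)
qed

text \<open>The expansion is along the direction \<open>G u\<close>: as a function of
  \<open>z\<close>, \<open>F u (x + G u * z)\<close> has a second derivative that is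
  \<open>Fxx\<close> times \<open>(G u)\<^sup>2\<close>, the combination controlled by
  \<open>deriv_growth\<close>. Two mean value estimates in succession give the square of
  \<open>w\<close>, without the usual factor one half.\<close>

lemma F_taylor:
  assumes "0 \<le> u" "u \<le> S"
  shows "\<bar>F u (x + G u * w) - F u x - Fx u x * G u * w\<bar> \<le> w\<^sup>2 * (k S * (1 + \<bar>x\<bar> + h S * \<bar>w\<bar>))"
proof -
  define B where "B = k S * (1 + \<bar>x\<bar> + h S * \<bar>w\<bar>)"
  have kS: "0 \<le> k S" using k_pos assms by (meson less_imp_le order_trans)
  have hS: "0 \<le> h S" using h_nonneg assms by auto
  let ?I = "{- \<bar>w\<bar>..\<bar>w\<bar>}"
  have Bz: "\<bar>Fxx u (x + G u * z) * (G u)\<^sup>2\<bar> \<le> B" if "z \<in> ?I" for z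
  proof -
    have "\<bar>Fxx u (x + G u * z) * (G u)\<^sup>2\<bar> \<le> k u * (1 + \<bar>x + G u * z\<bar>)"
      using deriv_growth[rule_format, of u "x + G u * z"] assms by auto
    also have "\<dots> \<le> k S * (1 + \<bar>x\<bar> + h S * \<bar>w\<bar>)"
    proof (intro mult_mono k_le assms kS)
      have "\<bar>G u * z\<bar> \<le> h S * \<bar>w\<bar>"
        unfolding abs_mult using HG_bound(2)[OF assms] that by (intro mult_mono) auto
      then show "1 + \<bar>x + G u * z\<bar> \<le> 1 + \<bar>x\<bar> + h S * \<bar>w\<bar>" by linarith
    qed simp
    finally show ?thesis by (simp add: B_def)
  qed
  have B0: "0 \<le> B" using kS hS by (auto simp: B_def)
  have d1: "((\<lambda>z. Fx u (x + G u * z) * G u) has_field_derivative Fxx u (x + G u * z) * (G u)\<^sup>2) (at z within A)" for z A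
    by (rule DERIV_subset[where s = UNIV])
       (auto intro!: derivative_eq_intros DERIV_chain2[OF Fxx_deriv[OF assms(1)]] simp: power2_eq_square)
  have d0: "((\<lambda>z. F u (x + G u * z) - Fx u x * G u * z) has_field_derivative (Fx u (x + G u * z) * G u - Fx u x * G u)) (at z within A)" for z A
    by (rule DERIV_subset[where s = UNIV])
       (auto intro!: derivative_eq_intros DERIV_chain2[OF Fx_deriv[OF assms(1)]])
  have e1: "\<bar>Fx u (x + G u * z) * G u - Fx u x * G u\<bar> \<le> B * \<bar>w\<bar>" if z: "z \<in> ?I" for z
  proof -
    have "norm (Fx u (x + G u * z) * G u - Fx u (x + G u * 0) * G u) \<le> B * norm (z - 0)"
      by (rule field_differentiable_bound[where S = ?I, OF _ d1]) (use Bz z in auto)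
    also have "\<dots> \<le> B * \<bar>w\<bar>" using z B0 by (intro mult_left_mono) auto
    finally show ?thesis by simp
  qed
  have "norm ((F u (x + G u * w) - Fx u x * G u * w) - (F u (x + G u * 0) - Fx u x * G u * 0)) \<le> (B * \<bar>w\<bar>) * norm (w - 0)"
    by (rule field_differentiable_bound[where S = ?I, OF _ d0]) (use e1 in auto)
  then show ?thesis
    unfolding B_def[symmetric] by (simp add: power2_eq_square algebra_simps)
qed

text \<open>Three moves: time from \<open>u\<close> to \<open>v\<close> at the displaced point,
  removal of \<open>a\<close> by the Lipschitz condition, and the Taylor expansion in the remaining
  direction. Only the Brownian displacement leaves a first-order term that is kept.\<close>

lemma F_local_expansion:
  assumes "0 \<le> u" "u \<le> v" "v \<le> S" "v - u \<le> \<delta>"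
  shows "\<bar>F v (x + a + G u * w) - F u x - Fx u x * G u * w\<bar> \<le>
    \<delta> * (k S * (1 + \<bar>x + a + G u * w\<bar>)) + h S * \<bar>a\<bar> + w\<^sup>2 * (k S * (1 + \<bar>x\<bar> + h S * \<bar>w\<bar>))"
proof -
  have u: "u \<le> S" using assms by simp
  have kS: "0 \<le> k S" using k_pos assms by (meson less_imp_le order_trans)
  have "(v - u) * (k S * (1 + \<bar>x + a + G u * w\<bar>)) \<le> \<delta> * (k S * (1 + \<bar>x + a + G u * w\<bar>))"
    using assms kS by (intro mult_right_mono) auto
  then have 1: "\<bar>F v (x + a + G u * w) - F u (x + a + G u * w)\<bar> \<le> \<delta> * (k S * (1 + \<bar>x + a + G u * w\<bar>))"
    using F_time[OF assms(1-3), of "x + a + G u * w"] by linarith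
  have 2: "\<bar>F u (x + a + G u * w) - F u (x + G u * w)\<bar> \<le> h S * \<bar>a\<bar>"
    using F_lipschitz[OF assms(1) u, of "x + a + G u * w" "x + G u * w"] by (simp add: algebra_simps)
  show ?thesis using 1 2 F_taylor[OF assms(1) u, of x w] by linarith
qed

lemma F_continuous_compose:
  assumes "continuous_on A f" "continuous_on A g" "\<And>x. x \<in> A \<Longrightarrow> 0 \<le> f x"
  shows "continuous_on A (\<lambda>x. F (f x) (g x))"
  using continuous_on_compose2[OF F_cont continuous_on_Pair[OF assms(1,2)]] assms(3) by auto

lemma F_measurable:
  assumes "f \<in> borel_measurable M" "g \<in> borel_measurable M"
  shows "(\<lambda>x. F (max 0 (f x)) (g x)) \<in> borel_measurable M"
proof -
  have "continuous_on UNIV (\<lambda>p::real \<times> real. F (max 0 (fst p)) (snd p))"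
    by (rule F_continuous_compose) (auto intro!: continuous_intros)
  then have "(\<lambda>p::real \<times> real. F (max 0 (fst p)) (snd p)) \<in> borel_measurable borel"
    by (rule borel_measurable_continuous_onI)
  from measurable_compose[OF borel_measurable_Pair[OF assms] this] show ?thesis by simp
qed

lemma Fx_measurable:
  assumes "0 \<le> u" "g \<in> borel_measurable M"
  shows "(\<lambda>x. Fx u (g x)) \<in> borel_measurable M"
proof -
  have "continuous_on UNIV (\<lambda>x. Fx u x)"
    using Fxx_deriv[OF assms(1)] by (intro continuous_at_imp_continuous_on ballI) (auto intro: DERIV_isCont)
  then show ?thesis
    using measurable_compose[OF assms(2) borel_measurable_continuous_onI] by simp
qed

end

section \<open>The scheme for a single pair of paths\<close>

locale em_path = subordinator_path d + em_coefficients H G h k F Fu Fx Fxx K \<theta>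
  for d H G h k F Fu Fx Fxx K \<theta> +
  fixes T x0 \<delta> :: real and \<beta> :: "real \<Rightarrow> real"
  assumes T: "0 < T" and \<delta>: "0 < \<delta>" "\<delta> < 1"
    and \<beta>_cont: "continuous_on {0..} \<beta>" and \<beta>0: "\<beta> 0 = 0"
begin

abbreviation S where "S \<equiv> e T"

definition N :: nat where "N = (SOME n. d (real n * \<delta>) \<le> T \<and> T < d (real (Suc n) * \<delta>))"

text \<open>The scheme is instantiated over a one-point sample space, so that its definition is
  reused for deterministic paths.\<close>

definition grid :: "nat \<Rightarrow> real" where
  "grid n = em_grid (\<lambda>t _. \<beta> t) (\<lambda>t _. d t) H F G x0 \<delta> n ()"

definition proc :: "real \<Rightarrow> real" where
  "proc s = em_process (\<lambda>t _. \<beta> t) (\<lambda>t _. d t) H F G x0 \<delta> s ()"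

definition drift :: "nat \<Rightarrow> real \<Rightarrow> real" where
  "drift n v = H (real n * \<delta>) * (d v - d (real n * \<delta>)) + F (real n * \<delta>) (grid n) * (v - real n * \<delta>)"

definition incr :: "nat \<Rightarrow> real \<Rightarrow> real" where
  "incr n v = \<beta> v - \<beta> (real n * \<delta>)"

text \<open>The coefficient of the Brownian increment in the expansion of \<open>F\<close>. It
  depends on \<beta> only up to time \<open>real n * \<delta>\<close>, which turns its sums against
  later increments into martingale transforms.\<close>

definition \<xi> :: "nat \<Rightarrow> real" where
  "\<xi> n = Fx (real n * \<delta>) (grid n) * G (real n * \<delta>)"

text \<open>The integral of the integrand \<open>G\<close> frozen on the grid.\<close>

definition gint :: "real \<Rightarrow> real" where
  "gint v = (\<Sum>j\<le>N. G (real j * \<delta>) * (\<beta> (min (real (Suc j) * \<delta>) v) - \<beta> (min (real j * \<delta>) v)))"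

lemma N: "d (real N * \<delta>) \<le> T" "T < d (real (Suc N) * \<delta>)"
proof -
  obtain n where "d (real n * \<delta>) \<le> T \<and> T < d (real (Suc n) * \<delta>)"
    using grid_index[of \<delta> T] \<delta> T by (metis less_imp_le)
  from someI[of "\<lambda>n. d (real n * \<delta>) \<le> T \<and> T < d (real (Suc n) * \<delta>)", OF this]
  show "d (real N * \<delta>) \<le> T" "T < d (real (Suc N) * \<delta>)"
    unfolding N_def by auto
qed

lemma S_nonneg: "0 \<le> S" by (rule e_nonneg)

lemma NS: "real N * \<delta> \<le> S" "S \<le> real (Suc N) * \<delta>"
  using grid_e[OF \<delta>(1) N] by auto

lemma grid_nonneg: "0 \<le> real n * \<delta>" using \<delta> by simp

lemma grid_mono: "m \<le> n \<Longrightarrow> real m * \<delta> \<le> real n * \<delta>"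
  using \<delta> by (simp add: mult_right_mono)

lemma grid_le_S: "n \<le> N \<Longrightarrow> real n * \<delta> \<le> S"
  using grid_mono[of n N] NS by linarith

lemma grid_0: "grid 0 = x0" by (simp add: grid_def)

lemma grid_Suc: "grid (Suc n) = grid n + drift n (real (Suc n) * \<delta>) + G (real n * \<delta>) * incr n (real (Suc n) * \<delta>)"
  by (simp add: grid_def drift_def incr_def distrib_right)

lemma grid_sum:
  "grid n = x0 + (\<Sum>i<n. drift i (real (Suc i) * \<delta>)) + (\<Sum>i<n. G (real i * \<delta>) * incr i (real (Suc i) * \<delta>))"
  by (induction n) (simp_all add: grid_0 grid_Suc del: of_nat_Suc)

lemma inverse_eq: "inverse_subordinator (\<lambda>t _. d t) s \<omega> = e s"
  by (simp add: inverse_subordinator_def e_def)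

lemma proc_eq:
  assumes "0 \<le> t" and n: "d (real n * \<delta>) \<le> t" "t < d (real (Suc n) * \<delta>)"
  shows "proc t = grid n + H (real n * \<delta>) * (t - d (real n * \<delta>))
    + F (real n * \<delta>) (grid n) * (e t - real n * \<delta>) + G (real n * \<delta>) * incr n (e t)"
proof -
  have the: "(THE n. d (real n * \<delta>) \<le> t \<and> t < d (real (Suc n) * \<delta>)) = n"
    by (rule the_equality, rule conjI[OF n], erule conjE, rule grid_index_unique[OF \<delta>(1) n])
  have Ed: "inverse_subordinator (\<lambda>t _. d t) (d (real n * \<delta>)) \<omega> = real n * \<delta>" for \<omega>
    unfolding inverse_eq by (rule e_d[OF grid_nonneg])
  have L: "(LINT r:{d (real n * \<delta>)..t}|lborel. c) = c * (t - d (real n * \<delta>))" for c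
    using n(1) by (simp add: set_lebesgue_integral_def)
  show ?thesis
    unfolding proc_def em_process_def Let_def the Ed grid_def[symmetric]
    unfolding inverse_eq incr_def interval_measure_e_const[OF n(1)] L e_d[OF grid_nonneg] ..
qed

definition idx :: "real \<Rightarrow> nat" where "idx v = nat \<lfloor>v / \<delta>\<rfloor>"

lemma idx_eq: "real n * \<delta> \<le> v \<Longrightarrow> v < real (Suc n) * \<delta> \<Longrightarrow> idx v = n"
proof -
  assume "real n * \<delta> \<le> v" "v < real (Suc n) * \<delta>"
  then have "real n \<le> v / \<delta>" "v / \<delta> < real n + 1" using \<delta> by (auto simp: field_simps)
  then have "\<lfloor>v / \<delta>\<rfloor> = int n" by (simp add: floor_eq_iff)
  then show ?thesis by (simp add: idx_def)
qed

lemma idx: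
  assumes "0 \<le> v" shows "real (idx v) * \<delta> \<le> v" "v < real (Suc (idx v)) * \<delta>"
proof -
  have "0 \<le> v / \<delta>" using assms \<delta> by simp
  then have "real (idx v) \<le> v / \<delta>" "v / \<delta> < real (idx v) + 1"
    unfolding idx_def by (simp_all add: of_nat_nat)
  then show "real (idx v) * \<delta> \<le> v" "v < real (Suc (idx v)) * \<delta>"
    using \<delta> by (simp_all add: pos_le_divide_eq pos_divide_less_eq add.commute)
qed

lemma idx_le_N: "0 \<le> v \<Longrightarrow> v < S \<Longrightarrow> idx v \<le> N"
proof -
  assume v: "0 \<le> v" "v < S"
  have "real (idx v) * \<delta> < real (Suc N) * \<delta>" using idx[OF v(1)] v(2) NS by linarith
  then have "real (idx v) < real (Suc N)" using \<delta>(1) by (simp only: mult_less_cancel_right_pos)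
  then show ?thesis by simp
qed

text \<open>The scheme in operational time.\<close>

definition Yop :: "real \<Rightarrow> real" where
  "Yop v = grid (idx v) + drift (idx v) v + G (real (idx v) * \<delta>) * incr (idx v) v"

lemma proc_d: "0 \<le> v \<Longrightarrow> proc (d v) = Yop v"
proof -
  assume v: "0 \<le> v"
  have "d (real (idx v) * \<delta>) \<le> d v" "d v < d (real (Suc (idx v)) * \<delta>)"
    using idx[OF v] d_le_iff[OF grid_nonneg v] d_less_iff[OF v grid_nonneg] by (auto simp del: of_nat_Suc)
  from proc_eq[OF d_nonneg[OF v] this] show ?thesis
    by (simp add: Yop_def drift_def e_d[OF v])
qed

lemma gint_eq:
  assumes "n \<le> N" "real n * \<delta> \<le> v" "v \<le> real (Suc n) * \<delta>"
  shows "gint v = (\<Sum>i<n. G (real i * \<delta>) * incr i (real (Suc i) * \<delta>)) + G (real n * \<delta>) * incr n v"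
proof -
  let ?f = "\<lambda>j. G (real j * \<delta>) * (\<beta> (min (real (Suc j) * \<delta>) v) - \<beta> (min (real j * \<delta>) v))"
  have "gint v = (\<Sum>j\<in>{..<Suc n}. ?f j)"
    unfolding gint_def
  proof (rule sum.mono_neutral_right)
    show "\<forall>j\<in>{..N} - {..<Suc n}. ?f j = 0"
    proof
      fix j assume "j \<in> {..N} - {..<Suc n}"
      then have "v \<le> real j * \<delta>" "real j * \<delta> \<le> real (Suc j) * \<delta>"
        using assms(3) grid_mono[of "Suc n" j] grid_mono[of j "Suc j"] by auto
      then show "?f j = 0" by (simp add: min_absorb2)
    qed
  qed (use assms in auto)
  also have "\<dots> = (\<Sum>i<n. G (real i * \<delta>) * incr i (real (Suc i) * \<delta>)) + G (real n * \<delta>) * incr n v"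
  proof -
    have 1: "?f i = G (real i * \<delta>) * incr i (real (Suc i) * \<delta>)" if "i < n" for i
    proof -
      have "real (Suc i) * \<delta> \<le> v" "real i * \<delta> \<le> v"
        using grid_mono[of "Suc i" n] grid_mono[of i n] that assms(2) by linarith+
      then show ?thesis by (simp add: min_absorb1 incr_def)
    qed
    have 2: "?f n = G (real n * \<delta>) * incr n v"
      using assms by (simp add: min_absorb1 min_absorb2 incr_def)
    show ?thesis unfolding sum.lessThan_Suc 2 by (intro arg_cong2[where f = "(+)"] sum.cong refl 1) auto
  qed
  finally show ?thesis .
qed

text \<open>
  Bounds the part of the freezing error of \<open>F\<close> that is not linear in the Brownian increment.
\<close>

definition rho :: "real \<Rightarrow> real" where
  "rho v = (let n = idx v; w = \<bar>incr n v\<bar> in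
     \<delta> * (k S * (1 + \<bar>grid n\<bar> + h S * T + h S * (1 + \<bar>grid n\<bar>) + h S * w))
     + h S * (h S * (min (d (max 0 v)) T - min (d (real n * \<delta>)) T) + h S * (1 + \<bar>grid n\<bar>) * \<delta>)
     + w\<^sup>2 * (k S * (1 + \<bar>grid n\<bar> + h S * w)))"

lemma hS: "0 \<le> h S" and kS: "0 \<le> k S"
  using h_nonneg k_pos S_nonneg by (auto intro: less_imp_le)

lemma rho_nonneg: "0 \<le> v \<Longrightarrow> 0 \<le> rho v"
proof -
  assume v: "0 \<le> v"
  have "min (d (real (idx v) * \<delta>)) T \<le> min (d (max 0 v)) T"
    using idx[OF v] v d_le_iff[OF grid_nonneg v] by (intro min.mono) (auto simp: max_def)
  then show ?thesis
    unfolding rho_def Let_def using hS kS T \<delta> by (intro add_nonneg_nonneg mult_nonneg_nonneg) auto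
qed

text \<open>Before \<open>S\<close> the path is still at most \<open>T\<close>, so that truncation
  by \<open>min\<close> changes nothing here; it keeps the increment bounded at \<open>S\<close>
  itself, where \<open>d\<close> may have jumped past \<open>T\<close>.\<close>

lemma drift_bound:
  assumes v: "0 \<le> v" "v < S"
  shows "\<bar>drift (idx v) v\<bar> \<le> h S * (min (d (max 0 v)) T - min (d (real (idx v) * \<delta>)) T) + h S * (1 + \<bar>grid (idx v)\<bar>) * \<delta>"
    and "min (d (max 0 v)) T - min (d (real (idx v) * \<delta>)) T \<le> T"
proof -
  let ?n = "idx v"
  have dv: "d v \<le> T" "d (real ?n * \<delta>) \<le> d v" "0 \<le> d (real ?n * \<delta>)"
    using d_less_le[of T v] T v idx[OF v(1)] d_le_iff[OF grid_nonneg v(1)] d_nonneg[OF grid_nonneg] by auto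
  have nS: "real ?n * \<delta> \<le> S" using idx[OF v(1)] v by linarith
  have m: "min (d (max 0 v)) T = d v" "min (d (real ?n * \<delta>)) T = d (real ?n * \<delta>)"
    using dv v by (auto simp: max_def)
  have "\<bar>H (real ?n * \<delta>) * (d v - d (real ?n * \<delta>))\<bar> \<le> h S * (d v - d (real ?n * \<delta>))"
    unfolding abs_mult using HG_bound(1)[OF grid_nonneg nS] dv by (intro mult_mono) auto
  moreover have "\<bar>F (real ?n * \<delta>) (grid ?n) * (v - real ?n * \<delta>)\<bar> \<le> h S * (1 + \<bar>grid ?n\<bar>) * \<delta>"
    unfolding abs_mult using F_bound[OF grid_nonneg nS, of "grid ?n"] idx[OF v(1)] hS
    by (intro mult_mono) (auto simp: distrib_right)
  ultimately show "\<bar>drift ?n v\<bar> \<le> h S * (min (d (max 0 v)) T - min (d (real ?n * \<delta>)) T) + h S * (1 + \<bar>grid ?n\<bar>) * \<delta>"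
    unfolding m drift_def by linarith
  show "min (d (max 0 v)) T - min (d (real ?n * \<delta>)) T \<le> T" unfolding m using dv by linarith
qed

text \<open>In the term that already carries the factor \<delta>, the increment of \<open>d\<close>
  is bounded crudely by \<open>T\<close>. In the drift term it has to be kept, as it is not small
  for a single \<open>v\<close>; only its integral over \<open>v\<close> has order \<delta>.\<close>

lemma local_error:
  assumes v: "0 \<le> v" "v < S"
  shows "\<bar>F v (Yop v) - F (real (idx v) * \<delta>) (grid (idx v)) - \<xi> (idx v) * incr (idx v) v\<bar> \<le> rho v"
proof -
  let ?n = "idx v"
  let ?a = "drift ?n v" and ?w = "incr ?n v" and ?g = "grid ?n"
  let ?D = "min (d (max 0 v)) T - min (d (real ?n * \<delta>)) T"
  have n: "0 \<le> real ?n * \<delta>" "real ?n * \<delta> \<le> v" "v \<le> S" "v - real ?n * \<delta> \<le> \<delta>"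
    using idx[OF v(1)] v by (auto simp: distrib_right)
  have "\<bar>F v (Yop v) - F (real ?n * \<delta>) ?g - \<xi> ?n * ?w\<bar> \<le>
     \<delta> * (k S * (1 + \<bar>Yop v\<bar>)) + h S * \<bar>?a\<bar> + ?w\<^sup>2 * (k S * (1 + \<bar>?g\<bar> + h S * \<bar>?w\<bar>))"
    using F_local_expansion[OF n, of ?g ?a ?w] by (simp add: Yop_def \<xi>_def)
  also have "\<dots> \<le> rho v"
  proof -
    have a: "\<bar>?a\<bar> \<le> h S * ?D + h S * (1 + \<bar>?g\<bar>) * \<delta>" "?D \<le> T"
      using drift_bound[OF v] by auto
    have "\<bar>G (real ?n * \<delta>) * ?w\<bar> \<le> h S * \<bar>?w\<bar>"
      unfolding abs_mult using HG_bound(2)[OF n(1), of S] n by (intro mult_right_mono) auto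
    moreover have "h S * ?D \<le> h S * T" by (intro mult_left_mono a hS)
    moreover have "h S * (1 + \<bar>?g\<bar>) * \<delta> \<le> h S * (1 + \<bar>?g\<bar>) * 1"
      using hS \<delta> by (intro mult_left_mono) auto
    ultimately have "\<bar>Yop v\<bar> \<le> \<bar>?g\<bar> + h S * T + h S * (1 + \<bar>?g\<bar>) + h S * \<bar>?w\<bar>"
      unfolding Yop_def using a by linarith
    then have "\<delta> * (k S * (1 + \<bar>Yop v\<bar>)) \<le> \<delta> * (k S * (1 + \<bar>?g\<bar> + h S * T + h S * (1 + \<bar>?g\<bar>) + h S * \<bar>?w\<bar>))"
      using kS \<delta> by (intro mult_left_mono) auto
    moreover have "h S * \<bar>?a\<bar> \<le> h S * (h S * ?D + h S * (1 + \<bar>?g\<bar>) * \<delta>)"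
      by (intro mult_left_mono a hS)
    ultimately show ?thesis unfolding rho_def Let_def by simp
  qed
  finally show ?thesis .
qed

lemma idx_measurable: "idx \<in> measurable borel (count_space UNIV)"
  unfolding idx_def[abs_def] by measurable

lemma \<beta>_max_cont: "continuous_on UNIV (\<lambda>v. \<beta> (max 0 v))"
  by (rule continuous_on_compose2[OF \<beta>_cont]) (auto intro!: continuous_intros)

lemma \<beta>_max_measurable [measurable]: "(\<lambda>v. \<beta> (max 0 v)) \<in> borel_measurable borel"
  by (rule borel_measurable_continuous_onI[OF \<beta>_max_cont])

lemma idx_compose_measurable:
  assumes "\<And>n. (\<lambda>v. f n v) \<in> borel_measurable borel"
  shows "(\<lambda>v. f (idx v) v) \<in> borel_measurable borel"
  by (rule measurable_compose_countable[OF assms idx_measurable])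

lemma rho_measurable: "(\<lambda>v. rho (max 0 v)) \<in> borel_measurable borel"
proof -
  have "idx (max 0 v) = idx v" for v
    using \<delta> by (auto simp: idx_def max_def divide_nonpos_pos divide_neg_pos)
  then have eq: "rho (max 0 v) = (\<lambda>n. \<delta> * (k S * (1 + \<bar>grid n\<bar> + h S * T + h S * (1 + \<bar>grid n\<bar>) + h S * \<bar>\<beta> (max 0 v) - \<beta> (real n * \<delta>)\<bar>))
     + h S * (h S * (min (d (max 0 v)) T - min (d (real n * \<delta>)) T) + h S * (1 + \<bar>grid n\<bar>) * \<delta>)
     + \<bar>\<beta> (max 0 v) - \<beta> (real n * \<delta>)\<bar>\<^sup>2 * (k S * (1 + \<bar>grid n\<bar> + h S * \<bar>\<beta> (max 0 v) - \<beta> (real n * \<delta>)\<bar>))) (idx v)" for v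
    by (simp add: rho_def Let_def incr_def)
  show ?thesis unfolding eq
    by (rule idx_compose_measurable) measurable
qed

end

section \<open>The pathwise error bound\<close>

lemma set_integral_abs_le:
  fixes f g :: "real \<Rightarrow> real"
  assumes f: "set_integrable M A f" and g: "set_integrable M A g"
    and le: "AE x in M. x \<in> A \<longrightarrow> \<bar>f x\<bar> \<le> g x"
  shows "\<bar>LINT x:A|M. f x\<bar> \<le> (LINT x:A|M. g x)"
proof -
  have "norm (LINT x:A|M. f x) \<le> (\<integral>x. norm (indicator A x *\<^sub>R f x) \<partial>M)"
    unfolding set_lebesgue_integral_def by (rule integral_norm_bound)
  also have "\<dots> \<le> (\<integral>x. indicator A x *\<^sub>R g x \<partial>M)"
  proof (rule integral_mono_AE)
    show "integrable M (\<lambda>x. norm (indicator A x *\<^sub>R f x))"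
      using f unfolding set_integrable_def by (rule integrable_norm)
    show "integrable M (\<lambda>x. indicator A x *\<^sub>R g x)"
      using g unfolding set_integrable_def .
    show "AE x in M. norm (indicator A x *\<^sub>R f x) \<le> indicator A x *\<^sub>R g x"
      using le by eventually_elim (auto simp: indicator_def)
  qed
  finally show ?thesis by (simp add: set_lebesgue_integral_def)
qed

lemma abs_sum_diff_le:
  fixes a b c :: "nat \<Rightarrow> real"
  assumes "\<And>i. i < n \<Longrightarrow> \<bar>a i - b i\<bar> \<le> c i"
  shows "\<bar>(\<Sum>i<n. a i) - (\<Sum>i<n. b i)\<bar> \<le> (\<Sum>i<n. c i)"
  unfolding sum_subtractf[symmetric]
  by (rule order_trans[OF sum_abs sum_mono]) (use assms in auto)

context em_path
begin

text \<open>This and \<open>\<beta>_max\<close> are finite for each pair of paths. They provide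
  integrability and the boundedness demanded by Gronwall's inequality and do not enter the error
  estimate.\<close>

definition grid_max :: real where "grid_max = (\<Sum>n\<le>Suc N. \<bar>grid n\<bar>)"
definition \<beta>_max :: real where "\<beta>_max = (SUP v\<in>{0..S}. \<bar>\<beta> v\<bar>)"

lemma grid_le_max: "n \<le> Suc N \<Longrightarrow> \<bar>grid n\<bar> \<le> grid_max"
  unfolding grid_max_def by (rule member_le_sum[where f = "\<lambda>n. \<bar>grid n\<bar>"]) auto

lemma \<beta>_le_max:
  assumes "0 \<le> v" "v \<le> S" shows "\<bar>\<beta> v\<bar> \<le> \<beta>_max"
  unfolding \<beta>_max_def
proof (rule cSUP_upper)
  have "continuous_on {0..S} (\<lambda>v. \<bar>\<beta> v\<bar>)"
    by (intro continuous_intros continuous_on_subset[OF \<beta>_cont]) auto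
  then have "compact ((\<lambda>v. \<bar>\<beta> v\<bar>) ` {0..S})" by (rule compact_continuous_image) simp
  then show "bdd_above ((\<lambda>v. \<bar>\<beta> v\<bar>) ` {0..S})" by (intro bounded_imp_bdd_above compact_imp_bounded)
qed (use assms in auto)

lemma idx_le_Suc_N: "0 \<le> v \<Longrightarrow> v \<le> S \<Longrightarrow> idx v \<le> Suc N"
proof -
  assume v: "0 \<le> v" "v \<le> S"
  have "real (idx v) * \<delta> \<le> real (Suc N) * \<delta>" using idx[OF v(1)] v(2) NS by linarith
  then have "real (idx v) \<le> real (Suc N)" using \<delta>(1) by (simp only: mult_le_cancel_right_pos)
  then show ?thesis by simp
qed

lemma incr_le_max:
  assumes "0 \<le> v" "v \<le> S" shows "\<bar>incr (idx v) v\<bar> \<le> 2 * \<beta>_max"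
  using \<beta>_le_max[OF assms] \<beta>_le_max[OF grid_nonneg[of "idx v"]] idx(1)[OF assms(1)] assms(2)
  by (simp add: incr_def)

lemma max_nonneg: "0 \<le> grid_max" "0 \<le> \<beta>_max"
  using grid_le_max[of 0] \<beta>_le_max[of 0] S_nonneg by auto

lemma Yop_bounded:
  assumes v: "0 \<le> v" "v < S"
  shows "\<bar>Yop v\<bar> \<le> grid_max + (h S * T + h S * (1 + grid_max)) + h S * (2 * \<beta>_max)"
proof -
  let ?n = "idx v"
  have n: "?n \<le> Suc N" "real ?n * \<delta> \<le> S" using idx_le_Suc_N[of v] idx(1)[OF v(1)] v by auto
  have "\<bar>G (real ?n * \<delta>) * incr ?n v\<bar> \<le> h S * (2 * \<beta>_max)"
    unfolding abs_mult using HG_bound(2)[OF grid_nonneg n(2)] incr_le_max[of v] v hS by (intro mult_mono) auto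
  moreover have "h S * (min (d (max 0 v)) T - min (d (real ?n * \<delta>)) T) \<le> h S * T"
    by (intro mult_left_mono hS drift_bound[OF v])
  moreover have "h S * (1 + \<bar>grid ?n\<bar>) * \<delta> \<le> h S * (1 + grid_max) * 1"
    using grid_le_max[OF n(1)] hS \<delta> max_nonneg by (intro mult_mono) auto
  ultimately show ?thesis
    using drift_bound(1)[OF v] grid_le_max[OF n(1)] unfolding Yop_def by linarith
qed

lemma rho_integrable: "set_integrable lborel {0..S} rho"
proof -
  define B where "B = \<delta> * (k S * (1 + grid_max + h S * T + h S * (1 + grid_max) + h S * (2 * \<beta>_max)))
     + h S * (h S * T + h S * (1 + grid_max) * \<delta>)
     + (2 * \<beta>_max)\<^sup>2 * (k S * (1 + grid_max + h S * (2 * \<beta>_max)))"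
  have "set_integrable lborel {0..S} (\<lambda>v. rho (max 0 v))"
  proof (rule set_integrable_bounded_interval[OF rho_measurable, where m = B])
    fix v assume "v \<in> {0..S}"
    then have v: "0 \<le> v" "v \<le> S" by auto
    let ?n = "idx v"
    have g: "\<bar>grid ?n\<bar> \<le> grid_max" by (rule grid_le_max[OF idx_le_Suc_N[OF v]])
    have w: "\<bar>incr ?n v\<bar> \<le> 2 * \<beta>_max" by (rule incr_le_max[OF v])
    have D: "min (d v) T - min (d (real ?n * \<delta>)) T \<le> T"
      using d_nonneg[OF grid_nonneg, of ?n] T by (auto simp: min_def)
    have hg: "h S * (1 + \<bar>grid ?n\<bar>) \<le> h S * (1 + grid_max)" and hw: "h S * \<bar>incr ?n v\<bar> \<le> h S * (2 * \<beta>_max)"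
      using g w hS by (intro mult_left_mono; simp)+
    have "\<delta> * (k S * (1 + \<bar>grid ?n\<bar> + h S * T + h S * (1 + \<bar>grid ?n\<bar>) + h S * \<bar>incr ?n v\<bar>))
        \<le> \<delta> * (k S * (1 + grid_max + h S * T + h S * (1 + grid_max) + h S * (2 * \<beta>_max)))"
      using g hg hw kS \<delta> by (intro mult_left_mono) linarith+
    moreover have "h S * (h S * (min (d (max 0 v)) T - min (d (real ?n * \<delta>)) T) + h S * (1 + \<bar>grid ?n\<bar>) * \<delta>)
        \<le> h S * (h S * T + h S * (1 + grid_max) * \<delta>)"
      using g D v hS \<delta> by (intro mult_left_mono add_mono mult_right_mono) simp_all
    moreover have "\<bar>incr ?n v\<bar>\<^sup>2 * (k S * (1 + \<bar>grid ?n\<bar> + h S * \<bar>incr ?n v\<bar>))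
        \<le> (2 * \<beta>_max)\<^sup>2 * (k S * (1 + grid_max + h S * (2 * \<beta>_max)))"
    proof (rule mult_mono)
      show "\<bar>incr ?n v\<bar>\<^sup>2 \<le> (2 * \<beta>_max)\<^sup>2" using w by (rule power_mono) simp
      show "k S * (1 + \<bar>grid ?n\<bar> + h S * \<bar>incr ?n v\<bar>) \<le> k S * (1 + grid_max + h S * (2 * \<beta>_max))"
        using g hw kS by (intro mult_left_mono) linarith+
      show "0 \<le> k S * (1 + \<bar>grid ?n\<bar> + h S * \<bar>incr ?n v\<bar>)"
        using kS hS by (intro mult_nonneg_nonneg add_nonneg_nonneg) auto
    qed simp
    ultimately have "rho v \<le> B"
      unfolding rho_def Let_def B_def by linarith
    then show "\<bar>rho (max 0 v)\<bar> \<le> B" using rho_nonneg[OF v(1)] v by simp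
  qed
  then show ?thesis
    by (rule set_integrable_cong[THEN iffD1, rotated 3]) auto
qed

text \<open>Equation and scheme are subtracted in integrated form. The freezing error of
  \<open>H\<close> is estimated inside; those of \<open>G\<close>, of the linear part of
  \<open>F\<close> and of its remainder enter as the bounds \<open>Q\<close>, \<open>U\<close> and
  \<open>V\<close>, whose means are taken later. Gronwall's inequality is applied to the error
  \<open>Z\<close> in operational time.\<close>

lemma pathwise_error:
  fixes x i :: "real \<Rightarrow> real"
  assumes x_cont: "continuous_on {0..T} x"
    and x_eq: "\<And>t. t \<in> {0..T} \<Longrightarrow> x t = x0 + (LINT r:{0..t}|lborel. H (e r)) + (LINT r:{0..t}|interval_measure e. F (e r) (x r)) + i t"
    and Q: "\<And>t. t \<in> {0..T} \<Longrightarrow> \<bar>i t - gint (e t)\<bar> \<le> Q"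
    and U: "\<And>n s. n \<le> N \<Longrightarrow> s \<in> {real n * \<delta>..real (Suc n) * \<delta>} \<Longrightarrow>
      \<bar>(\<Sum>j<n. \<xi> j * (LINT v:{real j * \<delta>..real (Suc j) * \<delta>}|lborel. incr j v)) + \<xi> n * (LINT v:{real n * \<delta>..s}|lborel. incr n v)\<bar> \<le> U"
    and V: "(LINT v:{0..S}|lborel. rho v) \<le> V"
    and t: "t \<in> {0..T}"
  shows "\<bar>x t - proc t\<bar> \<le> (T * (K * \<delta> powr \<theta>) + Q + U + V) * (1 + 2 * h S * S * exp ((2 * h S + 1) * S))"
proof -
  \<comment> \<open>Constant extension: operational times at or past \<open>S\<close> can be mapped
    by \<open>d\<close> beyond \<open>T\<close>, and a continuous function on the whole line
    composes measurably with \<open>d\<close>.\<close>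
  define X where "X r = x (max 0 (min r T))" for r
  have X_cont: "continuous_on UNIV X"
    unfolding X_def using T
    by (intro continuous_on_compose2[OF x_cont] continuous_intros) auto
  have X_eq: "X r = x r" if "r \<in> {0..T}" for r using that by (auto simp: X_def max_def min_def)
  have Xm[measurable]: "X \<in> borel_measurable borel" by (rule borel_measurable_continuous_onI[OF X_cont])
  obtain Bx where Bx: "\<And>r. \<bar>X r\<bar> \<le> Bx"
  proof -
    have "compact (x ` {0..T})" by (rule compact_continuous_image[OF x_cont]) simp
    then obtain B where "\<And>y. y \<in> x ` {0..T} \<Longrightarrow> norm y \<le> B" using compact_imp_bounded bounded_iff by metis
    then show ?thesis using that[of B] T by (auto simp: X_def)
  qed
  have Bx0: "0 \<le> Bx" using Bx[of 0] by simp
  define Xop where "Xop v = X (d (max 0 v))" for v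
  have Xopm[measurable]: "Xop \<in> borel_measurable borel" unfolding Xop_def[abs_def] by measurable
  define f where "f v = F (max 0 v) (Xop v)" for v
  have fm[measurable]: "f \<in> borel_measurable borel" unfolding f_def[abs_def] by (rule F_measurable) measurable
  define Z where "Z v = \<bar>Xop v - Yop (max 0 v)\<bar>" for v
  have idx_max: "idx (max 0 v) = idx v" for v
    using \<delta> by (auto simp: idx_def max_def divide_nonpos_pos divide_neg_pos)
  have Zm: "Z \<in> borel_measurable borel"
  proof -
    define zf where "zf n v = \<bar>Xop v - (grid n + (H (real n * \<delta>) * (d (max 0 v) - d (real n * \<delta>)) + F (real n * \<delta>) (grid n) * (max 0 v - real n * \<delta>))
         + G (real n * \<delta>) * (\<beta> (max 0 v) - \<beta> (real n * \<delta>)))\<bar>" for n v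
    have "Z = (\<lambda>v. zf (idx v) v)"
      by (simp add: fun_eq_iff zf_def Z_def Yop_def drift_def incr_def idx_max)
    moreover have "(\<lambda>v. zf (idx v) v) \<in> borel_measurable borel"
      by (rule idx_compose_measurable) (unfold zf_def, measurable)
    ultimately show ?thesis by simp
  qed
  define By where "By = grid_max + (h S * T + h S * (1 + grid_max)) + h S * (2 * \<beta>_max)"
  have Zb: "Z v \<le> Bx + By" if "0 \<le> v" "v < S" for v
    using Bx[of "d (max 0 v)"] Yop_bounded[OF that] that by (simp add: Z_def Xop_def By_def)
  have AE_S: "AE v in lborel. v \<noteq> S" by (rule AE_lborel_singleton)
  have Zi: "set_integrable lborel {0..S} Z"
  proof -
    have "set_integrable lborel {0..S} (\<lambda>v. if v < S then Z v else 0)"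
      by (rule set_integrable_bounded_interval[where m = "Bx + By"])
         (use Zm Zb Bx0 in \<open>force simp: Z_def By_def intro!: add_nonneg_nonneg mult_nonneg_nonneg hS max_nonneg less_imp_le[OF T]\<close>)+
    also have "?this \<longleftrightarrow> set_integrable lborel {0..S} Z"
      unfolding set_integrable_def
    proof (rule integrable_cong_AE)
      show "AE v in lborel. indicator {0..S} v *\<^sub>R (if v < S then Z v else 0) = indicator {0..S} v *\<^sub>R Z v"
        using AE_S by eventually_elim (auto simp: indicator_def)
    qed (use Zm in measurable)
    finally show ?thesis .
  qed
  \<comment> \<open>The first term is the Lipschitz cost of replacing the solution by the scheme,
    the second the cost of freezing \<open>F\<close> apart from its linear part.\<close>
  define R where "R v = h S * Z v + rho v" for v
  have Ri: "set_integrable lborel {0..S} R"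
    unfolding R_def[abs_def] by (intro set_integral_add set_integrable_mult_right Zi rho_integrable)
  have fi: "set_integrable lborel {0..S} f"
  proof (rule set_integrable_bounded_interval[OF fm])
    fix v assume "v \<in> {0..S}"
    then have "\<bar>f v\<bar> \<le> h S * (1 + \<bar>Xop v\<bar>)" unfolding f_def by (intro F_bound) auto
    also have "\<dots> \<le> h S * (1 + Bx)" using Bx[of "d (max 0 v)"] hS by (intro mult_left_mono) (auto simp: Xop_def)
    finally show "\<bar>f v\<bar> \<le> h S * (1 + Bx)" .
  qed
  have F_int: "(LINT r:{0..t}|interval_measure e. F (e r) (x r)) = (LINT v:{0..e t}|lborel. f v)" if t: "t \<in> {0..T}" for t
  proof -
    have "(LINT r:{0..t}|interval_measure e. F (e r) (x r)) = (LINT r:{0..t}|interval_measure e. F (max 0 (e r)) (X r))"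
      by (rule set_lebesgue_integral_cong) (use t e_nonneg in \<open>auto simp: X_eq\<close>)
    also have "\<dots> = (LINT v:{0..e t}|lborel. F (max 0 (e (d (max 0 v)))) (X (d (max 0 v))))"
    proof (rule interval_measure_e_integral)
      have "(\<lambda>r. F (max 0 (e r)) (X r)) \<in> borel_measurable borel" by (rule F_measurable) measurable
      then show "(\<lambda>r. indicator {0..t} r * F (max 0 (e r)) (X r)) \<in> borel_measurable borel"
        by (intro borel_measurable_times borel_measurable_indicator) auto
    qed (use t in auto)
    also have "\<dots> = (LINT v:{0..e t}|lborel. f v)"
      unfolding f_def Xop_def by (simp add: e_d)
    finally show ?thesis .
  qed
  have sub: "set_integrable lborel {a..b} g" if "set_integrable lborel {0..S} g" "0 \<le> a" "b \<le> S" for a b and g :: "real \<Rightarrow> real"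
    by (rule set_integrable_subset[OF that(1)]) (use that in auto)
  have incr_i: "set_integrable lborel {real n * \<delta>..s} (incr n)" for n s
  proof -
    have "continuous_on {real n * \<delta>..s} (incr n)"
      unfolding incr_def[abs_def] using grid_nonneg[of n]
      by (intro continuous_intros continuous_on_subset[OF \<beta>_cont]) auto
    then show ?thesis by (rule borel_integrable_atLeastAtMost')
  qed
  have F_step: "\<bar>(LINT v:{real n * \<delta>..s}|lborel. f v) - (F (real n * \<delta>) (grid n) * (s - real n * \<delta>) + \<xi> n * (LINT v:{real n * \<delta>..s}|lborel. incr n v))\<bar>
      \<le> (LINT v:{real n * \<delta>..s}|lborel. R v)"
    if s: "real n * \<delta> \<le> s" "s \<le> real (Suc n) * \<delta>" "s \<le> S" for n s
  proof -
    let ?A = "{real n * \<delta>..s}"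
    note i1 = sub[OF fi grid_nonneg[of n] s(3)]
    have i2: "set_integrable lborel ?A (\<lambda>v. F (real n * \<delta>) (grid n))"
      by (rule borel_integrable_atLeastAtMost') (rule continuous_on_const)
    have i3: "set_integrable lborel ?A (\<lambda>v. \<xi> n * incr n v)"
      by (rule set_integrable_mult_right) (rule incr_i)
    have eq: "(LINT v:?A|lborel. f v) - (F (real n * \<delta>) (grid n) * (s - real n * \<delta>) + \<xi> n * (LINT v:?A|lborel. incr n v))
      = (LINT v:?A|lborel. f v - (F (real n * \<delta>) (grid n) + \<xi> n * incr n v))"
    proof -
      have "(LINT v:?A|lborel. F (real n * \<delta>) (grid n)) = F (real n * \<delta>) (grid n) * (s - real n * \<delta>)"
        using s by (simp add: set_lebesgue_integral_def)
      then show ?thesis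
        by (simp only: set_integral_diff(2)[OF i1 set_integral_add(1)[OF i2 i3]] set_integral_add(2)[OF i2 i3] set_integral_mult_right)
    qed
    show ?thesis
      unfolding eq
    proof (rule set_integral_abs_le)
      show "set_integrable lborel ?A (\<lambda>v. f v - (F (real n * \<delta>) (grid n) + \<xi> n * incr n v))"
        by (intro set_integral_diff(1) set_integral_add(1) i1 i2 i3)
      show "set_integrable lborel ?A R" by (rule sub[OF Ri grid_nonneg s(3)])
      have "AE v in lborel. v \<noteq> s" by (rule AE_lborel_singleton)
      then show "AE v in lborel. v \<in> ?A \<longrightarrow> \<bar>f v - (F (real n * \<delta>) (grid n) + \<xi> n * incr n v)\<bar> \<le> R v"
      proof (eventually_elim, intro impI)
        fix v assume "v \<noteq> s" "v \<in> ?A"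
        then have v: "real n * \<delta> \<le> v" "v < real (Suc n) * \<delta>" "v < S" using s by auto
        then have v0: "0 \<le> v" using grid_nonneg[of n] by linarith
        have n: "idx v = n" by (rule idx_eq[OF v(1,2)])
        have "\<bar>F v (Xop v) - F v (Yop v)\<bar> \<le> h S * Z v"
          using F_lipschitz[of v S "Xop v" "Yop v"] v v0 by (simp add: Z_def)
        moreover have "\<bar>F v (Yop v) - F (real n * \<delta>) (grid n) - \<xi> n * incr n v\<bar> \<le> rho v"
          using local_error[OF v0 v(3)] by (simp add: n)
        ultimately show "\<bar>f v - (F (real n * \<delta>) (grid n) + \<xi> n * incr n v)\<bar> \<le> R v"
          using v0 by (simp add: f_def R_def)
      qed
    qed
  qed
  have He: "set_integrable lborel {a..b} (\<lambda>r. H (e r))" for a b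
    by (rule borel_integrable_atLeastAtMost')
       (rule continuous_on_compose2[OF H_cont continuous_on_e], use e_nonneg in auto)
  \<comment> \<open>While \<open>r\<close> runs through this interval, \<open>e r\<close> stays in
    one cell of length \<delta>. The bound is proportional to the length of the interval, which need
    not be small; the lengths add up to at most \<open>T\<close>.\<close>
  have H_step: "\<bar>(LINT r:{d (real n * \<delta>)..s}|lborel. H (e r)) - H (real n * \<delta>) * (s - d (real n * \<delta>))\<bar> \<le> K * \<delta> powr \<theta> * (s - d (real n * \<delta>))"
    if s: "d (real n * \<delta>) \<le> s" "s \<le> d (real (Suc n) * \<delta>)" for n s
  proof -
    let ?A = "{d (real n * \<delta>)..s}"
    have c: "set_integrable lborel ?A (\<lambda>v. c)" "(LINT v:?A|lborel. c) = c * (s - d (real n * \<delta>))" for c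
      using s by (auto intro!: borel_integrable_atLeastAtMost' continuous_on_const simp: set_lebesgue_integral_def)
    have eq: "(LINT r:?A|lborel. H (e r)) - H (real n * \<delta>) * (s - d (real n * \<delta>)) = (LINT r:?A|lborel. H (e r) - H (real n * \<delta>))"
      using c[of "H (real n * \<delta>)"] by (simp only: set_integral_diff(2)[OF He c(1)])
    have "\<bar>LINT r:?A|lborel. H (e r) - H (real n * \<delta>)\<bar> \<le> (LINT r:?A|lborel. K * \<delta> powr \<theta>)"
    proof (rule set_integral_abs_le[OF set_integral_diff(1)[OF He c(1)] c(1)], rule AE_I2, rule impI)
      fix r assume r: "r \<in> ?A"
      have "e (d (real n * \<delta>)) \<le> e r" "e r \<le> e (d (real (Suc n) * \<delta>))"
        using r s by (auto intro!: e_mono)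
      then have er: "real n * \<delta> \<le> e r" "e r \<le> real (Suc n) * \<delta>"
        unfolding e_d[OF grid_nonneg] .
      then have "\<bar>e r - real n * \<delta>\<bar> powr \<theta> \<le> \<delta> powr \<theta>"
        using \<theta> by (intro powr_mono2) (auto simp: distrib_right)
      then have "K * \<bar>e r - real n * \<delta>\<bar> powr \<theta> \<le> K * \<delta> powr \<theta>" using K by (intro mult_left_mono) auto
      then show "\<bar>H (e r) - H (real n * \<delta>)\<bar> \<le> K * \<delta> powr \<theta>"
        using hoelder[rule_format, of "e r" "real n * \<delta>"] e_nonneg[of r] grid_nonneg[of n] by linarith
    qed
    then show ?thesis unfolding eq c(2) .
  qed
  define A where "A = T * (K * \<delta> powr \<theta>) + Q + U + V"
  have A0: "0 \<le> A"
  proof -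
    have "0 \<le> Q" using Q[of 0] T by (meson abs_ge_zero atLeastAtMost_iff less_imp_le order_refl order_trans)
    moreover have "0 \<le> U" using U[of 0 0] \<delta> by (simp add: set_lebesgue_integral_def)
    moreover have "0 \<le> V"
      using V by (rule order_trans[rotated]) (auto simp: set_lebesgue_integral_def indicator_def intro!: integral_nonneg_AE AE_I2 rho_nonneg)
    ultimately show ?thesis using T K \<delta> by (auto simp: A_def intro!: add_nonneg_nonneg mult_nonneg_nonneg)
  qed
  have main: "\<bar>x t - proc t\<bar> \<le> A + h S * (LINT v:{0..e t}|lborel. Z v)" if t: "t \<in> {0..T}" for t
  proof -
    obtain n where n: "d (real n * \<delta>) \<le> t" "t < d (real (Suc n) * \<delta>)"
      using grid_index[of \<delta> t] \<delta> t by auto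
    have nN: "n \<le> N"
    proof -
      have "d (real n * \<delta>) < d (real (Suc N) * \<delta>)" using n N t by auto
      then have "real n * \<delta> < real (Suc N) * \<delta>" by (simp only: d_less_iff[OF grid_nonneg grid_nonneg])
      then have "real n < real (Suc N)" using \<delta>(1) by (simp only: mult_less_cancel_right_pos)
      then show ?thesis by simp
    qed
    have et: "real n * \<delta> \<le> e t" "e t \<le> real (Suc n) * \<delta>" "e t \<le> S"
      using grid_e[OF \<delta>(1) n] e_mono[of t T] t by auto
    let ?J = "(\<Sum>j<n. \<xi> j * (LINT v:{real j * \<delta>..real (Suc j) * \<delta>}|lborel. incr j v)) + \<xi> n * (LINT v:{real n * \<delta>..e t}|lborel. incr n v)"
    have J: "\<bar>?J\<bar> \<le> U" by (rule U[OF nN]) (use et in auto)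
    have p: "incseq (\<lambda>i. real i * \<delta>)" by (rule monoI) (rule grid_mono)
    have Fs: "\<bar>(LINT v:{0..e t}|lborel. f v) - (\<Sum>i<n. F (real i * \<delta>) (grid i) * (real (Suc i) * \<delta> - real i * \<delta>)) - F (real n * \<delta>) (grid n) * (e t - real n * \<delta>) - ?J\<bar>
       \<le> (LINT v:{0..e t}|lborel. R v)"
    proof -
      have s1: "(LINT v:{0..e t}|lborel. g v) = (\<Sum>i<n. LINT v:{real i * \<delta>..real (Suc i) * \<delta>}|lborel. g v) + (LINT v:{real n * \<delta>..e t}|lborel. g v)"
        if "set_integrable lborel {0..S} g" for g :: "real \<Rightarrow> real"
        using set_integral_grid_split[OF p et(1), of g] sub[OF that order_refl et(3)] by simp
      have "\<bar>(\<Sum>i<n. LINT v:{real i * \<delta>..real (Suc i) * \<delta>}|lborel. f v) - (\<Sum>i<n. F (real i * \<delta>) (grid i) * (real (Suc i) * \<delta> - real i * \<delta>) + \<xi> i * (LINT v:{real i * \<delta>..real (Suc i) * \<delta>}|lborel. incr i v))\<bar>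
        \<le> (\<Sum>i<n. LINT v:{real i * \<delta>..real (Suc i) * \<delta>}|lborel. R v)"
      proof (rule abs_sum_diff_le)
        fix i assume "i < n"
        then have "real (Suc i) * \<delta> \<le> real n * \<delta>" by (intro grid_mono) auto
        then show "\<bar>(LINT v:{real i * \<delta>..real (Suc i) * \<delta>}|lborel. f v) - (F (real i * \<delta>) (grid i) * (real (Suc i) * \<delta> - real i * \<delta>) + \<xi> i * (LINT v:{real i * \<delta>..real (Suc i) * \<delta>}|lborel. incr i v))\<bar>
          \<le> (LINT v:{real i * \<delta>..real (Suc i) * \<delta>}|lborel. R v)"
          using et by (intro F_step grid_mono) auto
      qed
      then show ?thesis
        unfolding s1[OF fi] s1[OF Ri] sum.distrib using F_step[OF et] by linarith
    qed
    have q: "incseq (\<lambda>i. d (real i * \<delta>))"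
      by (rule monoI) (simp only: d_le_iff[OF grid_nonneg grid_nonneg] grid_mono)
    have Hs: "\<bar>(LINT r:{0..t}|lborel. H (e r)) - (\<Sum>i<n. H (real i * \<delta>) * (d (real (Suc i) * \<delta>) - d (real i * \<delta>))) - H (real n * \<delta>) * (t - d (real n * \<delta>))\<bar>
      \<le> T * (K * \<delta> powr \<theta>)"
    proof -
      have s1: "(LINT r:{0..t}|lborel. H (e r)) = (\<Sum>i<n. LINT r:{d (real i * \<delta>)..d (real (Suc i) * \<delta>)}|lborel. H (e r)) + (LINT r:{d (real n * \<delta>)..t}|lborel. H (e r))"
        using set_integral_grid_split[OF q n(1), of "\<lambda>r. H (e r)"] He by (simp add: d0)
      have 1: "\<bar>(\<Sum>i<n. LINT r:{d (real i * \<delta>)..d (real (Suc i) * \<delta>)}|lborel. H (e r)) - (\<Sum>i<n. H (real i * \<delta>) * (d (real (Suc i) * \<delta>) - d (real i * \<delta>)))\<bar>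
        \<le> (\<Sum>i<n. K * \<delta> powr \<theta> * (d (real (Suc i) * \<delta>) - d (real i * \<delta>)))"
        by (rule abs_sum_diff_le) (intro H_step monoD[OF q]; simp)
      have 2: "(\<Sum>i<n. K * \<delta> powr \<theta> * (d (real (Suc i) * \<delta>) - d (real i * \<delta>))) = K * \<delta> powr \<theta> * d (real n * \<delta>)"
        unfolding sum_distrib_left[symmetric] sum_lessThan_telescope[of "\<lambda>i. d (real i * \<delta>)"] by (simp add: d0)
      have 3: "K * \<delta> powr \<theta> * d (real n * \<delta>) + K * \<delta> powr \<theta> * (t - d (real n * \<delta>)) \<le> T * (K * \<delta> powr \<theta>)"
      proof -
        have "K * \<delta> powr \<theta> * t \<le> K * \<delta> powr \<theta> * T" using t K by (intro mult_left_mono) auto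
        then show ?thesis by (simp add: algebra_simps)
      qed
      show ?thesis
        unfolding s1 using 1 2 3 H_step[OF n(1) less_imp_le[OF n(2)]] by linarith
    qed
    have Rs: "(LINT v:{0..e t}|lborel. R v) \<le> h S * (LINT v:{0..e t}|lborel. Z v) + V"
    proof -
      have 1: "(LINT v:{0..e t}|lborel. R v) = h S * (LINT v:{0..e t}|lborel. Z v) + (LINT v:{0..e t}|lborel. rho v)"
        unfolding R_def
        by (simp only: set_integral_add(2)[OF set_integrable_mult_right[OF sub[OF Zi order_refl et(3)]] sub[OF rho_integrable order_refl et(3)]] set_integral_mult_right)
      have 2: "(LINT v:{0..e t}|lborel. rho v) \<le> (LINT v:{0..S}|lborel. rho v)"
        unfolding set_lebesgue_integral_def
      proof (rule integral_mono)
        show "integrable lborel (\<lambda>v. indicator {0..e t} v *\<^sub>R rho v)"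
          using sub[OF rho_integrable order_refl et(3)] unfolding set_integrable_def .
        show "integrable lborel (\<lambda>v. indicator {0..S} v *\<^sub>R rho v)"
          using rho_integrable unfolding set_integrable_def .
        show "indicator {0..e t} v *\<^sub>R rho v \<le> indicator {0..S} v *\<^sub>R rho v" for v
          using rho_nonneg[of v] et(3) by (cases "0 \<le> v") (simp_all add: indicator_def)
      qed
      show ?thesis using 1 2 V by linarith
    qed
    have pr: "proc t = x0 + ((\<Sum>i<n. H (real i * \<delta>) * (d (real (Suc i) * \<delta>) - d (real i * \<delta>))) + (\<Sum>i<n. F (real i * \<delta>) (grid i) * (real (Suc i) * \<delta> - real i * \<delta>)))
        + H (real n * \<delta>) * (t - d (real n * \<delta>)) + F (real n * \<delta>) (grid n) * (e t - real n * \<delta>) + gint (e t)"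
      using proc_eq[OF _ n] t gint_eq[OF nN et(1,2)] grid_sum[of n]
      by (simp add: drift_def sum.distrib del: of_nat_Suc)
    show ?thesis
      using x_eq[OF t] F_int[OF t] pr Fs Hs Rs J Q[OF t] unfolding A_def by linarith
  qed
  have gron: "Z v \<le> 2 * A * exp ((2 * h S + 1) * v)" if v: "0 \<le> v" "v < S" for v
  proof (rule gronwall_measurable[OF Zm _ Zb A0 hS _ v])
    show "0 \<le> Z v" for v by (simp add: Z_def)
    fix v assume v: "0 \<le> v" "v < S"
    have "d v \<in> {0..T}" using d_less_le[of T v] T v d_nonneg by auto
    from main[OF this] show "Z v \<le> A + h S * (LINT w:{0..v}|lborel. Z w)"
      using v X_eq[OF \<open>d v \<in> {0..T}\<close>] by (simp add: Z_def Xop_def proc_d e_d)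
  qed
  have et: "e t \<le> S" using t by (intro e_mono) auto
  \<comment> \<open>\<open>gron\<close> reaches only times of the form \<open>d v\<close>. The
    right-hand side of \<open>main\<close> involves \<open>Z\<close> alone, so inserting the bound
    there covers every \<open>t\<close>, including the times skipped by jumps.\<close>
  have "(LINT v:{0..e t}|lborel. Z v) \<le> (LINT v:{0..e t}|lborel. 2 * A * exp ((2 * h S + 1) * S))"
  proof (rule set_integral_mono_AE)
    show "set_integrable lborel {0..e t} Z" by (rule sub[OF Zi order_refl et])
    show "set_integrable lborel {0..e t} (\<lambda>v. 2 * A * exp ((2 * h S + 1) * S))"
      by (rule borel_integrable_atLeastAtMost') (rule continuous_on_const)
    show "AE v \<in> {0..e t} in lborel. Z v \<le> 2 * A * exp ((2 * h S + 1) * S)"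
      using AE_S
    proof eventually_elim
      case (elim v)
      show ?case
      proof
        assume "v \<in> {0..e t}"
        then have v: "0 \<le> v" "v < S" using elim et by auto
        have "2 * A * exp ((2 * h S + 1) * v) \<le> 2 * A * exp ((2 * h S + 1) * S)"
          using v A0 hS by (intro mult_left_mono) (auto intro!: mult_left_mono)
        then show "Z v \<le> 2 * A * exp ((2 * h S + 1) * S)" using gron[OF v] by linarith
      qed
    qed
  qed
  also have "\<dots> = 2 * A * exp ((2 * h S + 1) * S) * e t"
    using e_nonneg[of t] by (simp add: set_lebesgue_integral_def)
  also have "\<dots> \<le> 2 * A * exp ((2 * h S + 1) * S) * S"
    using et A0 by (intro mult_left_mono) auto
  finally have "h S * (LINT v:{0..e t}|lborel. Z v) \<le> h S * (2 * A * exp ((2 * h S + 1) * S) * S)"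
    by (rule mult_left_mono[OF _ hS])
  then have "\<bar>x t - proc t\<bar> \<le> A + h S * (2 * A * exp ((2 * h S + 1) * S) * S)"
    using main[OF t] by linarith
  then show ?thesis unfolding A_def[symmetric] by (simp add: algebra_simps)
qed

end

section \<open>Growth of the grid values and the total size of the jumps\<close>

lemma em_grid_cong:
  assumes "\<And>t. 0 \<le> t \<Longrightarrow> B t \<omega> = B' t \<omega>'" "\<And>t. 0 \<le> t \<Longrightarrow> D t \<omega> = D' t \<omega>'" "0 \<le> \<delta>"
  shows "em_grid B D H F G x0 \<delta> n \<omega> = em_grid B' D' H F G x0 \<delta> n \<omega>'"
  by (induction n) (simp_all add: assms)

lemma inverse_subordinator_cong:
  assumes "\<And>t. 0 \<le> t \<Longrightarrow> D t \<omega> = D' t \<omega>'"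
  shows "inverse_subordinator D t \<omega> = inverse_subordinator D' t \<omega>'"
proof -
  have "{u. 0 < u \<and> t < D u \<omega>} = {u. 0 < u \<and> t < D' u \<omega>'}" using assms by auto
  then show ?thesis by (simp add: inverse_subordinator_def)
qed

text \<open>The scheme at a sample point depends only on its two paths at nonnegative times. This
  lets it be compared across the product space, its sections and the one-point space.\<close>

lemma em_process_cong:
  assumes "\<And>t. 0 \<le> t \<Longrightarrow> B t \<omega> = B' t \<omega>'" "\<And>t. 0 \<le> t \<Longrightarrow> D t \<omega> = D' t \<omega>'" "0 \<le> \<delta>"
    and "\<And>t. 0 \<le> inverse_subordinator D t \<omega>"
  shows "em_process B D H F G x0 \<delta> s \<omega> = em_process B' D' H F G x0 \<delta> s \<omega>'"
proof -
  have E: "inverse_subordinator D t \<omega> = inverse_subordinator D' t \<omega>'" for t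
    by (rule inverse_subordinator_cong) (rule assms)
  have g: "em_grid B D H F G x0 \<delta> n \<omega> = em_grid B' D' H F G x0 \<delta> n \<omega>'" for n
    by (rule em_grid_cong) (rule assms, assumption?)+
  have "D (real n * \<delta>) \<omega> = D' (real n * \<delta>) \<omega>'" for n using assms(2,3) by simp
  moreover have "B (inverse_subordinator D t \<omega>) \<omega> = B' (inverse_subordinator D t \<omega>) \<omega>'" for t
    by (rule assms(1)[OF assms(4)])
  ultimately show ?thesis unfolding em_process_def Let_def E g by (simp only: E)
qed

context em_path
begin

text \<open>Discrete Gronwall inequality for one pair of paths. The Brownian part is isolated in
  \<open>R\<close>, so that the growth factor depends on the subordinator alone and a mean is
  required only for a maximum of Brownian sums.\<close>

lemma grid_bound:
  assumes R: "\<And>m. m \<le> N \<Longrightarrow> \<bar>\<Sum>i<m. G (real i * \<delta>) * incr i (real (Suc i) * \<delta>)\<bar> \<le> R" and n: "n \<le> N"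
  shows "\<bar>grid n\<bar> \<le> (\<bar>x0\<bar> + h S * T + h S * S + R) * exp (h S * S)"
proof -
  define c where "c = \<bar>x0\<bar> + h S * T + h S * S + R"
  have R0: "0 \<le> R" using R[of 0] by simp
  have c0: "0 \<le> c" using R0 hS T S_nonneg by (simp add: c_def)
  have step: "\<bar>grid n\<bar> \<le> c + (h S * \<delta>) * (\<Sum>i<n. \<bar>grid i\<bar>)" if n: "n \<le> N" for n
  proof -
    have dr: "\<bar>drift i (real (Suc i) * \<delta>)\<bar> \<le> h S * (d (real (Suc i) * \<delta>) - d (real i * \<delta>)) + h S * \<delta> + h S * \<delta> * \<bar>grid i\<bar>"
      if "i < n" for i
    proof -
      have iS: "real i * \<delta> \<le> S" using that n by (intro grid_le_S) auto
      have dd: "d (real i * \<delta>) \<le> d (real (Suc i) * \<delta>)"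
        unfolding d_le_iff[OF grid_nonneg grid_nonneg] by (rule grid_mono) simp
      have "\<bar>H (real i * \<delta>) * (d (real (Suc i) * \<delta>) - d (real i * \<delta>))\<bar> \<le> h S * (d (real (Suc i) * \<delta>) - d (real i * \<delta>))"
        unfolding abs_mult using HG_bound(1)[OF grid_nonneg iS] dd by (intro mult_mono) auto
      moreover have "\<bar>F (real i * \<delta>) (grid i) * (real (Suc i) * \<delta> - real i * \<delta>)\<bar> \<le> h S * (1 + \<bar>grid i\<bar>) * \<delta>"
        unfolding abs_mult using F_bound[OF grid_nonneg iS, of "grid i"] hS \<delta>
        by (intro mult_mono) (auto simp: distrib_right)
      moreover have "h S * (1 + \<bar>grid i\<bar>) * \<delta> = h S * \<delta> + h S * \<delta> * \<bar>grid i\<bar>" by (simp add: algebra_simps)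
      ultimately show ?thesis unfolding drift_def by linarith
    qed
    have "\<bar>\<Sum>i<n. drift i (real (Suc i) * \<delta>)\<bar> \<le> (\<Sum>i<n. h S * (d (real (Suc i) * \<delta>) - d (real i * \<delta>)) + h S * \<delta> + h S * \<delta> * \<bar>grid i\<bar>)"
      by (rule order_trans[OF sum_abs sum_mono]) (use dr in auto)
    also have "\<dots> = h S * d (real n * \<delta>) + h S * (real n * \<delta>) + (h S * \<delta>) * (\<Sum>i<n. \<bar>grid i\<bar>)"
      unfolding sum.distrib sum_distrib_left[symmetric] sum_lessThan_telescope[of "\<lambda>i. d (real i * \<delta>)"]
      by (simp add: d0)
    finally have 1: "\<bar>\<Sum>i<n. drift i (real (Suc i) * \<delta>)\<bar> \<le> h S * d (real n * \<delta>) + h S * (real n * \<delta>) + (h S * \<delta>) * (\<Sum>i<n. \<bar>grid i\<bar>)" .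
    have "d (real n * \<delta>) \<le> d (real N * \<delta>)"
      unfolding d_le_iff[OF grid_nonneg grid_nonneg] by (rule grid_mono[OF n])
    then have "h S * d (real n * \<delta>) \<le> h S * T" using N by (intro mult_left_mono hS) linarith
    moreover have "h S * (real n * \<delta>) \<le> h S * S" by (intro mult_left_mono hS grid_le_S n)
    ultimately show ?thesis
      using 1 R[OF n] unfolding grid_sum[of n] c_def by linarith
  qed
  have "\<bar>grid n\<bar> \<le> c * (1 + h S * \<delta>) ^ n"
    by (rule gronwall_discrete[where N = N and x = "\<lambda>n. \<bar>grid n\<bar>"]) (use hS \<delta> step n in auto)
  also have "\<dots> \<le> c * exp (h S * S)"
  proof (rule mult_left_mono[OF _ c0])
    have "(1 + h S * \<delta>) ^ n \<le> exp (h S * \<delta>) ^ n"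
      using hS \<delta> by (intro power_mono exp_ge_add_one_self add_nonneg_nonneg mult_nonneg_nonneg) auto
    also have "\<dots> = exp (h S * (real n * \<delta>))" by (simp add: exp_of_nat_mult[symmetric] ac_simps)
    also have "\<dots> \<le> exp (h S * S)" using grid_le_S[OF n] hS by (simp add: mult_left_mono)
    finally show "(1 + h S * \<delta>) ^ n \<le> exp (h S * S)" .
  qed
  finally show ?thesis by (simp add: c_def)
qed

definition gap :: "real \<Rightarrow> real" where
  "gap v = min (d (max 0 v)) T - min (d (real (idx v) * \<delta>)) T"

lemma gap_measurable: "gap \<in> borel_measurable borel"
  unfolding gap_def[abs_def] by (rule idx_compose_measurable) measurable

lemma gap_bounds: "0 \<le> v \<Longrightarrow> 0 \<le> gap v" "gap v \<le> T"
proof -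
  show "gap v \<le> T" unfolding gap_def using d_nonneg[OF grid_nonneg, of "idx v"] T by (auto simp: min_def)
  assume "0 \<le> v"
  then have "d (real (idx v) * \<delta>) \<le> d (max 0 v)" using idx(1)[of v] d_le_iff[OF grid_nonneg, of v] by simp
  then show "0 \<le> gap v" unfolding gap_def by (auto simp: min_def)
qed

lemma gap_integrable: "set_integrable lborel {0..S} gap"
  by (rule set_integrable_bounded_interval[OF gap_measurable, where m = T])
     (use gap_bounds in \<open>auto simp: abs_of_nonneg\<close>)

text \<open>Single increments need not be small, but within a cell the gap is at most the truncated
  increment over that cell, and the cell has length \<delta>. The truncated increments telescope to
  at most \<open>T\<close>.\<close>

lemma gap_integral: "(LINT v:{0..S}|lborel. gap v) \<le> \<delta> * T"
proof -
  let ?m = "\<lambda>i. min (d (real i * \<delta>)) T"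
  have p: "incseq (\<lambda>i. real i * \<delta>)" by (rule monoI) (rule grid_mono)
  have mm: "?m i \<le> ?m j" if "i \<le> j" for i j
    using that by (intro min.mono) (simp_all add: d_le_iff[OF grid_nonneg grid_nonneg] grid_mono)
  have step: "(LINT v:{real n * \<delta>..s}|lborel. gap v) \<le> \<delta> * (?m (Suc n) - ?m n)"
    if s: "real n * \<delta> \<le> s" "s \<le> real (Suc n) * \<delta>" "s \<le> S" for n s
  proof -
    have le: "\<bar>gap v\<bar> \<le> ?m (Suc n) - ?m n" if v: "real n * \<delta> \<le> v" "v \<le> real (Suc n) * \<delta>" for v
    proof (cases "v < real (Suc n) * \<delta>")
      case True
      have v0: "0 \<le> v" using v grid_nonneg[of n] by linarith
      have "idx v = n" by (rule idx_eq[OF v(1) True])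
      moreover have "min (d v) T \<le> ?m (Suc n)"
        using d_le_iff[OF v0 grid_nonneg, of "Suc n"] v by (intro min.mono) auto
      ultimately show ?thesis using gap_bounds(1)[OF v0] v0 by (simp add: gap_def)
    next
      case False
      then have "v = real (Suc n) * \<delta>" using v by simp
      moreover have "idx (real (Suc n) * \<delta>) = Suc n" by (rule idx_eq) (use \<delta> in auto)
      ultimately have "gap v = 0" using grid_nonneg[of "Suc n"] by (simp add: gap_def del: of_nat_Suc)
      then show ?thesis using mm[of n "Suc n"] by simp
    qed
    have "\<bar>LINT v:{real n * \<delta>..s}|lborel. gap v\<bar> \<le> (LINT v:{real n * \<delta>..s}|lborel. ?m (Suc n) - ?m n)"
    proof (rule set_integral_abs_le)
      show "set_integrable lborel {real n * \<delta>..s} gap"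
        by (rule set_integrable_subset[OF gap_integrable]) (use s grid_nonneg[of n] in auto)
      show "set_integrable lborel {real n * \<delta>..s} (\<lambda>v. ?m (Suc n) - ?m n)"
        by (rule borel_integrable_atLeastAtMost') (rule continuous_on_const)
      show "AE v in lborel. v \<in> {real n * \<delta>..s} \<longrightarrow> \<bar>gap v\<bar> \<le> ?m (Suc n) - ?m n"
        by (rule AE_I2) (use le s in auto)
    qed
    also have "(LINT v:{real n * \<delta>..s}|lborel. ?m (Suc n) - ?m n) = (s - real n * \<delta>) * (?m (Suc n) - ?m n)"
      using s(1) by (simp add: set_lebesgue_integral_def)
    also have "\<dots> \<le> \<delta> * (?m (Suc n) - ?m n)"
      using s mm[of n "Suc n"] by (intro mult_right_mono) (auto simp: distrib_right)
    finally show ?thesis by linarith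
  qed
  have "(LINT v:{0..S}|lborel. gap v) = (\<Sum>i<N. LINT v:{real i * \<delta>..real (Suc i) * \<delta>}|lborel. gap v) + (LINT v:{real N * \<delta>..S}|lborel. gap v)"
    using set_integral_grid_split[OF p NS(1), of gap] gap_integrable by simp
  also have "\<dots> \<le> (\<Sum>i<N. \<delta> * (?m (Suc i) - ?m i)) + \<delta> * (?m (Suc N) - ?m N)"
  proof (intro add_mono sum_mono step grid_mono order_refl)
    fix i assume "i \<in> {..<N}"
    then show "real (Suc i) * \<delta> \<le> S" by (intro grid_le_S) auto
  qed (use NS in auto)
  also have "\<dots> = \<delta> * (?m (Suc N) - ?m 0)"
    unfolding sum_distrib_left[symmetric] sum_lessThan_telescope[of ?m] by (simp add: algebra_simps)
  also have "\<dots> \<le> \<delta> * T" using \<delta> T d0 by (intro mult_left_mono) auto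
  finally show ?thesis .
qed

end

section \<open>The mean error for a fixed path of the subordinator\<close>

locale em_brownian = brownian M b Fb + subordinator_path d + em_coefficients H G h k F Fu Fx Fxx K \<theta>
  for M :: "'a measure" and b Fb d H G h k F Fu Fx Fxx K \<theta> +
  fixes T x0 \<delta> :: real
  assumes T: "0 < T" and \<delta>: "0 < \<delta>" "\<delta> < 1"
begin

lemma em_path_instance:
  assumes "b 0 \<omega> = 0" "continuous_on {0..} (\<lambda>t. b t \<omega>)"
  shows "em_path d H G h k F Fu Fx Fxx K \<theta> T \<delta> (\<lambda>t. b t \<omega>)"
  by unfold_locales (use assms T \<delta> in auto)

text \<open>The zero path gives access to the quantities that depend on \<open>d\<close> only.\<close>

sublocale zero: em_path d H G h k F Fu Fx Fxx K \<theta> T x0 \<delta> "\<lambda>_. 0"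
  by unfold_locales (use T \<delta> in auto)

abbreviation S where "S \<equiv> e T"
abbreviation N where "N \<equiv> zero.N"
abbreviation L where "L \<equiv> S + 1"

definition g :: "nat \<Rightarrow> 'a \<Rightarrow> real" where
  "g n \<omega> = em_grid b (\<lambda>t _. d t) H F G x0 \<delta> n \<omega>"

lemma L_bound: "real (Suc N) * \<delta> \<le> L"
  using zero.NS(1) \<delta> by (simp add: distrib_right)

lemma g_adapted: "g n \<in> borel_measurable (Fb (real n * \<delta>))"
proof (induction n)
  case 0
  have "g 0 = (\<lambda>_. x0)" by (auto simp: g_def)
  then show ?case by simp
next
  case (Suc n)
  have up: "real n * \<delta> \<le> real (Suc n) * \<delta>" by (rule zero.grid_mono) simp
  have gm: "g n \<in> borel_measurable (Fb (real (Suc n) * \<delta>))" by (rule Fb_measurable_mono[OF up Suc])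
  have Fm: "(\<lambda>\<omega>. F (real n * \<delta>) (g n \<omega>)) \<in> borel_measurable (Fb (real (Suc n) * \<delta>))"
    using F_measurable[of "\<lambda>_. real n * \<delta>" "Fb (real (Suc n) * \<delta>)" "g n"] gm zero.grid_nonneg[of n] by simp
  have bm: "b (real (Suc n) * \<delta>) \<in> borel_measurable (Fb (real (Suc n) * \<delta>))"
    "b (real n * \<delta>) \<in> borel_measurable (Fb (real (Suc n) * \<delta>))"
    by (rule b_adapted[OF zero.grid_nonneg order_refl], rule b_adapted[OF zero.grid_nonneg up])
  have "g (Suc n) = (\<lambda>\<omega>. g n \<omega> + H (real n * \<delta>) * (d (real (Suc n) * \<delta>) - d (real n * \<delta>))
      + F (real n * \<delta>) (g n \<omega>) * \<delta> + G (real n * \<delta>) * (b (real (Suc n) * \<delta>) \<omega> - b (real n * \<delta>) \<omega>))"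
    by (auto simp: g_def)
  also have "\<dots> \<in> borel_measurable (Fb (real (Suc n) * \<delta>))"
    by (intro borel_measurable_add borel_measurable_times borel_measurable_diff borel_measurable_const gm Fm bm)
  finally show ?case .
qed

lemma g_measurable: "g n \<in> borel_measurable M" by (rule Fb_measurable[OF g_adapted])

text \<open>The maximal Brownian contribution demanded by \<open>grid_bound\<close>. Coefficients
  beyond \<open>N\<close> are set to 0 because \<open>h S\<close> bounds \<open>G\<close> only up to
  \<open>S\<close>.\<close>

definition R :: "'a \<Rightarrow> real" where
  "R \<omega> = running_max (\<lambda>m. \<bar>\<Sum>i<m. (if i \<le> N then G (real i * \<delta>) else 0) * (b (real i * \<delta> + \<delta>) \<omega> - b (real i * \<delta>) \<omega>)\<bar>) N"

text \<open>A bound for the mean of \<open>\<bar>g n\<bar>\<close>, uniform in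
  \<open>n \<le> N\<close> and free of \<delta>; it depends on the subordinator path through
  \<open>S\<close> only.\<close>

definition Gm :: real where
  "Gm = (\<bar>x0\<bar> + h S * T + h S * S + (1 + 8 * (h S)\<^sup>2 * L) / 2) * exp (h S * S)"

lemma R_square: "square_integrable M R" "(\<integral>\<omega>. (R \<omega>)\<^sup>2 \<partial>M) \<le> 8 * (h S)\<^sup>2 * L"
proof -
  have b1: "\<bar>if i \<le> N then G (real i * \<delta>) else 0\<bar> \<le> h S" for i
    using HG_bound(2)[OF zero.grid_nonneg zero.grid_le_S] zero.hS by auto
  note tm = transform_maximal[where \<xi> = "\<lambda>i _. if i \<le> N then G (real i * \<delta>) else 0" and c = "h S" and N = N, OF \<delta>(1) less_imp_le[OF \<delta>(1)] order_refl borel_measurable_const b1]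
  show "square_integrable M R" unfolding R_def by (rule tm(1))
  have "(\<integral>\<omega>. (R \<omega>)\<^sup>2 \<partial>M) \<le> 8 * (real N * (h S)\<^sup>2 * \<delta>)" unfolding R_def by (rule tm(2))
  also have "real N * (h S)\<^sup>2 * \<delta> = (h S)\<^sup>2 * (real N * \<delta>)" by simp
  also have "8 * \<dots> \<le> 8 * ((h S)\<^sup>2 * L)"
    using zero.NS(1) by (intro mult_left_mono) auto
  finally show "(\<integral>\<omega>. (R \<omega>)\<^sup>2 \<partial>M) \<le> 8 * (h S)\<^sup>2 * L" by simp
qed

lemma R_mean: "integrable M R" "(\<integral>\<omega>. \<bar>R \<omega>\<bar> \<partial>M) \<le> (1 + 8 * (h S)\<^sup>2 * L) / 2"
proof -
  show i: "integrable M R" by (rule integrable_square_integrable[OF prob_space_axioms R_square(1)])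
  have "ennreal (\<integral>\<omega>. \<bar>R \<omega>\<bar> \<partial>M) = (\<integral>\<^sup>+\<omega>. ennreal \<bar>R \<omega>\<bar> \<partial>M)"
    by (rule nn_integral_eq_integral[symmetric]) (use i in auto)
  also have "\<dots> \<le> ennreal ((1 + 8 * (h S)\<^sup>2 * L / 1) / 2)"
    by (rule nn_integral_abs_le_square[OF prob_space_axioms R_square(1) _ R_square(2)]) simp
  finally show "(\<integral>\<omega>. \<bar>R \<omega>\<bar> \<partial>M) \<le> (1 + 8 * (h S)\<^sup>2 * L) / 2"
    using zero.S_nonneg by (subst (asm) ennreal_le_iff) auto
qed

lemma g_pathwise:
  assumes "b 0 \<omega> = 0" "continuous_on {0..} (\<lambda>t. b t \<omega>)" and n: "n \<le> N"
  shows "\<bar>g n \<omega>\<bar> \<le> (\<bar>x0\<bar> + h S * T + h S * S + \<bar>R \<omega>\<bar>) * exp (h S * S)"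
proof -
  interpret P: em_path d H G h k F Fu Fx Fxx K \<theta> T x0 \<delta> "\<lambda>t. b t \<omega>"
    by (rule em_path_instance[OF assms(1,2)])
  have grid: "P.grid n = g n \<omega>" for n
    unfolding P.grid_def g_def by (rule em_grid_cong) (use \<delta> in auto)
  have "\<bar>P.grid n\<bar> \<le> (\<bar>x0\<bar> + h S * T + h S * S + \<bar>R \<omega>\<bar>) * exp (h S * S)"
  proof (rule P.grid_bound[OF _ n])
    fix m assume m: "m \<le> N"
    have "(\<Sum>i<m. G (real i * \<delta>) * P.incr i (real (Suc i) * \<delta>)) =
      (\<Sum>i<m. (if i \<le> N then G (real i * \<delta>) else 0) * (b (real i * \<delta> + \<delta>) \<omega> - b (real i * \<delta>) \<omega>))"
      by (rule sum.cong) (use m in \<open>auto simp: P.incr_def distrib_right add.commute\<close>)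
    then show "\<bar>\<Sum>i<m. G (real i * \<delta>) * P.incr i (real (Suc i) * \<delta>)\<bar> \<le> \<bar>R \<omega>\<bar>"
      using running_max_ge[OF m, of "\<lambda>m. \<bar>\<Sum>i<m. (if i \<le> N then G (real i * \<delta>) else 0) * (b (real i * \<delta> + \<delta>) \<omega> - b (real i * \<delta>) \<omega>)\<bar>"]
      by (simp add: R_def)
  qed
  then show ?thesis by (simp add: grid)
qed

lemma g_mean:
  assumes n: "n \<le> N"
  shows "integrable M (g n)" "(\<integral>\<omega>. \<bar>g n \<omega>\<bar> \<partial>M) \<le> Gm"
proof -
  let ?B = "\<lambda>\<omega>. (\<bar>x0\<bar> + h S * T + h S * S + \<bar>R \<omega>\<bar>) * exp (h S * S)"
  have iB: "integrable M ?B" using R_mean(1) by (intro integrable_mult_left Bochner_Integration.integrable_add) auto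
  have le: "AE \<omega> in M. \<bar>g n \<omega>\<bar> \<le> ?B \<omega>"
    using b_paths by eventually_elim (use g_pathwise[OF _ _ n] in blast)
  show i: "integrable M (g n)"
  proof (rule Bochner_Integration.integrable_bound[OF iB g_measurable])
    show "AE \<omega> in M. norm (g n \<omega>) \<le> norm (?B \<omega>)" using le by eventually_elim simp
  qed
  have "(\<integral>\<omega>. \<bar>g n \<omega>\<bar> \<partial>M) \<le> (\<integral>\<omega>. ?B \<omega> \<partial>M)"
    by (rule integral_mono_AE[OF integrable_abs[OF i] iB le])
  also have "\<dots> = (\<bar>x0\<bar> + h S * T + h S * S + (\<integral>\<omega>. \<bar>R \<omega>\<bar> \<partial>M)) * exp (h S * S)"
    using R_mean(1) by (simp add: prob_space)
  also have "\<dots> \<le> Gm"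
    unfolding Gm_def using R_mean(2) by (intro mult_right_mono) auto
  finally show "(\<integral>\<omega>. \<bar>g n \<omega>\<bar> \<partial>M) \<le> Gm" .
qed

text \<open>\<open>rho\<close> with index, gap and Brownian increment as separate arguments: for
  fixed \<open>v\<close> the first two are deterministic, so that the mean over the Brownian
  coordinate can be computed.\<close>

definition r :: "nat \<Rightarrow> real \<Rightarrow> 'a \<Rightarrow> real \<Rightarrow> real" where
  "r n D \<omega> w = \<delta> * (k S * (1 + \<bar>g n \<omega>\<bar> + h S * T + h S * (1 + \<bar>g n \<omega>\<bar>) + h S * \<bar>w\<bar>))
     + h S * (h S * D + h S * (1 + \<bar>g n \<omega>\<bar>) * \<delta>)
     + \<bar>w\<bar>\<^sup>2 * (k S * (1 + \<bar>g n \<omega>\<bar> + h S * \<bar>w\<bar>))"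

definition P :: real where
  "P = k S * (1 + Gm + h S * T + h S * (1 + Gm) + h S) + (h S)\<^sup>2 * (1 + Gm) + k S * (1 + Gm + 2 * h S)"

text \<open>Odd powers of the increment \<open>w\<close> are replaced by even ones,
  \<open>\<bar>w\<bar> \<le> (1 + w\<^sup>2) / 2\<close> and
  \<open>\<bar>w\<bar> ^ 3 \<le> (w\<^sup>2 + w ^ 4) / 2\<close>, whose Gaussian moments are
  explicit; the product of \<open>\<bar>g n\<bar>\<close> and \<open>w\<^sup>2\<close> factors by
  independence. All terms but the one with \<open>D\<close> then have order \<delta>, as \<sigma>
  and its square are at most \<delta>.\<close>

lemma r_mean:
  assumes n: "n \<le> N" and v: "real n * \<delta> \<le> v" "v \<le> real (Suc n) * \<delta>" and D: "0 \<le> D"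
  shows "(\<integral>\<^sup>+\<omega>. ennreal (r n D \<omega> (b v \<omega> - b (real n * \<delta>) \<omega>)) \<partial>M) \<le> ennreal (\<delta> * P + (h S)\<^sup>2 * D)"
proof -
  define \<sigma> where "\<sigma> = v - real n * \<delta>"
  have \<sigma>: "0 \<le> \<sigma>" "\<sigma> \<le> \<delta>" using v by (auto simp: \<sigma>_def distrib_right)
  have \<sigma>2: "\<sigma>\<^sup>2 \<le> \<delta>"
  proof -
    have "\<sigma> * \<sigma> \<le> \<delta> * 1" using \<sigma> \<delta> by (intro mult_mono) auto
    then show ?thesis by (simp add: power2_eq_square)
  qed
  note n0 = zero.grid_nonneg[of n]
  let ?x = "\<lambda>\<omega>. \<bar>g n \<omega>\<bar>" and ?w = "\<lambda>\<omega>. b v \<omega> - b (real n * \<delta>) \<omega>"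
  have ix: "integrable M ?x" using g_mean(1)[OF n] by (rule integrable_abs)
  have iw2: "integrable M (\<lambda>\<omega>. (?w \<omega>)\<^sup>2)" "(\<integral>\<omega>. (?w \<omega>)\<^sup>2 \<partial>M) = \<sigma>"
    using incr_power[OF n0 v(1), of 2] incr_var[OF n0 v(1)] by (auto simp: \<sigma>_def)
  have iw4: "integrable M (\<lambda>\<omega>. (?w \<omega>) ^ 4)" "(\<integral>\<omega>. (?w \<omega>) ^ 4 \<partial>M) = 3 * \<sigma>\<^sup>2"
    using incr_power[OF n0 v(1), of 4] incr_fourth[OF n0 v(1)] by (auto simp: \<sigma>_def)
  have xm: "?x \<in> borel_measurable (Fb (real n * \<delta>))" using g_adapted[of n] by simp
  have ixw: "integrable M (\<lambda>\<omega>. ?x \<omega> * (?w \<omega>)\<^sup>2)" "(\<integral>\<omega>. ?x \<omega> * (?w \<omega>)\<^sup>2 \<partial>M) = (\<integral>\<omega>. ?x \<omega> \<partial>M) * \<sigma>"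
    using incr_square_indep[OF n0 v(1) xm ix] by (auto simp: \<sigma>_def)
  note hS = zero.hS and kS = zero.kS
  define U where "U \<omega> = \<delta> * k S * (1 + h S * T + h S + h S / 2) + \<delta> * k S * (1 + h S) * ?x \<omega> + \<delta> * k S * h S / 2 * (?w \<omega>)\<^sup>2
     + (h S)\<^sup>2 * D + (h S)\<^sup>2 * \<delta> + (h S)\<^sup>2 * \<delta> * ?x \<omega>
     + k S * (1 + h S / 2) * (?w \<omega>)\<^sup>2 + k S * (?x \<omega> * (?w \<omega>)\<^sup>2) + k S * h S / 2 * (?w \<omega>) ^ 4" for \<omega>
  have iU: "integrable M U"
    unfolding U_def[abs_def]
    by (intro Bochner_Integration.integrable_add integrable_mult_right ix iw2(1) iw4(1) ixw(1) integrable_const)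
  have le: "r n D \<omega> (?w \<omega>) \<le> U \<omega>" for \<omega>
  proof -
    let ?y = "\<bar>?w \<omega>\<bar>"
    have y2: "?y\<^sup>2 = (?w \<omega>)\<^sup>2" "?y ^ 4 = (?w \<omega>) ^ 4" by simp_all
    have "0 \<le> (1 - ?y)\<^sup>2" by simp
    then have a: "?y \<le> (1 + ?y\<^sup>2) / 2" by (simp add: power2_eq_square algebra_simps)
    have b: "?y\<^sup>2 * ?y \<le> (?y\<^sup>2 + ?y ^ 4) / 2"
    proof -
      have "?y\<^sup>2 * ?y \<le> ?y\<^sup>2 * ((1 + ?y\<^sup>2) / 2)" by (rule mult_left_mono[OF a]) simp
      also have "\<dots> = (?y\<^sup>2 + ?y ^ 4) / 2" by (simp add: power2_eq_square power4_eq_xxxx algebra_simps)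
      finally show ?thesis .
    qed
    have 1: "(\<delta> * k S * h S) * ?y \<le> (\<delta> * k S * h S) * ((1 + ?y\<^sup>2) / 2)"
      using \<delta> kS hS by (intro mult_left_mono a) auto
    have 2: "(k S * h S) * (?y\<^sup>2 * ?y) \<le> (k S * h S) * ((?y\<^sup>2 + ?y ^ 4) / 2)"
      using kS hS by (intro mult_left_mono b) auto
    have "r n D \<omega> (?w \<omega>) = \<delta> * k S * (1 + h S * T + h S) + \<delta> * k S * (1 + h S) * ?x \<omega> + (\<delta> * k S * h S) * ?y
      + (h S)\<^sup>2 * D + (h S)\<^sup>2 * \<delta> + (h S)\<^sup>2 * \<delta> * ?x \<omega> + k S * ?y\<^sup>2 + k S * (?x \<omega> * ?y\<^sup>2) + (k S * h S) * (?y\<^sup>2 * ?y)"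
      unfolding r_def by (simp add: algebra_simps power2_eq_square del: abs_mult_self_eq)
    also have "\<dots> \<le> \<delta> * k S * (1 + h S * T + h S) + \<delta> * k S * (1 + h S) * ?x \<omega> + (\<delta> * k S * h S) * ((1 + ?y\<^sup>2) / 2)
      + (h S)\<^sup>2 * D + (h S)\<^sup>2 * \<delta> + (h S)\<^sup>2 * \<delta> * ?x \<omega> + k S * ?y\<^sup>2 + k S * (?x \<omega> * ?y\<^sup>2) + (k S * h S) * ((?y\<^sup>2 + ?y ^ 4) / 2)"
      using 1 2 by linarith
    also have "\<dots> = U \<omega>"
      unfolding U_def y2 by (simp add: algebra_simps add_divide_distrib)
    finally show ?thesis .
  qed
  have U0: "0 \<le> U \<omega>" for \<omega>
    unfolding U_def using \<delta> kS hS T D by (intro add_nonneg_nonneg mult_nonneg_nonneg divide_nonneg_nonneg) auto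
  let ?X = "\<integral>\<omega>. ?x \<omega> \<partial>M"
  have X: "?X \<le> Gm" by (rule g_mean(2)[OF n])
  have X0: "0 \<le> ?X" by (rule integral_nonneg_AE) simp
  have "(\<integral>\<omega>. U \<omega> \<partial>M) = \<delta> * k S * (1 + h S * T + h S + h S / 2) + \<delta> * k S * (1 + h S) * ?X + \<delta> * k S * h S / 2 * \<sigma>
     + (h S)\<^sup>2 * D + (h S)\<^sup>2 * \<delta> + (h S)\<^sup>2 * \<delta> * ?X
     + k S * (1 + h S / 2) * \<sigma> + k S * (?X * \<sigma>) + k S * h S / 2 * (3 * \<sigma>\<^sup>2)"
    unfolding U_def
    by (simp only: Bochner_Integration.integral_add Bochner_Integration.integrable_add integrable_mult_right
        ix iw2 iw4 ixw integrable_const integral_mult_right_zero lebesgue_integral_const prob_space scaleR_one)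
  also have "\<dots> \<le> \<delta> * k S * (1 + h S * T + h S + h S / 2) + \<delta> * k S * (1 + h S) * Gm + \<delta> * k S * h S / 2 * 1
     + (h S)\<^sup>2 * D + (h S)\<^sup>2 * \<delta> + (h S)\<^sup>2 * \<delta> * Gm
     + k S * (1 + h S / 2) * \<delta> + k S * (Gm * \<delta>) + k S * h S / 2 * (3 * \<delta>)"
  proof -
    have n1: "0 \<le> \<delta> * k S * (1 + h S)" "0 \<le> \<delta> * k S * h S / 2" "0 \<le> (h S)\<^sup>2 * \<delta>" "0 \<le> k S * (1 + h S / 2)" "0 \<le> k S * h S / 2"
      using \<delta> kS hS by simp_all
    have "\<sigma> \<le> 1" using \<sigma> \<delta> by simp
    have "?X * \<sigma> \<le> Gm * \<delta>" by (rule mult_mono[OF X \<sigma>(2) order_trans[OF X0 X] \<sigma>(1)])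
    then have a5: "k S * (?X * \<sigma>) \<le> k S * (Gm * \<delta>)" by (rule mult_left_mono[OF _ kS])
    have "3 * \<sigma>\<^sup>2 \<le> 3 * \<delta>" using \<sigma>2 by simp
    then show ?thesis
      using mult_left_mono[OF X n1(1)] mult_left_mono[OF \<open>\<sigma> \<le> 1\<close> n1(2)] mult_left_mono[OF X n1(3)]
        mult_left_mono[OF \<sigma>(2) n1(4)] a5 mult_left_mono[OF _ n1(5), of "3 * \<sigma>\<^sup>2" "3 * \<delta>"] by linarith
  qed
  also have "\<dots> = \<delta> * P + (h S)\<^sup>2 * D"
    unfolding P_def by (simp add: algebra_simps add_divide_distrib)
  finally have IU: "(\<integral>\<omega>. U \<omega> \<partial>M) \<le> \<delta> * P + (h S)\<^sup>2 * D" .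
  have "(\<integral>\<^sup>+\<omega>. ennreal (r n D \<omega> (?w \<omega>)) \<partial>M) \<le> (\<integral>\<^sup>+\<omega>. ennreal (U \<omega>) \<partial>M)"
    by (intro nn_integral_mono ennreal_leI le)
  also have "\<dots> = ennreal (\<integral>\<omega>. U \<omega> \<partial>M)"
    by (rule nn_integral_eq_integral[OF iU]) (use U0 in auto)
  also have "\<dots> \<le> ennreal (\<delta> * P + (h S)\<^sup>2 * D)" by (rule ennreal_leI[OF IU])
  finally show ?thesis .
qed

lemma P_nonneg: "0 \<le> P"
proof -
  have "0 \<le> Gm" using g_mean(2)[of 0] by (rule order_trans[rotated]) (auto intro: integral_nonneg_AE)
  then show ?thesis
    unfolding P_def using zero.hS zero.kS T by (intro add_nonneg_nonneg mult_nonneg_nonneg) auto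
qed

text \<open>The mean is exchanged with the integral over \<open>v\<close>, which uses the jointly
  measurable version of the Brownian motion. \<open>P * S\<close> collects the pointwise bounds of
  order \<delta>; \<open>(h S)\<^sup>2 * T\<close> comes from \<open>gap_integral\<close>.\<close>

lemma local_errors:
  obtains V :: "'a \<Rightarrow> ennreal" where "V \<in> borel_measurable M"
    "(\<integral>\<^sup>+\<omega>. V \<omega> \<partial>M) \<le> ennreal (\<delta> * (P * S + (h S)\<^sup>2 * T))"
    "AE \<omega> in M. ennreal (LINT v:{0..S}|lborel. r (zero.idx v) (zero.gap v) \<omega> (b v \<omega> - b (real (zero.idx v) * \<delta>) \<omega>)) \<le> V \<omega>"
proof -
  obtain b' where b'm: "(\<lambda>(v, \<omega>). b' v \<omega>) \<in> borel_measurable (borel \<Otimes>\<^sub>M M)"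
    and b'eq: "AE \<omega> in M. \<forall>v\<ge>0. b' v \<omega> = b v \<omega>"
    and b'c: "\<And>\<omega>. \<omega> \<in> space M \<Longrightarrow> continuous_on UNIV (\<lambda>v. b' v \<omega>)"
    using continuous_modification by blast
  define f where "f v \<omega> = ennreal (r (zero.idx v) (zero.gap v) \<omega> (b' v \<omega> - b' (real (zero.idx v) * \<delta>) \<omega>)) * indicator {0..S} v" for v \<omega>
  define V where "V \<omega> = (\<integral>\<^sup>+v. f v \<omega> \<partial>lborel)" for \<omega>
  have bs[measurable]: "(\<lambda>p. b' (fst p) (snd p)) \<in> borel_measurable (lborel \<Otimes>\<^sub>M M)"
    using measurable_compose[of "\<lambda>p. (fst p, snd p)" "lborel \<Otimes>\<^sub>M M" "borel \<Otimes>\<^sub>M M", OF _ b'm] by simp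
  have bc: "(\<lambda>\<omega>. b' a \<omega>) \<in> borel_measurable M" for a
    using measurable_compose[of "\<lambda>\<omega>. (a, \<omega>)" M "borel \<Otimes>\<^sub>M M", OF _ b'm] by simp
  have bc2[measurable]: "(\<lambda>p. b' a (snd p)) \<in> borel_measurable (lborel \<Otimes>\<^sub>M M)" for a
    by (rule measurable_compose[OF measurable_snd bc])
  have gm2[measurable]: "(\<lambda>p. g n (snd p)) \<in> borel_measurable (lborel \<Otimes>\<^sub>M M)" for n
    by (rule measurable_compose[OF measurable_snd g_measurable])
  have gap[measurable]: "(\<lambda>p. zero.gap (fst p)) \<in> borel_measurable (lborel \<Otimes>\<^sub>M M)"
    using measurable_compose[OF measurable_fst, of zero.gap lborel borel M] zero.gap_measurable by simp
  have idx: "(\<lambda>p. zero.idx (fst p)) \<in> measurable (lborel \<Otimes>\<^sub>M M) (count_space UNIV)"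
    using measurable_compose[OF measurable_fst, of zero.idx lborel "count_space UNIV" M] zero.idx_measurable by simp
  have fm: "(\<lambda>(v, \<omega>). f v \<omega>) \<in> borel_measurable (lborel \<Otimes>\<^sub>M M)"
  proof -
    have "(\<lambda>p. r (zero.idx (fst p)) (zero.gap (fst p)) (snd p) (b' (fst p) (snd p) - b' (real (zero.idx (fst p)) * \<delta>) (snd p)))
      \<in> borel_measurable (lborel \<Otimes>\<^sub>M M)"
    proof (rule measurable_compose_countable[OF _ idx, of "\<lambda>n p. r n (zero.gap (fst p)) (snd p) (b' (fst p) (snd p) - b' (real n * \<delta>) (snd p))"])
      show "(\<lambda>p. r n (zero.gap (fst p)) (snd p) (b' (fst p) (snd p) - b' (real n * \<delta>) (snd p))) \<in> borel_measurable (lborel \<Otimes>\<^sub>M M)" for n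
        unfolding r_def by measurable
    qed
    then show ?thesis unfolding f_def split_beta' by measurable
  qed
  interpret lM: pair_sigma_finite lborel M ..
  have E: "AE v in lborel. (\<integral>\<^sup>+\<omega>. f v \<omega> \<partial>M) \<le> ennreal (\<delta> * P + (h S)\<^sup>2 * zero.gap v) * indicator {0..S} v"
  proof -
    have "AE v in lborel. v \<noteq> S" by (rule AE_lborel_singleton)
    then show ?thesis
    proof eventually_elim
      fix v assume "v \<noteq> S"
      show "(\<integral>\<^sup>+\<omega>. f v \<omega> \<partial>M) \<le> ennreal (\<delta> * P + (h S)\<^sup>2 * zero.gap v) * indicator {0..S} v"
      proof (cases "v \<in> {0..S}")
        case True
        then have v: "0 \<le> v" "v < S" using \<open>v \<noteq> S\<close> by auto
        have "(\<integral>\<^sup>+\<omega>. f v \<omega> \<partial>M) = (\<integral>\<^sup>+\<omega>. ennreal (r (zero.idx v) (zero.gap v) \<omega> (b v \<omega> - b (real (zero.idx v) * \<delta>) \<omega>)) \<partial>M)"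
        proof (rule nn_integral_cong_AE)
          show "AE \<omega> in M. f v \<omega> = ennreal (r (zero.idx v) (zero.gap v) \<omega> (b v \<omega> - b (real (zero.idx v) * \<delta>) \<omega>))"
            using b'eq by eventually_elim (use v zero.grid_nonneg in \<open>simp add: f_def\<close>)
        qed
        also have "\<dots> \<le> ennreal (\<delta> * P + (h S)\<^sup>2 * zero.gap v)"
          by (rule r_mean) (use zero.idx_le_N[OF v] zero.idx[OF v(1)] zero.gap_bounds(1)[OF v(1)] in auto)
        finally show ?thesis using True by simp
      qed (simp add: f_def)
    qed
  qed
  show ?thesis
  proof (rule that[of V])
    show "V \<in> borel_measurable M"
      unfolding V_def
      by (rule lborel.borel_measurable_nn_integral) (use measurable_pair_swap[OF fm] in \<open>simp add: split_beta'\<close>)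
    have gi: "set_integrable lborel {0..S} (\<lambda>v. \<delta> * P + (h S)\<^sup>2 * zero.gap v)"
      by (intro set_integral_add(1) set_integrable_mult_right zero.gap_integrable borel_integrable_atLeastAtMost' continuous_on_const)
    have "(\<integral>\<^sup>+\<omega>. V \<omega> \<partial>M) = (\<integral>\<^sup>+v. \<integral>\<^sup>+\<omega>. f v \<omega> \<partial>M \<partial>lborel)"
      unfolding V_def using lM.Fubini'[OF fm] by simp
    also have "\<dots> \<le> (\<integral>\<^sup>+v. ennreal (\<delta> * P + (h S)\<^sup>2 * zero.gap v) * indicator {0..S} v \<partial>lborel)"
      by (rule nn_integral_mono_AE[OF E])
    also have "\<dots> = (\<integral>\<^sup>+v. ennreal (indicator {0..S} v *\<^sub>R (\<delta> * P + (h S)\<^sup>2 * zero.gap v)) \<partial>lborel)"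
      by (intro nn_integral_cong) (auto simp: indicator_def)
    also have "\<dots> = ennreal (LINT v:{0..S}|lborel. \<delta> * P + (h S)\<^sup>2 * zero.gap v)"
      unfolding set_lebesgue_integral_def using gi unfolding set_integrable_def
      by (rule nn_integral_eq_integral)
         (use \<delta> P_nonneg zero.gap_bounds(1) in \<open>auto simp: indicator_def intro!: AE_I2 add_nonneg_nonneg mult_nonneg_nonneg\<close>)
    also have "(LINT v:{0..S}|lborel. \<delta> * P + (h S)\<^sup>2 * zero.gap v) = \<delta> * P * S + (h S)\<^sup>2 * (LINT v:{0..S}|lborel. zero.gap v)"
    proof -
      have c: "set_integrable lborel {0..S} (\<lambda>v. \<delta> * P)" "(LINT v:{0..S}|lborel. \<delta> * P) = \<delta> * P * S"
        using zero.S_nonneg by (auto intro!: borel_integrable_atLeastAtMost' continuous_on_const simp: set_lebesgue_integral_def)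
      show ?thesis
        unfolding set_integral_add(2)[OF c(1) set_integrable_mult_right[OF zero.gap_integrable]]
        unfolding c(2) unfolding set_integral_mult_right ..
    qed
    also have "ennreal \<dots> \<le> ennreal (\<delta> * (P * S + (h S)\<^sup>2 * T))"
    proof (rule ennreal_leI)
      have "(h S)\<^sup>2 * (LINT v:{0..S}|lborel. zero.gap v) \<le> (h S)\<^sup>2 * (\<delta> * T)"
        by (intro mult_left_mono zero.gap_integral) simp
      then show "\<delta> * P * S + (h S)\<^sup>2 * (LINT v:{0..S}|lborel. zero.gap v) \<le> \<delta> * (P * S + (h S)\<^sup>2 * T)"
        by (simp add: algebra_simps)
    qed
    finally show "(\<integral>\<^sup>+\<omega>. V \<omega> \<partial>M) \<le> ennreal (\<delta> * (P * S + (h S)\<^sup>2 * T))" .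
    show "AE \<omega> in M. ennreal (LINT v:{0..S}|lborel. r (zero.idx v) (zero.gap v) \<omega> (b v \<omega> - b (real (zero.idx v) * \<delta>) \<omega>)) \<le> V \<omega>"
      using b'eq b_paths
    proof eventually_elim
      case (elim \<omega>)
      interpret Q: em_path d H G h k F Fu Fx Fxx K \<theta> T x0 \<delta> "\<lambda>t. b t \<omega>"
        by (rule em_path_instance) (use elim in auto)
      have grid: "Q.grid n = g n \<omega>" for n
        unfolding Q.grid_def g_def by (rule em_grid_cong) (use \<delta> in auto)
      let ?r = "\<lambda>v. r (zero.idx v) (zero.gap v) \<omega> (b v \<omega> - b (real (zero.idx v) * \<delta>) \<omega>)"
      have rho: "Q.rho v = ?r v" for v
        by (simp add: Q.rho_def Let_def r_def grid zero.gap_def Q.incr_def)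
      have i: "integrable lborel (\<lambda>v. indicator {0..S} v *\<^sub>R ?r v)"
        using Q.rho_integrable unfolding rho set_integrable_def .
      have "ennreal (LINT v:{0..S}|lborel. ?r v) = (\<integral>\<^sup>+v. ennreal (indicator {0..S} v *\<^sub>R ?r v) \<partial>lborel)"
        unfolding set_lebesgue_integral_def
        by (rule nn_integral_eq_integral[OF i, symmetric])
           (use Q.rho_nonneg in \<open>auto simp: rho[symmetric] indicator_def\<close>)
      also have "\<dots> = V \<omega>"
        unfolding V_def f_def
        by (intro nn_integral_cong) (use elim zero.grid_nonneg in \<open>auto simp: indicator_def\<close>)
      finally show "ennreal (LINT v:{0..S}|lborel. ?r v) \<le> V \<omega>" by simp
    qed
  qed
qed

end

section \<open>The freezing error of the stochastic integral\<close>

lemma partition_index: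
  fixes p :: "nat \<Rightarrow> real"
  assumes "p 0 < v" "v \<le> p n"
  obtains i where "i < n" "p i < v" "v \<le> p (Suc i)"
proof -
  have "\<exists>i<n. p i < v \<and> v \<le> p (Suc i)" using assms(2)
  proof (induction n)
    case 0
    then show ?case using assms(1) by simp
  next
    case (Suc n)
    then show ?case by (cases "v \<le> p n") (auto simp: less_Suc_eq not_le)
  qed
  then show ?thesis using that by blast
qed

lemma partition_sum:
  fixes p :: "nat \<Rightarrow> real" and c :: "nat \<Rightarrow> real"
  assumes "mono p" "i < n" "p i < v" "v \<le> p (Suc i)"
  shows "(\<Sum>j<n. c j * indicator {p j<..p (Suc j)} v) = c i"
proof -
  have "indicator {p j<..p (Suc j)} v = (if j = i then 1 else 0 :: real)" for j
  proof (cases "j = i")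
    case False
    then consider "Suc j \<le> i" | "Suc i \<le> j" by linarith
    then show ?thesis
    proof cases
      case 1
      then have "p (Suc j) \<le> p i" using \<open>mono p\<close> by (simp add: mono_def)
      then show ?thesis using False assms by (simp add: indicator_def)
    next
      case 2
      then have "p (Suc i) \<le> p j" using \<open>mono p\<close> by (simp add: mono_def)
      then show ?thesis using False assms by (simp add: indicator_def)
    qed
  qed (use assms in simp)
  then have "(\<Sum>j<n. c j * indicator {p j<..p (Suc j)} v) = (\<Sum>j<n. if j = i then c j else 0)"
    by (intro sum.cong) auto
  then show ?thesis using assms(2) by simp
qed

context em_brownian
begin

text \<open>The mesh is \<open>1 / real (Suc m)\<close> in original time. With
  \<open>(Suc m)\<^sup>2\<close> cells the grid becomes finer while its last point
  \<open>real (Suc m)\<close> tends to infinity.\<close>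

definition riemann_ito :: "nat \<Rightarrow> real \<Rightarrow> 'a \<Rightarrow> real" where
  "riemann_ito m t \<omega> = (\<Sum>i<(Suc m)\<^sup>2. G (e (real i / real (Suc m))) *
     (b (e (min (real (Suc i) / real (Suc m)) t)) \<omega> - b (e (min (real i / real (Suc m)) t)) \<omega>))"

definition gint :: "real \<Rightarrow> 'a \<Rightarrow> real" where
  "gint v \<omega> = (\<Sum>j\<le>N. G (real j * \<delta>) * (b (min (real (Suc j) * \<delta>) v) \<omega> - b (min (real j * \<delta>) v) \<omega>))"

lemma e_min: "e (min s t) = min (e s) (e t)"
  using e_mono[of s t] e_mono[of t s] by (auto simp: min_def)

text \<open>The difference of the two sums is one step integral over the disjoint union of both
  partitions. At operational time \<open>v\<close> its integrand is
  \<open>G (p i) - G (real j * \<delta>)\<close> with both arguments within \<delta> of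
  \<open>v\<close>, hence at most \<open>2 * K * \<delta> powr \<theta>\<close>. The maximal
  inequality with parameter \<open>\<delta> powr \<theta>\<close> keeps this order, and 32 is
  \<open>8 * 2\<^sup>2\<close>.\<close>

lemma ito_error_bound:
  assumes T: "T \<le> real (Suc m)"
    and fine: "\<And>s t. s \<in> {0..T + 1} \<Longrightarrow> t \<in> {0..T + 1} \<Longrightarrow> \<bar>s - t\<bar> \<le> 1 / real (Suc m) \<Longrightarrow> \<bar>e s - e t\<bar> \<le> \<delta>"
  shows "\<exists>Q. Q \<in> borel_measurable M \<and> (\<integral>\<^sup>+\<omega>. Q \<omega> \<partial>M) \<le> ennreal (\<delta> powr \<theta> * ((1 + 32 * K\<^sup>2 * S) / 2)) \<and>
    (AE \<omega> in M. \<forall>t\<in>{0..T}. ennreal \<bar>riemann_ito m t \<omega> - gint (e t) \<omega>\<bar> \<le> Q \<omega>)"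
proof -
  define p where "p i = e (real i / real (Suc m))" for i
  define A :: "(nat + nat) set" where "A = {..<(Suc m)\<^sup>2} <+> {..N}"
  define x where "x = case_sum p (\<lambda>j. real j * \<delta>)"
  define y where "y = case_sum (\<lambda>i. p (Suc i)) (\<lambda>j. real (Suc j) * \<delta>)"
  define c where "c = case_sum (\<lambda>i. G (p i)) (\<lambda>j. - G (real j * \<delta>))"
  have pm: "mono p"
    unfolding p_def by (intro monoI e_mono divide_right_mono) auto
  have qm: "mono (\<lambda>j. real j * \<delta>)" by (rule monoI) (rule zero.grid_mono)
  have p0: "p 0 = 0" by (simp add: p_def e_nonpos)
  have pS: "S \<le> p ((Suc m)\<^sup>2)"
  proof -
    have "real ((Suc m)\<^sup>2) / real (Suc m) = real (Suc m)"
      unfolding power2_eq_square of_nat_mult by (rule nonzero_mult_div_cancel_left) simp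
    then show ?thesis unfolding p_def using T by (intro e_mono) simp
  qed
  have xy: "0 \<le> x j \<and> x j \<le> y j" if "j \<in> A" for j
  proof (cases j)
    case (Inl i)
    then show ?thesis using monoD[OF pm, of i "Suc i"] e_nonneg by (simp add: x_def y_def p_def)
  next
    case (Inr i)
    then show ?thesis using zero.grid_mono[of i "Suc i"] zero.grid_nonneg[of i] by (simp add: x_def y_def)
  qed
  define \<mu> where "\<mu> = 2 * K * \<delta> powr \<theta>"
  have \<mu>: "0 \<le> \<mu>" using K by (simp add: \<mu>_def)
  have \<alpha>: "0 < \<delta> powr \<theta>" using \<delta> by simp
  have finA: "finite {..<(Suc m)\<^sup>2}" "finite {..N}" by auto
  have bound: "\<bar>\<Sum>j\<in>A. c j * indicator {x j<..y j} v\<bar> \<le> \<mu>" if v: "0 < v" "v \<le> S" for v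
  proof -
    obtain i where i: "i < (Suc m)\<^sup>2" "p i < v" "v \<le> p (Suc i)"
      using partition_index[of p v "(Suc m)\<^sup>2"] p0 pS v by force
    obtain j where j: "j < Suc N" "real j * \<delta> < v" "v \<le> real (Suc j) * \<delta>"
      using partition_index[of "\<lambda>j. real j * \<delta>" v "Suc N"] v zero.NS(2) by force
    have "(\<Sum>j\<in>A. c j * indicator {x j<..y j} v) =
      (\<Sum>i<(Suc m)\<^sup>2. G (p i) * indicator {p i<..p (Suc i)} v) + (\<Sum>j\<in>{..N}. (- G (real j * \<delta>)) * indicator {real j * \<delta><..real (Suc j) * \<delta>} v)"
      unfolding A_def sum.Plus[OF finA] x_def y_def c_def by simp
    also have "\<dots> = G (p i) - G (real j * \<delta>)"
      using partition_sum[OF pm i, of "\<lambda>i. G (p i)"] partition_sum[OF qm j, of "\<lambda>j. - G (real j * \<delta>)"]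
      by (simp add: lessThan_Suc_atMost)
    finally have eq: "(\<Sum>j\<in>A. c j * indicator {x j<..y j} v) = G (p i) - G (real j * \<delta>)" .
    have hol: "\<bar>G u - G v\<bar> \<le> K * \<delta> powr \<theta>" if "0 \<le> u" "\<bar>u - v\<bar> \<le> \<delta>" for u
    proof -
      have "\<bar>u - v\<bar> powr \<theta> \<le> \<delta> powr \<theta>" using that \<theta> by (intro powr_mono2) auto
      then have "K * \<bar>u - v\<bar> powr \<theta> \<le> K * \<delta> powr \<theta>" using K by (intro mult_left_mono) auto
      then show ?thesis using hoelder[rule_format, of u v] that v by linarith
    qed
    \<comment> \<open>A cell met at or before \<open>S\<close> starts before \<open>T\<close> and so
      ends before \<open>T + 1\<close>; this is why \<open>fine\<close> reaches one unit beyond the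
      horizon.\<close>
    have iT: "real i / real (Suc m) < T"
    proof (rule ccontr)
      assume "\<not> ?thesis"
      then have "S \<le> p i" unfolding p_def by (intro e_mono) simp
      then show False using i v by simp
    qed
    define z \<epsilon> where "z = real i / real (Suc m)" and "\<epsilon> = 1 / real (Suc m)"
    have z: "0 \<le> z" "z < T" "0 \<le> \<epsilon>" "\<epsilon> \<le> 1" using iT by (auto simp: z_def \<epsilon>_def)
    have pz: "p i = e z" "p (Suc i) = e (z + \<epsilon>)"
      by (auto simp: p_def z_def \<epsilon>_def add_divide_distrib add.commute)
    have "\<bar>p (Suc i) - p i\<bar> \<le> \<delta>"
      unfolding pz by (rule fine) (use z in \<open>auto simp: \<epsilon>_def[symmetric] simp del: of_nat_Suc\<close>)
    then have "\<bar>p i - v\<bar> \<le> \<delta>" using i by linarith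
    then have "\<bar>G (p i) - G v\<bar> \<le> K * \<delta> powr \<theta>" by (intro hol) (auto simp: p_def e_nonneg)
    moreover have "\<bar>G (real j * \<delta>) - G v\<bar> \<le> K * \<delta> powr \<theta>"
      using j by (intro hol zero.grid_nonneg) (auto simp: distrib_right)
    ultimately show ?thesis unfolding eq \<mu>_def by linarith
  qed
  obtain Q where Q: "Q \<in> borel_measurable M"
    "(\<integral>\<^sup>+\<omega>. Q \<omega> \<partial>M) \<le> ennreal ((\<delta> powr \<theta> + 8 * \<mu>\<^sup>2 * S / \<delta> powr \<theta>) / 2)"
    "AE \<omega> in M. \<forall>v\<in>{0..S}. ennreal \<bar>step_integral A c x y v \<omega>\<bar> \<le> Q \<omega>"
    using step_maximal[OF xy zero.S_nonneg \<alpha> \<mu> bound] by blast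
  have "8 * \<mu>\<^sup>2 * S / \<delta> powr \<theta> = \<delta> powr \<theta> * (32 * K\<^sup>2 * S)"
    using \<alpha> unfolding \<mu>_def by (simp add: power2_eq_square)
  then have val: "(\<delta> powr \<theta> + 8 * \<mu>\<^sup>2 * S / \<delta> powr \<theta>) / 2 = \<delta> powr \<theta> * ((1 + 32 * K\<^sup>2 * S) / 2)"
    by (simp add: algebra_simps)
  have eq: "step_integral A c x y (e t) \<omega> = riemann_ito m t \<omega> - gint (e t) \<omega>" for t \<omega>
    unfolding step_integral_def A_def sum.Plus[OF finA] x_def y_def c_def riemann_ito_def gint_def e_min p_def
    by (simp add: sum_negf)
  have "AE \<omega> in M. \<forall>t\<in>{0..T}. ennreal \<bar>riemann_ito m t \<omega> - gint (e t) \<omega>\<bar> \<le> Q \<omega>"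
    using Q(3)
  proof eventually_elim
    case (elim \<omega>)
    show ?case
    proof
      fix t assume "t \<in> {0..T}"
      then have "e t \<in> {0..S}" using e_nonneg e_mono by auto
      then show "ennreal \<bar>riemann_ito m t \<omega> - gint (e t) \<omega>\<bar> \<le> Q \<omega>" using elim eq by metis
    qed
  qed
  then show ?thesis
    by (intro exI[of _ Q] conjI Q(1) Q(2)[unfolded val])
qed

text \<open>Once the mesh is fine, the bound for the Riemann sums does not depend on
  \<open>m\<close> and passes to the limit by Fatou's lemma. Uniform continuity of \<open>e\<close>
  provides the fineness from some index on, and the lower limit ignores the initial segment.\<close>

lemma ito_error:
  assumes \<phi>: "filterlim \<phi> at_top sequentially"
    and lim: "AE \<omega> in M. \<forall>t\<in>{0..T}. (\<lambda>l. riemann_ito (\<phi> l) t \<omega>) \<longlonglongrightarrow> I t \<omega>"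
  obtains Q where "Q \<in> borel_measurable M"
    "(\<integral>\<^sup>+\<omega>. Q \<omega> \<partial>M) \<le> ennreal (\<delta> powr \<theta> * ((1 + 32 * K\<^sup>2 * S) / 2))"
    "AE \<omega> in M. \<forall>t\<in>{0..T}. ennreal \<bar>I t \<omega> - gint (e t) \<omega>\<bar> \<le> Q \<omega>"
proof -
  have "uniformly_continuous_on {0..T + 1} e"
    by (intro compact_uniformly_continuous continuous_on_e) simp
  then obtain \<eta> where \<eta>: "0 < \<eta>" "\<And>s t. s \<in> {0..T + 1} \<Longrightarrow> t \<in> {0..T + 1} \<Longrightarrow> dist t s < \<eta> \<Longrightarrow> dist (e t) (e s) < \<delta>"
    unfolding uniformly_continuous_on_def using \<delta>(1) by metis
  obtain m0 where m0: "T \<le> real m0" "1 / \<eta> < real m0"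
    using reals_Archimedean2[of "max T (1 / \<eta>)"] by (auto intro: less_imp_le)
  obtain l0 where l0: "\<And>l. l0 \<le> l \<Longrightarrow> m0 \<le> \<phi> l"
    using \<phi> unfolding filterlim_at_top eventually_sequentially by metis
  let ?B = "\<delta> powr \<theta> * ((1 + 32 * K\<^sup>2 * S) / 2)"
  have "\<exists>Q. Q \<in> borel_measurable M \<and> (\<integral>\<^sup>+\<omega>. Q \<omega> \<partial>M) \<le> ennreal ?B \<and>
    (AE \<omega> in M. \<forall>t\<in>{0..T}. ennreal \<bar>riemann_ito (\<phi> (l + l0)) t \<omega> - gint (e t) \<omega>\<bar> \<le> Q \<omega>)" for l
  proof (rule ito_error_bound)
    have m: "m0 \<le> \<phi> (l + l0)" by (rule l0) simp
    then show "T \<le> real (Suc (\<phi> (l + l0)))" using m0 by linarith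
    fix s t assume st: "s \<in> {0..T + 1}" "t \<in> {0..T + 1}" "\<bar>s - t\<bar> \<le> 1 / real (Suc (\<phi> (l + l0)))"
    have "1 / \<eta> < real (Suc (\<phi> (l + l0)))" using m m0 by linarith
    then have "1 / real (Suc (\<phi> (l + l0))) < \<eta>" using \<eta>(1) by (simp add: field_simps)
    then have "dist s t < \<eta>" using st(3) by (simp add: dist_real_def)
    from \<eta>(2)[OF st(2,1) this] show "\<bar>e s - e t\<bar> \<le> \<delta>" by (simp add: dist_real_def)
  qed
  then have "\<forall>l. \<exists>Q. Q \<in> borel_measurable M \<and> (\<integral>\<^sup>+\<omega>. Q \<omega> \<partial>M) \<le> ennreal ?B \<and>
    (AE \<omega> in M. \<forall>t\<in>{0..T}. ennreal \<bar>riemann_ito (\<phi> (l + l0)) t \<omega> - gint (e t) \<omega>\<bar> \<le> Q \<omega>)" ..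
  from choice[OF this] obtain Q where "\<forall>l. Q l \<in> borel_measurable M \<and> (\<integral>\<^sup>+\<omega>. Q l \<omega> \<partial>M) \<le> ennreal ?B \<and>
    (AE \<omega> in M. \<forall>t\<in>{0..T}. ennreal \<bar>riemann_ito (\<phi> (l + l0)) t \<omega> - gint (e t) \<omega>\<bar> \<le> Q l \<omega>)" ..
  then have Q: "\<And>l. Q l \<in> borel_measurable M" "\<And>l. (\<integral>\<^sup>+\<omega>. Q l \<omega> \<partial>M) \<le> ennreal ?B"
    "\<And>l. AE \<omega> in M. \<forall>t\<in>{0..T}. ennreal \<bar>riemann_ito (\<phi> (l + l0)) t \<omega> - gint (e t) \<omega>\<bar> \<le> Q l \<omega>"
    by simp_all
  note Q(1)[measurable]
  show ?thesis
  proof (rule that[of "\<lambda>\<omega>. liminf (\<lambda>l. Q l \<omega>)"])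
    show "(\<lambda>\<omega>. liminf (\<lambda>l. Q l \<omega>)) \<in> borel_measurable M" by measurable
    have "(\<integral>\<^sup>+\<omega>. liminf (\<lambda>l. Q l \<omega>) \<partial>M) \<le> liminf (\<lambda>l. \<integral>\<^sup>+\<omega>. Q l \<omega> \<partial>M)"
      by (rule nn_integral_liminf) (rule Q(1))
    also have "\<dots> \<le> liminf (\<lambda>l. ennreal ?B)"
      by (intro Liminf_mono always_eventually allI Q(2))
    also have "\<dots> = ennreal ?B" by (simp add: Liminf_const)
    finally show "(\<integral>\<^sup>+\<omega>. liminf (\<lambda>l. Q l \<omega>) \<partial>M) \<le> ennreal ?B" .
    have "AE \<omega> in M. \<forall>l. \<forall>t\<in>{0..T}. ennreal \<bar>riemann_ito (\<phi> (l + l0)) t \<omega> - gint (e t) \<omega>\<bar> \<le> Q l \<omega>"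
      unfolding AE_all_countable by (intro allI Q(3))
    then show "AE \<omega> in M. \<forall>t\<in>{0..T}. ennreal \<bar>I t \<omega> - gint (e t) \<omega>\<bar> \<le> liminf (\<lambda>l. Q l \<omega>)"
      using lim
    proof eventually_elim
      case (elim \<omega>)
      show ?case
      proof
        fix t assume t: "t \<in> {0..T}"
        have "(\<lambda>l. riemann_ito (\<phi> l) t \<omega>) \<longlonglongrightarrow> I t \<omega>" using elim t by blast
        from LIMSEQ_ignore_initial_segment[OF this, of l0]
        have "(\<lambda>l. ennreal \<bar>riemann_ito (\<phi> (l + l0)) t \<omega> - gint (e t) \<omega>\<bar>) \<longlonglongrightarrow> ennreal \<bar>I t \<omega> - gint (e t) \<omega>\<bar>"
          by (intro tendsto_ennrealI tendsto_rabs tendsto_diff tendsto_const)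
        then have "ennreal \<bar>I t \<omega> - gint (e t) \<omega>\<bar> = liminf (\<lambda>l. ennreal \<bar>riemann_ito (\<phi> (l + l0)) t \<omega> - gint (e t) \<omega>\<bar>)"
          by (intro lim_imp_Liminf[symmetric]) auto
        also have "\<dots> \<le> liminf (\<lambda>l. Q l \<omega>)"
          by (intro Liminf_mono always_eventually allI) (use elim t in blast)
        finally show "ennreal \<bar>I t \<omega> - gint (e t) \<omega>\<bar> \<le> liminf (\<lambda>l. Q l \<omega>)" .
      qed
    qed
  qed
qed

section \<open>Combination of the error bounds\<close>

definition total_bound :: real where
  "total_bound = (1 + 2 * h S * S * exp ((2 * h S + 1) * S)) *
     (T * K + (1 + 32 * K\<^sup>2 * S) / 2 + ((1 + 8 * (h S * h S)\<^sup>2 * L) / 2 + h S * h S * (1 + L) / 2) + (P * S + (h S)\<^sup>2 * T))"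

text \<open>The summands in the second factor of \<open>total_bound\<close> stem, in this order,
  from \<open>H\<close>, from \<open>G\<close>, from the linear part of \<open>F\<close> and from
  its remainder; the first factor is that of Gronwall's inequality. \<open>W\<close> is a measurable
  majorant and not the supremum itself.\<close>

lemma mean_error:
  assumes \<phi>: "filterlim \<phi> at_top sequentially"
    and lim: "AE \<omega> in M. \<forall>t\<in>{0..T}. (\<lambda>l. riemann_ito (\<phi> l) t \<omega>) \<longlonglongrightarrow> I t \<omega>"
    and X_cont: "AE \<omega> in M. continuous_on {0..T} (\<lambda>t. X t \<omega>)"
    and X_eq: "AE \<omega> in M. \<forall>t\<in>{0..T}. X t \<omega> = x0 + (LINT r:{0..t}|lborel. H (e r))
       + (LINT r:{0..t}|interval_measure e. F (e r) (X r \<omega>)) + I t \<omega>"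
  obtains W where "W \<in> borel_measurable M" "(\<integral>\<^sup>+\<omega>. W \<omega> \<partial>M) \<le> ennreal (\<delta> powr \<theta> * total_bound)"
    "AE \<omega> in M. \<forall>t\<in>{0..T}. ennreal \<bar>X t \<omega> - em_process b (\<lambda>t _. d t) H F G x0 \<delta> t \<omega>\<bar> \<le> W \<omega>"
proof -
  obtain Q where Q[measurable]: "Q \<in> borel_measurable M"
    and EQ: "(\<integral>\<^sup>+\<omega>. Q \<omega> \<partial>M) \<le> ennreal (\<delta> powr \<theta> * ((1 + 32 * K\<^sup>2 * S) / 2))"
    and AQ: "AE \<omega> in M. \<forall>t\<in>{0..T}. ennreal \<bar>I t \<omega> - gint (e t) \<omega>\<bar> \<le> Q \<omega>"
    using ito_error[OF \<phi> lim] by blast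
  \<comment> \<open>Cutting off at \<open>N\<close> makes the coefficients bounded for every index,
    as \<open>averaged_martingale\<close> demands.\<close>
  define \<xi> where "\<xi> i \<omega> = (if i \<le> N then Fx (real i * \<delta>) (g i \<omega>) * G (real i * \<delta>) else 0)" for i \<omega>
  have \<xi>ad: "\<xi> i \<in> borel_measurable (Fb (real i * \<delta>))" for i
    unfolding \<xi>_def[abs_def] using Fx_measurable[OF zero.grid_nonneg g_adapted] by simp
  note hS = zero.hS
  have \<xi>bd: "\<bar>\<xi> i \<omega>\<bar> \<le> h S * h S" for i \<omega>
    using Fx_bound[OF zero.grid_nonneg zero.grid_le_S, of i "g i \<omega>"] HG_bound(2)[OF zero.grid_nonneg zero.grid_le_S, of i] hS
    by (auto simp: \<xi>_def abs_mult intro!: mult_mono)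
  obtain U where U[measurable]: "U \<in> borel_measurable M"
    and EU: "(\<integral>\<^sup>+\<omega>. U \<omega> \<partial>M) \<le> ennreal (\<delta> * ((1 + 8 * (h S * h S)\<^sup>2 * L) / 2 + h S * h S * (1 + L) / 2))"
    and AU: "AE \<omega> in M. \<forall>n\<le>N. \<forall>s\<in>{real n * \<delta>..real (Suc n) * \<delta>}.
       ennreal \<bar>(\<Sum>i<n. \<xi> i \<omega> * (LINT v:{real i * \<delta>..real (Suc i) * \<delta>}|lborel. b v \<omega> - b (real i * \<delta>) \<omega>))
         + \<xi> n \<omega> * (LINT v:{real n * \<delta>..s}|lborel. b v \<omega> - b (real n * \<delta>) \<omega>)\<bar> \<le> U \<omega>"
    using averaged_martingale[OF \<delta>(1) mult_nonneg_nonneg[OF hS hS] L_bound \<xi>ad \<xi>bd] by blast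
  obtain V where V[measurable]: "V \<in> borel_measurable M"
    and EV: "(\<integral>\<^sup>+\<omega>. V \<omega> \<partial>M) \<le> ennreal (\<delta> * (P * S + (h S)\<^sup>2 * T))"
    and AV: "AE \<omega> in M. ennreal (LINT v:{0..S}|lborel. r (zero.idx v) (zero.gap v) \<omega> (b v \<omega> - b (real (zero.idx v) * \<delta>) \<omega>)) \<le> V \<omega>"
    using local_errors by blast
  define f where "f = 1 + 2 * h S * S * exp ((2 * h S + 1) * S)"
  have f1: "1 \<le> f" using hS zero.S_nonneg by (simp add: f_def)
  define W where "W \<omega> = ennreal f * (ennreal (T * (K * \<delta> powr \<theta>)) + Q \<omega> + U \<omega> + V \<omega>)" for \<omega>
  \<comment> \<open>The errors of \<open>F\<close> have order \<delta>; they fit into the rate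
    because \<delta> is below 1 and \<theta> is at most 1.\<close>
  have \<delta>\<theta>: "\<delta> \<le> \<delta> powr \<theta>" using powr_mono'[of \<theta> 1 \<delta>] \<delta> \<theta> by simp
  show ?thesis
  proof (rule that[of W])
    show "W \<in> borel_measurable M" unfolding W_def by measurable
    have L0: "0 \<le> L" using zero.S_nonneg by simp
    define u where "u = (1 + 8 * (h S * h S)\<^sup>2 * L) / 2 + h S * h S * (1 + L) / 2"
    define w where "w = P * S + (h S)\<^sup>2 * T"
    define q where "q = (1 + 32 * K\<^sup>2 * S) / 2"
    have n: "0 \<le> u" "0 \<le> w" "0 \<le> q" "0 \<le> T * (K * \<delta> powr \<theta>)" "0 \<le> \<delta> powr \<theta>"
      using hS L0 P_nonneg zero.S_nonneg T K by (auto simp: u_def w_def q_def intro!: add_nonneg_nonneg mult_nonneg_nonneg divide_nonneg_nonneg)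
    have "(\<integral>\<^sup>+\<omega>. W \<omega> \<partial>M) = ennreal f * (ennreal (T * (K * \<delta> powr \<theta>)) + (\<integral>\<^sup>+\<omega>. Q \<omega> \<partial>M) + (\<integral>\<^sup>+\<omega>. U \<omega> \<partial>M) + (\<integral>\<^sup>+\<omega>. V \<omega> \<partial>M))"
      unfolding W_def by (simp add: nn_integral_cmult nn_integral_add emeasure_space_1)
    also have "\<dots> \<le> ennreal f * (ennreal (T * (K * \<delta> powr \<theta>)) + ennreal (\<delta> powr \<theta> * q) + ennreal (\<delta> powr \<theta> * u) + ennreal (\<delta> powr \<theta> * w))"
    proof (intro mult_left_mono add_mono order_refl)
      show "(\<integral>\<^sup>+\<omega>. Q \<omega> \<partial>M) \<le> ennreal (\<delta> powr \<theta> * q)" using EQ by (simp add: q_def)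
      have "ennreal (\<delta> * u) \<le> ennreal (\<delta> powr \<theta> * u)" "ennreal (\<delta> * w) \<le> ennreal (\<delta> powr \<theta> * w)"
        using n \<delta>\<theta> by (auto intro!: ennreal_leI mult_right_mono)
      then show "(\<integral>\<^sup>+\<omega>. U \<omega> \<partial>M) \<le> ennreal (\<delta> powr \<theta> * u)" "(\<integral>\<^sup>+\<omega>. V \<omega> \<partial>M) \<le> ennreal (\<delta> powr \<theta> * w)"
        using EU EV unfolding u_def w_def by (meson order_trans)+
    qed simp
    also have "\<dots> = ennreal (f * (T * (K * \<delta> powr \<theta>) + \<delta> powr \<theta> * q + \<delta> powr \<theta> * u + \<delta> powr \<theta> * w))"
    proof -
      have m: "0 \<le> \<delta> powr \<theta> * q" "0 \<le> \<delta> powr \<theta> * u" "0 \<le> \<delta> powr \<theta> * w" using n by auto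
      show ?thesis
        using f1 n(4) m by (simp only: ennreal_plus[symmetric] ennreal_mult[symmetric] add_nonneg_nonneg order_trans[OF zero_le_one])
    qed
    also have "f * (T * (K * \<delta> powr \<theta>) + \<delta> powr \<theta> * q + \<delta> powr \<theta> * u + \<delta> powr \<theta> * w) = \<delta> powr \<theta> * total_bound"
      unfolding total_bound_def f_def[symmetric] u_def[symmetric] w_def[symmetric] q_def[symmetric]
      by (simp add: algebra_simps)
    finally show "(\<integral>\<^sup>+\<omega>. W \<omega> \<partial>M) \<le> ennreal (\<delta> powr \<theta> * total_bound)" .
    show "AE \<omega> in M. \<forall>t\<in>{0..T}. ennreal \<bar>X t \<omega> - em_process b (\<lambda>t _. d t) H F G x0 \<delta> t \<omega>\<bar> \<le> W \<omega>"
      using AQ AU AV X_cont X_eq b_paths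
    proof eventually_elim
      case (elim \<omega>)
      interpret Q: em_path d H G h k F Fu Fx Fxx K \<theta> T x0 \<delta> "\<lambda>t. b t \<omega>"
        by (rule em_path_instance) (use elim in auto)
      have grid: "Q.grid n = g n \<omega>" for n
        unfolding Q.grid_def g_def by (rule em_grid_cong) (use \<delta> in auto)
      have rho: "Q.rho v = r (zero.idx v) (zero.gap v) \<omega> (b v \<omega> - b (real (zero.idx v) * \<delta>) \<omega>)" for v
        by (simp add: Q.rho_def Let_def r_def grid zero.gap_def Q.incr_def)
      have proc: "Q.proc t = em_process b (\<lambda>t _. d t) H F G x0 \<delta> t \<omega>" for t
        unfolding Q.proc_def by (rule em_process_cong) (use \<delta> e_nonneg in \<open>auto simp: zero.inverse_eq\<close>)
      have gi: "Q.gint v = gint v \<omega>" for v by (simp add: Q.gint_def gint_def)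
      have \<xi>: "Q.\<xi> i = \<xi> i \<omega>" if "i \<le> N" for i using that by (simp add: Q.\<xi>_def \<xi>_def grid)
      show ?case
      proof
        fix t assume t: "t \<in> {0..T}"
        show "ennreal \<bar>X t \<omega> - em_process b (\<lambda>t _. d t) H F G x0 \<delta> t \<omega>\<bar> \<le> W \<omega>"
        proof (cases "Q \<omega> = \<infinity> \<or> U \<omega> = \<infinity> \<or> V \<omega> = \<infinity>")
          \<comment> \<open>Where a majorant is infinite there is nothing to show; elsewhere all
            three are real numbers and the pathwise bound applies.\<close>
          case True
          then have "W \<omega> = \<infinity>" using f1 by (auto simp: W_def ennreal_mult_eq_top_iff)
          then show ?thesis by simp
        next
          case False
          then obtain q u v where quv: "0 \<le> q" "Q \<omega> = ennreal q" "0 \<le> u" "U \<omega> = ennreal u" "0 \<le> v" "V \<omega> = ennreal v"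
            by (cases "Q \<omega>"; cases "U \<omega>"; cases "V \<omega>") auto
          have "\<bar>X t \<omega> - Q.proc t\<bar> \<le> (T * (K * \<delta> powr \<theta>) + q + u + v) * (1 + 2 * h S * S * exp ((2 * h S + 1) * S))"
          proof (rule Q.pathwise_error[where x = "\<lambda>t. X t \<omega>" and i = "\<lambda>t. I t \<omega>"])
            show "continuous_on {0..T} (\<lambda>t. X t \<omega>)" using elim by blast
            show "X t \<omega> = x0 + (LINT r:{0..t}|lborel. H (e r)) + (LINT r:{0..t}|interval_measure e. F (e r) (X r \<omega>)) + I t \<omega>"
              if "t \<in> {0..T}" for t using elim that by blast
            show "\<bar>I t \<omega> - Q.gint (e t)\<bar> \<le> q" if "t \<in> {0..T}" for t
            proof -
              have "ennreal \<bar>I t \<omega> - gint (e t) \<omega>\<bar> \<le> ennreal q" using elim(1) that quv(2) by auto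
              then show ?thesis using quv(1) by (simp add: gi)
            qed
            show "\<bar>(\<Sum>j<n. Q.\<xi> j * (LINT v:{real j * \<delta>..real (Suc j) * \<delta>}|lborel. Q.incr j v)) + Q.\<xi> n * (LINT v:{real n * \<delta>..s}|lborel. Q.incr n v)\<bar> \<le> u"
              if n: "n \<le> N" and s: "s \<in> {real n * \<delta>..real (Suc n) * \<delta>}" for n s
            proof -
              have "ennreal \<bar>(\<Sum>i<n. \<xi> i \<omega> * (LINT v:{real i * \<delta>..real (Suc i) * \<delta>}|lborel. b v \<omega> - b (real i * \<delta>) \<omega>))
                + \<xi> n \<omega> * (LINT v:{real n * \<delta>..s}|lborel. b v \<omega> - b (real n * \<delta>) \<omega>)\<bar> \<le> ennreal u"
                using elim(2) n s unfolding quv(4)[symmetric] by blast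
              then have "\<bar>(\<Sum>i<n. \<xi> i \<omega> * (LINT v:{real i * \<delta>..real (Suc i) * \<delta>}|lborel. b v \<omega> - b (real i * \<delta>) \<omega>))
                + \<xi> n \<omega> * (LINT v:{real n * \<delta>..s}|lborel. b v \<omega> - b (real n * \<delta>) \<omega>)\<bar> \<le> u"
                using quv(3) by (simp only: ennreal_le_iff)
              moreover have "(\<Sum>j<n. Q.\<xi> j * (LINT v:{real j * \<delta>..real (Suc j) * \<delta>}|lborel. Q.incr j v)) =
                  (\<Sum>i<n. \<xi> i \<omega> * (LINT v:{real i * \<delta>..real (Suc i) * \<delta>}|lborel. b v \<omega> - b (real i * \<delta>) \<omega>))"
                by (rule sum.cong) (use n in \<open>auto simp: \<xi> Q.incr_def\<close>)
              ultimately show ?thesis by (simp only: \<xi>[OF n] Q.incr_def)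
            qed
            show "(LINT v:{0..S}|lborel. Q.rho v) \<le> v"
              using elim(3) quv(5,6) unfolding rho by (simp only: ennreal_le_iff)
          qed (rule t)
          then have "\<bar>X t \<omega> - Q.proc t\<bar> \<le> f * (T * (K * \<delta> powr \<theta>) + q + u + v)" by (simp add: f_def mult.commute)
          then have "ennreal \<bar>X t \<omega> - Q.proc t\<bar> \<le> ennreal (f * (T * (K * \<delta> powr \<theta>) + q + u + v))" by (rule ennreal_leI)
          also have "\<dots> = W \<omega>"
          proof -
            have "0 \<le> T * (K * \<delta> powr \<theta>)" using T K by simp
            then show ?thesis
              unfolding W_def quv using quv(1,3,5) f1
              by (simp only: ennreal_plus[symmetric] ennreal_mult[symmetric] add_nonneg_nonneg order_trans[OF zero_le_one])
          qed
          finally show ?thesis by (simp add: proc)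
        qed
      qed
    qed
  qed
qed

end

text \<open>\<open>Z = exp ((1 + a) * (1 + s))\<close> dominates 1, \<open>a\<close>,
  \<open>s\<close>, \<open>1 + s\<close>, \<open>a * s\<close> and \<open>exp (a * s)\<close>, so
  that all expressions in \<open>h S\<close> and \<open>S\<close> become powers of \<open>Z\<close>.
  The Gronwall factor costs three powers and the rest seven, whence the exponent 10.
  \<open>k S\<close> occurs linearly and keeps its own factor \<open>1 + k S\<close>.\<close>

lemma (in em_brownian) total_bound_le:
  "total_bound \<le> 3 * (T * K + 16 * K\<^sup>2 + 4 * (\<bar>x0\<bar> + T + 7) + 2 * T + 10) * ((1 + k S) * exp (10 * (1 + h S) * (1 + S)))"
proof -
  define s a \<kappa> where "s = S" and "a = h s" and "\<kappa> = k s"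
  have n: "0 \<le> a" "0 \<le> \<kappa>" "0 \<le> s" using zero.hS zero.kS zero.S_nonneg by (simp_all add: a_def \<kappa>_def s_def)
  define Z where "Z = exp ((1 + a) * (1 + s))"
  have "(1 + a) * (1 + s) \<le> Z" unfolding Z_def using exp_ge_add_one_self[of "(1 + a) * (1 + s)"] by linarith
  moreover have "(1 + a) * (1 + s) = 1 + a + s + a * s" by (simp add: algebra_simps)
  moreover have as: "0 \<le> a * s" using n by simp
  ultimately have Z: "1 \<le> Z" "a \<le> Z" "s \<le> Z" "1 + s \<le> Z" "a * s \<le> Z" using n by linarith+
  have Zp: "Z ^ i \<le> Z ^ j" if "i \<le> j" for i j using Z(1) that by (rule power_increasing[rotated])
  have Zn: "0 \<le> Z ^ i" for i using Z(1) by simp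
  have prod: "x * y \<le> Z ^ m" if "0 \<le> x" "0 \<le> y" "x \<le> Z ^ i" "y \<le> Z ^ j" "m = i + j" for x y i j m
    unfolding that(5) power_add using that Zn by (intro mult_mono) auto
  have Z1: "a \<le> Z ^ 1" "s \<le> Z ^ 1" "1 + s \<le> Z ^ 1" "a * s \<le> Z ^ 1" using Z by auto
  have a2: "a\<^sup>2 \<le> Z ^ 2" using n Z by (intro power_mono) auto
  have a4: "a ^ 4 \<le> Z ^ 4" using n Z by (intro power_mono) auto
  have eas: "exp (a * s) \<le> Z" unfolding Z_def using n by (simp add: algebra_simps)
  have e2: "exp ((2 * a + 1) * s) \<le> Z ^ 2"
    unfolding Z_def exp_of_nat_mult[symmetric] using n as by (simp add: algebra_simps)
  define f where "f = 1 + 2 * a * s * exp ((2 * a + 1) * s)"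
  have f: "f \<le> 3 * Z ^ 3"
  proof -
    have "(a * s) * exp ((2 * a + 1) * s) \<le> Z ^ 3" by (rule prod[OF as _ Z1(4) e2]) auto
    then show ?thesis using Zp[of 0 3] by (simp add: f_def)
  qed
  have f0: "0 \<le> f" using n by (simp add: f_def)
  \<comment> \<open>The constant 7 is 6 for the numerical terms in the bound of \<open>Gm\<close>
    plus 1 for the summand in \<open>1 + Gm\<close>.\<close>
  define \<gamma> where "\<gamma> = \<bar>x0\<bar> + T + 7"
  have \<gamma>: "7 \<le> \<gamma>" using T by (simp add: \<gamma>_def)
  have Gm0: "0 \<le> Gm" using g_mean(2)[of 0] by (rule order_trans[rotated]) (auto intro: integral_nonneg_AE)
  have Gm: "1 + Gm \<le> \<gamma> * Z ^ 4"
  proof -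
    have b: "a\<^sup>2 * (1 + s) \<le> Z ^ 3" by (rule prod[OF _ _ a2 Z1(3)]) (use n in auto)
    have "\<bar>x0\<bar> * 1 \<le> \<bar>x0\<bar> * Z ^ 3" using Zp[of 0 3] by (intro mult_left_mono) auto
    moreover have "a * T \<le> Z ^ 3 * T" using Z1(1) Zp[of 1 3] T by (intro mult_right_mono) auto
    moreover have "(1 + 8 * a\<^sup>2 * (s + 1)) / 2 = 1 / 2 + 4 * (a\<^sup>2 * (1 + s))" by (simp add: algebra_simps)
    moreover have "Z \<le> Z ^ 3" "1 \<le> Z ^ 3" using Zp[of 1 3] Zp[of 0 3] by auto
    ultimately have "\<bar>x0\<bar> + a * T + a * s + (1 + 8 * a\<^sup>2 * (s + 1)) / 2 \<le> \<bar>x0\<bar> * Z ^ 3 + Z ^ 3 * T + 6 * Z ^ 3"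
      using b Z(5) by linarith
    also have "\<dots> = (\<gamma> - 1) * Z ^ 3" by (simp add: \<gamma>_def algebra_simps)
    finally have "Gm \<le> (\<gamma> - 1) * Z ^ 3 * exp (a * s)"
      unfolding Gm_def a_def[symmetric] s_def[symmetric] by (rule mult_right_mono) simp
    also have "\<dots> \<le> (\<gamma> - 1) * Z ^ 3 * Z" using eas \<gamma> by (intro mult_left_mono mult_nonneg_nonneg Zn) auto
    also have "\<dots> = (\<gamma> - 1) * Z ^ 4" by (simp add: power4_eq_xxxx power3_eq_cube)
    finally show ?thesis using Zp[of 0 4] by (simp add: algebra_simps)
  qed
  define u where "u = 1 + Gm"
  have u: "1 \<le> u" "u \<le> \<gamma> * Z ^ 4" using Gm0 Gm by (auto simp: u_def)
  have P: "P \<le> (1 + \<kappa>) * ((4 * \<gamma> + T + 3) * Z ^ 6)"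
  proof -
    have au: "a * u \<le> \<gamma> * Z ^ 5" "a\<^sup>2 * u \<le> \<gamma> * Z ^ 6"
    proof -
      have "a * u \<le> Z * (\<gamma> * Z ^ 4)" using n u Z by (intro mult_mono) auto
      also have "\<dots> = \<gamma> * Z ^ 5" by (simp add: eval_nat_numeral)
      finally show "a * u \<le> \<gamma> * Z ^ 5" .
      have "a\<^sup>2 * u \<le> Z ^ 2 * (\<gamma> * Z ^ 4)" using n u a2 Zn by (intro mult_mono) auto
      also have "\<dots> = \<gamma> * Z ^ 6" by (simp add: power_add[symmetric])
      finally show "a\<^sup>2 * u \<le> \<gamma> * Z ^ 6" .
    qed
    have up: "\<gamma> * Z ^ 4 \<le> \<gamma> * Z ^ 6" "\<gamma> * Z ^ 5 \<le> \<gamma> * Z ^ 6" using \<gamma> Zp by (auto intro!: mult_left_mono)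
    have aT: "a * T \<le> Z ^ 6 * T" using Z1(1) Zp[of 1 6] T by (intro mult_right_mono) auto
    have aZ: "a \<le> Z ^ 6" using Z1(1) Zp[of 1 6] by simp
    have "P = \<kappa> * (2 * u + a * T + a * u + 3 * a) + a\<^sup>2 * u"
      unfolding P_def s_def[symmetric] a_def[symmetric] \<kappa>_def[symmetric] u_def by (simp add: algebra_simps)
    also have "\<dots> \<le> \<kappa> * (2 * u + a * T + a * u + 3 * a + a\<^sup>2 * u) + 1 * (2 * u + a * T + a * u + 3 * a + a\<^sup>2 * u)"
      using n u T by (auto simp: algebra_simps intro!: add_nonneg_nonneg)
    also have "\<dots> = (1 + \<kappa>) * (2 * u + a * T + a * u + 3 * a + a\<^sup>2 * u)" by (simp add: algebra_simps)
    also have "\<dots> \<le> (1 + \<kappa>) * ((4 * \<gamma> + T + 3) * Z ^ 6)"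
      using n u au up aT aZ by (intro mult_left_mono) (auto simp: algebra_simps)
    finally show ?thesis .
  qed
  have P0: "0 \<le> P" by (rule P_nonneg)
  have Ps: "P * s \<le> (1 + \<kappa>) * ((4 * \<gamma> + T + 3) * Z ^ 7)"
  proof -
    have "P * s \<le> (1 + \<kappa>) * ((4 * \<gamma> + T + 3) * Z ^ 6) * Z" using n Z \<gamma> T by (intro mult_mono P mult_nonneg_nonneg Zn) auto
    also have "\<dots> = (1 + \<kappa>) * ((4 * \<gamma> + T + 3) * Z ^ 7)" by (simp add: eval_nat_numeral algebra_simps)
    finally show ?thesis .
  qed
  define R where "R = T * K + (1 + 32 * K\<^sup>2 * s) / 2 + ((1 + 8 * (a * a)\<^sup>2 * (s + 1)) / 2 + a * a * (1 + (s + 1)) / 2) + a\<^sup>2 * T"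
  have R: "R \<le> (T * K + 16 * K\<^sup>2 + T + 7) * Z ^ 7"
  proof -
    have 1: "T * K \<le> T * K * Z ^ 7" using T K Zp[of 0 7] by simp
    have 2: "K\<^sup>2 * s \<le> K\<^sup>2 * Z ^ 7" using Z1(2) Zp[of 1 7] by (intro mult_left_mono) auto
    have 3: "(a * a)\<^sup>2 * (s + 1) \<le> Z ^ 7"
    proof -
      have "(a ^ 4) * (1 + s) \<le> Z ^ 5" by (rule prod[OF _ _ a4 Z1(3)]) (use n in auto)
      also have "\<dots> \<le> Z ^ 7" by (rule Zp) simp
      finally show ?thesis by (simp add: power4_eq_xxxx power2_eq_square algebra_simps)
    qed
    have 4: "a * a * (1 + (s + 1)) \<le> 2 * Z ^ 7"
    proof -
      have "a\<^sup>2 * (1 + s) \<le> Z ^ 3" by (rule prod[OF _ _ a2 Z1(3)]) (use n in auto)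
      also have "\<dots> \<le> Z ^ 7" by (rule Zp) simp
      finally have "a\<^sup>2 * (1 + s) \<le> Z ^ 7" .
      moreover have "a\<^sup>2 \<le> Z ^ 7" using a2 Zp[of 2 7] by simp
      ultimately show ?thesis by (simp add: power2_eq_square algebra_simps)
    qed
    have 5: "a\<^sup>2 * T \<le> Z ^ 7 * T" using a2 Zp[of 2 7] T by (intro mult_right_mono) auto
    have "1 \<le> Z ^ 7" using Zp[of 0 7] by simp
    moreover have "R = T * K + 1 + 16 * (K\<^sup>2 * s) + 4 * ((a * a)\<^sup>2 * (s + 1)) + a * a * (1 + (s + 1)) / 2 + a\<^sup>2 * T"
      unfolding R_def by (simp add: algebra_simps add_divide_distrib)
    moreover have "(T * K + 16 * K\<^sup>2 + T + 7) * Z ^ 7 = T * K * Z ^ 7 + 16 * (K\<^sup>2 * Z ^ 7) + Z ^ 7 * T + 7 * Z ^ 7"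
      by (simp add: algebra_simps)
    ultimately show ?thesis using 1 2 3 4 5 by linarith
  qed
  have R0: "0 \<le> R" unfolding R_def using n T K by (intro add_nonneg_nonneg mult_nonneg_nonneg divide_nonneg_nonneg) auto
  define c where "c = T * K + 16 * K\<^sup>2 + 4 * \<gamma> + 2 * T + 10"
  have "R + P * s \<le> (1 + \<kappa>) * (c * Z ^ 7)"
  proof -
    have "R \<le> 1 * ((T * K + 16 * K\<^sup>2 + T + 7) * Z ^ 7)" using R by simp
    also have "\<dots> \<le> (1 + \<kappa>) * ((T * K + 16 * K\<^sup>2 + T + 7) * Z ^ 7)"
      using n T K by (intro mult_right_mono mult_nonneg_nonneg Zn add_nonneg_nonneg) auto
    finally have "R + P * s \<le> (1 + \<kappa>) * ((T * K + 16 * K\<^sup>2 + T + 7) * Z ^ 7) + (1 + \<kappa>) * ((4 * \<gamma> + T + 3) * Z ^ 7)"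
      using Ps by linarith
    also have "\<dots> = (1 + \<kappa>) * (c * Z ^ 7)" by (simp add: c_def algebra_simps)
    finally show ?thesis .
  qed
  then have "f * (R + P * s) \<le> 3 * Z ^ 3 * ((1 + \<kappa>) * (c * Z ^ 7))"
    using P0 R0 n by (intro mult_mono f mult_nonneg_nonneg Zn add_nonneg_nonneg) auto
  also have "\<dots> = 3 * c * ((1 + \<kappa>) * Z ^ 10)" by (simp add: power_add[symmetric])
  also have "Z ^ 10 = exp (10 * (1 + a) * (1 + s))"
    unfolding Z_def exp_of_nat_mult[symmetric] by (simp add: algebra_simps)
  also have "f * (R + P * s) = total_bound"
    unfolding total_bound_def f_def R_def a_def s_def by (simp add: algebra_simps)
  finally show ?thesis by (simp add: c_def \<gamma>_def a_def \<kappa>_def s_def)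
qed

section \<open>Regular variation and exponential moments of the inverse subordinator\<close>

text \<open>Past \<open>s0\<close> each doubling of the argument multiplies \<open>f\<close> by less
  than \<open>2 powr r\<close>. Iteration controls \<open>f\<close> at the points
  \<open>2 ^ n * s0\<close>, and monotonicity fills the gaps between them.\<close>

lemma regularly_varying_upper:
  assumes rv: "regularly_varying f q" and mono: "mono_on {0..} f" and r: "q < r" "0 \<le> r"
  shows "\<exists>C>0. \<forall>u\<ge>0. f u \<le> C * (1 + u) powr r"
proof -
  have lim: "((\<lambda>s. f (2 * s) / f s) \<longlongrightarrow> 2 powr q) at_top" and pos: "\<And>s. 0 < s \<Longrightarrow> 0 < f s"
    using rv by (auto simp: regularly_varying_def)
  have "eventually (\<lambda>s. f (2 * s) / f s < 2 powr r) at_top"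
    by (rule order_tendstoD(2)[OF lim]) (use r in auto)
  then obtain s1 where s1: "\<And>s. s1 \<le> s \<Longrightarrow> f (2 * s) / f s < 2 powr r"
    unfolding eventually_at_top_linorder by blast
  define s0 where "s0 = max 1 s1"
  have s0: "1 \<le> s0" "s1 \<le> s0" by (auto simp: s0_def)
  have it: "f (2 ^ n * s0) \<le> (2 powr r) ^ n * f s0" for n
  proof (induction n)
    case (Suc n)
    have ge: "s0 \<le> 2 ^ n * s0" using s0 by simp
    have "f (2 * (2 ^ n * s0)) / f (2 ^ n * s0) < 2 powr r" using s1[of "2 ^ n * s0"] ge s0 by linarith
    moreover have p: "0 < f (2 ^ n * s0)" using pos ge s0 by (intro pos) linarith
    ultimately have "f (2 * (2 ^ n * s0)) \<le> 2 powr r * f (2 ^ n * s0)" by (simp add: pos_divide_less_eq)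
    also have "\<dots> \<le> 2 powr r * ((2 powr r) ^ n * f s0)" using Suc by (intro mult_left_mono) auto
    finally show ?case by (simp add: ac_simps)
  qed simp
  \<comment> \<open>The additional factor \<open>2 powr r\<close> pays for rounding \<open>u\<close>
    up to the next point \<open>2 ^ n * s0\<close>.\<close>
  define C where "C = 2 powr r * f s0"
  have C: "0 < C" using pos[of s0] s0 by (simp add: C_def)
  have p1: "1 \<le> (1 + u) powr r" if "0 \<le> u" for u :: real using that r by (intro ge_one_powr_ge_zero) auto
  have "f u \<le> C * (1 + u) powr r" if u: "0 \<le> u" for u
  proof (cases "u < s0")
    case True
    have "f u \<le> f s0" using mono u True s0 by (auto simp: mono_on_def)
    also have "\<dots> \<le> C" unfolding C_def using pos[of s0] s0 r ge_one_powr_ge_zero[of 2 r] by simp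
    also have "\<dots> \<le> C * (1 + u) powr r" using p1[OF u] C by simp
    finally show ?thesis .
  next
    case False
    have "\<exists>n. u < 2 ^ n * s0"
    proof -
      obtain n where "u < 2 ^ n" using real_arch_pow[of 2 u] by auto
      moreover have "(2::real) ^ n \<le> 2 ^ n * s0" using s0 by simp
      ultimately show ?thesis by (intro exI[of _ n]) linarith
    qed
    define n where "n = (LEAST n. u < 2 ^ n * s0)"
    have n1: "u < 2 ^ n * s0" unfolding n_def by (rule LeastI_ex) fact
    have "n \<noteq> 0" using n1 False by (intro notI) simp
    then obtain m where m: "n = Suc m" by (cases n) auto
    have n2: "2 ^ m * s0 \<le> u"
    proof -
      have "\<not> u < 2 ^ m * s0" using not_less_Least[of m "\<lambda>n. u < 2 ^ n * s0"] m by (simp add: n_def)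
      then show ?thesis by simp
    qed
    have "f u \<le> f (2 ^ n * s0)" using mono u n1 s0 by (auto simp: mono_on_def)
    also have "\<dots> \<le> (2 powr r) ^ n * f s0" by (rule it)
    also have "\<dots> = C * (2 powr r) ^ m" by (simp add: m C_def)
    also have "(2 powr r) ^ m = (2 ^ m) powr r" by (simp add: powr_powr powr_realpow[symmetric] mult.commute)
    also have "C * (2 ^ m) powr r \<le> C * (1 + u) powr r"
    proof -
      have "(2::real) ^ m \<le> 2 ^ m * s0" using s0 by simp
      then have "(2::real) ^ m \<le> 1 + u" using n2 by linarith
      then show ?thesis using C r by (intro mult_left_mono powr_mono2) auto
    qed
    finally show ?thesis .
  qed
  then show ?thesis using C by blast
qed

text \<open>The mirror image of the upper bound: \<open>u\<close> is rounded down to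
  \<open>2 ^ m * s0\<close>, and the quotient of \<open>u\<close> and \<open>2 ^ m\<close>, which is
  below \<open>2 * s0\<close>, is absorbed by the denominator of \<open>c\<close>.\<close>

lemma regularly_varying_lower:
  assumes rv: "regularly_varying f q" and mono: "mono_on {0..} f" and r: "r < q" "0 \<le> r"
  shows "\<exists>c>0. \<exists>s0\<ge>1. \<forall>s\<ge>s0. c * s powr r \<le> f s"
proof -
  have lim: "((\<lambda>s. f (2 * s) / f s) \<longlongrightarrow> 2 powr q) at_top" and pos: "\<And>s. 0 < s \<Longrightarrow> 0 < f s"
    using rv by (auto simp: regularly_varying_def)
  have "eventually (\<lambda>s. 2 powr r < f (2 * s) / f s) at_top"
    by (rule order_tendstoD(1)[OF lim]) (use r in auto)
  then obtain s1 where s1: "\<And>s. s1 \<le> s \<Longrightarrow> 2 powr r < f (2 * s) / f s"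
    unfolding eventually_at_top_linorder by blast
  define s0 where "s0 = max 1 s1"
  have s0: "1 \<le> s0" "s1 \<le> s0" by (auto simp: s0_def)
  have it: "(2 powr r) ^ n * f s0 \<le> f (2 ^ n * s0)" for n
  proof (induction n)
    case (Suc n)
    have ge: "s0 \<le> 2 ^ n * s0" using s0 by simp
    have "2 powr r < f (2 * (2 ^ n * s0)) / f (2 ^ n * s0)" using s1[of "2 ^ n * s0"] ge s0 by linarith
    moreover have p: "0 < f (2 ^ n * s0)" using pos ge s0 by (intro pos) linarith
    ultimately have *: "2 powr r * f (2 ^ n * s0) \<le> f (2 * (2 ^ n * s0))" by (simp add: pos_less_divide_eq)
    have "2 powr r * ((2 powr r) ^ n * f s0) \<le> 2 powr r * f (2 ^ n * s0)" using Suc by (intro mult_left_mono) auto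
    from order_trans[OF this *] show ?case by (simp add: ac_simps)
  qed simp
  define c where "c = f s0 / (2 * s0) powr r"
  have c: "0 < c" using pos[of s0] s0 by (simp add: c_def)
  have "c * u powr r \<le> f u" if u: "s0 \<le> u" for u
  proof -
    have "\<exists>n. u < 2 ^ n * s0"
    proof -
      obtain n where "u < 2 ^ n" using real_arch_pow[of 2 u] by auto
      moreover have "(2::real) ^ n \<le> 2 ^ n * s0" using s0 by simp
      ultimately show ?thesis by (intro exI[of _ n]) linarith
    qed
    define n where "n = (LEAST n. u < 2 ^ n * s0)"
    have n1: "u < 2 ^ n * s0" unfolding n_def by (rule LeastI_ex) fact
    have "n \<noteq> 0" using n1 u by (intro notI) simp
    then obtain m where m: "n = Suc m" by (cases n) auto
    have n2: "2 ^ m * s0 \<le> u"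
    proof -
      have "\<not> u < 2 ^ m * s0" using not_less_Least[of m "\<lambda>n. u < 2 ^ n * s0"] m by (simp add: n_def)
      then show ?thesis by simp
    qed
    have "u powr r \<le> (2 ^ m * (2 * s0)) powr r" using n1 u s0 r by (intro powr_mono2) (auto simp: m)
    also have "\<dots> = (2 ^ m) powr r * (2 * s0) powr r" by (rule powr_mult)
    also have "(2 ^ m) powr r = (2 powr r) ^ m" by (simp add: powr_powr powr_realpow[symmetric] mult.commute)
    finally have "c * u powr r \<le> c * ((2 powr r) ^ m * (2 * s0) powr r)" using c by (intro mult_left_mono) auto
    also have "\<dots> = (2 powr r) ^ m * f s0" using s0 by (simp add: c_def)
    also have "\<dots> \<le> f (2 ^ m * s0)" by (rule it)
    also have "\<dots> \<le> f u" using mono n2 s0 u by (auto simp: mono_on_def)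
    finally show ?thesis .
  qed
  then show ?thesis using c s0(1) by blast
qed

section \<open>The Laplace exponent of an infinite Levy measure\<close>

locale levy_infinite =
  fixes \<nu> :: "real measure"
  assumes levy: "levy_measure_infinite \<nu>"
begin

abbreviation \<psi> where "\<psi> \<equiv> laplace_exponent \<nu>"

lemma sets_\<nu> [measurable_cong]: "sets \<nu> = sets borel"
  using levy by (simp add: levy_measure_infinite_def)

lemma AE_pos: "AE y in \<nu>. 0 < y"
proof (rule AE_I')
  show "{..0} \<in> null_sets \<nu>" using levy sets_\<nu> by (auto simp: levy_measure_infinite_def null_sets_def)
qed auto

lemma laplace_integrable:
  assumes "0 \<le> s" shows "set_integrable \<nu> {0<..} (\<lambda>y. 1 - exp (- s * y))"
proof -
  have i: "integrable \<nu> (\<lambda>y. \<bar>min 1 y\<bar>)"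
  proof (rule integrableI_nonneg)
    have "(\<integral>\<^sup>+ y. ennreal \<bar>min 1 y\<bar> \<partial>\<nu>) = (\<integral>\<^sup>+ y. ennreal (min 1 y) \<partial>\<nu>)"
      by (rule nn_integral_cong_AE) (use AE_pos in \<open>eventually_elim, auto\<close>)
    then show "(\<integral>\<^sup>+ y. ennreal \<bar>min 1 y\<bar> \<partial>\<nu>) < \<infinity>"
      using levy by (simp add: levy_measure_infinite_def)
  qed auto
  show ?thesis
    unfolding set_integrable_def
  proof (rule Bochner_Integration.integrable_bound[OF integrable_mult_right[OF i, of "1 + s"]])
    show "(\<lambda>y. indicator {0<..} y *\<^sub>R (1 - exp (- s * y))) \<in> borel_measurable \<nu>" by measurable
    have "\<bar>1 - exp (- s * y)\<bar> \<le> (1 + s) * min 1 y" if y: "0 < y" for y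
    proof -
      have 0: "0 \<le> 1 - exp (- s * y)" using y assms by simp
      have 1: "1 - exp (- s * y) \<le> s * y" using exp_ge_add_one_self[of "- s * y"] by simp
      show ?thesis
      proof (cases "y \<le> 1")
        case True
        have "s * y \<le> (1 + s) * y" using y by simp
        then show ?thesis using 0 1 True by simp
      next
        case False
        have "1 - exp (- s * y) \<le> 1 + s" using assms exp_ge_zero[of "- s * y"] by linarith
        then show ?thesis using 0 False by simp
      qed
    qed
    then have "norm (indicator {0<..} y *\<^sub>R (1 - exp (- s * y))) \<le> norm ((1 + s) * \<bar>min 1 y\<bar>)" for y
      using assms by (cases "0 < y") simp_all
    then show "AE y in \<nu>. norm (indicator {0<..} y *\<^sub>R (1 - exp (- s * y))) \<le> norm ((1 + s) * \<bar>min 1 y\<bar>)"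
      by (intro AE_I2)
  qed
qed

lemma laplace_mono: "0 \<le> s \<Longrightarrow> s \<le> s' \<Longrightarrow> \<psi> s \<le> \<psi> s'"
  unfolding laplace_exponent_def
  by (rule set_integral_mono[OF laplace_integrable laplace_integrable]) (auto intro!: mult_right_mono)

text \<open>The mass of the half-line from \<open>1 / s\<close> on grows to infinity with
  \<open>s\<close>, and there the integrand is at least \<open>1 - exp (- 1)\<close>, hence at least
  one half. Unboundedness of \<open>\<psi>\<close> later yields strict growth and divergence of the
  paths and the decay in the case of constant \<open>h\<close> and \<open>k\<close>.\<close>

lemma laplace_ge:
  assumes M: "0 < M" shows "\<exists>s>0. M \<le> \<psi> s"
proof -
  let ?A = "\<lambda>n::nat. {1 / real (Suc n)..}"
  have "(\<lambda>n. emeasure \<nu> (?A n)) \<longlonglongrightarrow> emeasure \<nu> (\<Union>n. ?A n)"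
  proof (rule Lim_emeasure_incseq)
    show "incseq ?A"
    proof (rule monoI, rule subsetI)
      fix m n :: nat and x :: real assume "m \<le> n" "x \<in> ?A m"
      moreover have "1 / real (Suc n) \<le> 1 / real (Suc m)" using \<open>m \<le> n\<close> by (intro divide_left_mono) auto
      ultimately show "x \<in> ?A n" by auto
    qed
  qed (auto simp: sets_\<nu>)
  also have "(\<Union>n. ?A n) = {0<..}"
  proof safe
    fix x :: real and n :: nat assume "1 / real (Suc n) \<le> x"
    moreover have "0 < 1 / real (Suc n)" by simp
    ultimately show "0 < x" by linarith
  next
    fix x :: real assume "0 < x"
    then obtain n where "inverse (real (Suc n)) < x" using reals_Archimedean by blast
    then show "x \<in> (\<Union>n. ?A n)" by (intro UN_I[of n]) (auto simp: inverse_eq_divide)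
  qed
  also have "emeasure \<nu> {0<..} = \<infinity>" using levy by (simp add: levy_measure_infinite_def)
  finally have "eventually (\<lambda>n. ennreal (2 * M) < emeasure \<nu> (?A n)) sequentially"
    by (rule order_tendstoD) simp
  then obtain n where n: "ennreal (2 * M) < emeasure \<nu> (?A n)" by (auto simp: eventually_sequentially)
  define s where "s = real (Suc n)"
  have s: "0 < s" by (simp add: s_def)
  have e2: "exp (- 1 :: real) \<le> 1 / 2"
  proof -
    have "2 \<le> exp (1::real)" using exp_ge_add_one_self[of 1] by simp
    then have "inverse (exp 1) \<le> inverse (2::real)" by (intro le_imp_inverse_le) auto
    then show ?thesis by (simp add: exp_minus)
  qed
  have "ennreal (1 / 2) * ennreal (2 * M) \<le> ennreal (1 / 2) * emeasure \<nu> (?A n)"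
    using n by (intro mult_left_mono) auto
  also have "\<dots> = (\<integral>\<^sup>+ y. ennreal (1 / 2) * indicator (?A n) y \<partial>\<nu>)"
    by (rule nn_integral_cmult_indicator[symmetric]) (simp add: sets_\<nu>)
  also have "\<dots> \<le> (\<integral>\<^sup>+ y. ennreal (indicator {0<..} y *\<^sub>R (1 - exp (- s * y))) \<partial>\<nu>)"
  proof (rule nn_integral_mono)
    fix y :: real
    show "ennreal (1 / 2) * indicator (?A n) y \<le> ennreal (indicator {0<..} y *\<^sub>R (1 - exp (- s * y)))"
    proof (cases "y \<in> ?A n")
      case True
      then have "1 / s \<le> y" by (simp add: s_def)
      then have sy: "1 \<le> s * y" using s by (simp add: field_simps)
      have y: "0 < y" using \<open>1 / s \<le> y\<close> s by (meson less_le_trans zero_less_divide_1_iff)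
      have "exp (- s * y) \<le> exp (- 1)" using sy by simp
      then have "ennreal (1 / 2) \<le> ennreal (1 - exp (- s * y))"
        using e2 by (intro ennreal_leI) linarith
      moreover have "indicator (?A n) y = (1 :: ennreal)" "indicator {0<..} y = (1 :: real)" using True y by auto
      ultimately show ?thesis by (simp only: mult_1_right scaleR_one)
    qed simp
  qed
  also have "\<dots> = ennreal (\<psi> s)"
    unfolding laplace_exponent_def set_lebesgue_integral_def
    by (rule nn_integral_eq_integral[OF laplace_integrable[OF less_imp_le[OF s], unfolded set_integrable_def]], rule AE_I2)
       (use s in \<open>simp add: indicator_def\<close>)
  finally have "ennreal M \<le> ennreal (\<psi> s)"
    using M by (subst (asm) ennreal_mult[symmetric]) auto
  then have "M \<le> \<psi> s" using M by (simp add: ennreal_le_iff2)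
  then show ?thesis using s by blast
qed

end

section \<open>Summability of the weighted Chernoff bounds\<close>

lemma eventually_powr_dominates:
  fixes a c r :: real
  assumes "0 < c" "0 < r"
  shows "eventually (\<lambda>n. a - c * real n powr r \<le> - 1) sequentially"
proof -
  have "filterlim (\<lambda>n. real n powr r) at_top sequentially"
    by (rule filterlim_compose[OF real_powr_at_top[OF \<open>0 < r\<close>] filterlim_real_sequentially])
  then have "eventually (\<lambda>n. (a + 1) / c \<le> real n powr r) sequentially"
    by (simp add: filterlim_at_top)
  then show ?thesis
    by eventually_elim (use \<open>0 < c\<close> in \<open>simp add: field_simps\<close>)
qed

text \<open>The \<open>n\<close>-th term is the weight at \<open>real n + 2\<close> times a Chernoff
  bound for the event that the subordinator is at most \<open>T\<close> at time \<open>n\<close>.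
  The parameter may vary with \<open>n\<close>, since every term has its own Chernoff bound.\<close>

lemma (in levy_infinite) exponential_moment_summable:
  fixes h k :: "real \<Rightarrow> real"
  assumes h: "\<forall>u\<ge>0. 0 \<le> h u" "mono_on {0..} h"
    and k: "\<forall>u\<ge>0. 0 < k u" "mono_on {0..} k" and T: "0 < T"
    and a_or_b:
      "((\<exists>c. \<forall>u\<ge>0. h u = c) \<and> (\<exists>c. \<forall>u\<ge>0. k u = c)) \<or>
       (\<exists>q q' \<beta>. 0 \<le> q \<and> 0 \<le> q' \<and>
          regularly_varying h q \<and> regularly_varying (\<lambda>u. ln (k u)) q' \<and>
          regularly_varying \<psi> \<beta> \<and>
          (max (2 * q + 1) q' - 1) / max (2 * q + 1) q' < \<beta> \<and> \<beta> < 1)"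
  shows "\<exists>s. (\<forall>n. 0 \<le> s n) \<and>
    summable (\<lambda>n. (1 + k (real n + 2)) * exp (10 * (1 + h (real n + 2)) * (1 + (real n + 2))) * exp (s n * T - real n * \<psi> (s n)))"
  using a_or_b
proof (elim disjE conjE exE)
  fix c1 c2 assume c: "\<forall>u\<ge>0. h u = c1" "\<forall>u\<ge>0. k u = c2"
  have c0: "0 \<le> c1" "0 < c2" using c h(1) k(1) by (metis order_refl)+
  \<comment> \<open>The weight grows exponentially at rate \<open>10 * (1 + c1)\<close>. One fixed
    \<open>s\<close> for which \<open>\<psi> s\<close> exceeds this rate by 1 leaves the geometric
    factor \<open>exp (- real n)\<close>.\<close>
  obtain s where s: "0 < s" "10 * (1 + c1) + 1 \<le> \<psi> s"
    using laplace_ge[of "10 * (1 + c1) + 1"] c0 by auto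
  define A where "A = (1 + c2) * exp (30 * (1 + c1) + s * T)"
  have "summable (\<lambda>n. A * exp (- real n))"
  proof (rule summable_mult)
    have "summable (\<lambda>n. exp (- 1 :: real) ^ n)" by (rule summable_geometric) simp
    then show "summable (\<lambda>n. exp (- real n))" by (simp add: exp_of_nat_mult[symmetric])
  qed
  then have "summable (\<lambda>n. (1 + c2) * exp (10 * (1 + c1) * (1 + (real n + 2))) * exp (s * T - real n * \<psi> s))"
  proof (rule summable_comparison_test'[where N = 0])
    fix n :: nat
    have "real n * (10 * (1 + c1) + 1) \<le> real n * \<psi> s" by (rule mult_left_mono[OF s(2)]) simp
    then have "10 * (1 + c1) * (1 + (real n + 2)) + (s * T - real n * \<psi> s) \<le> 30 * (1 + c1) + s * T - real n"
      by (simp add: algebra_simps)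
    then have "exp (10 * (1 + c1) * (1 + (real n + 2))) * exp (s * T - real n * \<psi> s) \<le> exp (30 * (1 + c1) + s * T) * exp (- real n)"
      unfolding exp_add[symmetric] by simp
    then have "(1 + c2) * (exp (10 * (1 + c1) * (1 + (real n + 2))) * exp (s * T - real n * \<psi> s)) \<le> (1 + c2) * (exp (30 * (1 + c1) + s * T) * exp (- real n))"
      using c0 by (intro mult_left_mono) auto
    then show "norm ((1 + c2) * exp (10 * (1 + c1) * (1 + (real n + 2))) * exp (s * T - real n * \<psi> s)) \<le> A * exp (- real n)"
      using c0 by (simp add: A_def mult.assoc)
  qed
  then show ?thesis using c s(1) by (intro exI[of _ "\<lambda>_. s"]) auto
next
  fix q q' \<beta>
  assume q: "0 \<le> q" "0 \<le> q'" and rv: "regularly_varying h q" "regularly_varying (\<lambda>u. ln (k u)) q'" "regularly_varying \<psi> \<beta>"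
    and \<beta>: "(max (2 * q + 1) q' - 1) / max (2 * q + 1) q' < \<beta>" "\<beta> < 1"
  define q0 where "q0 = max (2 * q + 1) q'"
  have q0: "1 \<le> q0" "q + 1 \<le> q0" "q' \<le> q0" using q by (auto simp: q0_def)
  \<comment> \<open>The lower bound on \<beta> solved for \<open>q0\<close>. The strict inequality
    leaves room for \<open>p\<close> above \<open>q0\<close> and then for \<open>\<beta>'\<close>
    below \<beta>.\<close>
  have "q0 < 1 / (1 - \<beta>)"
  proof -
    have "q0 - 1 < \<beta> * q0" using \<beta>(1) q0 unfolding q0_def[symmetric] by (simp add: pos_divide_less_eq)
    then show ?thesis using \<beta>(2) by (subst pos_less_divide_eq) (auto simp: algebra_simps)
  qed
  then obtain p where p: "q0 < p" "p < 1 / (1 - \<beta>)" using dense by blast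
  have p1: "1 < p" using p q0 by simp
  have "(p - 1) / p < \<beta>"
  proof -
    have "p * (1 - \<beta>) < 1" using p(2) \<beta>(2) by (subst (asm) pos_less_divide_eq) auto
    then show ?thesis using p1 by (simp add: pos_divide_less_eq algebra_simps)
  qed
  then obtain \<beta>' where \<beta>': "(p - 1) / p < \<beta>'" "\<beta>' < \<beta>" using dense by blast
  have \<beta>'0: "0 \<le> \<beta>'" using \<beta>'(1) p1 by (smt (verit) divide_nonneg_pos)
  \<comment> \<open>The surplus exponent: for \<open>s = real n powr p\<close> the term
    \<open>real n * \<psi> s\<close> is at least of order \<open>real n powr (p + r)\<close>,
    whereas the exponent of the weight and \<open>s * T\<close> are at most of order
    \<open>real n powr p\<close>.\<close>
  define r where "r = 1 + p * \<beta>' - p"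
  have r: "0 < r" using \<beta>'(1) p1 by (simp add: r_def pos_divide_less_eq algebra_simps)
  obtain C1 where C1: "0 < C1" "\<And>u. 0 \<le> u \<Longrightarrow> h u \<le> C1 * (1 + u) powr (p - 1)"
    using regularly_varying_upper[OF rv(1) h(2), of "p - 1"] p q0 by auto
  have kmono: "mono_on {0..} (\<lambda>u. ln (k u))"
    using k by (auto simp: mono_on_def)
  obtain C2 where C2: "0 < C2" "\<And>u. 0 \<le> u \<Longrightarrow> ln (k u) \<le> C2 * (1 + u) powr p"
    using regularly_varying_upper[OF rv(2) kmono, of p] p q0 q by auto
  have \<psi>mono: "mono_on {0..} \<psi>" by (auto simp: mono_on_def intro: laplace_mono)
  obtain c s0 where c: "0 < c" "1 \<le> s0" "\<And>s. s0 \<le> s \<Longrightarrow> c * s powr \<beta>' \<le> \<psi> s"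
    using regularly_varying_lower[OF rv(3) \<psi>mono \<beta>'(2) \<beta>'0] by blast
  \<comment> \<open>\<open>D\<close> bounds the exponent of the weight in units of
    \<open>(1 + u) powr p\<close>. \<open>E\<close> adds \<open>T\<close> and contains
    \<open>4 powr p\<close> because \<open>real n + 3\<close> is at most
    \<open>4 * real n\<close>.\<close>
  define D where "D = 10 + 10 * C1 + C2"
  define E where "E = D * 4 powr p + T"
  have \<Phi>: "(1 + k u) * exp (10 * (1 + h u) * (1 + u)) \<le> 2 * exp (D * (1 + u) powr p)" if u: "0 \<le> u" for u
  proof -
    let ?z = "(1 + u) powr p"
    have z: "1 \<le> ?z" "1 + u \<le> ?z"
      using u p1 powr_mono[of 1 p "1 + u"] by (auto intro!: ge_one_powr_ge_zero)
    have "k u = exp (ln (k u))" using k u by simp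
    also have "\<dots> \<le> exp (C2 * ?z)" using C2(2)[OF u] by simp
    finally have k1: "k u \<le> exp (C2 * ?z)" .
    have "1 \<le> exp (C2 * ?z)" using C2 z by simp
    then have k2: "1 + k u \<le> 2 * exp (C2 * ?z)" using k1 by linarith
    have "h u * (1 + u) \<le> C1 * (1 + u) powr (p - 1) * (1 + u)" using C1(2)[OF u] u by (intro mult_right_mono) auto
    also have "\<dots> = C1 * ?z" using u by (simp add: powr_diff)
    finally have "10 * (1 + h u) * (1 + u) \<le> (10 + 10 * C1) * ?z" using z by (simp add: algebra_simps)
    then have "exp (10 * (1 + h u) * (1 + u)) \<le> exp ((10 + 10 * C1) * ?z)" by simp
    then have "(1 + k u) * exp (10 * (1 + h u) * (1 + u)) \<le> 2 * exp (C2 * ?z) * exp ((10 + 10 * C1) * ?z)"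
      using k2 by (intro mult_mono) auto
    also have "\<dots> = 2 * exp (D * ?z)" by (simp add: D_def exp_add[symmetric] algebra_simps)
    finally show ?thesis .
  qed
  have D0: "0 \<le> D" using C1 C2 by (simp add: D_def)
  define s where "s n = real n powr p" for n :: nat
  have "summable (\<lambda>n. 2 * exp (- real n))"
  proof (rule summable_mult)
    have "summable (\<lambda>n. exp (- 1 :: real) ^ n)" by (rule summable_geometric) simp
    then show "summable (\<lambda>n. exp (- real n))" by (simp add: exp_of_nat_mult[symmetric])
  qed
  moreover have "eventually (\<lambda>n. norm ((1 + k (real n + 2)) * exp (10 * (1 + h (real n + 2)) * (1 + (real n + 2))) * exp (s n * T - real n * \<psi> (s n))) \<le> 2 * exp (- real n)) sequentially"
    using eventually_powr_dominates[OF c(1) r, of E] eventually_ge_at_top[of "nat \<lceil>s0\<rceil>"]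
  proof eventually_elim
    case (elim n)
    have n1: "s0 \<le> real n" "1 \<le> real n" using elim(2) c(2) by linarith+
    have np: "real n \<le> real n powr p" using powr_mono[of 1 p "real n"] p1 n1 by simp
    have "(1 + (real n + 2)) powr p \<le> (4 * real n) powr p" using n1 p1 by (intro powr_mono2) auto
    also have "\<dots> = 4 powr p * real n powr p" by (rule powr_mult)
    finally have a: "D * (1 + (real n + 2)) powr p \<le> D * (4 powr p * real n powr p)" by (rule mult_left_mono[OF _ D0])
    have "c * s n powr \<beta>' \<le> \<psi> (s n)" by (rule c(3)) (use n1 np in \<open>simp add: s_def\<close>)
    then have "real n * (c * s n powr \<beta>') \<le> real n * \<psi> (s n)" by (rule mult_left_mono) simp
    moreover have "real n * (c * s n powr \<beta>') = c * (real n powr p * real n powr r)"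
    proof -
      have "real n powr p * real n powr r = real n powr (1 + p * \<beta>')" by (simp add: powr_add[symmetric] r_def)
      also have "\<dots> = real n * s n powr \<beta>'" using n1 by (simp add: powr_add s_def powr_powr)
      finally show ?thesis by simp
    qed
    ultimately have "D * (1 + (real n + 2)) powr p + (s n * T - real n * \<psi> (s n)) \<le>
      D * (4 powr p * real n powr p) + real n powr p * T - c * (real n powr p * real n powr r)"
      using a unfolding s_def by linarith
    also have "\<dots> = real n powr p * (E - c * real n powr r)" by (simp add: E_def algebra_simps)
    also have "\<dots> \<le> real n powr p * (- 1)" by (rule mult_left_mono[OF elim(1)]) simp
    also have "\<dots> \<le> - real n" using np by simp
    finally have ex: "exp (D * (1 + (real n + 2)) powr p) * exp (s n * T - real n * \<psi> (s n)) \<le> exp (- real n)"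
      unfolding exp_add[symmetric] by simp
    let ?P = "(1 + k (real n + 2)) * exp (10 * (1 + h (real n + 2)) * (1 + (real n + 2)))"
    have P0: "0 \<le> ?P" using k(1)[rule_format, of "real n + 2"] by simp
    have "?P * exp (s n * T - real n * \<psi> (s n)) \<le> 2 * exp (D * (1 + (real n + 2)) powr p) * exp (s n * T - real n * \<psi> (s n))"
      using \<Phi>[of "real n + 2"] by (intro mult_right_mono) auto
    also have "\<dots> \<le> 2 * exp (- real n)" using ex by simp
    finally have le: "?P * exp (s n * T - real n * \<psi> (s n)) \<le> 2 * exp (- real n)" .
    have "0 \<le> ?P * exp (s n * T - real n * \<psi> (s n))" by (rule mult_nonneg_nonneg[OF P0]) simp
    then show ?case unfolding real_norm_def by (simp only: abs_of_nonneg le)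
  qed
  ultimately have "summable (\<lambda>n. (1 + k (real n + 2)) * exp (10 * (1 + h (real n + 2)) * (1 + (real n + 2))) * exp (s n * T - real n * \<psi> (s n)))"
    by (rule summable_comparison_test_ev[rotated])
  then show ?thesis by (intro exI[of _ s]) (auto simp: s_def)
qed

section \<open>The time-changed filtration and the stochastic integral\<close>

text \<open>Strictness between rational times costs only countably many null sets. It extends to all
  times because two rationals fit between any two times and the path is monotone.\<close>

lemma less_of_less_on_rats:
  assumes "\<forall>q\<in>\<rat>. \<forall>r\<in>\<rat>. 0 \<le> q \<longrightarrow> q < r \<longrightarrow> (f q :: real) < f r" "mono_on {0..} f" "0 \<le> u" "u < (v :: real)"
  shows "f u < f v"
proof -
  obtain q where q: "q \<in> \<rat>" "u < q" "q < v" using Rats_dense_in_real[OF assms(4)] by blast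
  obtain r where r: "r \<in> \<rat>" "q < r" "r < v" using Rats_dense_in_real[OF q(3)] by blast
  have "f u \<le> f q" using assms(2,3) q by (intro mono_onD[OF assms(2)]) auto
  also have "f q < f r" using assms(1,3) q r by auto
  also have "f r \<le> f v" using assms(3) q r by (intro mono_onD[OF assms(2)]) auto
  finally show ?thesis .
qed

section \<open>Almost sure path properties of the subordinator\<close>

locale driving_processes = prob_space M + complete_measure M + levy_infinite \<nu>
  for M :: "'w measure" and Fl :: "real \<Rightarrow> 'w measure" and \<nu> :: "real measure" and B D :: "real \<Rightarrow> 'w \<Rightarrow> real" +
  assumes usual: "usual_conditions M Fl" and brownian: "brownian_motion M Fl B"
    and subordinator: "subordinator M Fl \<nu> D"
begin

abbreviation E where "E \<equiv> inverse_subordinator D"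
abbreviation Gl where "Gl \<equiv> time_changed_filtration M Fl E"

lemma filtration: "filtration (space M) Fl"
  and sets_Fl: "sets (Fl t) \<subseteq> sets M"
  and null_sets_Fl: "null_sets M \<subseteq> sets (Fl t)"
  and right_continuous: "sets (Fl t) = (\<Inter>s\<in>{t<..}. sets (Fl s))"
  using usual[unfolded usual_conditions_def] by blast+

sublocale Fl: filtration "space M" Fl by (rule filtration)

lemma Fl_measurable: "f \<in> borel_measurable (Fl t) \<Longrightarrow> f \<in> borel_measurable M"
  using sets_Fl[of t] by (auto simp: measurable_def Fl.space_F)

lemma D_adapted: "0 \<le> t \<Longrightarrow> D t \<in> borel_measurable (Fl t)"
  using subordinator by (simp add: subordinator_def)

lemma D_measurable: "0 \<le> t \<Longrightarrow> D t \<in> borel_measurable M"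
  by (rule Fl_measurable[OF D_adapted])

lemma D_paths: "AE \<omega> in M. D 0 \<omega> = 0 \<and> mono_on {0..} (\<lambda>t. D t \<omega>) \<and> (\<forall>t\<ge>0. continuous (at_right t) (\<lambda>t. D t \<omega>))"
  using subordinator by (simp add: subordinator_def)

lemma subordinator_tail:
  assumes "0 \<le> s" "0 \<le> t"
  shows "measure M {\<omega>\<in>space M. D t \<omega> \<le> m} \<le> exp (s * m - t * \<psi> s)"
proof -
  have L: "(LINT \<omega>|M. exp (- s * D t \<omega>)) = exp (- t * \<psi> s)"
    using subordinator assms by (simp add: subordinator_def)
  \<comment> \<open>A function that is not integrable would have integral 0, whereas the Laplace
    transform is positive.\<close>
  then have i: "integrable M (\<lambda>\<omega>. exp (- s * D t \<omega>))"
    using not_integrable_integral_eq by fastforce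
  have [measurable]: "D t \<in> borel_measurable M" by (rule D_measurable[OF assms(2)])
  have "measure M {\<omega>\<in>space M. D t \<omega> \<le> m} \<le> measure M {\<omega>\<in>space M. exp (- s * m) \<le> exp (- s * D t \<omega>)}"
    using assms(1) by (intro finite_measure_mono) (auto intro: mult_left_mono)
  also have "\<dots> \<le> (LINT \<omega>|M. exp (- s * D t \<omega>)) / exp (- s * m)"
    by (rule integral_Markov_inequality_measure[OF i sets.empty_sets]) auto
  also have "\<dots> = exp (s * m - t * \<psi> s)" unfolding L exp_diff[symmetric] by simp
  finally show ?thesis .
qed

text \<open>The increment has the law of \<open>D (r - q)\<close>, and the tail bound at level 0 is
  \<open>exp (- (r - q) * \<psi> s)\<close>, which becomes arbitrarily small because
  \<open>\<psi>\<close> is unbounded.\<close>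

lemma D_less:
  assumes "0 \<le> q" "q < r"
  shows "AE \<omega> in M. D q \<omega> < D r \<omega>"
proof -
  have [measurable]: "D q \<in> borel_measurable M" "D r \<in> borel_measurable M" "D (r - q) \<in> borel_measurable M"
    using assms by (auto intro: D_measurable)
  have "distr M borel (\<lambda>\<omega>. D (q + (r - q)) \<omega> - D q \<omega>) = distr M borel (D (r - q))"
    using subordinator assms unfolding subordinator_def by (metis diff_ge_0_iff_ge less_imp_le)
  then have "measure (distr M borel (\<lambda>\<omega>. D r \<omega> - D q \<omega>)) {..0} = measure (distr M borel (D (r - q))) {..0}"
    by simp
  then have eq: "measure M {\<omega>\<in>space M. D r \<omega> - D q \<omega> \<le> 0} = measure M {\<omega>\<in>space M. D (r - q) \<omega> \<le> 0}"
    by (simp add: measure_distr vimage_def Int_def conj_commute)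
  have "measure M {\<omega>\<in>space M. D (r - q) \<omega> \<le> 0} \<le> 0 + \<epsilon>" if "0 < \<epsilon>" for \<epsilon>
  proof -
    have "0 < max 1 (- ln \<epsilon> / (r - q))" by simp
    from laplace_ge[OF this] obtain s where s: "0 < s" "max 1 (- ln \<epsilon> / (r - q)) \<le> \<psi> s" by blast
    have "- ln \<epsilon> \<le> (r - q) * \<psi> s" using s assms by (simp add: field_simps)
    then have "exp (s * 0 - (r - q) * \<psi> s) \<le> exp (ln \<epsilon>)" by simp
    then show ?thesis using subordinator_tail[of s "r - q" 0] s assms that by simp
  qed
  then have "measure M {\<omega>\<in>space M. D (r - q) \<omega> \<le> 0} \<le> 0" by (rule field_le_epsilon)
  then have "measure M {\<omega>\<in>space M. D r \<omega> - D q \<omega> \<le> 0} = 0" by (simp only: eq measure_le_0_iff)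
  then have "AE \<omega> in M. \<not> D r \<omega> - D q \<omega> \<le> 0"
    by (subst AE_iff_measurable[OF _ refl]) (simp_all add: emeasure_eq_measure)
  then show ?thesis by eventually_elim simp
qed

text \<open>Here the level and \<open>s\<close> stay fixed while time grows: with
  \<open>\<psi> s\<close> at least 1 the tail bound tends to 0 as \<open>n\<close> does to
  infinity.\<close>

lemma D_unbounded: "AE \<omega> in M. \<forall>m::nat. \<exists>n::nat. real m < D (real n) \<omega>"
  unfolding AE_all_countable
proof
  fix m :: nat
  have [measurable]: "D (real n) \<in> borel_measurable M" for n by (rule D_measurable) simp
  obtain s where s: "0 < s" "1 \<le> \<psi> s" using laplace_ge[OF zero_less_one] by blast
  let ?A = "{\<omega>\<in>space M. \<forall>n. D (real n) \<omega> \<le> real m}"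
  have "measure M ?A \<le> 0 + \<epsilon>" if "0 < \<epsilon>" for \<epsilon>
  proof -
    obtain n :: nat where n: "s * real m - ln \<epsilon> \<le> real n" using real_arch_simple by blast
    have "real n * 1 \<le> real n * \<psi> s" using s by (intro mult_left_mono) auto
    then have "exp (s * real m - real n * \<psi> s) \<le> exp (ln \<epsilon>)" using n by simp
    moreover have "measure M ?A \<le> measure M {\<omega>\<in>space M. D (real n) \<omega> \<le> real m}"
      by (rule finite_measure_mono) auto
    ultimately show ?thesis using subordinator_tail[of s "real n" "real m"] s that by simp
  qed
  then have "measure M ?A \<le> 0" by (rule field_le_epsilon)
  then have "measure M ?A = 0" by (simp only: measure_le_0_iff)
  then have "AE \<omega> in M. \<not> (\<forall>n. D (real n) \<omega> \<le> real m)"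
    by (subst AE_iff_measurable[OF _ refl]) (simp_all add: emeasure_eq_measure)
  then show "AE \<omega> in M. \<exists>n::nat. real m < D (real n) \<omega>" by eventually_elim (simp add: not_le)
qed

lemma subordinator_path: "AE \<omega> in M. subordinator_path (\<lambda>t. D t \<omega>)"
proof -
  have "AE \<omega> in M. \<forall>q\<in>\<rat>. \<forall>r\<in>\<rat>. 0 \<le> q \<longrightarrow> q < r \<longrightarrow> D q \<omega> < D r \<omega>"
  proof (intro AE_ball_countable[THEN iffD2, OF countable_rat] ballI)
    fix q r :: real
    show "AE \<omega> in M. 0 \<le> q \<longrightarrow> q < r \<longrightarrow> D q \<omega> < D r \<omega>"
      by (cases "0 \<le> q \<and> q < r") (use D_less in auto)
  qed
  then show ?thesis
    using D_paths D_unbounded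
  proof eventually_elim
    case (elim \<omega>)
    show ?case
    proof
      show "D 0 \<omega> = 0" using elim by simp
      show "D u \<omega> < D v \<omega>" if "0 \<le> u" "u < v" for u v
        by (rule less_of_less_on_rats[OF elim(1) _ that]) (use elim in simp)
      show "continuous (at_right u) (\<lambda>t. D t \<omega>)" if "0 \<le> u" for u using elim that by simp
      show "\<exists>u\<ge>0. m < D u \<omega>" for m
      proof -
        obtain j :: nat where "m \<le> real j" using real_arch_simple by blast
        then obtain n :: nat where "m < D (real n) \<omega>" using elim(3) by (meson le_less_trans)
        then show ?thesis by (intro exI[of _ "real n"]) auto
      qed
    qed
  qed
qed

section \<open>The inverse as a family of stopping times\<close>

lemma E_eq: "subordinator_path.e (\<lambda>t. D t \<omega>) t = E t \<omega>" if "subordinator_path (\<lambda>t. D t \<omega>)"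
  by (simp add: subordinator_path.e_def[OF that] inverse_subordinator_def)

text \<open>Properties of \<open>E\<close> hold only almost surely. Since every \<open>Fl t\<close>
  contains the null sets, an event may be exchanged for one that agrees with it almost
  surely.\<close>

lemma Fl_AE:
  assumes "A \<in> sets (Fl t)" "AE \<omega> in M. \<omega> \<in> A \<longleftrightarrow> \<omega> \<in> A'" "A' \<subseteq> space M"
  shows "A' \<in> sets (Fl t)"
proof -
  have A: "A \<subseteq> space M" using sets.sets_into_space[OF assms(1)] by (simp add: Fl.space_F)
  have "AE \<omega> in M. \<omega> \<notin> A' - A" "AE \<omega> in M. \<omega> \<notin> A - A'"
    using assms(2) by (eventually_elim, blast)+
  then have "A' - A \<in> null_sets M" "A - A' \<in> null_sets M"
    using A assms(3) by (auto simp: null_sets_iff_AE)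
  then have "A' - A \<in> sets (Fl t)" "A - A' \<in> sets (Fl t)" using null_sets_Fl by auto
  moreover have "A' = (A - (A - A')) \<union> (A' - A)" by blast
  ultimately show ?thesis using assms(1) by (metis sets.Diff sets.Un)
qed

text \<open>For nonnegative \<open>u\<close>, almost surely \<open>E t \<le> u\<close> holds exactly
  when \<open>t < D (p j)\<close> for all members of a sequence decreasing to \<open>u\<close>. That
  event belongs to \<open>Fl s\<close> for every \<open>s > u\<close>, hence to \<open>Fl u\<close>
  by right continuity of the filtration. Comparison with \<open>D u\<close> alone would not do,
  since \<open>E t = u\<close> is compatible with \<open>D u = t\<close>.\<close>

lemma stopping_time_E: "stopping_time Fl (E t)"
proof
  fix u
  show "Measurable.pred (Fl u) (\<lambda>\<omega>. E t \<omega> \<le> u)"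
  proof (cases "0 \<le> u")
    case True
    have "{\<omega>\<in>space M. E t \<omega> \<le> u} \<in> sets (Fl s)" if s: "u < s" for s
    proof (rule Fl_AE)
      define p where "p j = u + (s - u) / real (Suc j)" for j :: nat
      have p: "u < p j" "p j \<le> s" for j
      proof -
        show "u < p j" using s by (simp add: p_def)
        have "(s - u) / real (Suc j) \<le> (s - u) / 1" using s by (intro divide_left_mono) auto
        then show "p j \<le> s" by (simp add: p_def)
      qed
      have lim: "p \<longlonglongrightarrow> u"
      proof -
        have "(\<lambda>j. u + (s - u) * inverse (real (Suc j))) \<longlonglongrightarrow> u + (s - u) * 0"
          by (intro tendsto_intros LIMSEQ_inverse_real_of_nat)
        then show ?thesis by (simp add: p_def[abs_def] divide_inverse)
      qed
      have "D (p j) \<in> borel_measurable (Fl s)" for j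
      proof -
        have "D (p j) \<in> borel_measurable (Fl (p j))" using p(1)[of j] True by (intro D_adapted) simp
        then show ?thesis using Fl.sets_F_mono[OF p(2)[of j]] by (auto simp: measurable_def Fl.space_F)
      qed
      then have [measurable]: "\<And>j. D (p j) \<in> borel_measurable (Fl s)" .
      have "{\<omega>\<in>space (Fl s). \<forall>j. t < D (p j) \<omega>} \<in> sets (Fl s)" by measurable
      then show "{\<omega>\<in>space M. \<forall>j. t < D (p j) \<omega>} \<in> sets (Fl s)" by (simp add: Fl.space_F)
      show "AE \<omega> in M. (\<omega> \<in> {\<omega>\<in>space M. \<forall>j. t < D (p j) \<omega>}) = (\<omega> \<in> {\<omega>\<in>space M. E t \<omega> \<le> u})"
        using subordinator_path
      proof eventually_elim
        case (elim \<omega>)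
        then interpret subordinator_path "\<lambda>t. D t \<omega>" .
        have "(\<forall>j. t < D (p j) \<omega>) \<longleftrightarrow> e t \<le> u"
        proof
          assume "\<forall>j. t < D (p j) \<omega>"
          then have "e t \<le> p j" for j using p(1)[of j] True by (intro e_le) auto
          then show "e t \<le> u" by (intro LIMSEQ_le_const[OF lim]) auto
        next
          assume "e t \<le> u"
          then show "\<forall>j. t < D (p j) \<omega>" using p(1) by (intro allI e_lessD) (rule le_less_trans)
        qed
        then show ?case using E_eq[OF elim] by simp
      qed
    qed auto
    then have "{\<omega>\<in>space M. E t \<omega> \<le> u} \<in> sets (Fl u)"
      unfolding right_continuous[of u] by blast
    then show ?thesis by (simp add: pred_def Fl.space_F)
  next
    case False
    have "{\<omega>\<in>space M. E t \<omega> \<le> u} \<in> sets (Fl u)"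
    proof (rule Fl_AE[OF sets.empty_sets])
      show "AE \<omega> in M. (\<omega> \<in> {}) = (\<omega> \<in> {\<omega>\<in>space M. E t \<omega> \<le> u})"
        using subordinator_path
      proof eventually_elim
        case (elim \<omega>)
        then interpret subordinator_path "\<lambda>t. D t \<omega>" .
        show ?case using e_nonneg[of t] E_eq[OF elim] False by (auto simp: not_le)
      qed
    qed auto
    then show ?thesis by (simp add: pred_def Fl.space_F)
  qed
qed

lemma sets_Gl: "A \<in> sets (Gl t) \<longleftrightarrow> (\<forall>u. {\<omega>\<in>A. E t \<omega> \<le> u} \<in> sets (Fl u))"
  by (simp add: time_changed_filtration_def Fl.sets_pre_sigma[OF stopping_time_E])

lemma space_Gl: "space (Gl t) = space M"
  by (simp add: time_changed_filtration_def Fl.space_pre_sigma)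

lemma Gl_subset: "sets (Gl t) \<subseteq> sets M"
proof
  fix A assume A: "A \<in> sets (Gl t)"
  have "A = (\<Union>n::nat. {\<omega>\<in>A. E t \<omega> \<le> real n})" using real_arch_simple by auto
  also have "\<dots> \<in> sets M"
    using A[unfolded sets_Gl] sets_Fl by (intro sets.countable_UN') auto
  finally show "A \<in> sets M" .
qed

lemma Gl_measurable: "f \<in> borel_measurable (Gl t) \<Longrightarrow> f \<in> borel_measurable M"
  using Gl_subset[of t] by (auto simp: measurable_def space_Gl)

text \<open>The inequality \<open>E s \<le> E t\<close> is available only almost surely, so that the
  inclusion passes through \<open>Fl_AE\<close>.\<close>

lemma filtration_Gl: "filtration (space M) Gl"
proof
  fix s t :: real assume st: "s \<le> t"
  show "sets (Gl s) \<subseteq> sets (Gl t)"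
  proof
    fix A assume A: "A \<in> sets (Gl s)"
    have "{\<omega>\<in>A. E t \<omega> \<le> u} \<in> sets (Fl u)" for u
    proof (rule Fl_AE)
      have "{\<omega>\<in>space (Fl u). E t \<omega> \<le> u} \<in> sets (Fl u)"
        using stopping_time_E by (simp add: stopping_time_def pred_def)
      then show "{\<omega>\<in>A. E s \<omega> \<le> u} \<inter> {\<omega>\<in>space (Fl u). E t \<omega> \<le> u} \<in> sets (Fl u)"
        using A unfolding sets_Gl by blast
      show "{\<omega>\<in>A. E t \<omega> \<le> u} \<subseteq> space M" using sets.sets_into_space[OF A] by (auto simp: space_Gl)
      show "AE \<omega> in M. (\<omega> \<in> {\<omega>\<in>A. E s \<omega> \<le> u} \<inter> {\<omega>\<in>space (Fl u). E t \<omega> \<le> u}) = (\<omega> \<in> {\<omega>\<in>A. E t \<omega> \<le> u})"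
        using subordinator_path AE_space
      proof eventually_elim
        case (elim \<omega>)
        then interpret subordinator_path "\<lambda>t. D t \<omega>" by simp
        show ?case using e_mono[OF st] E_eq[OF elim(1)] elim(2) by (auto simp: Fl.space_F)
      qed
    qed
    then show "A \<in> sets (Gl t)" by (simp add: sets_Gl)
  qed
qed (rule space_Gl)

lemma E_adapted: "E t \<in> borel_measurable (Gl t)"
  unfolding time_changed_filtration_def by (rule Fl.measurable_stopping_time_pre_sigma[OF stopping_time_E])

lemma E_measurable [measurable]: "E t \<in> borel_measurable M"
  by (rule Gl_measurable[OF E_adapted])

lemma Gl_pre_sigma_const: "sets (Gl c) \<subseteq> sets (filtration.pre_sigma (space M) Gl (\<lambda>_. c))"
proof
  interpret Gl: filtration "space M" Gl by (rule filtration_Gl)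
  fix A assume A: "A \<in> sets (Gl c)"
  show "A \<in> sets (Gl.pre_sigma (\<lambda>_. c))"
  proof (rule Gl.sets_pre_sigmaI)
    show "{\<omega>\<in>A. c \<le> t} \<in> sets (Gl t)" for t
      using A Gl.sets_F_mono[of c t] by (cases "c \<le> t") auto
  qed (rule stopping_time_const)
qed

end

text \<open>\<open>\<phi> l\<close> is chosen so that an error above \<open>1 / real (Suc l)\<close>
  on \<open>{0..T}\<close> has probability below \<open>(1 / 2) ^ l\<close>. By the Borel-Cantelli
  lemma such errors eventually cease on almost every path. The indices have to tend to infinity,
  which \<open>l \<le> \<phi> l\<close> ensures; they need not increase strictly.\<close>

lemma ucp_limit_subsequence:
  assumes M: "finite_measure M" and lim: "ucp_limit M J I" and T: "0 \<le> T"
  obtains \<phi> :: "nat \<Rightarrow> nat" where "filterlim \<phi> at_top sequentially"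
    "AE \<omega> in M. \<forall>t\<in>{0..T}. (\<lambda>l. J (\<phi> l) t \<omega>) \<longlonglongrightarrow> I t \<omega>"
proof -
  interpret finite_measure M by fact
  define A where "A n l = {\<omega>\<in>space M. \<exists>s\<in>{0..T}. inverse (real (Suc l)) < \<bar>J n s \<omega> - I s \<omega>\<bar>}" for n l
  have A: "A n l \<in> sets M" for n l
    using lim T unfolding A_def ucp_limit_def by auto
  have lim0: "(\<lambda>n. measure M (A n l)) \<longlonglongrightarrow> 0" for l
    using lim T unfolding A_def ucp_limit_def by auto
  have "\<exists>n\<ge>l. measure M (A n l) < (1 / 2) ^ l" for l
  proof -
    have "eventually (\<lambda>n. measure M (A n l) < (1 / 2) ^ l) sequentially"
      by (rule order_tendstoD(2)[OF lim0]) simp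
    then show ?thesis unfolding eventually_sequentially by (meson le_cases order_refl)
  qed
  then obtain \<phi> where \<phi>: "\<And>l. l \<le> \<phi> l" "\<And>l. measure M (A (\<phi> l) l) < (1 / 2) ^ l" by metis
  have "AE \<omega> in M. eventually (\<lambda>l. \<omega> \<in> space M - A (\<phi> l) l) sequentially"
  proof (rule borel_cantelli_AE1)
    show "summable (\<lambda>l. measure M (A (\<phi> l) l))"
      by (rule summable_comparison_test'[OF summable_geometric[of "1 / 2 :: real"], of 0])
        (use \<phi>(2) in \<open>auto intro: less_imp_le\<close>)
  qed (use A in \<open>auto simp: less_top[symmetric]\<close>)
  then have "AE \<omega> in M. \<forall>t\<in>{0..T}. (\<lambda>l. J (\<phi> l) t \<omega>) \<longlonglongrightarrow> I t \<omega>"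
  proof eventually_elim
    case (elim \<omega>)
    show ?case
    proof
      fix t assume t: "t \<in> {0..T}"
      have "eventually (\<lambda>l. norm (J (\<phi> l) t \<omega> - I t \<omega>) \<le> inverse (real (Suc l))) sequentially"
        using elim by eventually_elim (use t in \<open>auto simp: A_def not_less\<close>)
      then have "(\<lambda>l. J (\<phi> l) t \<omega> - I t \<omega>) \<longlonglongrightarrow> 0"
        by (rule tendsto_0_le[OF LIMSEQ_inverse_real_of_nat, where K = 1, rotated, OF eventually_mono]) simp
      then show "(\<lambda>l. J (\<phi> l) t \<omega>) \<longlonglongrightarrow> I t \<omega>" by (simp add: LIM_zero_iff)
    qed
  qed
  moreover have "filterlim \<phi> at_top sequentially"
    by (rule filterlim_at_top_mono[OF filterlim_ident]) (simp add: \<phi>(1))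
  ultimately show ?thesis using that by blast
qed

lemma uniform_grid_cell:
  fixes s :: real
  assumes "0 < s"
  obtains j :: nat where "real j / real (Suc m) < s" "s \<le> real (Suc j) / real (Suc m)"
proof -
  define j where "j = nat (\<lceil>s * real (Suc m)\<rceil> - 1)"
  have "0 < s * real (Suc m)" using assms by simp
  then have "real j < s * real (Suc m)" "s * real (Suc m) \<le> real (Suc j)"
    unfolding j_def by linarith+
  then show ?thesis using that[of j] by (simp add: field_simps)
qed

section \<open>Grid approximations of the integrand\<close>

context driving_processes
begin

lemma E_paths: "AE \<omega> in M. E 0 \<omega> = 0 \<and> (\<forall>t. 0 \<le> E t \<omega>) \<and> continuous_on UNIV (\<lambda>t. E t \<omega>)"
  using subordinator_path
proof eventually_elim
  case (elim \<omega>)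
  then interpret subordinator_path "\<lambda>t. D t \<omega>" .
  show ?case using e_nonpos[of 0] e_nonneg continuous_on_e[of UNIV] E_eq[OF elim] by simp
qed

text \<open>Sampling at the left end of each cell makes the process predictable. The cut-off by
  \<open>max 0\<close> is due to \<open>E\<close> being nonnegative only almost surely while
  \<open>G\<close> is continuous only on nonnegative arguments; the value at time 0 is
  \<open>G 0\<close> because \<open>E\<close> starts at 0 almost surely.\<close>

definition grid_approx :: "(real \<Rightarrow> real) \<Rightarrow> nat \<Rightarrow> real \<Rightarrow> 'w \<Rightarrow> real" where
  "grid_approx G m = simple_process ((Suc m)\<^sup>2) (\<lambda>_. G 0) (\<lambda>i _. real i / real (Suc m))
     (\<lambda>i \<omega>. G (max 0 (E (real i / real (Suc m)) \<omega>)))"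

lemma grid_approx_cell:
  assumes "real j / real (Suc m) < s" "s \<le> real (Suc j) / real (Suc m)"
  shows "grid_approx G m s \<omega> = (if j < (Suc m)\<^sup>2 then G (max 0 (E (real j / real (Suc m)) \<omega>)) else 0)"
proof -
  let ?p = "\<lambda>i. real i / real (Suc m)"
  have p: "?p i \<le> ?p i'" if "i \<le> i'" for i i' using that by (intro divide_right_mono) auto
  have pos: "0 < s" using assms(1) by (meson divide_nonneg_nonneg le_less_trans of_nat_0_le_iff)
  have ind: "indicator {?p i<..?p (Suc i)} s = (if i = j then 1 else 0 :: real)" for i
  proof (cases "i = j")
    case True
    then show ?thesis using assms by (simp del: of_nat_Suc)
  next
    case False
    then consider "Suc i \<le> j" | "Suc j \<le> i" by linarith
    then show ?thesis
    proof cases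
      case 1
      then show ?thesis using False p[OF 1] assms by (simp add: indicator_def del: of_nat_Suc)
    next
      case 2
      then show ?thesis using False p[OF 2] assms by (simp add: indicator_def del: of_nat_Suc)
    qed
  qed
  show ?thesis
    unfolding grid_approx_def simple_process_def ind using pos
    by (simp add: if_distrib[of "\<lambda>x. _ * x"] sum.delta' cong: if_cong)
qed

lemma grid_approx_0: "grid_approx G m 0 \<omega> = G 0"
proof -
  have "indicator {real i / real (Suc m)<..real (Suc i) / real (Suc m)} (0::real) = (0 :: real)" for i
    by (simp add: indicator_def not_less)
  then show ?thesis unfolding grid_approx_def simple_process_def by simp
qed

context
  fixes G :: "real \<Rightarrow> real"
  assumes G: "continuous_on {0..} G"
begin

lemma G_max_measurable [measurable]: "(\<lambda>x. G (max 0 x)) \<in> borel_measurable borel"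
  by (intro borel_measurable_continuous_onI continuous_on_compose2[OF G]) (auto intro: continuous_intros)

text \<open>The event quantifies over uncountably many times. Both processes are left-continuous at
  positive times, so a strict violation at \<open>s > 0\<close> persists at rational times slightly
  to the left; at time 0 there is almost surely no error. Completeness absorbs the exceptional null
  set.\<close>

lemma grid_error_measurable:
  "{\<omega>\<in>space M. \<exists>s\<in>{0..t}. \<epsilon> < \<bar>grid_approx G m s \<omega> - G (E s \<omega>)\<bar>} \<in> sets M" if "0 < \<epsilon>"
proof (rule in_sets_AE)
  have [measurable]: "grid_approx G m s \<in> borel_measurable M" for s
    unfolding grid_approx_def simple_process_def by measurable
  have "countable (\<rat> \<inter> {0..t})" by (simp add: countable_rat)
  then show "{\<omega>\<in>space M. \<exists>s\<in>\<rat> \<inter> {0..t}. \<epsilon> < \<bar>grid_approx G m s \<omega> - G (max 0 (E s \<omega>))\<bar>} \<in> sets M"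
    by measurable
  show "AE \<omega> in M. (\<omega> \<in> {\<omega>\<in>space M. \<exists>s\<in>\<rat> \<inter> {0..t}. \<epsilon> < \<bar>grid_approx G m s \<omega> - G (max 0 (E s \<omega>))\<bar>})
    = (\<omega> \<in> {\<omega>\<in>space M. \<exists>s\<in>{0..t}. \<epsilon> < \<bar>grid_approx G m s \<omega> - G (E s \<omega>)\<bar>})"
    using E_paths AE_space
  proof eventually_elim
    case (elim \<omega>)
    let ?f = "\<lambda>s. grid_approx G m s \<omega> - G (E s \<omega>)"
    have "\<exists>q\<in>\<rat> \<inter> {0..t}. \<epsilon> < \<bar>?f q\<bar>" if s: "s \<in> {0..t}" "\<epsilon> < \<bar>?f s\<bar>" for s
    proof -
      have "s \<noteq> 0" using s(2) elim(1) \<open>0 < \<epsilon>\<close> grid_approx_0[of G m \<omega>] by auto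
      then have s0: "0 < s" using s by simp
      obtain j where j: "real j / real (Suc m) < s" "s \<le> real (Suc j) / real (Suc m)"
        using uniform_grid_cell[OF s0] by blast
      define c where "c = (if j < (Suc m)\<^sup>2 then G (max 0 (E (real j / real (Suc m)) \<omega>)) else 0)"
      have c: "grid_approx G m q \<omega> = c" if "real j / real (Suc m) < q" "q \<le> s" for q
        using grid_approx_cell[OF that(1), of G \<omega>] that(2) j(2) unfolding c_def by linarith
      have "continuous_on UNIV (\<lambda>q. \<bar>c - G (E q \<omega>)\<bar>)"
        by (intro continuous_intros continuous_on_compose2[OF G]) (use elim in auto)
      then have "isCont (\<lambda>q. \<bar>c - G (E q \<omega>)\<bar>) s" by (simp add: continuous_on_eq_continuous_at)
      then have "((\<lambda>q. \<bar>c - G (E q \<omega>)\<bar>) \<longlongrightarrow> \<bar>c - G (E s \<omega>)\<bar>) (at_left s)"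
        using isContD filterlim_at_split by blast
      moreover have "\<epsilon> < \<bar>c - G (E s \<omega>)\<bar>" using s(2) c[OF j(1) order_refl] by simp
      ultimately have "eventually (\<lambda>q. \<epsilon> < \<bar>c - G (E q \<omega>)\<bar>) (at_left s)"
        by (rule order_tendstoD)
      then obtain a where a: "a < s" "\<And>q. a < q \<Longrightarrow> q < s \<Longrightarrow> \<epsilon> < \<bar>c - G (E q \<omega>)\<bar>"
        unfolding eventually_at_left_field by blast
      have "max (max a 0) (real j / real (Suc m)) < s" using a(1) s0 j(1) by simp
      then obtain q where "q \<in> \<rat>" "max (max a 0) (real j / real (Suc m)) < q" "q < s"
        using Rats_dense_in_real by blast
      then have "q \<in> \<rat>" "a < q" "0 < q" "real j / real (Suc m) < q" "q < s" by (simp_all del: of_nat_Suc)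
      then show ?thesis using a(2)[of q] c[of q] s(1) by (intro bexI[of _ q]) auto
    qed
    moreover have "max 0 (E s \<omega>) = E s \<omega>" for s using elim by simp
    ultimately show ?case using elim(2) by auto
  qed
qed auto

lemma grid_error_eventually:
  assumes "E 0 \<omega> = 0" "\<And>t. 0 \<le> E t \<omega>" "continuous_on UNIV (\<lambda>t. E t \<omega>)" "0 < \<epsilon>"
  shows "eventually (\<lambda>m. \<forall>s\<in>{0..t}. \<bar>grid_approx G m s \<omega> - G (E s \<omega>)\<bar> \<le> \<epsilon>) sequentially"
proof -
  have "continuous_on {0..t} (\<lambda>s. G (E s \<omega>))"
    by (rule continuous_on_compose2[OF G]) (use assms in \<open>auto intro: continuous_on_subset\<close>)
  then have "uniformly_continuous_on {0..t} (\<lambda>s. G (E s \<omega>))"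
    by (rule compact_uniformly_continuous[OF _ compact_Icc])
  from this[unfolded uniformly_continuous_on_def, rule_format, OF assms(4)]
  obtain \<eta> where \<eta>: "0 < \<eta>" "\<And>s r. s \<in> {0..t} \<Longrightarrow> r \<in> {0..t} \<Longrightarrow> dist r s < \<eta> \<Longrightarrow> dist (G (E r \<omega>)) (G (E s \<omega>)) < \<epsilon>"
    by blast
  obtain m0 where m0: "max t (1 / \<eta>) < real m0"
    using reals_Archimedean2 by blast
  show ?thesis
    using eventually_ge_at_top[of m0]
  proof eventually_elim
    case (elim m)
    show ?case
    proof
      fix s assume s: "s \<in> {0..t}"
      show "\<bar>grid_approx G m s \<omega> - G (E s \<omega>)\<bar> \<le> \<epsilon>"
      proof (cases "s = 0")
        case True
        then show ?thesis using assms grid_approx_0[of G m \<omega>] by simp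
      next
        case False
        then have s0: "0 < s" using s by simp
        obtain j where j: "real j / real (Suc m) < s" "s \<le> real (Suc j) / real (Suc m)"
          using uniform_grid_cell[OF s0] by blast
        define r where "r = real j / real (Suc m)"
        have r: "0 \<le> r" "r < s" "s \<le> r + 1 / real (Suc m)"
          using j by (auto simp: r_def add_divide_distrib)
        have m: "t < real (Suc m)" "1 / \<eta> < real (Suc m)" using m0 elim by auto
        have "real j < real (Suc m) * real (Suc m)"
        proof -
          have "real j / real (Suc m) < real (Suc m)" using r(2) s m(1) unfolding r_def by simp
          then show ?thesis by (subst (asm) pos_divide_less_eq) auto
        qed
        then have "j < (Suc m)\<^sup>2" unfolding power2_eq_square of_nat_mult[symmetric] by (simp only: of_nat_less_iff)
        then have eq: "grid_approx G m s \<omega> = G (E r \<omega>)"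
          using grid_approx_cell[OF j, of G \<omega>] assms(2) by (simp add: r_def)
        have "1 / real (Suc m) < \<eta>" using m(2) \<eta>(1) by (simp add: field_simps)
        then have "dist r s < \<eta>" using r by (simp add: dist_real_def)
        from \<eta>(2)[OF s _ this] show ?thesis unfolding eq using r s by (simp add: dist_real_def)
      qed
    qed
  qed
qed

text \<open>On almost every path the approximation is uniform on \<open>{0..t}\<close>, so the
  indicators of the error events tend to 0, and dominated convergence turns this into convergence in
  probability.\<close>

lemma grid_approx_ucp: "ucp_limit M (grid_approx G) (\<lambda>t \<omega>. G (E t \<omega>))"
  unfolding ucp_limit_def
proof (intro allI impI conjI)
  fix t \<epsilon> :: real assume \<epsilon>: "0 < \<epsilon>"
  let ?A = "\<lambda>m. {\<omega>\<in>space M. \<exists>s\<in>{0..t}. \<epsilon> < \<bar>grid_approx G m s \<omega> - G (E s \<omega>)\<bar>}"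
  show A: "?A m \<in> sets M" for m by (rule grid_error_measurable[OF \<epsilon>])
  have "(\<lambda>m. LINT \<omega>|M. indicator (?A m) \<omega>) \<longlonglongrightarrow> (LINT \<omega>|M. (0 :: real))"
  proof (rule integral_dominated_convergence[where w = "\<lambda>_. 1"])
    show "AE \<omega> in M. (\<lambda>m. indicator (?A m) \<omega>) \<longlonglongrightarrow> (0 :: real)"
      using E_paths
    proof eventually_elim
      case (elim \<omega>)
      have "eventually (\<lambda>m. indicator (?A m) \<omega> = (0 :: real)) sequentially"
        using grid_error_eventually[of \<omega> \<epsilon> t] elim \<epsilon>
        by (auto elim!: eventually_mono simp: indicator_def not_less)
      then show ?case by (rule tendsto_eventually)
    qed
  qed (use A in \<open>auto simp: indicator_def\<close>)
  then show "(\<lambda>m. measure M (?A m)) \<longlonglongrightarrow> 0"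
    using A by (simp add: Int_absorb2 sets.sets_into_space)
qed

lemma grid_simple_approximation:
  "simple_approximation M Gl (\<lambda>t \<omega>. G (E t \<omega>)) (\<lambda>m. (Suc m)\<^sup>2) (\<lambda>_ _. G 0) (\<lambda>m i _. real i / real (Suc m))
     (\<lambda>m i \<omega>. G (max 0 (E (real i / real (Suc m)) \<omega>)))"
  unfolding simple_approximation_def grid_approx_def[symmetric]
proof (intro conjI allI grid_approx_ucp)
  fix m
  have "(\<lambda>\<omega>. G (max 0 (E c \<omega>))) \<in> borel_measurable (filtration.pre_sigma (space M) Gl (\<lambda>_. c))" for c
  proof -
    have "(\<lambda>\<omega>. G (max 0 (E c \<omega>))) \<in> borel_measurable (Gl c)"
      using measurable_compose[OF E_adapted G_max_measurable] .
    then show ?thesis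
      using Gl_pre_sigma_const[of c] filtration.space_pre_sigma[OF filtration_Gl]
      by (auto simp: measurable_def space_Gl)
  qed
  then show "simple_predictable (space M) Gl ((Suc m)\<^sup>2) (\<lambda>_. G 0) (\<lambda>i _. real i / real (Suc m))
     (\<lambda>i \<omega>. G (max 0 (E (real i / real (Suc m)) \<omega>)))"
    unfolding simple_predictable_def by (auto intro!: stopping_time_const divide_right_mono)
qed

text \<open>The integral is characterised through all approximating sequences, so it may be
  evaluated along deterministic grids. The initial term of the simple integrals vanishes with
  \<open>B 0\<close>.\<close>

lemma stoch_integral_riemann_sums:
  assumes "has_stoch_integral M Gl (\<lambda>t \<omega>. B (E t \<omega>) \<omega>) (\<lambda>t \<omega>. G (E t \<omega>)) I" "0 \<le> T"
  obtains \<phi> :: "nat \<Rightarrow> nat" where "filterlim \<phi> at_top sequentially"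
    "AE \<omega> in M. \<forall>t\<in>{0..T}. (\<lambda>l. \<Sum>i<(Suc (\<phi> l))\<^sup>2. G (E (real i / real (Suc (\<phi> l))) \<omega>) *
       (B (E (min (real (Suc i) / real (Suc (\<phi> l))) t) \<omega>) \<omega> - B (E (min (real i / real (Suc (\<phi> l))) t) \<omega>) \<omega>))
       \<longlonglongrightarrow> I t \<omega>"
proof -
  define J where "J m = simple_integral ((Suc m)\<^sup>2) (\<lambda>_. G 0) (\<lambda>i _. real i / real (Suc m))
     (\<lambda>i \<omega>. G (max 0 (E (real i / real (Suc m)) \<omega>))) (\<lambda>t \<omega>. B (E t \<omega>) \<omega>)" for m
  have "ucp_limit M J I"
    using assms(1) grid_simple_approximation unfolding has_stoch_integral_def J_def by blast
  from ucp_limit_subsequence[OF finite_measure_axioms this assms(2)] obtain \<phi> where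
    \<phi>: "filterlim \<phi> at_top sequentially" "AE \<omega> in M. \<forall>t\<in>{0..T}. (\<lambda>l. J (\<phi> l) t \<omega>) \<longlonglongrightarrow> I t \<omega>" by blast
  have B0: "AE \<omega> in M. B 0 \<omega> = 0" using brownian by (auto simp: brownian_motion_def)
  have "AE \<omega> in M. \<forall>t\<in>{0..T}. (\<lambda>l. \<Sum>i<(Suc (\<phi> l))\<^sup>2. G (E (real i / real (Suc (\<phi> l))) \<omega>) *
       (B (E (min (real (Suc i) / real (Suc (\<phi> l))) t) \<omega>) \<omega> - B (E (min (real i / real (Suc (\<phi> l))) t) \<omega>) \<omega>))
       \<longlonglongrightarrow> I t \<omega>"
    using \<phi>(2) B0 E_paths
  proof eventually_elim
    case (elim \<omega>)
    have "max 0 (E s \<omega>) = E s \<omega>" for s using elim by simp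
    then show ?case using elim(1) elim(2) elim(3) unfolding J_def simple_integral_def by simp
  qed
  then show ?thesis using that \<phi>(1) by blast
qed

end

end

section \<open>Sections of the product space\<close>

lemma subordinator_path_cong:
  assumes "subordinator_path d" "\<And>t. 0 \<le> t \<Longrightarrow> d t = d' t"
  shows "subordinator_path d'"
proof
  interpret subordinator_path d by fact
  show "d' 0 = 0" using assms(2)[of 0] d0 by simp
  show "d' u < d' v" if "0 \<le> u" "u < v" for u v
    using strict[OF that] assms(2)[of u] assms(2)[of v] that by simp
  show "continuous (at_right u) d'" if "0 \<le> u" for u
  proof -
    have ev: "eventually (\<lambda>x. d x = d' x) (at_right u)"
      by (rule eventually_at_rightI[of u "u + 1"]) (use that assms(2) in auto)
    have "(d \<longlongrightarrow> d u) (at_right u)" using right_cont[OF that] by (simp add: continuous_within)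
    then have "(d' \<longlongrightarrow> d u) (at_right u)" by (rule tendsto_cong[THEN iffD1, OF ev])
    then show ?thesis using assms(2)[OF that] by (simp add: continuous_within)
  qed
  show "\<exists>u\<ge>0. m < d' u" for m using unbounded[of m] assms(2) by auto
qed

lemma (in complete_measure) borel_measurable_AE_cong:
  fixes f g :: "'a \<Rightarrow> 'b::topological_space"
  assumes "f \<in> borel_measurable M" "AE \<omega> in M. f \<omega> = g \<omega>"
  shows "g \<in> borel_measurable M"
proof (rule measurableI)
  fix A :: "'b set" assume "A \<in> sets borel"
  then have "f -` A \<inter> space M \<in> sets M" by (rule measurable_sets[OF assms(1)])
  then show "g -` A \<inter> space M \<in> sets M"
    by (rule in_sets_AE[rotated]) (use assms(2) in \<open>auto elim!: eventually_mono\<close>)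
qed simp

text \<open>The property \<open>Q\<close> may fail to be measurable; a measurable null set
  containing its exceptions allows the two quantifiers to be exchanged.\<close>

lemma (in pair_sigma_finite) AE_pair_swap:
  assumes "AE \<omega> in M1 \<Otimes>\<^sub>M M2. Q \<omega>"
  shows "AE y in M2. AE x in M1. Q (x, y)"
proof -
  obtain N where N: "{\<omega>\<in>space (M1 \<Otimes>\<^sub>M M2). \<not> Q \<omega>} \<subseteq> N" "N \<in> null_sets (M1 \<Otimes>\<^sub>M M2)"
    using assms unfolding eventually_ae_filter by blast
  have "AE \<omega> in M1 \<Otimes>\<^sub>M M2. \<omega> \<notin> N" by (rule AE_not_in[OF N(2)])
  then have "AE x in M1. AE y in M2. (x, y) \<notin> N" by (rule AE_pair)
  moreover have "{\<omega>\<in>space (M1 \<Otimes>\<^sub>M M2). (fst \<omega>, snd \<omega>) \<notin> N} = space (M1 \<Otimes>\<^sub>M M2) - N" by auto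
  then have "{\<omega>\<in>space (M1 \<Otimes>\<^sub>M M2). (fst \<omega>, snd \<omega>) \<notin> N} \<in> sets (M1 \<Otimes>\<^sub>M M2)"
    using N(2) by auto
  ultimately have "AE y in M2. AE x in M1. (x, y) \<notin> N"
    using AE_commute[of "\<lambda>x y. (x, y) \<notin> N"] by simp
  then show ?thesis
    using AE_space[of M2]
  proof eventually_elim
    case (elim y)
    from elim(1) AE_space[of M1] show ?case
      by eventually_elim (use N(1) elim(2) in \<open>auto simp: space_pair_measure\<close>)
  qed
qed

section \<open>Brownian motion on the first factor\<close>

locale product_driving = pair_prob_space PB PD + driving_processes "completion (PB \<Otimes>\<^sub>M PD)" Fl \<nu> B D
  for PB :: "'a measure" and PD :: "'b measure" and Fl \<nu> B D +
  fixes bf :: "real \<Rightarrow> 'a \<Rightarrow> real" and df :: "real \<Rightarrow> 'b \<Rightarrow> real"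
  assumes bf_measurable: "\<And>t. 0 \<le> t \<Longrightarrow> bf t \<in> borel_measurable PB"
    and B_eq: "\<And>t \<omega>. 0 \<le> t \<Longrightarrow> \<omega> \<in> space (PB \<Otimes>\<^sub>M PD) \<Longrightarrow> B t \<omega> = bf t (fst \<omega>)"
    and df_measurable: "\<And>t. 0 \<le> t \<Longrightarrow> df t \<in> borel_measurable PD"
    and D_eq: "\<And>t \<omega>. 0 \<le> t \<Longrightarrow> \<omega> \<in> space (PB \<Otimes>\<^sub>M PD) \<Longrightarrow> D t \<omega> = df t (snd \<omega>)"
begin

abbreviation \<Omega> where "\<Omega> \<equiv> completion (PB \<Otimes>\<^sub>M PD)"

text \<open>The part of \<open>Fl\<close> that is visible in the first coordinate. Independence of
  an increment from \<open>Fl s\<close> holds in particular for cylinders and therefore descends to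
  \<open>Fb s\<close>. The generating family is already a sigma-algebra, by
  \<open>sigma_algebra_Fb\<close>.\<close>

definition Fb :: "real \<Rightarrow> 'a measure" where
  "Fb t = sigma (space PB) {A \<in> sets PB. A \<times> space PD \<in> sets (Fl t)}"

lemma sigma_algebra_Fb: "sigma_algebra (space PB) {A \<in> sets PB. A \<times> space PD \<in> sets (Fl t)}"
  unfolding sigma_algebra_iff2
proof (intro conjI allI ballI impI)
  show "{A \<in> sets PB. A \<times> space PD \<in> sets (Fl t)} \<subseteq> Pow (space PB)"
    using sets.sets_into_space by auto
  show "{} \<in> {A \<in> sets PB. A \<times> space PD \<in> sets (Fl t)}" by simp
  show "space PB - A \<in> {A \<in> sets PB. A \<times> space PD \<in> sets (Fl t)}"
    if "A \<in> {A \<in> sets PB. A \<times> space PD \<in> sets (Fl t)}" for A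
  proof -
    have "(space PB - A) \<times> space PD = space (Fl t) - A \<times> space PD"
      by (auto simp: Fl.space_F space_pair_measure)
    then show ?thesis using that by (simp add: sets.compl_sets)
  qed
  show "\<Union>(range A) \<in> {A \<in> sets PB. A \<times> space PD \<in> sets (Fl t)}"
    if "range A \<subseteq> {A \<in> sets PB. A \<times> space PD \<in> sets (Fl t)}" for A :: "nat \<Rightarrow> 'a set"
  proof -
    have "\<Union>(range A) \<times> space PD = (\<Union>i. A i \<times> space PD)" by auto
    moreover have "(\<Union>i. A i \<times> space PD) \<in> sets (Fl t)" using that by (intro sets.countable_UN) auto
    moreover have "\<Union>(range A) \<in> sets PB" using that by (intro sets.countable_UN) auto
    ultimately show ?thesis by simp
  qed
qed

lemma sets_Fb: "sets (Fb t) = {A \<in> sets PB. A \<times> space PD \<in> sets (Fl t)}"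
  and space_Fb: "space (Fb t) = space PB"
proof -
  have *: "{A \<in> sets PB. A \<times> space PD \<in> sets (Fl t)} \<subseteq> Pow (space PB)"
    using sets.sets_into_space by auto
  show "space (Fb t) = space PB" unfolding Fb_def by (rule space_measure_of[OF *])
  show "sets (Fb t) = {A \<in> sets PB. A \<times> space PD \<in> sets (Fl t)}"
    unfolding Fb_def sets_measure_of[OF *] by (rule sigma_algebra.sigma_sets_eq[OF sigma_algebra_Fb])
qed

lemma prob_fst: "A \<in> sets PB \<Longrightarrow> measure (PB \<Otimes>\<^sub>M PD) (A \<times> space PD) = measure PB A"
  by (simp add: measure_def M2.emeasure_pair_measure_Times M2.emeasure_space_1)

lemma prob_snd: "A \<in> sets PD \<Longrightarrow> measure (PB \<Otimes>\<^sub>M PD) (space PB \<times> A) = measure PD A"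
  by (simp add: measure_def M2.emeasure_pair_measure_Times M1.emeasure_space_1)

text \<open>The properties descend from the product space because they concern the first coordinate
  only: on cylinders the product measure agrees with \<open>PB\<close>, and completion changes
  neither laws nor almost sure statements.\<close>

lemma brownian_PB: "brownian PB bf Fb"
proof
  show "space (Fb t) = space PB" for t by (rule space_Fb)
  show "sets (Fb t) \<subseteq> sets PB" for t by (auto simp: sets_Fb)
  show "sets (Fb s) \<subseteq> sets (Fb t)" if "s \<le> t" for s t
    using Fl.sets_F_mono[OF that] by (auto simp: sets_Fb)
  show "bf t \<in> borel_measurable (Fb t)" if t: "0 \<le> t" for t
  proof (rule measurableI)
    fix A :: "real set" assume A: "A \<in> sets borel"
    have "B t \<in> borel_measurable (Fl t)" using brownian t by (simp add: brownian_motion_def)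
    then have "B t -` A \<inter> space (Fl t) \<in> sets (Fl t)" by (rule measurable_sets[OF _ A])
    moreover have "B t -` A \<inter> space (Fl t) = (bf t -` A \<inter> space PB) \<times> space PD"
      using B_eq[OF t] by (auto simp: Fl.space_F space_pair_measure)
    ultimately show "bf t -` A \<inter> space (Fb t) \<in> sets (Fb t)"
      using measurable_sets[OF bf_measurable[OF t] A] by (simp add: sets_Fb space_Fb)
  qed simp
  have "AE \<omega> in \<Omega>. B 0 \<omega> = 0 \<and> continuous_on {0..} (\<lambda>t. B t \<omega>)"
    using brownian by (simp add: brownian_motion_def)
  then have "AE \<omega> in PB \<Otimes>\<^sub>M PD. B 0 \<omega> = 0 \<and> continuous_on {0..} (\<lambda>t. B t \<omega>)"
    by (simp add: AE_completion_iff)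
  then have "AE \<omega> in PB \<Otimes>\<^sub>M PD. bf 0 (fst \<omega>) = 0 \<and> continuous_on {0..} (\<lambda>t. bf t (fst \<omega>))"
    using AE_space
  proof eventually_elim
    case (elim \<omega>)
    have "continuous_on {0..} (\<lambda>t. B t \<omega>) = continuous_on {0..} (\<lambda>t. bf t (fst \<omega>))"
      by (rule continuous_on_cong) (use B_eq elim in auto)
    then show ?case using elim B_eq[of 0 \<omega>] by simp
  qed
  from AE_pair[OF this] show "AE x in PB. bf 0 x = 0 \<and> continuous_on {0..} (\<lambda>t. bf t x)"
    by (simp add: M2.AE_const)
  fix s t :: real assume st: "0 \<le> s" "s < t"
  have bm[measurable]: "bf s \<in> borel_measurable PB" "bf t \<in> borel_measurable PB"
    using st by (auto intro: bf_measurable)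
  have eq: "B t \<omega> - B s \<omega> = bf t (fst \<omega>) - bf s (fst \<omega>)" if "\<omega> \<in> space (PB \<Otimes>\<^sub>M PD)" for \<omega>
    using B_eq[OF _ that] st by simp
  have dB: "distributed \<Omega> lborel (\<lambda>\<omega>. B t \<omega> - B s \<omega>) (\<lambda>x. ennreal (normal_density 0 (sqrt (t - s)) x))"
    and iB: "indep_set (sets (vimage_algebra (space \<Omega>) (\<lambda>\<omega>. B t \<omega> - B s \<omega>) borel)) (sets (Fl s))"
    using brownian st by (simp_all add: brownian_motion_def)
  have "distr PB lborel (\<lambda>x. bf t x - bf s x) = distr (distr (PB \<Otimes>\<^sub>M PD) PB fst) lborel (\<lambda>x. bf t x - bf s x)"
    by (simp add: M2.distr_pair_fst)
  also have "\<dots> = distr (PB \<Otimes>\<^sub>M PD) lborel (\<lambda>\<omega>. bf t (fst \<omega>) - bf s (fst \<omega>))"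
    by (subst distr_distr) (auto simp: comp_def)
  also have "\<dots> = distr \<Omega> lborel (\<lambda>\<omega>. bf t (fst \<omega>) - bf s (fst \<omega>))"
    by (rule distr_completion[symmetric]) simp
  also have "\<dots> = distr \<Omega> lborel (\<lambda>\<omega>. B t \<omega> - B s \<omega>)"
    by (rule distr_cong) (use eq in auto)
  finally show "distributed PB lborel (\<lambda>x. bf t x - bf s x) (\<lambda>x. ennreal (normal_density 0 (sqrt (t - s)) x))"
    using dB by (simp add: distributed_def)
  fix Z :: "'a \<Rightarrow> real" assume Z: "Z \<in> borel_measurable (Fb s)"
  have Zm: "Z \<in> borel_measurable PB" using Z by (auto simp: measurable_def sets_Fb space_Fb)
  have "M1.indep_set (sets (vimage_algebra (space PB) Z borel)) (sets (vimage_algebra (space PB) (\<lambda>x. bf t x - bf s x) borel))"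
  proof (rule M1.indep_setI)
    show "sets (vimage_algebra (space PB) Z borel) \<subseteq> sets PB"
      using Zm by (auto simp: sets_vimage_algebra2)
    show "sets (vimage_algebra (space PB) (\<lambda>x. bf t x - bf s x) borel) \<subseteq> sets PB"
      by (auto simp: sets_vimage_algebra2)
    fix U V assume "U \<in> sets (vimage_algebra (space PB) Z borel)"
      and "V \<in> sets (vimage_algebra (space PB) (\<lambda>x. bf t x - bf s x) borel)"
    then obtain A C where A: "A \<in> sets borel" "U = Z -` A \<inter> space PB"
      and C: "C \<in> sets borel" "V = (\<lambda>x. bf t x - bf s x) -` C \<inter> space PB"
      by (auto simp: sets_vimage_algebra2)
    have U: "U \<in> sets PB" "U \<times> space PD \<in> sets (Fl s)"
      using measurable_sets[OF Z A(1)] A(2) by (auto simp: sets_Fb space_Fb)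
    have V: "V \<in> sets PB" using C by simp
    have "V \<times> space PD = (\<lambda>\<omega>. B t \<omega> - B s \<omega>) -` C \<inter> space \<Omega>"
      using eq C by (auto simp: space_pair_measure)
    then have "V \<times> space PD \<in> sets (vimage_algebra (space \<Omega>) (\<lambda>\<omega>. B t \<omega> - B s \<omega>) borel)"
      using C(1) by (auto simp: sets_vimage_algebra2)
    from indep_setD[OF iB this U(2)]
    have "measure \<Omega> ((V \<times> space PD) \<inter> (U \<times> space PD)) = measure \<Omega> (V \<times> space PD) * measure \<Omega> (U \<times> space PD)" .
    moreover have "(V \<times> space PD) \<inter> (U \<times> space PD) = (U \<inter> V) \<times> space PD" by auto
    ultimately show "measure PB (U \<inter> V) = measure PB U * measure PB V"
      using U V by (simp add: prob_fst mult.commute)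
  qed
  then show "M1.indep_var borel Z borel (\<lambda>x. bf t x - bf s x)"
    unfolding M1.indep_var_eq sets_vimage_algebra using Zm by simp
qed

lemma section_path:
  assumes "y \<in> space PD" "x \<in> space PB" "subordinator_path (\<lambda>t. D t (x, y))"
  shows "subordinator_path (\<lambda>t. df t y)"
  by (rule subordinator_path_cong[OF assms(3)]) (use D_eq assms in \<open>simp add: space_pair_measure\<close>)

lemma E_section: "\<omega> \<in> space (PB \<Otimes>\<^sub>M PD) \<Longrightarrow> E t \<omega> = inverse_subordinator df t (snd \<omega>)"
  by (rule inverse_subordinator_cong) (rule D_eq)

end

lemma product_driving_ex:
  assumes "product_setting PB PD Fl \<nu> B D"
  shows "\<exists>bf df. product_driving PB PD Fl \<nu> B D bf df"
proof -
  note s = assms[unfolded product_setting_def]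
  interpret PB: prob_space PB using s by blast
  interpret PD: prob_space PD using s by blast
  interpret pair_prob_space PB PD ..
  have "\<forall>t. \<exists>b. 0 \<le> t \<longrightarrow> b \<in> borel_measurable PB \<and> (\<forall>\<omega>\<in>space (PB \<Otimes>\<^sub>M PD). B t \<omega> = b (fst \<omega>))" using s by blast
  from choice[OF this] obtain bf where bf: "\<forall>t. 0 \<le> t \<longrightarrow> bf t \<in> borel_measurable PB \<and> (\<forall>\<omega>\<in>space (PB \<Otimes>\<^sub>M PD). B t \<omega> = bf t (fst \<omega>))" ..
  have "\<forall>t. \<exists>d. 0 \<le> t \<longrightarrow> d \<in> borel_measurable PD \<and> (\<forall>\<omega>\<in>space (PB \<Otimes>\<^sub>M PD). D t \<omega> = d (snd \<omega>))" using s by blast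
  from choice[OF this] obtain df where df: "\<forall>t. 0 \<le> t \<longrightarrow> df t \<in> borel_measurable PD \<and> (\<forall>\<omega>\<in>space (PB \<Otimes>\<^sub>M PD). D t \<omega> = df t (snd \<omega>))" ..
  have "driving_processes (completion (PB \<Otimes>\<^sub>M PD)) Fl \<nu> B D"
    unfolding driving_processes_def driving_processes_axioms_def levy_infinite_def
    using s P.prob_space_completion completion.complete_measure_axioms by (intro conjI) blast+
  moreover have "product_driving_axioms PB PD B D bf df"
    unfolding product_driving_axioms_def using bf df by blast
  ultimately have "product_driving PB PD Fl \<nu> B D bf df"
    unfolding product_driving_def using pair_prob_space_axioms by blast
  then show ?thesis by blast
qed

text \<open>Every time before \<open>T\<close> is approached by rational times from the right.
  \<open>T\<close> cannot be approached in this way within the interval and is therefore added to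
  the countable set.\<close>

lemma SUP_right_continuous:
  fixes f :: "real \<Rightarrow> ennreal"
  assumes "\<And>s. 0 \<le> s \<Longrightarrow> s < T \<Longrightarrow> (f \<longlongrightarrow> f s) (at_right s)"
  shows "(SUP s\<in>{0..T}. f s) = (SUP s\<in>{0..T} \<inter> insert T \<rat>. f s)"
proof (rule antisym)
  show "(SUP s\<in>{0..T}. f s) \<le> (SUP s\<in>{0..T} \<inter> insert T \<rat>. f s)"
  proof (rule SUP_least, rule ccontr)
    fix s assume s: "s \<in> {0..T}"
    assume neg: "\<not> f s \<le> (SUP s\<in>{0..T} \<inter> insert T \<rat>. f s)"
    have "s \<noteq> T"
    proof
      assume "s = T"
      then have "f s \<le> (SUP s\<in>{0..T} \<inter> insert T \<rat>. f s)" using s by (intro SUP_upper) auto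
      then show False using neg by contradiction
    qed
    then have sT: "0 \<le> s" "s < T" using s by auto
    have "eventually (\<lambda>q. (SUP s\<in>{0..T} \<inter> insert T \<rat>. f s) < f q) (at_right s)"
      using neg by (intro order_tendstoD(1)[OF assms[OF sT]]) (simp only: not_le)
    then obtain a where a: "s < a" "\<And>q. s < q \<Longrightarrow> q < a \<Longrightarrow> (SUP s\<in>{0..T} \<inter> insert T \<rat>. f s) < f q"
      unfolding eventually_at_right_field by blast
    obtain q where q: "q \<in> \<rat>" "s < q" "q < min a T"
      using Rats_dense_in_real[of s "min a T"] a(1) sT by auto
    then have "f q \<le> (SUP s\<in>{0..T} \<inter> insert T \<rat>. f s)" using sT by (intro SUP_upper) auto
    then show False using a(2)[of q] q by (simp add: leD)
  qed
  show "(SUP s\<in>{0..T} \<inter> insert T \<rat>. f s) \<le> (SUP s\<in>{0..T}. f s)"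
    by (rule SUP_subset_mono) auto
qed

section \<open>Measurability of the supremum error\<close>

locale em_sde = product_driving PB PD Fl \<nu> B D bf df + em_coefficients H G h k F Fu Fx Fxx K \<theta>
  for PB :: "'a measure" and PD :: "'b measure" and Fl \<nu> B D bf df H G h k F Fu Fx Fxx K \<theta> +
  fixes T x0 :: real and X I :: "real \<Rightarrow> 'a \<times> 'b \<Rightarrow> real"
  assumes T: "0 < T"
    and X_measurable: "\<And>t. t \<in> {0..T} \<Longrightarrow> X t \<in> borel_measurable (completion (PB \<Otimes>\<^sub>M PD))"
    and X_cont: "AE \<omega> in completion (PB \<Otimes>\<^sub>M PD). continuous_on {0..T} (\<lambda>t. X t \<omega>)"
    and stoch_integral: "has_stoch_integral (completion (PB \<Otimes>\<^sub>M PD)) Gl (\<lambda>t \<omega>. B (E t \<omega>) \<omega>) (\<lambda>t \<omega>. G (E t \<omega>)) I"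
    and X_eq: "AE \<omega> in completion (PB \<Otimes>\<^sub>M PD). \<forall>t\<in>{0..T}. X t \<omega> = x0 + (LINT r:{0..t}|lborel. H (E r \<omega>))
       + (LINT r:{0..t}|interval_measure (\<lambda>r. E r \<omega>). F (E r \<omega>) (X r \<omega>)) + I t \<omega>"
begin

abbreviation Y where "Y \<delta> \<equiv> em_process B D H F G x0 \<delta>"
abbreviation Ygrid where "Ygrid \<delta> \<equiv> em_grid B D H F G x0 \<delta>"

lemma B_paths: "AE \<omega> in \<Omega>. B 0 \<omega> = 0 \<and> continuous_on {0..} (\<lambda>t. B t \<omega>)"
  using brownian by (simp add: brownian_motion_def)

lemma B_measurable: "0 \<le> t \<Longrightarrow> B t \<in> borel_measurable \<Omega>"
  by (rule Fl_measurable) (use brownian[unfolded brownian_motion_def] in blast)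

lemma Y_interpolation:
  assumes \<delta>: "0 < \<delta>" "\<delta> < 1" and "subordinator_path (\<lambda>t. D t \<omega>)" "B 0 \<omega> = 0" "continuous_on {0..} (\<lambda>t. B t \<omega>)"
    and t: "0 \<le> t" "D (real n * \<delta>) \<omega> \<le> t" "t < D (real (Suc n) * \<delta>) \<omega>"
  shows "Y \<delta> t \<omega> = Ygrid \<delta> n \<omega> + H (real n * \<delta>) * (t - D (real n * \<delta>) \<omega>)
    + F (real n * \<delta>) (Ygrid \<delta> n \<omega>) * (E t \<omega> - real n * \<delta>) + G (real n * \<delta>) * (B (E t \<omega>) \<omega> - B (real n * \<delta>) \<omega>)"
proof -
  interpret subordinator_path "\<lambda>t. D t \<omega>" by fact
  interpret P: em_path "\<lambda>t. D t \<omega>" H G h k F Fu Fx Fxx K \<theta> T x0 \<delta> "\<lambda>t. B t \<omega>"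
    by unfold_locales (use assms T in auto)
  have "P.proc t = Y \<delta> t \<omega>" unfolding P.proc_def
    by (rule em_process_cong[symmetric]) (use \<delta> e_nonneg E_eq[OF assms(3)] in auto)
  moreover have "P.grid n = Ygrid \<delta> n \<omega>" unfolding P.grid_def
    by (rule em_grid_cong) (use \<delta> in auto)
  moreover have "e t = E t \<omega>" by (rule E_eq[OF assms(3)])
  ultimately show ?thesis using P.proc_eq[OF t] by (simp only: P.incr_def)
qed

lemma Ygrid_measurable: "0 < \<delta> \<Longrightarrow> Ygrid \<delta> n \<in> borel_measurable \<Omega>"
proof (induction n)
  case 0
  then show ?case by (simp add: em_grid.simps[abs_def])
next
  case (Suc n)
  have [measurable]: "Ygrid \<delta> n \<in> borel_measurable \<Omega>" using Suc by simp
  have [measurable]: "D (real i * \<delta>) \<in> borel_measurable \<Omega>" "B (real i * \<delta>) \<in> borel_measurable \<Omega>" for i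
    using Suc.prems by (auto intro: D_measurable B_measurable)
  have "(\<lambda>\<omega>. F (max 0 (real n * \<delta>)) (Ygrid \<delta> n \<omega>)) \<in> borel_measurable \<Omega>"
    by (rule F_measurable[OF borel_measurable_const]) (rule Suc.IH[OF Suc.prems])
  moreover have "max 0 (real n * \<delta>) = real n * \<delta>" using Suc.prems by (intro max_absorb2) simp
  ultimately have [measurable]: "(\<lambda>\<omega>. F (real n * \<delta>) (Ygrid \<delta> n \<omega>)) \<in> borel_measurable \<Omega>"
    by (simp only:)
  have "(\<lambda>\<omega>. Ygrid \<delta> (Suc n) \<omega>) \<in> borel_measurable \<Omega>"
    unfolding em_grid.simps by measurable
  then show ?case .
qed

text \<open>Evaluation at a random time uses a jointly measurable version of \<open>bf\<close>.
  Along \<open>E\<close> it agrees with \<open>B\<close> outside a null set, which completeness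
  absorbs.\<close>

lemma B_E_measurable: "(\<lambda>\<omega>. B (E t \<omega>) \<omega>) \<in> borel_measurable \<Omega>"
proof -
  obtain b' where b': "(\<lambda>(v, x). b' v x) \<in> borel_measurable (borel \<Otimes>\<^sub>M PB)" "AE x in PB. \<forall>v\<ge>0. b' v x = bf v x"
    "\<And>x. x \<in> space PB \<Longrightarrow> continuous_on UNIV (\<lambda>v. b' v x)"
    by (rule brownian.continuous_modification[OF brownian_PB]) (rule that, assumption+)
  have "(\<lambda>\<omega>. (E t \<omega>, fst \<omega>)) \<in> \<Omega> \<rightarrow>\<^sub>M borel \<Otimes>\<^sub>M PB"
    by (intro measurable_Pair E_measurable measurable_completion measurable_fst)
  from measurable_compose[OF this b'(1)]
  have m: "(\<lambda>\<omega>. b' (E t \<omega>) (fst \<omega>)) \<in> borel_measurable \<Omega>" by simp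
  have "AE \<omega> in PB \<Otimes>\<^sub>M PD. \<forall>v\<ge>0. b' v (fst \<omega>) = bf v (fst \<omega>)"
    by (rule AE_distrD[OF measurable_fst]) (use b'(2) in \<open>simp only: M2.distr_pair_fst\<close>)
  then have "AE \<omega> in \<Omega>. \<forall>v\<ge>0. b' v (fst \<omega>) = bf v (fst \<omega>)" by (rule AE_completion)
  then have "AE \<omega> in \<Omega>. b' (E t \<omega>) (fst \<omega>) = B (E t \<omega>) \<omega>"
    using E_paths AE_space
  proof eventually_elim
    case (elim \<omega>)
    then show ?case using B_eq[of "E t \<omega>" \<omega>] by simp
  qed
  then show ?thesis by (rule borel_measurable_AE_cong[OF m])
qed

text \<open>The cell index given by \<open>THE\<close> is replaced by the least index
  \<open>J\<close>, which is measurable. On almost every path both select the same cell, and the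
  countably many formulas \<open>V n\<close> are glued along \<open>J\<close>.\<close>

lemma Y_measurable:
  assumes \<delta>: "0 < \<delta>" "\<delta> < 1" and t: "0 \<le> t"
  shows "Y \<delta> t \<in> borel_measurable \<Omega>"
proof -
  define V where "V n \<omega> = Ygrid \<delta> n \<omega> + H (real n * \<delta>) * (t - D (real n * \<delta>) \<omega>)
    + F (real n * \<delta>) (Ygrid \<delta> n \<omega>) * (E t \<omega> - real n * \<delta>) + G (real n * \<delta>) * (B (E t \<omega>) \<omega> - B (real n * \<delta>) \<omega>)" for n \<omega>
  define J where "J \<omega> = (LEAST n. t < D (real (Suc n) * \<delta>) \<omega>)" for \<omega>
  note Ygrid_measurable[OF \<delta>(1), measurable] B_E_measurable[measurable]
  have [measurable]: "D (real i * \<delta>) \<in> borel_measurable \<Omega>" "B (real i * \<delta>) \<in> borel_measurable \<Omega>" for i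
    using \<delta> by (auto intro: D_measurable B_measurable)
  have [measurable]: "(\<lambda>\<omega>. F (real n * \<delta>) (Ygrid \<delta> n \<omega>)) \<in> borel_measurable \<Omega>" for n
  proof -
    have "max 0 (real n * \<delta>) = real n * \<delta>" using \<delta> by (intro max_absorb2) simp
    then show ?thesis
      using F_measurable[OF borel_measurable_const Ygrid_measurable[OF \<delta>(1)], of "real n * \<delta>" n] by (simp only:)
  qed
  have "V n \<in> borel_measurable \<Omega>" for n unfolding V_def by measurable
  moreover have "J \<in> measurable \<Omega> (count_space UNIV)"
    unfolding J_def by (intro measurable_Least) measurable
  ultimately have "(\<lambda>\<omega>. V (J \<omega>) \<omega>) \<in> borel_measurable \<Omega>" by (rule measurable_compose_countable)
  moreover have "AE \<omega> in \<Omega>. V (J \<omega>) \<omega> = Y \<delta> t \<omega>"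
    using subordinator_path B_paths
  proof eventually_elim
    case (elim \<omega>)
    interpret subordinator_path "\<lambda>t. D t \<omega>" by fact
    obtain n where n: "D (real n * \<delta>) \<omega> \<le> t" "t < D (real (Suc n) * \<delta>) \<omega>"
      using grid_index[OF \<delta>(1) t] by blast
    have "n \<le> m" if "t < D (real (Suc m) * \<delta>) \<omega>" for m
    proof -
      have "D (real n * \<delta>) \<omega> < D (real (Suc m) * \<delta>) \<omega>" using n(1) that by simp
      then have "real n * \<delta> < real (Suc m) * \<delta>" using d_less_iff[of "real n * \<delta>" "real (Suc m) * \<delta>"] \<delta> by simp
      then show ?thesis using \<delta> by (simp del: of_nat_Suc)
    qed
    then have "J \<omega> = n" unfolding J_def using n(2) by (intro Least_equality)
    then show ?case using Y_interpolation[OF \<delta> elim(1) _ _ t n] elim(2) by (simp only: V_def)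
  qed
  ultimately show ?thesis by (rule borel_measurable_AE_cong)
qed

text \<open>To the right of \<open>s\<close> the scheme stays for a while in the cell of
  \<open>s\<close>, where it follows one formula, continuous because \<open>e\<close> and the
  Brownian path are. No matching of adjacent cells is involved.\<close>

lemma Y_right_continuous:
  assumes \<delta>: "0 < \<delta>" "\<delta> < 1" and path: "subordinator_path (\<lambda>t. D t \<omega>)" and B: "B 0 \<omega> = 0" "continuous_on {0..} (\<lambda>t. B t \<omega>)"
    and s: "0 \<le> s"
  shows "((\<lambda>t. Y \<delta> t \<omega>) \<longlongrightarrow> Y \<delta> s \<omega>) (at_right s)"
proof -
  interpret subordinator_path "\<lambda>t. D t \<omega>" by fact
  obtain n where n: "D (real n * \<delta>) \<omega> \<le> s" "s < D (real (Suc n) * \<delta>) \<omega>"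
    using grid_index[OF \<delta>(1) s] by blast
  define L where "L t = Ygrid \<delta> n \<omega> + H (real n * \<delta>) * (t - D (real n * \<delta>) \<omega>)
    + F (real n * \<delta>) (Ygrid \<delta> n \<omega>) * (e t - real n * \<delta>) + G (real n * \<delta>) * (B (e t) \<omega> - B (real n * \<delta>) \<omega>)" for t
  have "continuous_on UNIV (\<lambda>t. B (e t) \<omega>)"
    by (rule continuous_on_compose2[OF B(2) continuous_on_e]) (auto simp: e_nonneg)
  then have "continuous_on UNIV L" unfolding L_def by (intro continuous_intros continuous_on_e)
  then have "isCont L s" by (simp add: continuous_on_eq_continuous_at)
  then have "(L \<longlongrightarrow> L s) (at_right s)" using isContD filterlim_at_split by blast
  moreover have L: "Y \<delta> t \<omega> = L t" if "s \<le> t" "t < D (real (Suc n) * \<delta>) \<omega>" for t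
    using Y_interpolation[OF \<delta> path B, of t n] that s n unfolding L_def E_eq[OF path] by simp
  have "eventually (\<lambda>t. L t = Y \<delta> t \<omega>) (at_right s)"
    by (rule eventually_at_rightI[OF _ n(2)]) (simp add: L)
  ultimately show ?thesis using L[OF order_refl n(2)] by (simp add: tendsto_cong)
qed

lemma sup_error_measurable:
  assumes \<delta>: "0 < \<delta>" "\<delta> < 1"
  shows "(\<lambda>\<omega>. SUP s\<in>{0..T}. ennreal \<bar>X s \<omega> - Y \<delta> s \<omega>\<bar>) \<in> borel_measurable \<Omega>"
proof (rule borel_measurable_AE_cong)
  have "countable ({0..T} \<inter> insert T \<rat>)" by (intro countable_Int2 countable_insert countable_rat)
  moreover have "(\<lambda>\<omega>. ennreal \<bar>X s \<omega> - Y \<delta> s \<omega>\<bar>) \<in> borel_measurable \<Omega>" if "s \<in> {0..T} \<inter> insert T \<rat>" for s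
  proof -
    have [measurable]: "X s \<in> borel_measurable \<Omega>" "Y \<delta> s \<in> borel_measurable \<Omega>"
      using that by (auto intro: X_measurable Y_measurable[OF \<delta>])
    show ?thesis by measurable
  qed
  ultimately show "(\<lambda>\<omega>. SUP s\<in>{0..T} \<inter> insert T \<rat>. ennreal \<bar>X s \<omega> - Y \<delta> s \<omega>\<bar>) \<in> borel_measurable \<Omega>"
    by (rule borel_measurable_SUP)
  show "AE \<omega> in \<Omega>. (SUP s\<in>{0..T} \<inter> insert T \<rat>. ennreal \<bar>X s \<omega> - Y \<delta> s \<omega>\<bar>) = (SUP s\<in>{0..T}. ennreal \<bar>X s \<omega> - Y \<delta> s \<omega>\<bar>)"
    using subordinator_path B_paths X_cont
  proof eventually_elim
    case (elim \<omega>)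
    have "((\<lambda>t. ennreal \<bar>X t \<omega> - Y \<delta> t \<omega>\<bar>) \<longlongrightarrow> ennreal \<bar>X s \<omega> - Y \<delta> s \<omega>\<bar>) (at_right s)" if s: "0 \<le> s" "s < T" for s
    proof -
      have "continuous_on {s..T} (\<lambda>t. X t \<omega>)" using elim(3) s by (auto intro: continuous_on_subset)
      then have "((\<lambda>t. X t \<omega>) \<longlongrightarrow> X s \<omega>) (at s within {s..T})" using s by (simp add: continuous_on_def)
      then have "((\<lambda>t. X t \<omega>) \<longlongrightarrow> X s \<omega>) (at_right s)" using s by (simp add: at_within_Icc_at_right)
      then show ?thesis
        using elim s by (intro tendsto_intros tendsto_ennrealI Y_right_continuous[OF \<delta>]) auto
    qed
    then show ?case by (intro SUP_right_continuous[symmetric])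
  qed
qed

section \<open>Integration over the two coordinates\<close>

abbreviation Eff where "Eff y \<equiv> inverse_subordinator df T y"
definition \<Phi> :: "real \<Rightarrow> real" where "\<Phi> u = (1 + k u) * exp (10 * (1 + h u) * (1 + u))"
definition C0 :: real where "C0 = 3 * (T * K + 16 * K\<^sup>2 + 4 * (\<bar>x0\<bar> + T + 7) + 2 * T + 10)"

text \<open>For almost every \<open>y\<close> the almost sure statements hold for almost every
  \<open>x\<close>, and the estimate for a fixed path applies. The subsequence is chosen on the
  product space beforehand, so that one stochastic integral serves all sections. \<open>R\<close>
  stands for a version of the error that is measurable before completion, as the iterated
  integration later requires.\<close>

lemma section_error:
  assumes \<delta>: "0 < \<delta>" "\<delta> < 1"
    and R: "AE \<omega> in PB \<Otimes>\<^sub>M PD. (SUP s\<in>{0..T}. ennreal \<bar>X s \<omega> - Y \<delta> s \<omega>\<bar>) = R \<omega>"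
  shows "AE y in PD. subordinator_path (\<lambda>t. df t y) \<and> (\<integral>\<^sup>+x. R (x, y) \<partial>PB) \<le> ennreal (\<delta> powr \<theta> * (C0 * \<Phi> (Eff y)))"
proof -
  obtain \<phi> where \<phi>: "filterlim \<phi> at_top sequentially"
    "AE \<omega> in \<Omega>. \<forall>t\<in>{0..T}. (\<lambda>l. \<Sum>i<(Suc (\<phi> l))\<^sup>2. G (E (real i / real (Suc (\<phi> l))) \<omega>) *
       (B (E (min (real (Suc i) / real (Suc (\<phi> l))) t) \<omega>) \<omega> - B (E (min (real i / real (Suc (\<phi> l))) t) \<omega>) \<omega>))
       \<longlonglongrightarrow> I t \<omega>"
    by (rule stoch_integral_riemann_sums[OF G_cont stoch_integral less_imp_le[OF T]]) (rule that, assumption+)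
  note AE_swap = AE_pair_swap[OF AE_completion_iff[THEN iffD1]]
  show ?thesis
    using AE_swap[OF subordinator_path] AE_swap[OF \<phi>(2)] AE_swap[OF X_cont] AE_swap[OF X_eq] AE_pair_swap[OF R] AE_space
  proof eventually_elim
    case (elim y)
    have "AE x in PB. subordinator_path (\<lambda>t. df t y)"
      using elim(1) AE_space by eventually_elim (rule section_path[OF elim(6)])
    then have path: "subordinator_path (\<lambda>t. df t y)" by (simp add: M1.AE_const)
    interpret b: brownian PB bf Fb by (rule brownian_PB)
    interpret d: subordinator_path "\<lambda>t. df t y" by (rule path)
    interpret Q: em_brownian PB bf Fb "\<lambda>t. df t y" H G h k F Fu Fx Fxx K \<theta> T x0 \<delta>
      by unfold_locales (use T \<delta> in auto)
    have e: "E t (x, y) = d.e t" if "x \<in> space PB" for t x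
      using E_section[of "(x, y)" t] that elim(6) by (simp add: space_pair_measure inverse_subordinator_def d.e_def)
    have Be: "B (d.e t) (x, y) = bf (d.e t) x" if "x \<in> space PB" for t x
      using B_eq[of "d.e t" "(x, y)"] d.e_nonneg[of t] that elim(6) by (simp add: space_pair_measure)
    have l1: "AE x in PB. \<forall>t\<in>{0..T}. (\<lambda>l. Q.riemann_ito (\<phi> l) t x) \<longlonglongrightarrow> I t (x, y)"
      using elim(2) AE_space
    proof eventually_elim
      case (elim x)
      then show ?case unfolding Q.riemann_ito_def e[OF elim(2)] Be[OF elim(2)] by blast
    qed
    have l2: "AE x in PB. \<forall>t\<in>{0..T}. X t (x, y) = x0 + (LINT r:{0..t}|lborel. H (d.e r))
       + (LINT r:{0..t}|interval_measure d.e. F (d.e r) (X r (x, y))) + I t (x, y)"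
      using elim(4) AE_space
    proof eventually_elim
      case (elim x)
      then show ?case unfolding e[OF elim(2)] by (simp only: eta_contract_eq)
    qed
    obtain W where W: "W \<in> borel_measurable PB" "(\<integral>\<^sup>+x. W x \<partial>PB) \<le> ennreal (\<delta> powr \<theta> * Q.total_bound)"
      "AE x in PB. \<forall>t\<in>{0..T}. ennreal \<bar>X t (x, y) - em_process bf (\<lambda>t _. df t y) H F G x0 \<delta> t x\<bar> \<le> W x"
      by (rule Q.mean_error[OF \<phi>(1) l1 elim(3) l2])
    have "AE x in PB. R (x, y) \<le> W x"
      using W(3) elim(5) AE_space
    proof eventually_elim
      case (elim x)
      have "em_process bf (\<lambda>t _. df t y) H F G x0 \<delta> t x = Y \<delta> t (x, y)" for t
        by (rule em_process_cong[symmetric])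
          (use B_eq D_eq \<delta> elim(3) \<open>y \<in> space PD\<close> e[OF elim(3)] d.e_nonneg in \<open>auto simp: space_pair_measure\<close>)
      then have "(SUP s\<in>{0..T}. ennreal \<bar>X s (x, y) - Y \<delta> s (x, y)\<bar>) \<le> W x"
        using elim(1) by (intro SUP_least) simp
      then show ?case using elim(2) by simp
    qed
    then have "(\<integral>\<^sup>+x. R (x, y) \<partial>PB) \<le> (\<integral>\<^sup>+x. W x \<partial>PB)" by (rule nn_integral_mono_AE)
    also note W(2)
    also have "ennreal (\<delta> powr \<theta> * Q.total_bound) \<le> ennreal (\<delta> powr \<theta> * (C0 * \<Phi> (d.e T)))"
      unfolding C0_def \<Phi>_def by (intro ennreal_leI mult_left_mono Q.total_bound_le) simp
    finally show ?case using path by (simp add: inverse_subordinator_def d.e_def)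
  qed
qed

lemma \<Phi>_mono: "0 \<le> u \<Longrightarrow> u \<le> v \<Longrightarrow> \<Phi> u \<le> \<Phi> v" "0 \<le> u \<Longrightarrow> 0 \<le> \<Phi> u"
proof -
  assume u: "0 \<le> u"
  have k: "0 < k u" and h: "0 \<le> h u" using k_pos h_nonneg u by auto
  show "0 \<le> \<Phi> u" using k by (simp add: \<Phi>_def)
  assume v: "u \<le> v"
  have kv: "k u \<le> k v" and hv: "h u \<le> h v" using k_le[OF u v] h_le[OF u v] by auto
  have "(1 + h u) * (1 + u) \<le> (1 + h v) * (1 + v)" using hv h u v by (intro mult_mono) auto
  then have "exp (10 * (1 + h u) * (1 + u)) \<le> exp (10 * (1 + h v) * (1 + v))"
    unfolding exp_le_cancel_iff mult.assoc by (rule mult_left_mono) simp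
  then show "\<Phi> u \<le> \<Phi> v" unfolding \<Phi>_def using kv k by (intro mult_mono) auto
qed

lemma C0_nonneg: "0 \<le> C0" using T K by (simp add: C0_def)

text \<open>One term of the series suffices: the integer \<open>n\<close> just below the inverse at
  \<open>T\<close> satisfies \<open>df (real n) y \<le> T\<close>, and the inverse is at most
  \<open>real n + 2\<close>, so that monotonicity of \<open>\<Phi>\<close> applies. For
  \<open>n = 0\<close> the event holds because the path starts at 0.\<close>

lemma section_sum:
  assumes "subordinator_path (\<lambda>t. df t y)" "y \<in> space PD"
  shows "ennreal (\<Phi> (Eff y)) \<le> (\<Sum>n. ennreal (\<Phi> (real n + 2)) * indicator {y\<in>space PD. df (real n) y \<le> T} y)"
proof -
  interpret subordinator_path "\<lambda>t. df t y" by fact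
  have e: "Eff y = e T" by (simp add: inverse_subordinator_def e_def)
  define f :: "nat \<Rightarrow> ennreal" where "f n = ennreal (\<Phi> (real n + 2)) * indicator {y\<in>space PD. df (real n) y \<le> T} y" for n
  define n where "n = nat (\<lceil>e T\<rceil> - 1)"
  have n: "e T \<le> real n + 2" "real n = 0 \<or> real n < e T" unfolding n_def using e_nonneg[of T] by linarith+
  have "df (real n) y \<le> T"
    using n(2) d0 T d_less_le[of T "real n"] by auto
  then have "ennreal (\<Phi> (Eff y)) \<le> f n"
    using assms(2) \<Phi>_mono(1)[OF e_nonneg n(1)] unfolding e f_def by (simp add: ennreal_leI)
  also have "\<dots> = sum f {n}" by simp
  also have "\<dots> \<le> suminf f" by (rule sum_le_suminf) auto
  finally show ?thesis unfolding f_def .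
qed

lemma df_tail:
  assumes "0 \<le> s"
  shows "emeasure PD {y\<in>space PD. df (real n) y \<le> T} \<le> ennreal (exp (s * T - real n * \<psi> s))"
proof -
  have [measurable]: "df (real n) \<in> borel_measurable PD" by (rule df_measurable) simp
  have "{\<omega>\<in>space \<Omega>. D (real n) \<omega> \<le> T} = space PB \<times> {y\<in>space PD. df (real n) y \<le> T}"
    using D_eq[of "real n"] by (auto simp: space_pair_measure)
  then have "measure PD {y\<in>space PD. df (real n) y \<le> T} \<le> exp (s * T - real n * \<psi> s)"
    using subordinator_tail[OF assms, of "real n" T] prob_snd[of "{y\<in>space PD. df (real n) y \<le> T}"] by simp
  then show ?thesis by (simp add: M2.emeasure_eq_measure ennreal_leI)
qed

text \<open>Tonelli's theorem separates the coordinates: the inner integral is bounded by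
  \<open>section_error\<close>, the outer one term by term through \<open>section_sum\<close> and
  \<open>df_tail\<close>. The summand 1 in the constant ensures positivity, and the constant is the
  same for every \<delta>.\<close>

lemma error_bound:
  assumes s: "\<And>n. 0 \<le> s n" and sum: "summable (\<lambda>n. \<Phi> (real n + 2) * exp (s n * T - real n * \<psi> (s n)))"
    and \<delta>: "0 < \<delta>" "\<delta> < 1"
  shows "mean_sup_error_le \<Omega> T X (Y \<delta>)
    ((C0 * (\<Sum>n. \<Phi> (real n + 2) * exp (s n * T - real n * \<psi> (s n))) + 1) * \<delta> powr \<theta>)"
  unfolding mean_sup_error_le_def
proof
  let ?a = "\<lambda>n. \<Phi> (real n + 2) * exp (s n * T - real n * \<psi> (s n))"
  let ?R = "\<lambda>\<omega>. SUP s\<in>{0..T}. ennreal \<bar>X s \<omega> - Y \<delta> s \<omega>\<bar>"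
  show Rm: "?R \<in> borel_measurable \<Omega>" by (rule sup_error_measurable[OF \<delta>])
  obtain R where R[measurable]: "R \<in> borel_measurable (PB \<Otimes>\<^sub>M PD)" and RR: "AE \<omega> in PB \<Otimes>\<^sub>M PD. ?R \<omega> = R \<omega>"
    using completion_ex_borel_measurable[OF Rm] by blast
  have a0: "0 \<le> ?a n" for n using \<Phi>_mono(2) by simp
  have [measurable]: "df (real n) \<in> borel_measurable PD" for n by (rule df_measurable) simp
  let ?S = "\<lambda>y. \<Sum>n. ennreal (\<Phi> (real n + 2)) * indicator {y\<in>space PD. df (real n) y \<le> T} y"
  have "(\<integral>\<^sup>+ \<omega>. ?R \<omega> \<partial>\<Omega>) = (\<integral>\<^sup>+ \<omega>. R \<omega> \<partial>(PB \<Otimes>\<^sub>M PD))"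
    unfolding nn_integral_completion by (rule nn_integral_cong_AE[OF RR])
  also have "\<dots> = (\<integral>\<^sup>+ y. \<integral>\<^sup>+ x. R (x, y) \<partial>PB \<partial>PD)"
    by (rule nn_integral_snd[symmetric]) simp
  also have "\<dots> \<le> (\<integral>\<^sup>+ y. ennreal (\<delta> powr \<theta> * C0) * ?S y \<partial>PD)"
  proof (rule nn_integral_mono_AE)
    show "AE y in PD. (\<integral>\<^sup>+ x. R (x, y) \<partial>PB) \<le> ennreal (\<delta> powr \<theta> * C0) * ?S y"
      using section_error[OF \<delta> RR] AE_space
    proof eventually_elim
      case (elim y)
      have "(\<integral>\<^sup>+ x. R (x, y) \<partial>PB) \<le> ennreal (\<delta> powr \<theta> * (C0 * \<Phi> (Eff y)))" using elim by simp
      also have "\<dots> = ennreal (\<delta> powr \<theta> * C0) * ennreal (\<Phi> (Eff y))"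
        using C0_nonneg by (simp add: ennreal_mult'[symmetric] mult.assoc)
      also have "\<dots> \<le> ennreal (\<delta> powr \<theta> * C0) * ?S y"
        using section_sum elim by (intro mult_left_mono) auto
      finally show ?case .
    qed
  qed
  also have "\<dots> = ennreal (\<delta> powr \<theta> * C0) * (\<integral>\<^sup>+ y. ?S y \<partial>PD)"
    by (rule nn_integral_cmult) measurable
  also have "(\<integral>\<^sup>+ y. ?S y \<partial>PD) = (\<Sum>n. \<integral>\<^sup>+ y. ennreal (\<Phi> (real n + 2)) * indicator {y\<in>space PD. df (real n) y \<le> T} y \<partial>PD)"
    by (rule nn_integral_suminf) measurable
  also have "\<dots> = (\<Sum>n. ennreal (\<Phi> (real n + 2)) * emeasure PD {y\<in>space PD. df (real n) y \<le> T})"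
    by (subst nn_integral_cmult_indicator) auto
  also have "\<dots> \<le> (\<Sum>n. ennreal (?a n))"
  proof (rule suminf_le)
    fix n
    show "ennreal (\<Phi> (real n + 2)) * emeasure PD {y\<in>space PD. df (real n) y \<le> T} \<le> ennreal (?a n)"
      using df_tail[OF s[of n], of n] by (subst ennreal_mult) (auto intro!: mult_left_mono \<Phi>_mono(2))
  qed auto
  also have "\<dots> = ennreal (\<Sum>n. ?a n)" by (rule suminf_ennreal2[OF a0 sum])
  finally have "(\<integral>\<^sup>+ \<omega>. ?R \<omega> \<partial>\<Omega>) \<le> ennreal (\<delta> powr \<theta> * C0) * ennreal (\<Sum>n. ?a n)"
    by (simp add: mult_left_mono)
  also have "\<dots> = ennreal (\<delta> powr \<theta> * C0 * (\<Sum>n. ?a n))"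
    by (rule ennreal_mult[symmetric]) (use C0_nonneg suminf_nonneg[OF sum a0] in auto)
  also have "\<dots> \<le> ennreal ((C0 * (\<Sum>n. ?a n) + 1) * \<delta> powr \<theta>)"
    by (rule ennreal_leI) (simp add: algebra_simps)
  finally show "(\<integral>\<^sup>+ \<omega>. ?R \<omega> \<partial>\<Omega>) \<le> ennreal ((C0 * (\<Sum>n. ?a n) + 1) * \<delta> powr \<theta>)" .
qed

end

section \<open>Uniform strong convergence of order \<theta>\<close>

theorem theorem4p2:
  fixes PB :: "'a measure" and PD :: "'b measure"
    and Fl :: "real \<Rightarrow> ('a \<times> 'b) measure" and \<nu> :: "real measure"
    and B D X :: "real \<Rightarrow> 'a \<times> 'b \<Rightarrow> real"
    and H G h k :: "real \<Rightarrow> real" and F Fu Fx Fxx :: "real \<Rightarrow> real \<Rightarrow> real"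
    and T x0 K \<theta> :: real
  assumes setting: "product_setting PB PD Fl \<nu> B D"
    and T: "0 < T"
    and cont: "continuous_on {0..} H" "continuous_on {0..} G"
      "continuous_on ({0..} \<times> UNIV) (\<lambda>(u, x). F u x)"
    and h: "\<forall>u\<ge>0. 0 \<le> h u" "continuous_on {0..} h" "mono_on {0..} h"
    and k: "\<forall>u\<ge>0. 0 < k u" "continuous_on {0..} k" "mono_on {0..} k"
    and K: "0 < K" and \<theta>: "0 < \<theta>" "\<theta> \<le> 1"
    and C12: "C12 F Fu Fx Fxx"
    and lipschitz: "\<forall>u\<ge>0. \<forall>x y. \<bar>F u x - F u y\<bar> \<le> h u * \<bar>x - y\<bar>"
    and growth: "\<forall>u\<ge>0. \<forall>x. \<bar>H u\<bar> + \<bar>F u x\<bar> + \<bar>G u\<bar> \<le> h u * (1 + \<bar>x\<bar>)"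
    and hoelder: "\<forall>u\<ge>0. \<forall>v\<ge>0. \<bar>H u - H v\<bar> + \<bar>G u - G v\<bar> \<le> K * \<bar>u - v\<bar> powr \<theta>"
    and deriv_growth: "\<forall>u\<ge>0. \<forall>x.
      \<bar>Fu u x\<bar> + \<bar>Fx u x * H u\<bar> + \<bar>Fx u x * F u x\<bar> + \<bar>Fx u x * G u\<bar> + \<bar>Fxx u x * (G u)\<^sup>2\<bar>
        \<le> k u * (1 + \<bar>x\<bar>)"
    and X: "sde_solution (completion (PB \<Otimes>\<^sub>M PD)) Fl B D H F G x0 T X"
    and a_or_b:
      "((\<exists>c. \<forall>u\<ge>0. h u = c) \<and> (\<exists>c. \<forall>u\<ge>0. k u = c)) \<or>
       (\<exists>q q' \<beta>. 0 \<le> q \<and> 0 \<le> q' \<and>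
          regularly_varying h q \<and> regularly_varying (\<lambda>u. ln (k u)) q' \<and>
          regularly_varying (laplace_exponent \<nu>) \<beta> \<and>
          (max (2 * q + 1) q' - 1) / max (2 * q + 1) q' < \<beta> \<and> \<beta> < 1)"
  shows "(\<exists>C>0. \<forall>\<delta>\<in>{0<..<1}.
            mean_sup_error_le (completion (PB \<Otimes>\<^sub>M PD)) T X
              (em_process B D H F G x0 \<delta>) (C * \<delta> powr \<theta>)) \<and>
         converges_strongly_with_order (completion (PB \<Otimes>\<^sub>M PD)) T
           (\<lambda>\<delta>. em_process B D H F G x0 \<delta>) X \<theta>"
proof -
  obtain bf df where pd: "product_driving PB PD Fl \<nu> B D bf df"
    using product_driving_ex[OF setting] by blast
  interpret product_driving PB PD Fl \<nu> B D bf df by (rule pd)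
  interpret em_coefficients H G h k F Fu Fx Fxx K \<theta>
    by (rule em_coefficients.intro) fact+
  note sol = X[unfolded sde_solution_def Let_def]
  obtain I where I: "has_stoch_integral \<Omega> Gl (\<lambda>t \<omega>. B (E t \<omega>) \<omega>) (\<lambda>t \<omega>. G (E t \<omega>)) I"
    "AE \<omega> in \<Omega>. \<forall>t\<in>{0..T}. X t \<omega> = x0 + (LINT r:{0..t}|lborel. H (E r \<omega>))
       + (LINT r:{0..t}|interval_measure (\<lambda>r. E r \<omega>). F (E r \<omega>) (X r \<omega>)) + I t \<omega>"
    using sol by blast
  have Xm: "X t \<in> borel_measurable \<Omega>" if "t \<in> {0..T}" for t
    using sol that by (blast intro: Gl_measurable)
  interpret em_sde PB PD Fl \<nu> B D bf df H G h k F Fu Fx Fxx K \<theta> T x0 X I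
    by unfold_locales (use T Xm sol I in blast)+
  obtain s where s: "\<And>n. 0 \<le> s n" "summable (\<lambda>n. \<Phi> (real n + 2) * exp (s n * T - real n * \<psi> (s n)))"
    using exponential_moment_summable[OF h(1,3) k(1,3) T a_or_b] unfolding \<Phi>_def by blast
  let ?C = "C0 * (\<Sum>n. \<Phi> (real n + 2) * exp (s n * T - real n * \<psi> (s n))) + 1"
  have "0 \<le> (\<Sum>n. \<Phi> (real n + 2) * exp (s n * T - real n * \<psi> (s n)))"
    by (rule suminf_nonneg[OF s(2)]) (simp add: \<Phi>_mono(2))
  then have "0 < ?C" using C0_nonneg by (simp add: add_nonneg_pos)
  moreover have "\<forall>\<delta>\<in>{0<..<1}. mean_sup_error_le \<Omega> T X (Y \<delta>) (?C * \<delta> powr \<theta>)"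
    using error_bound[OF s] by simp
  ultimately have "\<exists>C>0. \<forall>\<delta>\<in>{0<..<1}. mean_sup_error_le \<Omega> T X (Y \<delta>) (C * \<delta> powr \<theta>)" by blast
  \<comment> \<open>The threshold for the step size in the definition of strong convergence is taken
    to be 1.\<close>
  then show ?thesis unfolding converges_strongly_with_order_def using zero_less_one by blast
qed

end
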